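(* Let $\mathcal{A}\in\mathbb{R}^{I_1\times I_2\times\dots\times I_N}$ and for each $n=1,\dots,N$ let $\mu_n$, $I_n$, $T_n$ and $K$ be positive integers such that $\mu_n\leq\mu_n+K\leq I_n''$, where $I_n''=\min\{I_n,T_n\}$. Put $I_n'=\min\{I_n,\,I_1\cdots I_{n-1}I_{n+1}\cdots I_N\}$. For $\beta>1$, $\gamma>1$ and $0<\delta_n<1$, suppose that $$p=1-\sum_{n=1}^N\left(\frac{1}{4(\gamma^2-1)\sqrt{\pi\max\{I_n''-\mu_n,\mu_n+K\}\gamma^2}}\left(\frac{2\gamma^2}{e^{\gamma^2-1}}\right)^2+\frac{1}{\sqrt{2\pi(K+1)}}\left(\frac{e}{K+1}\right)^{K+1}+\frac{1}{4(\gamma^2-1)\sqrt{\pi I_n\gamma^2}}\left(\frac{2\gamma^2}{e^{\gamma^2-1}}\right)^2+\delta_n\right)$$ is nonnegative. Let $\mathbf{Q}_1,\dots,\mathbf{Q}_N$ be the orthonormal matrices produced, with $q=1$, by the sampled randomized T-HOSVD algorithm described in the context, with sampling distributions $\mathbf{p}_n$, and let $\widehat{\mathcal{A}}=\mathcal{A}\times_1(\mathbf{Q}_1\mathbf{Q}_1^\top)\cdots\times_N(\mathbf{Q}_N\mathbf{Q}_N^\top)$. Then $$\|\mathcal{A}-\widehat{\mathcal{A}}\|_F^2\leq\sum_{n=1}^N\mathrm{rank}(\mathbf{A}_{(n)})\left(2(1+\lambda_n)I_n\Delta_{\mu_n+1}(\mathbf{A}_{(n)},1)+\phi_n\|\mathcal{A}\|_F^2\right)$$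 holds with probability at least $p$, where $$\lambda_n=\left(\sqrt{\max\{I_n''-\mu_n,\mu_n+K\}}+\sqrt{I_n}\right)\sqrt{2(\mu_n+K)}\,\gamma\beta,$$ and where: if the $\mathbf{p}_n$ are nearly optimal probabilities with constant $\beta_0\in(0,1]$, then $$\phi_n=\frac{\eta_n}{\sqrt{\beta_0T_n}},\qquad \eta_n=1+\sqrt{(8/\delta_n)\log(1/\delta_n)};$$ and if the $\mathbf{p}_n$ are the uniform probabilities, then $$\phi_n=1+\sqrt{\frac{I_n'}{T_n}}+\frac{I_n'}{\sqrt{T_n}}\sqrt{8\log(1/\delta_n)}.$$
   Context: $\sigma_i(\cdot)$ is the $i$th largest singular value; $\|\cdot\|_F$ is the Frobenius norm of a matrix or tensor. A matrix $\mathbf{Q}$ is orthonormal if $\mathbf{Q}^\top\mathbf{Q}$ is the identity. $\mathbf{A}_{(n)}\in\mathbb{R}^{I_n\times J_n}$, with $J_n=I_1\cdots I_{n-1}I_{n+1}\cdots I_N$, is the mode-$n$ unfolding of $\mathcal{A}$ (its columns are the mode-$n$ fibers), and $\mathcal{A}\times_n\mathbf{B}$ is the mode-$n$ product, with entries $\sum_{i_n}a_{i_1\dots i_n\dots i_N}b_{j i_n}$. A standard Gaussian matrix has i.i.d. $N(0,1)$ entries. $\Delta_{\mu_n+1}(\mathbf{A}_{(n)},1)=\left(\sum_{i=\mu_n+1}^{I_n'}\sigma_i(\mathbf{A}_{(n)})^{4}\right)^{1/2}$. Sampling matrix: for a probability distribution $\mathbf{p}=(p_1,\dots,p_J)$ and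 a positive integer $L$, $\mathbf{S}\in\mathbb{R}^{J\times L}\sim\mathrm{RANDSAMPLE}(L,\mathbf{p})$ means that $s_{ij}=1/\sqrt{Lp_i}$ if $\xi_j=i$ and $s_{ij}=0$ otherwise, where $\xi_1,\dots,\xi_L$ are independent with $\mathbb{P}(\xi_j=i)=p_i$. Probabilities $\mathbf{p}_n=(p_{n,1},\dots,p_{n,J_n})$ are nearly optimal with constant $\beta_0\in(0,1]$ (for the product $\mathbf{A}_{(n)}\mathbf{A}_{(n)}^\top$) if $p_{n,i}\geq\beta_0\|\mathbf{A}_{(n)}(:,i)\|_2^2/\|\mathbf{A}_{(n)}\|_F^2$ for all $i$; they are uniform if $p_{n,i}=1/J_n$ for all $i$. Sampled randomized T-HOSVD algorithm: for each $n=1,\dots,N$, generate $\mathbf{S}_n\in\mathbb{R}^{J_n\times T_n}\sim\mathrm{RANDSAMPLE}(T_n,\mathbf{p}_n)$; set $\mathbf{C}_n'=\mathbf{A}_{(n)}\mathbf{S}_n$; generate a standard Gaussian matrix $\mathbf{G}_n\in\mathbb{R}^{I_n\times(\mu_n+K)}$ (independent of $\mathbf{S}_n$); set $\mathbf{C}_n=(\mathbf{C}_n'\mathbf{C}_n'^\top)^q\mathbf{G}_n$; find an orthonormal $\mathbf{Q}_n\in\mathbb{R}^{I_n\times\mu_n}$ for which there exists $\mathbf{R}_n\in\mathbb{R}^{\mu_n\times(\mu_n+K)}$ with $\|\mathbf{Q}_n\mathbf{R}_n-\mathbf{C}_n\|_F\leq\left(\sum_{k=\mu_n+1}^{\mu_n+K}\sigma_k(\mathbf{C}_n)^2\right)^{1/2}$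 (for example, the first $\mu_n$ left singular vectors of $\mathbf{C}_n$). *)

theory Defs
  imports "HOL-Probability.Probability" "Jordan_Normal_Form.Char_Poly" "Jordan_Normal_Form.DL_Rank"
begin

text \<open>The matrix names \<open>mat\<close>, \<open>row\<close>, \<open>rank\<close>, ... of HOL-Analysis have dimensions fixed by types;
  here all matrices are those of Jordan_Normal_Form, with rows and columns numbered from 0.\<close>

definition frob_norm :: "real mat \<Rightarrow> real" where
  "frob_norm X = sqrt (\<Sum>i<dim_row X. \<Sum>j<dim_col X. (X $$ (i, j))\<^sup>2)"

text \<open>Square roots of the eigenvalues of \<open>X\<^sup>T X\<close>, counted with multiplicity. The index starts at 1;
  the list has \<open>dim_col X\<close> entries, those beyond \<open>min (dim_row X) (dim_col X)\<close> being 0.\<close>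

definition singular_values :: "real mat \<Rightarrow> real list" where
  "singular_values X =
     rev (sorted_list_of_multiset (image_mset sqrt (proots (char_poly (transpose_mat X * X)))))"

definition sigma_val :: "nat \<Rightarrow> real mat \<Rightarrow> real" where
  "sigma_val i X = singular_values X ! (i - 1)"

definition Delta1 :: "nat \<Rightarrow> real mat \<Rightarrow> real" where
  "Delta1 k X = sqrt (\<Sum>i = k..min (dim_row X) (dim_col X). sigma_val i X ^ 4)"

definition orthonormal_mat :: "real mat \<Rightarrow> bool" where
  "orthonormal_mat Q \<longleftrightarrow> transpose_mat Q * Q = 1\<^sub>m (dim_col Q)"

text \<open>A tensor of format \<open>I 1 \<times> \<dots> \<times> I N\<close> is a function on multi-indices \<open>i\<close>, with modes \<open>n\<close>
  numbered from 1 to N and entries \<open>i n\<close> from 0 to \<open>I n - 1\<close>. Its values outside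
  \<open>multi_idx I N\<close> are irrelevant.\<close>

type_synonym tensor = "(nat \<Rightarrow> nat) \<Rightarrow> real"

definition multi_idx :: "(nat \<Rightarrow> nat) \<Rightarrow> nat \<Rightarrow> (nat \<Rightarrow> nat) set" where
  "multi_idx I N = (\<Pi>\<^sub>E n\<in>{1..N}. {..<I n})"

definition tensor_norm :: "(nat \<Rightarrow> nat) \<Rightarrow> nat \<Rightarrow> tensor \<Rightarrow> real" where
  "tensor_norm I N A = sqrt (\<Sum>i\<in>multi_idx I N. (A i)\<^sup>2)"

definition other_dim :: "(nat \<Rightarrow> nat) \<Rightarrow> nat \<Rightarrow> nat \<Rightarrow> nat" where
  "other_dim I N n = (\<Prod>m\<in>{1..N} - {n}. I m)"

text \<open>Column c holds the mode-n fiber whose remaining indices are the mixed-radix digits of c,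
  the lowest mode varying fastest.\<close>

definition unfolding_mat :: "(nat \<Rightarrow> nat) \<Rightarrow> nat \<Rightarrow> nat \<Rightarrow> tensor \<Rightarrow> real mat" where
  "unfolding_mat I N n A = Matrix.mat (I n) (other_dim I N n)
     (\<lambda>(r, c). A (\<lambda>k\<in>{1..N}. if k = n then r else (c div (\<Prod>m\<in>{1..<k} - {n}. I m)) mod I k))"

definition mode_prod :: "tensor \<Rightarrow> nat \<Rightarrow> real mat \<Rightarrow> tensor" where
  "mode_prod A n B = (\<lambda>i. \<Sum>k<dim_col B. A (i(n := k)) * B $$ (i n, k))"

definition mode_prods :: "nat \<Rightarrow> tensor \<Rightarrow> (nat \<Rightarrow> real mat) \<Rightarrow> tensor" where
  "mode_prods N A B = fold (\<lambda>n X. mode_prod X n (B n)) [1..<Suc N] A"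

text \<open>The Borel sigma-algebra on the r by c matrices; its measure is irrelevant.\<close>

definition mat_borel :: "nat \<Rightarrow> nat \<Rightarrow> real mat measure" where
  "mat_borel r c = vimage_algebra (carrier_mat r c) (\<lambda>X. restrict (($$) X) ({..<r} \<times> {..<c}))
     (\<Pi>\<^sub>M ij\<in>{..<r} \<times> {..<c}. borel)"

definition std_gaussian_mat :: "'w measure \<Rightarrow> nat \<Rightarrow> nat \<Rightarrow> ('w \<Rightarrow> real mat) \<Rightarrow> bool" where
  "std_gaussian_mat M r c G \<longleftrightarrow>
     G \<in> measurable M (mat_borel r c) \<and>
     prob_space.indep_vars M (\<lambda>_. borel) (\<lambda>ij \<omega>. G \<omega> $$ ij) ({..<r} \<times> {..<c}) \<and>
     (\<forall>ij\<in>{..<r} \<times> {..<c}. distributed M lborel (\<lambda>\<omega>. G \<omega> $$ ij) (\<lambda>x. ennreal (std_normal_density x)))"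

definition prob_vector :: "nat \<Rightarrow> (nat \<Rightarrow> real) \<Rightarrow> bool" where
  "prob_vector J p \<longleftrightarrow> (\<forall>i<J. 0 \<le> p i) \<and> (\<Sum>i<J. p i) = 1"

definition randsample :: "'w measure \<Rightarrow> nat \<Rightarrow> nat \<Rightarrow> (nat \<Rightarrow> real) \<Rightarrow> ('w \<Rightarrow> real mat) \<Rightarrow> bool" where
  "randsample M J L p S \<longleftrightarrow>
     (\<exists>\<xi> :: nat \<Rightarrow> 'w \<Rightarrow> nat.
        prob_space.indep_vars M (\<lambda>_. count_space {..<J}) \<xi> {..<L} \<and>
        (\<forall>j<L. \<forall>i<J. measure M {\<omega> \<in> space M. \<xi> j \<omega> = i} = p i) \<and>
        (\<forall>\<omega>\<in>space M. S \<omega> =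
           Matrix.mat J L (\<lambda>(i, j). if \<xi> j \<omega> = i then 1 / sqrt (real L * p i) else 0)))"

text \<open>Optimality refers to the product \<open>X X\<^sup>T\<close>. For \<open>X = 0\<close> the bound reads \<open>p i \<ge> 0\<close>.\<close>

definition nearly_optimal :: "real \<Rightarrow> real mat \<Rightarrow> (nat \<Rightarrow> real) \<Rightarrow> bool" where
  "nearly_optimal \<beta>0 X p \<longleftrightarrow>
     (\<forall>i<dim_col X. p i \<ge> \<beta>0 * (\<Sum>k<dim_row X. (X $$ (k, i))\<^sup>2) / (frob_norm X)\<^sup>2)"

definition uniform_probs :: "nat \<Rightarrow> (nat \<Rightarrow> real) \<Rightarrow> bool" where
  "uniform_probs J p \<longleftrightarrow> (\<forall>i<J. p i = 1 / real J)"

text \<open>\<open>Q\<close> is an admissible result of the last step of the algorithm for the sketch \<open>C\<close>.\<close>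

definition range_basis :: "nat \<Rightarrow> nat \<Rightarrow> real mat \<Rightarrow> real mat \<Rightarrow> bool" where
  "range_basis \<mu> K C Q \<longleftrightarrow>
     Q \<in> carrier_mat (dim_row C) \<mu> \<and> orthonormal_mat Q \<and>
     (\<exists>R \<in> carrier_mat \<mu> (\<mu> + K).
        frob_norm (Q * R - C) \<le> sqrt (\<Sum>k = \<mu> + 1..\<mu> + K. (sigma_val k C)\<^sup>2))"

text \<open>One run of the algorithm on the probability space \<open>M\<close>, where \<open>S n\<close>, \<open>G n\<close>, \<open>Q n\<close> are random
  matrices. Independence between different modes is not required.\<close>

definition sampled_rthosvd ::
  "'w measure \<Rightarrow> (nat \<Rightarrow> nat) \<Rightarrow> nat \<Rightarrow> tensor \<Rightarrow> (nat \<Rightarrow> nat) \<Rightarrow> (nat \<Rightarrow> nat) \<Rightarrow> nat \<Rightarrow> nat \<Rightarrow>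
   (nat \<Rightarrow> nat \<Rightarrow> real) \<Rightarrow> (nat \<Rightarrow> 'w \<Rightarrow> real mat) \<Rightarrow> (nat \<Rightarrow> 'w \<Rightarrow> real mat) \<Rightarrow>
   (nat \<Rightarrow> 'w \<Rightarrow> real mat) \<Rightarrow> bool" where
  "sampled_rthosvd M I N A \<mu> T K q p S G Q \<longleftrightarrow>
     (\<forall>n\<in>{1..N}.
        randsample M (other_dim I N n) (T n) (p n) (S n) \<and>
        std_gaussian_mat M (I n) (\<mu> n + K) (G n) \<and>
        prob_space.indep_var M (mat_borel (other_dim I N n) (T n)) (S n)
          (mat_borel (I n) (\<mu> n + K)) (G n) \<and>
        Q n \<in> measurable M (mat_borel (I n) (\<mu> n)) \<and>
        (\<forall>\<omega>\<in>space M.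
           let C' = unfolding_mat I N n A * S n \<omega>;
               C = ((C' * transpose_mat C') ^\<^sub>m q) * G n \<omega>
           in range_basis (\<mu> n) K C (Q n \<omega>)))"

end

theory Submission imports Defs begin

unbundle no inner_syntax and no vec_syntax

text \<open>The squared error is at most the sum over the modes of the squared residuals of \<open>X = A\<^sub>(\<^sub>n\<^sub>)\<close>
  under the projections \<open>1 - Q Q\<^sup>T\<close>. By Cauchy-Schwarz on the eigenvalues, the residual of \<open>X\<close> is at
  most \<open>\<surd>rank X\<close> times \<open>\<parallel>X X\<^sup>T - B\<parallel> + \<parallel>(1 - Q Q\<^sup>T) B\<parallel>\<close>, where \<open>B = X S (X S)\<^sup>T\<close>. Splitting \<open>B = L V\<^sup>T + Y\<close>
  with \<open>V\<close> orthonormal of \<open>\<mu>\<close> columns and \<open>\<parallel>Y\<parallel>\<close> bounded by the sampled tail energy \<open>Z\<close>, the last norm is at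
  most \<open>\<parallel>Y\<parallel> + 2 \<parallel>Y G\<parallel> (\<Sum>k. 1 / D\<^sub>k)\<^sup>1\<^sup>/\<^sup>2\<close>, where \<open>D\<^sub>k\<close> is the squared distance of row \<open>k\<close> of the
  Gaussian matrix \<open>V\<^sup>T G\<close> from the span of its other rows.

  Given \<open>S\<close>, the event that some \<open>D\<^sub>k\<close> is small or \<open>\<parallel>Y G\<parallel>\<close> is large has probability at most the
  Stirling-like term \<open>\<kappa>\<close> of the theorem (Laplace transforms of chi-square variables). Off this event, failure
  forces a combination of \<open>\<parallel>X X\<^sup>T - B\<parallel>\<close> and \<open>\<bar>Z - \<tau>\<bar>\<close>, with \<open>\<tau>\<close> the tail energy of \<open>X\<close>, to
  exceed a threshold; second moments of importance sampling and Chebyshev's inequality bound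
  the probability of this by \<open>\<delta>\<close>. If \<open>\<phi> \<ge> 1\<close>, as for uniform probabilities, the bound is trivial.
  The factor \<open>\<lambda>\<close> enters only through \<open>(1 + \<lambda>) I \<ge> m + 2 \<surd>2 m\<^sup>2\<close> with \<open>m = \<mu> + K\<close>.\<close>

section \<open>Frobenius inner product\<close>

text \<open>The degrees of freedom fix the shape of the estimate: a row of
  \<open>V\<^sup>T G\<close> has \<open>m = \<mu> + K\<close> independent normal entries and the
  other rows remove at most \<open>\<mu> - 1\<close> directions, so \<open>D\<^sub>k\<close> is
  compared with a chi-square variable of \<open>n = K + 1\<close> degrees of freedom. The
  reciprocals are therefore cut off at a level \<open>s\<close>, and the loss is recovered from the
  probability budget: for \<open>\<kappa> + \<delta> > 1\<close> there is nothing to prove, so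
  \<open>\<delta> \<le> 1 - \<kappa>\<close>, which keeps \<open>ln (1 / \<delta>)\<close> away from
  0 when \<open>n\<close> is small and \<open>\<kappa>\<close> large.

  The sampled tail energy is split into \<open>\<tau>\<close> and its deviation. The factor of
  \<open>\<tau>\<close> is bounded with all \<open>D\<^sub>k\<close> at the floor \<open>s\<close>,
  that of the deviation only in mean square. This conditional bound is averaged over the values of
  \<open>S\<close> afterwards, so that sampling and sketching errors share a single
  \<open>\<delta>\<close>. Room for the threshold comes from the factor
  \<open>sqrt (rank - \<mu>)\<close>, instead of \<open>sqrt rank\<close>, in the tail
  energy.\<close>

definition finner :: "real mat \<Rightarrow> real mat \<Rightarrow> real" where
  "finner X Y = (\<Sum>i<dim_row X. \<Sum>j<dim_col X. X $$ (i, j) * Y $$ (i, j))"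

lemma mult_mat_entry:
  assumes "A \<in> carrier_mat n k" "B \<in> carrier_mat k c" "i < n" "j < c"
  shows "(A * B) $$ (i, j) = (\<Sum>l<k. A $$ (i, l) * B $$ (l, j))"
  using assms by (auto simp: scalar_prod_def lessThan_atLeast0 intro!: sum.cong)

lemma frob_norm_finner: "frob_norm X = sqrt (finner X X)"
  by (simp add: frob_norm_def finner_def power2_eq_square)

lemma finner_self_nonneg: "0 \<le> finner X X"
  by (auto simp: finner_def intro!: sum_nonneg)

lemma frob_norm_nonneg: "0 \<le> frob_norm X"
  by (simp add: frob_norm_finner finner_self_nonneg)

lemma frob_norm_power2: "(frob_norm X)\<^sup>2 = finner X X"
  by (simp add: frob_norm_finner finner_self_nonneg)

lemma finner_commute:
  assumes "X \<in> carrier_mat n c" "Y \<in> carrier_mat n c"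
  shows "finner X Y = finner Y X"
  using assms by (auto simp: finner_def mult.commute)

lemma finner_transpose:
  assumes "X \<in> carrier_mat n c" "Y \<in> carrier_mat n c"
  shows "finner X\<^sup>T Y\<^sup>T = finner X Y"
proof -
  have "finner X\<^sup>T Y\<^sup>T = (\<Sum>j<c. \<Sum>i<n. X $$ (i, j) * Y $$ (i, j))"
    using assms by (auto simp: finner_def intro!: sum.cong)
  also have "\<dots> = finner X Y"
    using assms by (subst sum.swap) (auto simp: finner_def)
  finally show ?thesis .
qed

lemma frob_norm_transpose: "frob_norm X\<^sup>T = frob_norm X"
  by (simp add: frob_norm_finner finner_transpose[of X "dim_row X" "dim_col X" X])

lemma finner_minus_left:
  assumes "X \<in> carrier_mat n c" "Y \<in> carrier_mat n c" "Z \<in> carrier_mat n c"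
  shows "finner (X - Y) Z = finner X Z - finner Y Z"
proof -
  have "finner (X - Y) Z = (\<Sum>i<n. \<Sum>j<c. X $$ (i, j) * Z $$ (i, j) - Y $$ (i, j) * Z $$ (i, j))"
    using assms by (auto simp: finner_def algebra_simps intro!: sum.cong)
  then show ?thesis using assms by (simp add: finner_def sum_subtractf)
qed

lemma finner_minus_right:
  assumes "X \<in> carrier_mat n c" "Y \<in> carrier_mat n c" "Z \<in> carrier_mat n c"
  shows "finner Z (X - Y) = finner Z X - finner Z Y"
  using finner_minus_left[OF assms] finner_commute assms minus_carrier_mat by metis

text \<open>\<open>finner X Y\<close> is the trace of \<open>X\<^sup>T Y\<close>, so left
  multiplication by \<open>A\<close> has adjoint \<open>A\<^sup>T\<close>; the proof only
  interchanges finite sums.\<close>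

lemma finner_mult_left:
  assumes A: "A \<in> carrier_mat n k" and B: "B \<in> carrier_mat k c" and C: "C \<in> carrier_mat n c"
  shows "finner (A * B) C = finner B (A\<^sup>T * C)"
proof -
  have "finner (A * B) C = (\<Sum>i<n. \<Sum>j<c. \<Sum>l<k. A $$ (i, l) * B $$ (l, j) * C $$ (i, j))"
    using A B C by (auto simp: finner_def mult_mat_entry[OF A B] sum_distrib_right simp del: index_mult_mat(1) intro!: sum.cong)
  also have "\<dots> = (\<Sum>i<n. \<Sum>l<k. \<Sum>j<c. A $$ (i, l) * B $$ (l, j) * C $$ (i, j))"
    by (intro sum.cong refl sum.swap)
  also have "\<dots> = (\<Sum>l<k. \<Sum>i<n. \<Sum>j<c. A $$ (i, l) * B $$ (l, j) * C $$ (i, j))"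
    by (rule sum.swap)
  also have "\<dots> = (\<Sum>l<k. \<Sum>j<c. \<Sum>i<n. A $$ (i, l) * B $$ (l, j) * C $$ (i, j))"
    by (intro sum.cong refl sum.swap)
  also have "\<dots> = finner B (A\<^sup>T * C)"
    using A B C by (auto simp: finner_def mult_mat_entry[of "A\<^sup>T" k n C c] sum_distrib_left algebra_simps
        simp del: index_mult_mat(1) intro!: sum.cong)
  finally show ?thesis .
qed

lemma finner_mult_right:
  assumes A: "A \<in> carrier_mat n k" and B: "B \<in> carrier_mat k c" and C: "C \<in> carrier_mat n c"
  shows "finner (A * B) C = finner A (C * B\<^sup>T)"
proof -
  have "finner (A * B) C = finner (B\<^sup>T * A\<^sup>T) C\<^sup>T"
    using finner_transpose[of "A * B" n c C] assms by (simp add: transpose_mult)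
  also have "\<dots> = finner A\<^sup>T (B * C\<^sup>T)"
    using finner_mult_left[of "B\<^sup>T" c k "A\<^sup>T" n "C\<^sup>T"] assms by simp
  also have "\<dots> = finner A (C * B\<^sup>T)"
    using finner_transpose[of A n k "C * B\<^sup>T"] assms by (simp add: transpose_mult)
  finally show ?thesis .
qed

lemma frob_norm_L2_set:
  assumes "X \<in> carrier_mat n c"
  shows "frob_norm X = L2_set (\<lambda>ij. X $$ ij) ({..<n} \<times> {..<c})"
  using assms by (simp add: frob_norm_def L2_set_def sum.cartesian_product split_def)

lemma frob_norm_triangle:
  assumes "X \<in> carrier_mat n c" "Y \<in> carrier_mat n c"
  shows "frob_norm (X + Y) \<le> frob_norm X + frob_norm Y"
proof -
  have "frob_norm (X + Y) = L2_set (\<lambda>ij. X $$ ij + Y $$ ij) ({..<n} \<times> {..<c})"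
    using assms by (subst frob_norm_L2_set[of _ n c]) (auto intro!: L2_set_cong)
  also have "\<dots> \<le> frob_norm X + frob_norm Y"
    using assms L2_set_triangle_ineq by (auto simp: frob_norm_L2_set)
  finally show ?thesis .
qed

lemma frob_norm_uminus:
  assumes "X \<in> carrier_mat n c"
  shows "frob_norm (- X) = frob_norm X"
  using assms by (simp add: frob_norm_def)

lemma frob_norm_triangle_minus:
  assumes "X \<in> carrier_mat n c" "Y \<in> carrier_mat n c"
  shows "frob_norm (X - Y) \<le> frob_norm X + frob_norm Y"
proof -
  have "X - Y = X + (- Y)" using assms by auto
  then show ?thesis using frob_norm_triangle[of X n c "- Y"] assms by (simp add: frob_norm_uminus)
qed

lemma finner_le:
  assumes "X \<in> carrier_mat n c" "Y \<in> carrier_mat n c"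
  shows "finner X Y \<le> frob_norm X * frob_norm Y"
proof -
  have "finner X Y = (\<Sum>ij\<in>{..<n} \<times> {..<c}. X $$ ij * Y $$ ij)"
    using assms by (simp add: finner_def sum.cartesian_product split_def)
  also have "\<dots> \<le> (\<Sum>ij\<in>{..<n} \<times> {..<c}. \<bar>X $$ ij\<bar> * \<bar>Y $$ ij\<bar>)"
    by (intro sum_mono) (metis abs_ge_self abs_mult)
  also have "\<dots> \<le> frob_norm X * frob_norm Y"
    using assms L2_set_mult_ineq[of "\<lambda>ij. X $$ ij" "\<lambda>ij. Y $$ ij"] by (simp add: frob_norm_L2_set)
  finally show ?thesis .
qed

lemma frob_norm_mult:
  assumes A: "A \<in> carrier_mat n k" and B: "B \<in> carrier_mat k c"
  shows "frob_norm (A * B) \<le> frob_norm A * frob_norm B"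
proof -
  have "finner (A * B) (A * B) = (\<Sum>i<n. \<Sum>j<c. (\<Sum>l<k. A $$ (i, l) * B $$ (l, j))\<^sup>2)"
    using A B by (auto simp: finner_def mult_mat_entry[OF A B] power2_eq_square simp del: index_mult_mat(1) intro!: sum.cong)
  also have "\<dots> \<le> (\<Sum>i<n. \<Sum>j<c. (\<Sum>l<k. (A $$ (i, l))\<^sup>2) * (\<Sum>l<k. (B $$ (l, j))\<^sup>2))"
    by (intro sum_mono Cauchy_Schwarz_ineq_sum)
  also have "\<dots> = (\<Sum>i<n. \<Sum>l<k. (A $$ (i, l))\<^sup>2) * (\<Sum>j<c. \<Sum>l<k. (B $$ (l, j))\<^sup>2)"
    by (simp add: sum_product)
  also have "(\<Sum>j<c. \<Sum>l<k. (B $$ (l, j))\<^sup>2) = finner B B"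
    using B by (subst sum.swap) (simp add: finner_def power2_eq_square)
  also have "(\<Sum>i<n. \<Sum>l<k. (A $$ (i, l))\<^sup>2) = finner A A"
    using A by (simp add: finner_def power2_eq_square)
  finally show ?thesis
    by (simp add: frob_norm_finner flip: real_sqrt_mult)
qed

section \<open>Matrices with orthonormal columns and their projections\<close>

lemma orthonormal_matD:
  assumes "orthonormal_mat Q" "Q \<in> carrier_mat n k"
  shows "Q\<^sup>T * Q = 1\<^sub>m k"
  using assms by (simp add: orthonormal_mat_def)

lemma frob_norm_orthonormal_mult:
  assumes Q: "orthonormal_mat Q" "Q \<in> carrier_mat n k" and Y: "Y \<in> carrier_mat k c"
  shows "frob_norm (Q * Y) = frob_norm Y"
proof -
  have "Q\<^sup>T * (Q * Y) = (Q\<^sup>T * Q) * Y"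
    using Q(2) Y by (simp add: assoc_mult_mat[of _ k n _ k _ c])
  then have "Q\<^sup>T * (Q * Y) = Y" using orthonormal_matD[OF Q] Y by simp
  then have "finner (Q * Y) (Q * Y) = finner Y Y"
    using finner_mult_left[of Q n k Y c "Q * Y"] Q Y by simp
  then show ?thesis by (simp add: frob_norm_finner)
qed

lemma frob_norm_mult_orthonormal_transpose:
  assumes Q: "orthonormal_mat Q" "Q \<in> carrier_mat n k" and Y: "Y \<in> carrier_mat c k"
  shows "frob_norm (Y * Q\<^sup>T) = frob_norm Y"
  using frob_norm_orthonormal_mult[OF Q, of "Y\<^sup>T" c] frob_norm_transpose[of "Y * Q\<^sup>T"] Q Y
  by (simp add: transpose_mult[of Y c k "Q\<^sup>T" n] frob_norm_transpose)

text \<open>The projected part \<open>Q Q\<^sup>T X\<close> and the residual are orthogonal for the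
  trace form, and \<open>Q\<close> is an isometry, which turns the norm of
  \<open>Q Q\<^sup>T X\<close> into that of \<open>Q\<^sup>T X\<close>. This is also the step of the
  induction over the tensor modes.\<close>

lemma orthonormal_projection_Pythagoras:
  assumes Q: "orthonormal_mat Q" "Q \<in> carrier_mat n k" and X: "X \<in> carrier_mat n c"
  shows "finner X X = finner (Q\<^sup>T * X) (Q\<^sup>T * X) + finner (X - Q * (Q\<^sup>T * X)) (X - Q * (Q\<^sup>T * X))"
proof -
  let ?Y = "Q\<^sup>T * X"
  have Y: "?Y \<in> carrier_mat k c" using Q X by simp
  have QY: "Q * ?Y \<in> carrier_mat n c" using Q X by simp
  have 1: "finner (Q * ?Y) (Q * ?Y) = finner ?Y ?Y"
    using frob_norm_orthonormal_mult[OF Q Y] by (metis frob_norm_power2)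
  have 2: "finner (Q * ?Y) X = finner ?Y ?Y"
    using finner_mult_left[OF Q(2) Y X] .
  have 3: "finner X (Q * ?Y) = finner ?Y ?Y"
    using 2 finner_commute[OF X QY] by simp
  show ?thesis
    using finner_minus_left[OF X QY minus_carrier_mat[OF QY, of X]]
      finner_minus_right[OF X QY X] finner_minus_right[OF X QY QY] 1 2 3 by simp
qed

lemma frob_norm_projection_residual_le:
  assumes Q: "orthonormal_mat Q" "Q \<in> carrier_mat n k" and X: "X \<in> carrier_mat n c"
  shows "frob_norm (X - Q * (Q\<^sup>T * X)) \<le> frob_norm X"
  using orthonormal_projection_Pythagoras[OF assms] finner_self_nonneg
  by (simp add: frob_norm_finner)

lemma frob_norm_orthonormal_transpose_mult_le:
  assumes Q: "orthonormal_mat Q" "Q \<in> carrier_mat n k" and X: "X \<in> carrier_mat n c"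
  shows "frob_norm (Q\<^sup>T * X) \<le> frob_norm X"
  using orthonormal_projection_Pythagoras[OF assms] finner_self_nonneg
  by (simp add: frob_norm_finner)

lemma frob_norm_mult_orthonormal_le:
  assumes Q: "orthonormal_mat Q" "Q \<in> carrier_mat n k" and X: "X \<in> carrier_mat c n"
  shows "frob_norm (X * Q) \<le> frob_norm X"
  using frob_norm_orthonormal_transpose_mult_le[OF Q, of "X\<^sup>T" c] frob_norm_transpose[of "X * Q"] Q X
  by (simp add: transpose_mult[of X c n Q k] frob_norm_transpose)

lemma frob_norm_orthonormal:
  assumes Q: "orthonormal_mat Q" "Q \<in> carrier_mat n k"
  shows "frob_norm Q = sqrt k"
proof -
  have "frob_norm Q = frob_norm (1\<^sub>m k :: real mat)"
    using frob_norm_orthonormal_mult[OF Q, of "1\<^sub>m k" k] Q by simp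
  also have "\<dots> = sqrt k"
    by (simp add: frob_norm_def if_distrib[of "\<lambda>x. x\<^sup>2"] cong: if_cong)
  finally show ?thesis .
qed

section \<open>Orthonormal bases and the spectral theorem\<close>

lemma exists_orthogonal_vec:
  fixes A :: "real mat"
  assumes A: "A \<in> carrier_mat k n" and "k < n"
  shows "\<exists>v\<in>carrier_vec n. v \<noteq> 0\<^sub>v n \<and> A *\<^sub>v v = 0\<^sub>v k"
proof -
  define c where "c i = (if i < k then Matrix.row A i else 0\<^sub>v n)" for i
  \<comment> \<open>Since \<open>k < n\<close>, padding to a square matrix leaves a zero row at
    index \<open>k\<close>. The determinant vanishes and yields a kernel vector; the test
    \<open>i = k\<close> has the form that \<open>det_row_0\<close> expects.\<close>
  define B where "B = mat\<^sub>r n n (\<lambda>i. if i = k then 0\<^sub>v n else c i)"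
  have B: "B \<in> carrier_mat n n" by (simp add: B_def)
  have "Determinant.det B = 0"
    unfolding B_def by (rule det_row_0) (use assms in \<open>auto simp: c_def\<close>)
  then obtain v where v: "v \<in> carrier_vec n" "v \<noteq> 0\<^sub>v n" "B *\<^sub>v v = 0\<^sub>v n"
    using det_0_iff_vec_prod_zero[OF B] by auto
  have "A *\<^sub>v v = 0\<^sub>v k"
  proof (rule eq_vecI)
    fix i assume "i < dim_vec (0\<^sub>v k :: real vec)"
    then have i: "i < k" by simp
    have "Matrix.row B i = Matrix.row A i"
      using i assms by (auto simp: B_def c_def)
    then have "(A *\<^sub>v v) $ i = (B *\<^sub>v v) $ i"
      using i assms B by simp
    then show "(A *\<^sub>v v) $ i = 0\<^sub>v k $ i" using v(3) i assms by simp
  qed (use A in simp)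
  then show ?thesis using v by auto
qed

lemma scalar_prod_eq_sum:
  fixes v w :: "real vec"
  assumes "w \<in> carrier_vec n"
  shows "v \<bullet> w = (\<Sum>i<n. v $ i * w $ i)"
  using assms by (simp add: scalar_prod_def lessThan_atLeast0)

lemma scalar_prod_self_pos:
  fixes v :: "real vec"
  assumes "v \<in> carrier_vec n" "v \<noteq> 0\<^sub>v n"
  shows "0 < v \<bullet> v"
proof -
  obtain i where i: "i < n" "v $ i \<noteq> 0"
    using assms by (metis carrier_vecD eq_vecI index_zero_vec)
  have "0 < (\<Sum>i<n. v $ i * v $ i)"
    using i by (intro sum_pos2[of _ i]) (auto simp: zero_less_mult_iff mult_neg_neg not_less_iff_gr_or_eq)
  then show ?thesis using assms(1) by (simp add: scalar_prod_eq_sum)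
qed

lemma exists_unit_multiple:
  fixes v :: "real vec"
  assumes v: "v \<in> carrier_vec n" "v \<noteq> 0\<^sub>v n"
  shows "\<exists>c. (c \<cdot>\<^sub>v v) \<bullet> (c \<cdot>\<^sub>v v) = 1"
proof
  have "0 < v \<bullet> v" by (rule scalar_prod_self_pos[OF v])
  then show "((1 / sqrt (v \<bullet> v)) \<cdot>\<^sub>v v) \<bullet> ((1 / sqrt (v \<bullet> v)) \<cdot>\<^sub>v v) = 1"
    using v by (simp add: field_simps)
qed

definition append_col :: "real mat \<Rightarrow> real vec \<Rightarrow> real mat" where
  "append_col Z v = Matrix.mat (dim_row Z) (Suc (dim_col Z))
     (\<lambda>(i, j). if j < dim_col Z then Z $$ (i, j) else v $ i)"

lemma append_col_carrier [simp]:
  "Z \<in> carrier_mat n k \<Longrightarrow> append_col Z v \<in> carrier_mat n (Suc k)"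
  by (auto simp: append_col_def)

lemma col_append_col:
  assumes "Z \<in> carrier_mat n k" "v \<in> carrier_vec n" "j < Suc k"
  shows "col (append_col Z v) j = (if j < k then col Z j else v)"
  using assms by (auto simp: append_col_def)

lemma orthonormal_mat_iff:
  assumes "Q \<in> carrier_mat n k"
  shows "orthonormal_mat Q \<longleftrightarrow> (\<forall>i<k. \<forall>j<k. col Q i \<bullet> col Q j = (if i = j then 1 else 0))"
proof -
  have "orthonormal_mat Q \<longleftrightarrow> (\<forall>i<k. \<forall>j<k. (Q\<^sup>T * Q) $$ (i, j) = (1\<^sub>m k) $$ (i, j))"
  proof
    assume "orthonormal_mat Q"
    then show "\<forall>i<k. \<forall>j<k. (Q\<^sup>T * Q) $$ (i, j) = (1\<^sub>m k) $$ (i, j)"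
      using assms by (simp only: orthonormal_mat_def carrier_matD) auto
  next
    assume *: "\<forall>i<k. \<forall>j<k. (Q\<^sup>T * Q) $$ (i, j) = (1\<^sub>m k) $$ (i, j)"
    have "Q\<^sup>T * Q = 1\<^sub>m k"
      by (rule eq_matI) (use * assms in \<open>auto simp del: index_mult_mat(1)\<close>)
    then show "orthonormal_mat Q" using assms by (simp add: orthonormal_mat_def)
  qed
  then show ?thesis using assms by simp
qed

lemma orthonormal_append_col:
  assumes Z: "Z \<in> carrier_mat n k" "orthonormal_mat Z" and v: "v \<in> carrier_vec n" "v \<bullet> v = 1"
    and "Z\<^sup>T *\<^sub>v v = 0\<^sub>v k"
  shows "orthonormal_mat (append_col Z v)"
proof -
  have 1: "col Z i \<bullet> v = 0" if "i < k" for i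
    using arg_cong[OF assms(5), of "\<lambda>w. w $ i"] that Z by simp
  then have 2: "v \<bullet> col Z i = 0" if "i < k" for i
    using comm_scalar_prod[of v n "col Z i"] that v Z by simp
  show ?thesis
    unfolding orthonormal_mat_iff[OF append_col_carrier[OF Z(1)]]
    using Z v 1 2 by (auto simp: col_append_col[OF Z(1) v(1)] orthonormal_mat_iff less_Suc_eq)
qed

lemma mult_mat_eq_zero_iff:
  fixes A B :: "real mat"
  assumes "A \<in> carrier_mat k n" "B \<in> carrier_mat n c"
  shows "A * B = 0\<^sub>m k c \<longleftrightarrow> (\<forall>j<c. A *\<^sub>v col B j = 0\<^sub>v k)"
proof
  assume *: "A * B = 0\<^sub>m k c"
  show "\<forall>j<c. A *\<^sub>v col B j = 0\<^sub>v k"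
  proof (intro allI impI)
    fix j assume "j < c"
    then show "A *\<^sub>v col B j = 0\<^sub>v k"
      using arg_cong[OF *, of "\<lambda>M. col M j"] assms by (simp add: col_mult2[OF assms] del: col_mult)
  qed
next
  assume *: "\<forall>j<c. A *\<^sub>v col B j = 0\<^sub>v k"
  show "A * B = 0\<^sub>m k c"
  proof (rule eq_matI)
    fix i j assume "i < dim_row (0\<^sub>m k c :: real mat)" "j < dim_col (0\<^sub>m k c :: real mat)"
    then have ij: "i < k" "j < c" by auto
    have "(A *\<^sub>v col B j) $ i = 0" using * ij by simp
    then show "(A * B) $$ (i, j) = 0\<^sub>m k c $$ (i, j)" using ij assms by simp
  qed (use assms in auto)
qed

text \<open>The columns are found one at a time: the next one must be killed by \<open>A\<close> and
  be orthogonal to those already chosen, so it lies in the kernel of \<open>A\<close> stacked on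
  \<open>Z\<^sup>T\<close>, which has \<open>k + j < n\<close> rows. With
  \<open>A = V\<^sup>T\<close> this completes an orthonormal system without Gram-Schmidt.\<close>

lemma exists_orthonormal_kernel:
  fixes A :: "real mat"
  assumes A: "A \<in> carrier_mat k n" and "k \<le> n"
  shows "\<exists>Z\<in>carrier_mat n (n - k). orthonormal_mat Z \<and> A * Z = 0\<^sub>m k (n - k)"
proof -
  have "\<exists>Z\<in>carrier_mat n j. orthonormal_mat Z \<and> A * Z = 0\<^sub>m k j" if "j \<le> n - k" for j
    using that
  proof (induction j)
    case 0
    have "orthonormal_mat (0\<^sub>m n 0)" by (auto simp: orthonormal_mat_def)
    moreover have "A * 0\<^sub>m n 0 = 0\<^sub>m k 0" using A by auto
    ultimately show ?case by (intro bexI[of _ "0\<^sub>m n 0"]) auto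
  next
    case (Suc j)
    then obtain Z where Z: "Z \<in> carrier_mat n j" "orthonormal_mat Z" "A * Z = 0\<^sub>m k j"
      by auto
    define B where "B = A @\<^sub>r Z\<^sup>T"
    have B: "B \<in> carrier_mat (k + j) n"
      unfolding B_def using A Z by (intro carrier_append_rows) auto
    obtain v where v: "v \<in> carrier_vec n" "v \<noteq> 0\<^sub>v n" "B *\<^sub>v v = 0\<^sub>v (k + j)"
      using exists_orthogonal_vec[OF B] Suc.prems \<open>k \<le> n\<close> by (metis Suc_le_eq le_add_diff_inverse nat_add_left_cancel_less)
    obtain c where c: "(c \<cdot>\<^sub>v v) \<bullet> (c \<cdot>\<^sub>v v) = 1" using exists_unit_multiple[OF v(1,2)] ..
    define w where "w = c \<cdot>\<^sub>v v"
    have "(A *\<^sub>v v) @\<^sub>v (Z\<^sup>T *\<^sub>v v) = 0\<^sub>v k @\<^sub>v 0\<^sub>v j"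
    proof -
      have "B *\<^sub>v v = (A *\<^sub>v v) @\<^sub>v (Z\<^sup>T *\<^sub>v v)"
        unfolding B_def using A Z v by (intro mat_mult_append[of _ k n _ j]) auto
      moreover have "0\<^sub>v (k + j) = (0\<^sub>v k :: real vec) @\<^sub>v 0\<^sub>v j" by auto
      ultimately show ?thesis using v by simp
    qed
    then have "A *\<^sub>v v = 0\<^sub>v k" "Z\<^sup>T *\<^sub>v v = 0\<^sub>v j"
      using append_vec_eq[of "A *\<^sub>v v" k "0\<^sub>v k"] mult_mat_vec_carrier[OF A v(1)] by auto
    then have w: "w \<in> carrier_vec n" "w \<bullet> w = 1" "A *\<^sub>v w = 0\<^sub>v k" "Z\<^sup>T *\<^sub>v w = 0\<^sub>v j"
      using c v A Z by (auto simp: w_def mult_mat_vec)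
    have "A * append_col Z w = 0\<^sub>m k (Suc j)"
      unfolding mult_mat_eq_zero_iff[OF A append_col_carrier[OF Z(1)]]
      using w Z mult_mat_eq_zero_iff[OF A Z(1)] by (simp add: col_append_col[OF Z(1) w(1)])
    then show ?case
      using orthonormal_append_col[OF Z(1,2) w(1,2,4)] Z by (intro bexI[of _ "append_col Z w"]) auto
  qed
  then show ?thesis by auto
qed

lemma mult_mat_zero_vec:
  fixes A :: "real mat"
  assumes "A \<in> carrier_mat n k"
  shows "A *\<^sub>v 0\<^sub>v k = 0\<^sub>v n"
  by (rule eq_vecI) (use assms in auto)

lemma zero_mat_mult_vec:
  fixes v :: "real vec"
  assumes "v \<in> carrier_vec k"
  shows "0\<^sub>m n k *\<^sub>v v = 0\<^sub>v n"
  by (rule eq_vecI) (use assms in \<open>auto simp: scalar_prod_def\<close>)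

lemma orthonormal_cols_le:
  assumes Q: "Q \<in> carrier_mat n k" "orthonormal_mat Q"
  shows "k \<le> n"
proof (rule ccontr)
  assume "\<not> k \<le> n"
  then obtain v where v: "v \<in> carrier_vec k" "v \<noteq> 0\<^sub>v k" "Q *\<^sub>v v = 0\<^sub>v n"
    using exists_orthogonal_vec[OF Q(1)] by auto
  have "v = (Q\<^sup>T * Q) *\<^sub>v v" using Q v by (simp add: orthonormal_mat_def)
  also have "\<dots> = Q\<^sup>T *\<^sub>v (Q *\<^sub>v v)" using Q v by (intro assoc_mult_mat_vec) auto
  also have "\<dots> = 0\<^sub>v k" using v Q by (simp add: mult_mat_zero_vec)
  finally show False using v by simp
qed

text \<open>The square matrix \<open>W = [V Z]\<close> is orthogonal, so
  \<open>W\<^sup>T R' = 0\<close> forces \<open>R' = 0\<close>. Both blocks annihilate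
  \<open>R' = R - Z Z\<^sup>T R\<close>: the first by the hypotheses on \<open>V\<close>, the second
  because \<open>Z\<^sup>T Z = 1\<close>.\<close>

lemma orthonormal_complement_decomp:
  assumes V: "V \<in> carrier_mat n k" "orthonormal_mat V"
    and Z: "Z \<in> carrier_mat n (n - k)" "orthonormal_mat Z" and VZ: "V\<^sup>T * Z = 0\<^sub>m k (n - k)"
    and R: "R \<in> carrier_mat n c" and VR: "V\<^sup>T * R = 0\<^sub>m k c"
  shows "Z * (Z\<^sup>T * R) = R"
proof -
  have kn: "k \<le> n" by (rule orthonormal_cols_le[OF V])
  define W where "W = Matrix.mat n n (\<lambda>(i, j). if j < k then V $$ (i, j) else Z $$ (i, j - k))"
  have W: "W \<in> carrier_mat n n" by (simp add: W_def)
  have colW: "col W j = (if j < k then col V j else col Z (j - k))" if "j < n" for j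
    using that V Z kn by (auto simp: W_def)
  have vz: "col V i \<bullet> col Z j = 0" if "i < k" "j < n - k" for i j
    using arg_cong[OF VZ, of "\<lambda>M. M $$ (i, j)"] that V Z by simp
  then have zv: "col Z j \<bullet> col V i = 0" if "i < k" "j < n - k" for i j
    using comm_scalar_prod[of "col Z j" n "col V i"] that V Z by simp
  have "orthonormal_mat W"
    unfolding orthonormal_mat_iff[OF W]
    using V Z vz zv by (auto simp: colW orthonormal_mat_iff)
  then have "W\<^sup>T * W = 1\<^sub>m n" using W by (simp add: orthonormal_mat_def)
  then have WW: "W * W\<^sup>T = 1\<^sub>m n"
    using mat_mult_left_right_inverse[of "W\<^sup>T" n W] W by simp
  define R' where "R' = R - Z * (Z\<^sup>T * R)"
  have R': "R' \<in> carrier_mat n c" unfolding R'_def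
    by (rule minus_carrier_mat) (use R Z in simp)
  have "V\<^sup>T * (Z * (Z\<^sup>T * R)) = (V\<^sup>T * Z) * (Z\<^sup>T * R)"
    using V Z R by (simp add: assoc_mult_mat[of _ k n _ "n - k" _ c])
  then have VR': "V\<^sup>T * R' = 0\<^sub>m k c"
    using V Z R VR VZ by (simp add: R'_def mult_minus_distrib_mat[of _ k n _ c])
  have "Z\<^sup>T * (Z * (Z\<^sup>T * R)) = (Z\<^sup>T * Z) * (Z\<^sup>T * R)"
    using V Z R by (simp add: assoc_mult_mat[of _ "n - k" n _ "n - k" _ c])
  also have "\<dots> = Z\<^sup>T * R" using Z R by (simp add: orthonormal_mat_def)
  finally have ZR': "Z\<^sup>T * R' = 0\<^sub>m (n - k) c"
    using V Z R by (simp add: R'_def mult_minus_distrib_mat[of _ "n - k" n _ c])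
  have "W\<^sup>T * R' = 0\<^sub>m n c"
  proof (rule eq_matI)
    fix i j assume "i < dim_row (0\<^sub>m n c :: real mat)" "j < dim_col (0\<^sub>m n c :: real mat)"
    then have ij: "i < n" "j < c" by auto
    have "(W\<^sup>T * R') $$ (i, j) = col W i \<bullet> col R' j" using ij W R' by simp
    also have "\<dots> = 0"
    proof (cases "i < k")
      case True
      then show ?thesis using arg_cong[OF VR', of "\<lambda>M. M $$ (i, j)"] ij V R' by (simp add: colW)
    next
      case False
      then show ?thesis using arg_cong[OF ZR', of "\<lambda>M. M $$ (i - k, j)"] ij Z R' by (simp add: colW)
    qed
    finally show "(W\<^sup>T * R') $$ (i, j) = 0\<^sub>m n c $$ (i, j)" using ij by simp
  qed (use W R' in auto)
  then have "W * (W\<^sup>T * R') = 0\<^sub>m n c" using W by simp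
  moreover have "W * (W\<^sup>T * R') = (W * W\<^sup>T) * R'"
    using W R' by (simp add: assoc_mult_mat[of _ n n _ n _ c])
  ultimately have "R' = 0\<^sub>m n c" using WW R' by simp
  show ?thesis
  proof (rule eq_matI)
    fix i j assume "i < dim_row R" "j < dim_col R"
    then show "(Z * (Z\<^sup>T * R)) $$ (i, j) = R $$ (i, j)"
      using arg_cong[OF \<open>R' = 0\<^sub>m n c\<close>, of "\<lambda>M. M $$ (i, j)"] R Z by (simp add: R'_def)
  qed (use R Z in auto)
qed

text \<open>The orthogonal complement is taken twice: \<open>Z\<close> is orthogonal to the columns
  of \<open>Y\<close>, and \<open>V\<close> completes \<open>Z\<close>. This gives exactly
  \<open>k\<close> columns even when \<open>Y\<close> is rank deficient; \<open>V\<close> may then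
  span more than the column space of \<open>Y\<close>.\<close>

lemma exists_orthonormal_range:
  fixes Y :: "real mat"
  assumes Y: "Y \<in> carrier_mat n k" and "k \<le> n"
  shows "\<exists>V\<in>carrier_mat n k. orthonormal_mat V \<and> V * (V\<^sup>T * Y) = Y"
proof -
  obtain Z where Z: "Z \<in> carrier_mat n (n - k)" "orthonormal_mat Z" "Y\<^sup>T * Z = 0\<^sub>m k (n - k)"
    using exists_orthonormal_kernel[of "Y\<^sup>T" k n] assms by auto
  obtain V where V: "V \<in> carrier_mat n (n - (n - k))" "orthonormal_mat V"
    "Z\<^sup>T * V = 0\<^sub>m (n - k) (n - (n - k))"
    using exists_orthonormal_kernel[of "Z\<^sup>T" "n - k" n] Z by auto
  have ZY: "Z\<^sup>T * Y = 0\<^sub>m (n - k) k"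
    using transpose_mult[of "Y\<^sup>T" k n Z "n - k"] Z Y by simp
  have "V * (V\<^sup>T * Y) = Y"
    using orthonormal_complement_decomp[OF Z(1,2) V Y ZY] .
  then show ?thesis using V assms by auto
qed

section \<open>Spectral theorem for real symmetric matrices\<close>

lemma real_symmetric_eigenvector:
  fixes A :: "real mat"
  assumes A: "A \<in> carrier_mat n n" "A\<^sup>T = A" and "0 < n"
  shows "\<exists>e. \<exists>v\<in>carrier_vec n. v \<noteq> 0\<^sub>v n \<and> A *\<^sub>v v = e \<cdot>\<^sub>v v"
proof -
  define Ac where "Ac = map_mat complex_of_real A"
  have Ac: "Ac \<in> carrier_mat n n" using A by (simp add: Ac_def)
  have "degree (char_poly Ac) = n" using degree_monic_char_poly[OF Ac] by simp
  then obtain z where "poly (char_poly Ac) z = 0"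
    using fundamental_theorem_of_algebra_alt[of "char_poly Ac"] \<open>0 < n\<close>
    by (metis constant_degree fundamental_theorem_of_algebra less_numeral_extra(3))
  then have "eigenvalue Ac z" using eigenvalue_root_char_poly[OF Ac] by simp
  then obtain w where w: "w \<in> carrier_vec n" "w \<noteq> 0\<^sub>v n" "Ac *\<^sub>v w = z \<cdot>\<^sub>v w"
    using Ac by (auto simp: eigenvalue_def eigenvector_def)
  define x where "x = map_vec Re w"
  define y where "y = map_vec Im w"
  have x: "x \<in> carrier_vec n" and y: "y \<in> carrier_vec n" using w by (auto simp: x_def y_def)
  have wi: "(\<Sum>j<n. complex_of_real (A $$ (i, j)) * w $ j) = z * w $ i" if "i < n" for i
    using arg_cong[OF w(3), of "\<lambda>v. v $ i"] that w A
    by (simp add: Ac_def scalar_prod_def lessThan_atLeast0)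
  have Ax: "A *\<^sub>v x = Re z \<cdot>\<^sub>v x - Im z \<cdot>\<^sub>v y"
  proof (rule eq_vecI)
    fix i assume "i < dim_vec (Re z \<cdot>\<^sub>v x - Im z \<cdot>\<^sub>v y)"
    then have i: "i < n" using x y by simp
    show "(A *\<^sub>v x) $ i = (Re z \<cdot>\<^sub>v x - Im z \<cdot>\<^sub>v y) $ i"
      using arg_cong[OF wi[OF i], of Re] i x y w A
      by (simp add: x_def y_def scalar_prod_def lessThan_atLeast0)
  qed (use A x y in auto)
  have Ay: "A *\<^sub>v y = Im z \<cdot>\<^sub>v x + Re z \<cdot>\<^sub>v y"
  proof (rule eq_vecI)
    fix i assume "i < dim_vec (Im z \<cdot>\<^sub>v x + Re z \<cdot>\<^sub>v y)"
    then have i: "i < n" using x y by simp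
    show "(A *\<^sub>v y) $ i = (Im z \<cdot>\<^sub>v x + Re z \<cdot>\<^sub>v y) $ i"
      using arg_cong[OF wi[OF i], of Im] i x y w A
      by (simp add: x_def y_def scalar_prod_def lessThan_atLeast0 algebra_simps)
  qed (use A x y in auto)
  have xy: "x \<noteq> 0\<^sub>v n \<or> y \<noteq> 0\<^sub>v n"
  proof (rule ccontr)
    assume *: "\<not> ?thesis"
    have "w = 0\<^sub>v n"
    proof (rule eq_vecI)
      fix i assume "i < dim_vec (0\<^sub>v n :: complex vec)"
      then have i: "i < n" by simp
      have "x $ i = 0" "y $ i = 0" using * i by auto
      then show "w $ i = 0\<^sub>v n $ i" using i w by (simp add: x_def y_def complex_eq_iff)
    qed (use w in simp)
    then show False using w by simp
  qed
  \<comment> \<open>For a complex eigenvector \<open>x + i y\<close> with eigenvalue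
    \<open>z\<close>, symmetry makes the two pairings of \<open>x\<close> and \<open>y\<close>
    through \<open>A\<close> agree; up to sign their difference is \<open>Im z\<close> times
    \<open>x \<bullet> x + y \<bullet> y\<close>. Hence \<open>z\<close> is real, and each of
    \<open>x\<close> and \<open>y\<close> is an eigenvector unless it is zero.\<close>
  have "y \<bullet> (A *\<^sub>v x) = (A *\<^sub>v y) \<bullet> x"
    using A x y transpose_vec_mult_scalar[of A n n x y] by simp
  then have "Im z * (x \<bullet> x + y \<bullet> y) = 0"
    unfolding Ax Ay using x y comm_scalar_prod[OF x y]
    by (simp add: scalar_prod_minus_distrib[of _ n] add_scalar_prod_distrib[of _ n] algebra_simps)
  moreover have "x \<bullet> x + y \<bullet> y > 0"
    using xy scalar_prod_self_pos[OF x] scalar_prod_self_pos[OF y] x y by fastforce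
  ultimately have "Im z = 0" by simp
  then have "A *\<^sub>v x = Re z \<cdot>\<^sub>v x" "A *\<^sub>v y = Re z \<cdot>\<^sub>v y"
    using Ax Ay x y by auto
  then show ?thesis using xy x y by blast
qed

lemma real_symmetric_spectral:
  fixes A :: "real mat"
  assumes A: "A \<in> carrier_mat n n" "A\<^sup>T = A"
  shows "\<exists>V\<in>carrier_mat n n. \<exists>d. orthonormal_mat V \<and> (\<forall>j<n. A *\<^sub>v col V j = d j \<cdot>\<^sub>v col V j)"
proof -
  have "\<exists>V\<in>carrier_mat n k. \<exists>d. orthonormal_mat V \<and> (\<forall>j<k. A *\<^sub>v col V j = d j \<cdot>\<^sub>v col V j)"
    if "k \<le> n" for k
    using that
  proof (induction k)
    case 0
    have "orthonormal_mat (0\<^sub>m n 0)" by (auto simp: orthonormal_mat_def)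
    then show ?case by (intro bexI[of _ "0\<^sub>m n 0"]) auto
  next
    case (Suc k)
    then obtain V d where V: "V \<in> carrier_mat n k" "orthonormal_mat V"
      and d: "\<And>j. j < k \<Longrightarrow> A *\<^sub>v col V j = d j \<cdot>\<^sub>v col V j" by auto
    obtain Z where Z: "Z \<in> carrier_mat n (n - k)" "orthonormal_mat Z" "V\<^sup>T * Z = 0\<^sub>m k (n - k)"
      using exists_orthonormal_kernel[of "V\<^sup>T" k n] V Suc.prems by auto
    \<comment> \<open>The eigenvectors found so far span an invariant subspace and \<open>A\<close>
      is symmetric, so \<open>A\<close> also maps the complement, spanned by the columns of
      \<open>Z\<close>, into itself.\<close>
    have VAZ: "V\<^sup>T * (A * Z) = 0\<^sub>m k (n - k)"
    proof (rule eq_matI)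
      fix i j assume "i < dim_row (0\<^sub>m k (n - k) :: real mat)" "j < dim_col (0\<^sub>m k (n - k) :: real mat)"
      then have ij: "i < k" "j < n - k" by auto
      have "(V\<^sup>T * (A * Z)) $$ (i, j) = col V i \<bullet> (A *\<^sub>v col Z j)"
        using ij V A Z by (simp del: col_mult)
      also have "\<dots> = (A *\<^sub>v col V i) \<bullet> col Z j"
        using A V Z ij transpose_vec_mult_scalar[of A n n "col Z j" "col V i"] by simp
      also have "\<dots> = d i * (col V i \<bullet> col Z j)"
        using d[OF ij(1)] V Z ij by simp
      also have "col V i \<bullet> col Z j = 0"
      proof -
        have "(V\<^sup>T * Z) $$ (i, j) = col V i \<bullet> col Z j" using ij V(1) Z(1) by simp
        then show ?thesis using ij Z(3) by simp
      qed
      finally show "(V\<^sup>T * (A * Z)) $$ (i, j) = 0\<^sub>m k (n - k) $$ (i, j)" using ij by simp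
    qed (use V A Z in auto)
    have AZ: "A * Z \<in> carrier_mat n (n - k)" using A Z by simp
    \<comment> \<open>The compression of \<open>A\<close> to the complement. Since
      \<open>Z A' = A Z\<close>, an eigenvector \<open>u'\<close> of \<open>A'\<close> lifts to the
      eigenvector \<open>Z u'\<close> of \<open>A\<close>, which has the same length and is
      orthogonal to the earlier ones.\<close>
    define A' where "A' = Z\<^sup>T * (A * Z)"
    have A': "A' \<in> carrier_mat (n - k) (n - k)" using A Z by (simp add: A'_def)
    have decomp: "Z * A' = A * Z"
      unfolding A'_def by (rule orthonormal_complement_decomp[OF V Z AZ VAZ])
    have "A'\<^sup>T = A'"
      using A Z by (simp add: A'_def transpose_mult[of _ "n - k" n _ "n - k"]
          transpose_mult[of _ n n _ "n - k"] assoc_mult_mat[of _ "n - k" n _ n _ "n - k"])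
    then obtain e u where u: "u \<in> carrier_vec (n - k)" "u \<noteq> 0\<^sub>v (n - k)" "A' *\<^sub>v u = e \<cdot>\<^sub>v u"
      using real_symmetric_eigenvector[OF A'] Suc.prems by auto
    obtain c where c: "(c \<cdot>\<^sub>v u) \<bullet> (c \<cdot>\<^sub>v u) = 1" using exists_unit_multiple[OF u(1,2)] ..
    define u' where "u' = c \<cdot>\<^sub>v u"
    have u': "u' \<in> carrier_vec (n - k)" "u' \<bullet> u' = 1" "A' *\<^sub>v u' = e \<cdot>\<^sub>v u'"
      using u c A' by (auto simp: u'_def mult_mat_vec smult_smult_assoc mult.commute)
    define v where "v = Z *\<^sub>v u'"
    have v: "v \<in> carrier_vec n" using Z u' by (simp add: v_def)
    have "v \<bullet> v = (Z\<^sup>T *\<^sub>v (Z *\<^sub>v u')) \<bullet> u'"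
      using transpose_vec_mult_scalar[of Z n "n - k" u' v] Z u' v by (simp add: v_def)
    also have "Z\<^sup>T *\<^sub>v (Z *\<^sub>v u') = (Z\<^sup>T * Z) *\<^sub>v u'"
      by (rule assoc_mult_mat_vec[symmetric, of _ _ n _ "n - k"]) (use Z u' in auto)
    also have "\<dots> = u'" using Z u' by (simp add: orthonormal_mat_def)
    finally have vv: "v \<bullet> v = 1" using u' by simp
    have "V\<^sup>T *\<^sub>v v = (V\<^sup>T * Z) *\<^sub>v u'" unfolding v_def
      by (rule assoc_mult_mat_vec[symmetric, of _ k n _ "n - k"]) (use V Z u' in auto)
    then have Vv: "V\<^sup>T *\<^sub>v v = 0\<^sub>v k" unfolding Z(3)
      by (metis mult_mat_vec_carrier u'(1) zero_carrier_mat zero_mat_mult_vec)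
    have "A *\<^sub>v v = (A * Z) *\<^sub>v u'" unfolding v_def
      by (rule assoc_mult_mat_vec[symmetric]) (use A Z u' in auto)
    also have "\<dots> = Z *\<^sub>v (A' *\<^sub>v u')" unfolding decomp[symmetric]
      by (rule assoc_mult_mat_vec) (use A' Z u' in auto)
    also have "\<dots> = e \<cdot>\<^sub>v v" using u' Z by (simp add: v_def mult_mat_vec)
    finally have Av: "A *\<^sub>v v = e \<cdot>\<^sub>v v" .
    show ?case
      using orthonormal_append_col[OF V v vv Vv] V d Av
      by (intro bexI[of _ "append_col V v"] exI[of _ "\<lambda>j. if j < k then d j else e"])
         (auto simp: col_append_col[OF V(1) v] less_Suc_eq)
  qed
  then show ?thesis by auto
qed

section \<open>Singular values\<close>

text \<open>\<open>W\<close> lists a maximal linearly independent set of columns of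
  \<open>X\<close>, and column \<open>j\<close> of \<open>R\<close> holds the coordinates of column
  \<open>j\<close> of \<open>X\<close>. The bound \<open>r \<le> n\<close> is what
  \<open>exists_orthonormal_range\<close> asks for.\<close>

lemma rank_factorization:
  fixes X :: "real mat"
  assumes X: "X \<in> carrier_mat n c"
  defines "r \<equiv> vec_space.rank n X"
  shows "\<exists>W\<in>carrier_mat n r. \<exists>R\<in>carrier_mat r c. X = W * R" "r \<le> n"
proof -
  interpret vec_space "TYPE(real)" n .
  let ?P = "\<lambda>T. T \<subseteq> set (cols X) \<and> lin_indpt T"
  have "?P {}" by (simp add: lindep_span)
  then obtain S where S: "maximal S ?P" "finite S"
    using maximal_exists_superset[of "set (cols X)" ?P "{}"] by auto
  have card: "card S = r" unfolding r_def using rank_card_indpt[OF X S(1)] by simp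
  have Ssub: "S \<subseteq> set (cols X)" "lin_indpt S" using S by (auto simp: maximal_def)
  have Sc: "S \<subseteq> carrier_vec n" using Ssub X cols_dim by blast
  obtain xs where xs: "distinct xs" "set xs = S" using finite_distinct_list[OF S(2)] by auto
  have len: "length xs = r" using xs card distinct_card by metis
  define W where "W = mat_of_cols n xs"
  have W: "W \<in> carrier_mat n r" using len by (auto simp: W_def)
  have colsW: "cols W = xs" using xs Sc by (simp add: W_def)
  have "\<exists>v\<in>carrier_vec r. col X j = W *\<^sub>v v" if j: "j < c" for j
  proof -
    have cj: "col X j \<in> set (cols X)" using X j by (auto simp: cols_def)
    have cjc: "col X j \<in> carrier_vec n" using X j by simp
    have "col X j \<in> span S"
    proof (cases "col X j \<in> S")
      case True
      then show ?thesis using Sc span_mem by auto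
    next
      case False
      have "\<not> lin_indpt (insert (col X j) S)"
        using S(1) cj Ssub False unfolding maximal_def by blast
      then show ?thesis using lin_dep_iff_in_span[of S "col X j"] Sc Ssub(2) cjc False by simp
    qed
    then obtain a where a: "col X j = lincomb a S"
      using finite_span[OF S(2)] Sc by auto
    have "lincomb a S = W *\<^sub>v vec r (\<lambda>i. a (col W i))"
      using mat_mult_eq_lincomb[OF W, of a] colsW xs by simp
    then show ?thesis using a by (intro bexI[of _ "vec r (\<lambda>i. a (col W i))"]) auto
  qed
  then obtain v where v: "\<And>j. j < c \<Longrightarrow> v j \<in> carrier_vec r \<and> col X j = W *\<^sub>v v j" by metis
  define R where "R = Matrix.mat r c (\<lambda>(i, j). v j $ i)"
  have R: "R \<in> carrier_mat r c" by (simp add: R_def)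
  have "col R j = v j" if "j < c" for j using that v[OF that] by (auto simp: R_def)
  then have "col (W * R) j = col X j" if "j < c" for j
    using that v[OF that] by (simp add: col_mult2[OF W R] del: col_mult)
  then have "X = W * R"
    by (intro mat_col_eqI) (use W R X in auto)
  then show "\<exists>W\<in>carrier_mat n r. \<exists>R\<in>carrier_mat r c. X = W * R" using W R by blast
  show "r \<le> n"
  proof (rule ccontr)
    assume "\<not> r \<le> n"
    then obtain v where "v \<in> carrier_vec r" "v \<noteq> 0\<^sub>v r" "W *\<^sub>v v = 0\<^sub>v n"
      using exists_orthogonal_vec[OF W] by auto
    then have "lin_dep (set (cols W))" using lin_depI[OF W] colsW xs by simp
    then show False using colsW xs Ssub by simp
  qed
qed

lemma exists_orthonormal_column_space:
  fixes X :: "real mat"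
  assumes X: "X \<in> carrier_mat n c"
  defines "r \<equiv> vec_space.rank n X"
  shows "\<exists>U\<in>carrier_mat n r. orthonormal_mat U \<and> U * (U\<^sup>T * X) = X"
proof -
  obtain W R where W: "W \<in> carrier_mat n r" "R \<in> carrier_mat r c" "X = W * R"
    using rank_factorization[OF X] by (auto simp: r_def)
  obtain U where U: "U \<in> carrier_mat n r" "orthonormal_mat U" "U * (U\<^sup>T * W) = W"
    using exists_orthonormal_range[OF W(1)] rank_factorization(2)[OF X] by (auto simp: r_def)
  have "U\<^sup>T * (W * R) = (U\<^sup>T * W) * R"
    using assoc_mult_mat[of "U\<^sup>T" r n W r R c] U W by simp
  moreover have "U * ((U\<^sup>T * W) * R) = (U * (U\<^sup>T * W)) * R"
    using assoc_mult_mat[of U n r "U\<^sup>T * W" r R c] U W by simp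
  ultimately have "U * (U\<^sup>T * X) = X" using U W by simp
  then show ?thesis using U W by auto
qed

lemma orthonormal_transpose:
  assumes V: "V \<in> carrier_mat n n" "orthonormal_mat V"
  shows "V * V\<^sup>T = 1\<^sub>m n" "orthonormal_mat V\<^sup>T"
proof -
  show "V * V\<^sup>T = 1\<^sub>m n"
    using mat_mult_left_right_inverse[of "V\<^sup>T" n V] V by (simp add: orthonormal_mat_def)
  then show "orthonormal_mat V\<^sup>T" using V by (simp add: orthonormal_mat_def)
qed

lemma proots_prod_linear:
  "proots (\<Prod>a\<leftarrow>as. [:- a, 1:]) = mset (as :: real list)"
proof (induction as)
  case (Cons a as)
  have nz: "(\<Prod>a\<leftarrow>as. [:- a, 1:]) \<noteq> (0 :: real poly)" by (auto simp: prod_list_zero_iff)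
  have "proots ([:- a, 1:] * (\<Prod>a\<leftarrow>as. [:- a, 1:])) = proots [:- a, 1:] + proots (\<Prod>a\<leftarrow>as. [:- a, 1:])"
    by (rule proots_mult[OF _ nz]) simp
  then show ?case
    by (simp only: list.map prod_list.Cons Cons.IH proots_linear_factor) simp
qed simp

text \<open>Ties the definition by sorted roots of a characteristic polynomial to actual
  eigenvectors. Diagonalising \<open>X\<^sup>T X\<close> shows that the roots are the eigenvalues
  \<open>d\<close>; the sorted list of their square roots is a permutation of the unsorted one, and
  the columns of \<open>V\<close> are permuted accordingly. Indices of \<open>sigma_val\<close>
  start at 1, hence \<open>Suc j\<close>.\<close>

lemma singular_value_decomposition:
  fixes X :: "real mat"
  assumes X: "X \<in> carrier_mat n c"
  shows "\<exists>V\<in>carrier_mat c c. orthonormal_mat V \<and>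
    (\<forall>j<c. (X\<^sup>T * X) *\<^sub>v col V j = (sigma_val (Suc j) X)\<^sup>2 \<cdot>\<^sub>v col V j)"
    and "\<And>i j. i \<le> j \<Longrightarrow> j < c \<Longrightarrow> sigma_val (Suc j) X \<le> sigma_val (Suc i) X"
    and "\<And>j. j < c \<Longrightarrow> 0 \<le> sigma_val (Suc j) X"
proof -
  define A where "A = X\<^sup>T * X"
  have A: "A \<in> carrier_mat c c" using X by (simp add: A_def)
  have "A\<^sup>T = A" using X by (simp add: A_def transpose_mult[of _ c n _ c])
  then obtain V d where V: "V \<in> carrier_mat c c" "orthonormal_mat V"
    and d: "\<And>j. j < c \<Longrightarrow> A *\<^sub>v col V j = d j \<cdot>\<^sub>v col V j"
    using real_symmetric_spectral[OF A] by auto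
  \<comment> \<open>The eigenvalue of a unit eigenvector \<open>v\<close> is the squared length of
    \<open>X v\<close>. Only for nonnegative \<open>d\<close> do the squares of the singular values
    return the eigenvalues.\<close>
  have d_nonneg: "0 \<le> d j" if j: "j < c" for j
  proof -
    have "d j = col V j \<bullet> (A *\<^sub>v col V j)"
      using V j by (simp add: d orthonormal_mat_iff)
    also have "A *\<^sub>v col V j = X\<^sup>T *\<^sub>v (X *\<^sub>v col V j)"
      unfolding A_def by (rule assoc_mult_mat_vec) (use X V j in auto)
    also have "col V j \<bullet> \<dots> = (X *\<^sub>v col V j) \<bullet> (X *\<^sub>v col V j)"
      using transpose_vec_mult_scalar[of "X\<^sup>T" c n "X *\<^sub>v col V j" "col V j"] X V j by simp
    also have "\<dots> = (\<Sum>i<n. (X *\<^sub>v col V j) $ i * (X *\<^sub>v col V j) $ i)"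
      using mult_mat_vec_carrier[OF X] V j by (intro scalar_prod_eq_sum) simp
    also have "\<dots> \<ge> 0" by (auto intro!: sum_nonneg)
    finally show ?thesis .
  qed
  define D where "D = mat_diag c d"
  have D: "D \<in> carrier_mat c c" by (simp add: D_def)
  have AV: "A * V = V * D"
  proof (rule eq_matI)
    fix i j assume "i < dim_row (V * D)" "j < dim_col (V * D)"
    then have ij: "i < c" "j < c" using V D by auto
    have "(A * V) $$ (i, j) = (A *\<^sub>v col V j) $ i" using ij A V by simp
    also have "\<dots> = V $$ (i, j) * d j" using ij V by (simp add: d)
    also have "\<dots> = (V * D) $$ (i, j)"
      using ij V unfolding D_def by (simp add: mat_diag_mult_right[of V c c])
    finally show "(A * V) $$ (i, j) = (V * D) $$ (i, j)" .
  qed (use A V D in auto)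
  have VV: "V * V\<^sup>T = 1\<^sub>m c" by (rule orthonormal_transpose[OF V])
  have "A = V * D * V\<^sup>T"
    using assoc_mult_mat[of A c c V c "V\<^sup>T" c] A V VV by (simp flip: AV)
  then have "similar_mat_wit A D V V\<^sup>T"
    using A D V VV by (simp add: similar_mat_wit_def orthonormal_mat_def Let_def)
  then have "char_poly A = char_poly D"
    by (intro char_poly_similar) (auto simp: similar_mat_def)
  also have "\<dots> = (\<Prod>a\<leftarrow>diag_mat D. [:- a, 1:])"
    by (rule char_poly_upper_triangular[OF D]) (auto simp: D_def upper_triangular_def mat_diag_def)
  also have "diag_mat D = map d [0..<c]"
    by (auto simp: diag_mat_def D_def mat_diag_def)
  finally have pr: "proots (char_poly A) = mset (map d [0..<c])"
    by (simp only: proots_prod_linear)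
  define ys where "ys = map (\<lambda>j. sqrt (d j)) [0..<c]"
  have sv: "singular_values X = rev (sort ys)"
  proof -
    have "image_mset sqrt (mset (map d [0..<c])) = mset ys"
      by (simp add: ys_def multiset.map_comp comp_def)
    then show ?thesis
      unfolding singular_values_def A_def[symmetric] pr by (simp only: sorted_list_of_multiset_mset)
  qed
  have len: "length (singular_values X) = c" by (simp add: sv ys_def)
  have "mset (singular_values X) = mset ys" by (simp add: sv)
  then obtain p where p: "p permutes {..<length ys}" "permute_list p ys = singular_values X"
    by (rule mset_eq_permutation)
  have lys: "length ys = c" by (simp add: ys_def)
  have pc: "p j < c" if "j < c" for j
    using permutes_in_image[OF p(1), of j] that lys by simp
  have sig: "sigma_val (Suc j) X = sqrt (d (p j))" if "j < c" for j
    using permute_list_nth[OF p(1), of j] that lys pc[OF that] p(2)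
    by (simp add: sigma_val_def ys_def)
  show "0 \<le> sigma_val (Suc j) X" if "j < c" for j
    using sig[OF that] d_nonneg[OF pc[OF that]] by simp
  have "sorted (sort ys)" by simp
  then have srt: "sorted_wrt (\<ge>) (singular_values X)" unfolding sv by (simp add: sorted_wrt_rev)
  show "sigma_val (Suc j) X \<le> sigma_val (Suc i) X" if "i \<le> j" "j < c" for i j
    using sorted_wrt_nth_less[OF srt, of i j] that len by (cases "i = j") (auto simp: sigma_val_def)
  define V' where "V' = Matrix.mat c c (\<lambda>(i, j). V $$ (i, p j))"
  have V': "V' \<in> carrier_mat c c" by (simp add: V'_def)
  have colV': "col V' j = col V (p j)" if "j < c" for j
    using that pc[OF that] V by (auto simp: V'_def)
  have "orthonormal_mat V'"
    unfolding orthonormal_mat_iff[OF V']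
  proof (intro allI impI)
    fix i j assume "i < c" "j < c"
    moreover have "p i = p j \<longleftrightarrow> i = j" using permutes_inj[OF p(1)] by (auto dest: injD)
    ultimately show "col V' i \<bullet> col V' j = (if i = j then 1 else 0)"
      using V pc by (simp add: colV' orthonormal_mat_iff)
  qed
  moreover have "A *\<^sub>v col V' j = (sigma_val (Suc j) X)\<^sup>2 \<cdot>\<^sub>v col V' j" if "j < c" for j
    using that d[OF pc[OF that]] d_nonneg[OF pc[OF that]] by (simp add: colV' sig)
  ultimately show "\<exists>V\<in>carrier_mat c c. orthonormal_mat V \<and>
    (\<forall>j<c. (X\<^sup>T * X) *\<^sub>v col V j = (sigma_val (Suc j) X)\<^sup>2 \<cdot>\<^sub>v col V j)"
    using V' by (auto simp: A_def)
qed

section \<open>Variational bound, rank and tail energy\<close>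

lemma frob_norm_le_iff: "frob_norm X \<le> frob_norm Y \<longleftrightarrow> finner X X \<le> finner Y Y"
  by (simp add: frob_norm_finner)

text \<open>Left singular vectors would be the columns of \<open>X V\<close> divided by their
  lengths, which may vanish; the diagonal Gram matrix carries the same information without the
  division.\<close>

lemma singular_vectors_gram:
  fixes X :: "real mat"
  assumes X: "X \<in> carrier_mat n c" and V: "V \<in> carrier_mat c c" "orthonormal_mat V"
    and ev: "\<forall>j<c. (X\<^sup>T * X) *\<^sub>v col V j = (s j)\<^sup>2 \<cdot>\<^sub>v col V j"
  shows "(X * V)\<^sup>T * (X * V) = mat_diag c (\<lambda>j. (s j)\<^sup>2)"
proof -
  have XX: "X\<^sup>T * X \<in> carrier_mat c c" using X by simp
  have "(X * V)\<^sup>T * (X * V) = (V\<^sup>T * X\<^sup>T) * (X * V)"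
    using X V by (simp add: transpose_mult[of X n c V c])
  also have "\<dots> = V\<^sup>T * (X\<^sup>T * (X * V))"
    by (rule assoc_mult_mat[of _ c c _ n _ c]) (use X V in auto)
  also have "X\<^sup>T * (X * V) = (X\<^sup>T * X) * V"
    by (rule assoc_mult_mat[symmetric, of _ c n _ c _ c]) (use X V in auto)
  finally have eq: "(X * V)\<^sup>T * (X * V) = V\<^sup>T * ((X\<^sup>T * X) * V)" .
  show ?thesis
  proof (rule eq_matI)
    fix i j assume "i < dim_row (mat_diag c (\<lambda>j. (s j)\<^sup>2))" "j < dim_col (mat_diag c (\<lambda>j. (s j)\<^sup>2))"
    then have ij: "i < c" "j < c" by (auto simp: mat_diag_def)
    have "((X * V)\<^sup>T * (X * V)) $$ (i, j) = col V i \<bullet> ((X\<^sup>T * X) *\<^sub>v col V j)"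
      unfolding eq using ij XX V by (simp del: col_mult)
    also have "\<dots> = (s j)\<^sup>2 * (col V i \<bullet> col V j)" using ev ij V by simp
    also have "\<dots> = mat_diag c (\<lambda>j. (s j)\<^sup>2) $$ (i, j)"
      using ij V by (auto simp: mat_diag_def orthonormal_mat_iff)
    finally show "((X * V)\<^sup>T * (X * V)) $$ (i, j) = mat_diag c (\<lambda>j. (s j)\<^sup>2) $$ (i, j)" .
  qed (use X V in \<open>auto simp: mat_diag_def\<close>)
qed

text \<open>Bessel's inequality for the unit vector \<open>e\<^sub>j\<close>: row \<open>j\<close>
  of \<open>W\<close> is \<open>W\<^sup>T e\<^sub>j\<close>.\<close>

lemma orthonormal_row_norm_le:
  assumes W: "W \<in> carrier_mat n k" "orthonormal_mat W" and j: "j < n"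
  shows "(\<Sum>c<k. (W $$ (j, c))\<^sup>2) \<le> 1"
proof -
  define E :: "real mat" where "E = Matrix.mat n 1 (\<lambda>(i, _). if i = j then 1 else 0)"
  have E: "E \<in> carrier_mat n 1" by (simp add: E_def)
  have "finner E E = 1"
    using j by (simp add: finner_def E_def if_distrib[of "\<lambda>x. x * _"] cong: if_cong)
  moreover have "(W\<^sup>T * E) $$ (c, 0) = W $$ (j, c)" if "c < k" for c
    using that j W by (subst mult_mat_entry[of _ k n E 1])
      (auto simp: E_def if_distrib[of "\<lambda>x. _ * x"] cong: if_cong)
  then have "finner (W\<^sup>T * E) (W\<^sup>T * E) = (\<Sum>c<k. (W $$ (j, c))\<^sup>2)"
    using W E by (simp add: finner_def power2_eq_square del: index_mult_mat(1))
  ultimately show ?thesis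
    using frob_norm_orthonormal_transpose_mult_le[OF W(2,1) E] by (simp add: frob_norm_le_iff)
qed

text \<open>The weight missing from the last \<open>k\<close> positions sits on the first
  \<open>m\<close>, and the two amounts are equal because the total is \<open>k\<close>. Pricing
  both at the pivot \<open>d m\<close> gives the comparison, since \<open>d\<close> is decreasing.
  For \<open>k = 0\<close> the pivot is out of range, hence the separate case.\<close>

lemma weighted_sum_ge_tail:
  fixes d w :: "nat \<Rightarrow> real"
  assumes anti: "\<And>i j. i \<le> j \<Longrightarrow> j < m + k \<Longrightarrow> d j \<le> d i"
    and w: "\<And>j. j < m + k \<Longrightarrow> 0 \<le> w j" "\<And>j. j < m + k \<Longrightarrow> w j \<le> 1"
    and sum: "(\<Sum>j<m + k. w j) = real k"
  shows "(\<Sum>j\<in>{m..<m + k}. d j) \<le> (\<Sum>j<m + k. d j * w j)"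
proof (cases "k = 0")
  case True
  have "\<forall>j\<in>{..<m}. w j = 0"
    using sum w True by (subst sum_nonneg_eq_0_iff[symmetric]) auto
  then show ?thesis using True by simp
next
  case False
  have split: "{..<m + k} = {..<m} \<union> {m..<m + k}" by auto
  have S: "(\<Sum>j<m. w j) + (\<Sum>j\<in>{m..<m + k}. w j) = real k"
    using sum unfolding split by (subst (asm) sum.union_disjoint) auto
  have "(\<Sum>j\<in>{m..<m + k}. d j * (1 - w j)) \<le> (\<Sum>j\<in>{m..<m + k}. d m * (1 - w j))"
    using anti w by (intro sum_mono mult_right_mono) auto
  also have "\<dots> = d m * (\<Sum>j<m. w j)"
    using S by (simp add: sum_subtractf flip: sum_distrib_left)
  also have "\<dots> = (\<Sum>j<m. d m * w j)" by (simp add: sum_distrib_left)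
  also have "\<dots> \<le> (\<Sum>j<m. d j * w j)"
    using anti w False by (intro sum_mono mult_right_mono) auto
  finally have "(\<Sum>j\<in>{m..<m + k}. d j) \<le> (\<Sum>j<m. d j * w j) + (\<Sum>j\<in>{m..<m + k}. d j * w j)"
    by (simp add: right_diff_distrib sum_subtractf)
  also have "\<dots> = (\<Sum>j<m + k. d j * w j)"
    unfolding split by (subst sum.union_disjoint) auto
  finally show ?thesis .
qed

text \<open>The variational half of Ky Fan's theorem, for the smallest singular values.\<close>

lemma sum_tail_singular_values_le:
  fixes C :: "real mat"
  assumes C: "C \<in> carrier_mat n (m + k)" and Z: "Z \<in> carrier_mat (m + k) k" "orthonormal_mat Z"
  shows "(\<Sum>i = m + 1..m + k. (sigma_val i C)\<^sup>2) \<le> finner (C * Z) (C * Z)"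
proof -
  let ?d = "\<lambda>j. (sigma_val (Suc j) C)\<^sup>2"
  obtain V where V: "V \<in> carrier_mat (m + k) (m + k)" "orthonormal_mat V"
    and ev: "\<forall>j<m + k. (C\<^sup>T * C) *\<^sub>v col V j = ?d j \<cdot>\<^sub>v col V j"
    using singular_value_decomposition(1)[OF C] by auto
  have VV: "V * V\<^sup>T = 1\<^sub>m (m + k)" by (rule orthonormal_transpose[OF V])
  \<comment> \<open>Coordinates of \<open>Z\<close> in the eigenbasis. The energy of
    \<open>C Z\<close> becomes a weighted sum of squared singular values whose weights, the squared
    row norms of \<open>W\<close>, are at most 1 and add up to \<open>k\<close>.\<close>
  define W where "W = V\<^sup>T * Z"
  have W: "W \<in> carrier_mat (m + k) k" using V Z by (simp add: W_def)
  have VW: "V * W = Z"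
    using assoc_mult_mat[of V "m + k" "m + k" "V\<^sup>T" "m + k" Z k] V Z VV by (simp add: W_def)
  have "Z\<^sup>T * Z = W\<^sup>T * (V\<^sup>T * (V * W))"
    unfolding VW[symmetric]
    using V W assoc_mult_mat[of "W\<^sup>T" k "m + k" "V\<^sup>T" "m + k" "V * W" k]
    by (simp add: transpose_mult[of V "m + k" "m + k" W k])
  also have "V\<^sup>T * (V * W) = W" unfolding VW by (simp only: W_def)
  finally have oW: "orthonormal_mat W" using Z W by (simp add: orthonormal_mat_def)
  have CV: "C * V \<in> carrier_mat n (m + k)" using C V by simp
  have CZ: "C * Z = (C * V) * W"
    unfolding VW[symmetric] using C V W by (simp add: assoc_mult_mat[of C n "m + k" V "m + k" W k])
  have "finner (C * Z) (C * Z) = finner W ((C * V)\<^sup>T * ((C * V) * W))"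
    unfolding CZ by (rule finner_mult_left[OF CV W]) (use CV W in simp)
  also have "(C * V)\<^sup>T * ((C * V) * W) = ((C * V)\<^sup>T * (C * V)) * W"
    by (rule assoc_mult_mat[symmetric, of _ "m + k" n _ "m + k" _ k]) (use CV W in auto)
  also have "\<dots> = mat_diag (m + k) ?d * W" by (simp only: singular_vectors_gram[OF C V ev])
  also have "\<dots> = Matrix.mat (m + k) k (\<lambda>(i, j). ?d i * W $$ (i, j))"
    by (rule mat_diag_mult_left[OF W])
  also have "finner W \<dots> = (\<Sum>j<m + k. ?d j * (\<Sum>c<k. (W $$ (j, c))\<^sup>2))"
    using W by (simp add: finner_def power2_eq_square sum_distrib_left algebra_simps)
  finally have *: "finner (C * Z) (C * Z) = (\<Sum>j<m + k. ?d j * (\<Sum>c<k. (W $$ (j, c))\<^sup>2))" .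
  have "finner W W = real k"
    using frob_norm_orthonormal[OF oW W] frob_norm_power2[of W] by simp
  then have "(\<Sum>j<m + k. \<Sum>c<k. (W $$ (j, c))\<^sup>2) = real k"
    using W by (simp add: finner_def power2_eq_square)
  then have "(\<Sum>j\<in>{m..<m + k}. ?d j) \<le> finner (C * Z) (C * Z)"
    unfolding *
    using singular_value_decomposition(2,3)[OF C] orthonormal_row_norm_le[OF W oW]
    by (intro weighted_sum_ge_tail) (auto intro!: sum_nonneg power_mono)
  also have "(\<Sum>j\<in>{m..<m + k}. ?d j) = (\<Sum>i = m + 1..m + k. (sigma_val i C)\<^sup>2)"
    by (rule sum.reindex_bij_witness[of _ "\<lambda>i. i - 1" Suc]) auto
  finally show ?thesis .
qed

text \<open>If singular value number \<open>j + 1\<close> were nonzero, normalising the first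
  \<open>j + 1\<close> columns of \<open>X V\<close> would give orthonormal vectors in the column
  space of \<open>X\<close>. Their coordinates \<open>Y\<close> in an orthonormal basis
  \<open>U\<close> of that space are again orthonormal, so \<open>j + 1\<close> is at most the
  rank.\<close>

lemma singular_value_zero:
  fixes X :: "real mat"
  assumes X: "X \<in> carrier_mat n c" and j: "vec_space.rank n X \<le> j" "j < c"
  shows "sigma_val (Suc j) X = 0"
proof (rule ccontr)
  let ?r = "vec_space.rank n X" and ?s = "\<lambda>j. sigma_val (Suc j) X"
  assume "?s j \<noteq> 0"
  then have pos: "0 < ?s i" if "i \<le> j" for i
    using singular_value_decomposition(2)[OF X that j(2)] singular_value_decomposition(3)[OF X j(2)] by simp
  obtain V where V: "V \<in> carrier_mat c c" "orthonormal_mat V"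
    and ev: "\<forall>j<c. (X\<^sup>T * X) *\<^sub>v col V j = (?s j)\<^sup>2 \<cdot>\<^sub>v col V j"
    using singular_value_decomposition(1)[OF X] by auto
  note gram = singular_vectors_gram[OF X V ev]
  define E where "E = Matrix.mat c (Suc j) (\<lambda>(a, b). V $$ (a, b) / ?s b)"
  have E: "E \<in> carrier_mat c (Suc j)" by (simp add: E_def)
  define F where "F = X * E"
  have F: "F \<in> carrier_mat n (Suc j)" using X E by (simp add: F_def)
  have colF: "col F b = (1 / ?s b) \<cdot>\<^sub>v col (X * V) b" if "b < Suc j" for b
  proof -
    have "col E b = (1 / ?s b) \<cdot>\<^sub>v col V b" using that j V by (auto simp: E_def)
    moreover have "X *\<^sub>v ((1 / ?s b) \<cdot>\<^sub>v col V b) = (1 / ?s b) \<cdot>\<^sub>v (X *\<^sub>v col V b)"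
      by (rule mult_mat_vec[OF X]) (use that j V in auto)
    ultimately show ?thesis
      using that j X E V by (simp add: F_def del: col_mult)
  qed
  have XV: "X * V \<in> carrier_mat n c" using X V by simp
  have oF: "orthonormal_mat F"
    unfolding orthonormal_mat_iff[OF F]
  proof (intro allI impI)
    fix a b assume ab: "a < Suc j" "b < Suc j"
    have ac: "a < c" "b < c" using ab j by auto
    have "col (X * V) a \<bullet> col (X * V) b = ((X * V)\<^sup>T * (X * V)) $$ (a, b)"
      using ac X V by (simp del: col_mult)
    also have "\<dots> = (if a = b then (?s b)\<^sup>2 else 0)"
      unfolding gram using ac by (simp add: mat_diag_def)
    finally have "col (X * V) a \<bullet> col (X * V) b = (if a = b then (?s b)\<^sup>2 else 0)" .
    moreover have "dim_vec (col (X * V) a) = n" "dim_vec (col (X * V) b) = n" using X by auto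
    ultimately show "col F a \<bullet> col F b = (if a = b then 1 else 0)"
      using pos[of b] ab ac by (simp add: colF power2_eq_square del: col_mult)
  qed
  obtain U where U: "U \<in> carrier_mat n ?r" "orthonormal_mat U" "U * (U\<^sup>T * X) = X"
    using exists_orthonormal_column_space[OF X] by auto
  define Y where "Y = U\<^sup>T * F"
  have Y: "Y \<in> carrier_mat ?r (Suc j)" using U F by (simp add: Y_def)
  have "Y = (U\<^sup>T * X) * E" unfolding Y_def F_def
    by (rule assoc_mult_mat[symmetric]) (use U X E in auto)
  then have "U * Y = U * ((U\<^sup>T * X) * E)" by simp
  also have "\<dots> = U * (U\<^sup>T * X) * E"
    by (rule assoc_mult_mat[symmetric]) (use U X E in auto)
  finally have UY: "U * Y = F" using U by (simp add: F_def)
  have "F\<^sup>T * F = Y\<^sup>T * (U\<^sup>T * (U * Y))"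
    unfolding UY[symmetric]
    using U Y assoc_mult_mat[of "Y\<^sup>T" "Suc j" ?r "U\<^sup>T" n "U * Y" "Suc j"]
    by (simp add: transpose_mult[of U n ?r Y "Suc j"])
  also have "U\<^sup>T * (U * Y) = Y" unfolding UY by (simp only: Y_def)
  finally have "orthonormal_mat Y" using oF F Y by (simp add: orthonormal_mat_def)
  then have "Suc j \<le> ?r" by (rule orthonormal_cols_le[OF Y])
  then show False using j by simp
qed

lemma add_diff_cancel_mat:
  fixes A :: "real mat"
  assumes "A \<in> carrier_mat n c" "B \<in> carrier_mat n c" "C \<in> carrier_mat n c"
  shows "(A + B) - (A + C) = B - C"
  by (rule eq_matI) (use assms in auto)

text \<open>The range of \<open>U\<close> has to contain the first \<open>\<mu>\<close> columns of
  \<open>F = X V\<close>; the residual of \<open>F\<close> then equals that of its remaining columns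
  \<open>R\<close>, whose lengths are the trailing singular values. Multiplication by the orthogonal
  \<open>V\<close> transfers the bound from \<open>F\<close> to \<open>X\<close>.\<close>

lemma exists_leading_left_singular_space:
  fixes X :: "real mat"
  assumes X: "X \<in> carrier_mat n c" and mu: "\<mu> \<le> n"
  shows "\<exists>U\<in>carrier_mat n \<mu>. orthonormal_mat U \<and>
    finner (X - U * (U\<^sup>T * X)) (X - U * (U\<^sup>T * X)) \<le> (\<Sum>j\<in>{\<mu>..<c}. (sigma_val (Suc j) X)\<^sup>2)"
proof -
  let ?s = "\<lambda>j. sigma_val (Suc j) X"
  obtain V where V: "V \<in> carrier_mat c c" "orthonormal_mat V"
    and ev: "\<forall>j<c. (X\<^sup>T * X) *\<^sub>v col V j = (?s j)\<^sup>2 \<cdot>\<^sub>v col V j"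
    using singular_value_decomposition(1)[OF X] by auto
  note gram = singular_vectors_gram[OF X V ev]
  define F where "F = X * V"
  have F: "F \<in> carrier_mat n c" using X V by (simp add: F_def)
  \<comment> \<open>Zero columns pad \<open>Y\<close> when \<open>\<mu> > c\<close>;
    \<open>E\<close> puts the leading columns back among the \<open>c\<close> columns of
    \<open>F\<close>.\<close>
  define Y where "Y = Matrix.mat n \<mu> (\<lambda>(i, j). if j < c then F $$ (i, j) else 0)"
  define E :: "real mat" where "E = Matrix.mat \<mu> c (\<lambda>(i, j). if i = j then 1 else 0)"
  define R where "R = Matrix.mat n c (\<lambda>(i, j). if j < \<mu> then 0 else F $$ (i, j))"
  have Y: "Y \<in> carrier_mat n \<mu>" and E: "E \<in> carrier_mat \<mu> c" and R: "R \<in> carrier_mat n c"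
    by (simp_all add: Y_def E_def R_def)
  obtain U where U: "U \<in> carrier_mat n \<mu>" "orthonormal_mat U" "U * (U\<^sup>T * Y) = Y"
    using exists_orthonormal_range[OF Y mu] by auto
  have YE: "Y * E \<in> carrier_mat n c" using Y E by simp
  have FYE: "F = Y * E + R"
  proof (rule eq_matI)
    fix i j assume "i < dim_row (Y * E + R)" "j < dim_col (Y * E + R)"
    then have ij: "i < n" "j < c" using R by auto
    have "(Y * E) $$ (i, j) = (\<Sum>l<\<mu>. if l = j then Y $$ (i, l) else 0)"
      using ij mult_mat_entry[OF Y E ij]
      by (simp add: E_def if_distrib[of "\<lambda>x. _ * x"] cong: if_cong)
    also have "\<dots> = (if j < \<mu> then F $$ (i, j) else 0)" using ij by (simp add: Y_def)
    finally show "F $$ (i, j) = (Y * E + R) $$ (i, j)" using ij YE R by (simp add: R_def)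
  qed (use F Y E R in auto)
  have "U\<^sup>T * (Y * E) = (U\<^sup>T * Y) * E"
    using assoc_mult_mat[of "U\<^sup>T" \<mu> n Y \<mu> E c] U Y E by simp
  moreover have "U * ((U\<^sup>T * Y) * E) = (U * (U\<^sup>T * Y)) * E"
    using assoc_mult_mat[of U n \<mu> "U\<^sup>T * Y" \<mu> E c] U Y E by simp
  ultimately have UYE: "U * (U\<^sup>T * (Y * E)) = Y * E" using U by simp
  have UR: "U * (U\<^sup>T * R) \<in> carrier_mat n c" using U R by simp
  have "U * (U\<^sup>T * F) = U * (U\<^sup>T * (Y * E) + U\<^sup>T * R)"
    unfolding FYE using U YE R by (simp add: mult_add_distrib_mat[of _ \<mu> n _ c])
  also have "\<dots> = Y * E + U * (U\<^sup>T * R)"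
    using U YE R by (simp add: mult_add_distrib_mat[of U n \<mu> _ c] UYE)
  finally have FR: "F - U * (U\<^sup>T * F) = R - U * (U\<^sup>T * R)"
    using add_diff_cancel_mat[OF YE R UR] FYE by simp
  define P where "P = X - U * (U\<^sup>T * X)"
  have P: "P \<in> carrier_mat n c" unfolding P_def by (rule minus_carrier_mat) (use U X in simp)
  have "U * (U\<^sup>T * F) = U * (U\<^sup>T * X) * V"
  proof -
    have "U\<^sup>T * F = (U\<^sup>T * X) * V"
      unfolding F_def using assoc_mult_mat[of "U\<^sup>T" \<mu> n X c V c] U X V by simp
    then show ?thesis using assoc_mult_mat[of U n \<mu> "U\<^sup>T * X" c V c] U X V by simp
  qed
  then have PV: "P * V = F - U * (U\<^sup>T * F)"
    unfolding P_def F_def using minus_mult_distrib_mat[of X n c "U * (U\<^sup>T * X)" V c] X U V by simp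
  have "frob_norm P = frob_norm (P * V)"
    using frob_norm_mult_orthonormal_transpose[of "V\<^sup>T" c c P n] orthonormal_transpose[OF V] V P by simp
  also have "\<dots> \<le> frob_norm R"
    unfolding PV FR by (rule frob_norm_projection_residual_le[OF U(2,1) R])
  finally have "finner P P \<le> finner R R" by (simp add: frob_norm_le_iff)
  also have "finner R R = (\<Sum>j<c. \<Sum>i<n. R $$ (i, j) * R $$ (i, j))"
    using R by (subst sum.swap) (simp add: finner_def)
  also have "\<dots> = (\<Sum>j<c. if j < \<mu> then 0 else (?s j)\<^sup>2)"
  proof (intro sum.cong refl)
    fix j assume "j \<in> {..<c}"
    then have j: "j < c" by simp
    have "(\<Sum>i<n. F $$ (i, j) * F $$ (i, j)) = (F\<^sup>T * F) $$ (j, j)"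
      using j F by (simp add: mult_mat_entry[of "F\<^sup>T" c n F c] del: index_mult_mat(1))
    also have "\<dots> = (?s j)\<^sup>2" unfolding F_def gram using j by (simp add: mat_diag_def)
    finally show "(\<Sum>i<n. R $$ (i, j) * R $$ (i, j)) = (if j < \<mu> then 0 else (?s j)\<^sup>2)"
      using j by (auto simp: R_def)
  qed
  also have "\<dots> = (\<Sum>j\<in>{\<mu>..<c}. (?s j)\<^sup>2)"
    by (intro sum.mono_neutral_cong_right) auto
  finally show ?thesis using U unfolding P_def by auto
qed

text \<open>Cauchy-Schwarz over the singular values beyond \<open>\<mu>\<close> that can be nonzero.
  Counting these, instead of all \<open>r\<close>, matters later: with
  \<open>q\<^sup>2 = r - \<mu>\<close> one has \<open>r = q\<^sup>2 + \<mu>\<close>, and for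
  \<open>r \<le> \<mu>\<close> the truncated difference makes the bound 0.\<close>

lemma tail_energy_le_Delta1:
  fixes X :: "real mat"
  assumes X: "X \<in> carrier_mat n c" and mu: "\<mu> \<le> n"
  defines "r \<equiv> vec_space.rank n X"
  shows "\<exists>U\<in>carrier_mat n \<mu>. orthonormal_mat U \<and>
    finner (X - U * (U\<^sup>T * X)) (X - U * (U\<^sup>T * X)) \<le> sqrt (real (r - \<mu>)) * Delta1 (\<mu> + 1) X"
proof -
  let ?s = "\<lambda>j. sigma_val (Suc j) X"
  have rn: "r \<le> n" "r \<le> c"
    using rank_factorization(2)[OF X] vec_space.rank_le_nc[OF X] by (auto simp: r_def)
  obtain U where U: "U\<in>carrier_mat n \<mu>" "orthonormal_mat U"
    "finner (X - U * (U\<^sup>T * X)) (X - U * (U\<^sup>T * X)) \<le> (\<Sum>j\<in>{\<mu>..<c}. (?s j)\<^sup>2)"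
    using exists_leading_left_singular_space[OF X mu] by auto
  note U(3)
  also have "(\<Sum>j\<in>{\<mu>..<c}. (?s j)\<^sup>2) = (\<Sum>j\<in>{\<mu>..<r}. (?s j)\<^sup>2 * 1)"
    using rn singular_value_zero[OF X] by (intro sum.mono_neutral_cong_right) (auto simp: r_def)
  also have "\<dots> \<le> (\<Sum>j\<in>{\<mu>..<r}. \<bar>(?s j)\<^sup>2\<bar> * \<bar>1\<bar>)" by simp
  also have "\<dots> \<le> L2_set (\<lambda>j. (?s j)\<^sup>2) {\<mu>..<r} * L2_set (\<lambda>_. 1) {\<mu>..<r}"
    by (rule L2_set_mult_ineq)
  also have "L2_set (\<lambda>_. 1) {\<mu>..<r} = sqrt (real (r - \<mu>))" by (simp add: L2_set_def)
  also have "L2_set (\<lambda>j. (?s j)\<^sup>2) {\<mu>..<r} = sqrt (\<Sum>j\<in>{\<mu>..<r}. ?s j ^ 4)"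
    by (simp add: L2_set_def flip: power_mult)
  also have "(\<Sum>j\<in>{\<mu>..<r}. ?s j ^ 4) = (\<Sum>i\<in>{\<mu> + 1..r}. sigma_val i X ^ 4)"
    by (rule sum.reindex_bij_witness[of _ "\<lambda>i. i - 1" Suc]) auto
  also have "sqrt \<dots> \<le> Delta1 (\<mu> + 1) X"
    unfolding Delta1_def using rn X by (intro real_sqrt_le_mono sum_mono2) auto
  finally have "finner (X - U * (U\<^sup>T * X)) (X - U * (U\<^sup>T * X)) \<le> Delta1 (\<mu> + 1) X * sqrt (real (r - \<mu>))"
    by (simp add: mult_right_mono)
  then show ?thesis using U by (auto simp: mult.commute)
qed

lemma mat_add_diff_cancel_right:
  fixes A :: "real mat"
  assumes "A \<in> carrier_mat n c" "B \<in> carrier_mat n c"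
  shows "(A + B) - B = A"
  by (rule eq_matI) (use assms in auto)

lemma mat_diff_diff_swap:
  fixes A :: "real mat"
  assumes "A \<in> carrier_mat n c" "B \<in> carrier_mat n c" "C \<in> carrier_mat n c" "D \<in> carrier_mat n c"
  shows "(A - B) - (C - D) = (A - C) - (B - D)"
  by (rule eq_matI) (use assms in auto)

section \<open>Residuals of the sampled range finder\<close>

definition resid :: "real mat \<Rightarrow> real mat \<Rightarrow> real mat" where
  "resid Q A = A - Q * (Q\<^sup>T * A)"

lemma resid_carrier:
  assumes "Q \<in> carrier_mat n k" "A \<in> carrier_mat n c"
  shows "resid Q A \<in> carrier_mat n c"
  unfolding resid_def by (rule minus_carrier_mat) (use assms in simp)

lemma resid_mult:
  assumes Q: "Q \<in> carrier_mat n k" and A: "A \<in> carrier_mat n a" "B \<in> carrier_mat a c"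
  shows "resid Q (A * B) = resid Q A * B"
proof -
  have "Q\<^sup>T * (A * B) = (Q\<^sup>T * A) * B"
    by (rule assoc_mult_mat[symmetric]) (use Q A in auto)
  then have "Q * (Q\<^sup>T * (A * B)) = Q * ((Q\<^sup>T * A) * B)" by simp
  also have "\<dots> = (Q * (Q\<^sup>T * A)) * B"
    by (rule assoc_mult_mat[symmetric]) (use Q A in auto)
  finally show ?thesis
    unfolding resid_def using minus_mult_distrib_mat[of A n a "Q * (Q\<^sup>T * A)" B c] Q A by simp
qed

lemma resid_minus:
  assumes Q: "Q \<in> carrier_mat n k" and A: "A \<in> carrier_mat n c" "B \<in> carrier_mat n c"
  shows "resid Q (A - B) = resid Q A - resid Q B"
proof -
  have "Q\<^sup>T * (A - B) = Q\<^sup>T * A - Q\<^sup>T * B"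
    by (rule mult_minus_distrib_mat) (use Q A in auto)
  then have "Q * (Q\<^sup>T * (A - B)) = Q * (Q\<^sup>T * A - Q\<^sup>T * B)" by simp
  also have "\<dots> = Q * (Q\<^sup>T * A) - Q * (Q\<^sup>T * B)"
    by (rule mult_minus_distrib_mat) (use Q A in auto)
  finally have *: "Q * (Q\<^sup>T * (A - B)) = Q * (Q\<^sup>T * A) - Q * (Q\<^sup>T * B)" .
  have c: "Q * (Q\<^sup>T * A) \<in> carrier_mat n c" "Q * (Q\<^sup>T * B) \<in> carrier_mat n c" using Q A by simp_all
  show ?thesis unfolding resid_def * by (rule mat_diff_diff_swap[OF A c])
qed

lemma resid_add:
  assumes Q: "Q \<in> carrier_mat n k" and A: "A \<in> carrier_mat n c" "B \<in> carrier_mat n c"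
  shows "resid Q (A + B) = resid Q A + resid Q B"
proof -
  have "A = (A + B) - B" by (rule eq_matI) (use A in auto)
  then have "resid Q A = resid Q (A + B) - resid Q B"
    using resid_minus[OF Q, of "A + B" c B] A by simp
  moreover have "resid Q (A + B) = (resid Q (A + B) - resid Q B) + resid Q B"
    using resid_carrier[OF Q, of "A + B" c] resid_carrier[OF Q A(2)] A by (intro eq_matI) auto
  ultimately show ?thesis by simp
qed

lemma resid_range:
  assumes Q: "Q \<in> carrier_mat n k" "orthonormal_mat Q" and R: "R \<in> carrier_mat k c"
  shows "resid Q (Q * R) = 0\<^sub>m n c"
proof -
  have "Q\<^sup>T * (Q * R) = (Q\<^sup>T * Q) * R"
    by (rule assoc_mult_mat[symmetric]) (use Q R in auto)
  then have "Q\<^sup>T * (Q * R) = R" using orthonormal_matD[OF Q(2,1)] R by simp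
  then show ?thesis using Q R by (simp add: resid_def)
qed

lemma frob_norm_resid_le:
  assumes "Q \<in> carrier_mat n k" "orthonormal_mat Q" "X \<in> carrier_mat n c"
  shows "frob_norm (resid Q X) \<le> frob_norm X"
  unfolding resid_def by (rule frob_norm_projection_residual_le[OF assms(2,1,3)])

text \<open>The range of the sketch is split by the row space of the leading part of the sampled matrix, so
  that only the sampled tail enters the residual \<open>Y\<close>.\<close>

lemma sampled_gram_split:
  fixes X S U :: "real mat"
  assumes X: "X \<in> carrier_mat n c" and S: "S \<in> carrier_mat c t"
    and U: "U \<in> carrier_mat n \<mu>" "orthonormal_mat U" and mu: "\<mu> \<le> n" "\<mu> \<le> t"
  defines "C' \<equiv> X * S"
  shows "\<exists>V\<in>carrier_mat n \<mu>. \<exists>L\<in>carrier_mat n \<mu>. \<exists>Y\<in>carrier_mat n n. orthonormal_mat V \<and>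
    C' * C'\<^sup>T = L * V\<^sup>T + Y \<and>
    frob_norm Y \<le> finner (resid U X * S) (resid U X * S)"
proof -
  have C: "C' \<in> carrier_mat n t" using X S by (simp add: C'_def)
  have CU: "C'\<^sup>T * U \<in> carrier_mat t \<mu>" using C U by simp
  \<comment> \<open>A \<open>\<mu>\<close>-dimensional space of row vectors that contains the rows
    of \<open>U\<^sup>T C'\<close>. Splitting by it on the right, instead of by \<open>U\<close> on
    the left, makes both parts of \<open>C' C'\<^sup>T\<close> symmetric.\<close>
  obtain \<Theta> where T: "\<Theta> \<in> carrier_mat t \<mu>" "orthonormal_mat \<Theta>" "\<Theta> * (\<Theta>\<^sup>T * (C'\<^sup>T * U)) = C'\<^sup>T * U"
    using exists_orthonormal_range[OF CU mu(2)] by auto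
  define F where "F = C'\<^sup>T - \<Theta> * (\<Theta>\<^sup>T * C'\<^sup>T)"
  have TC: "\<Theta> * (\<Theta>\<^sup>T * C'\<^sup>T) \<in> carrier_mat t n" using T C by simp
  have F: "F \<in> carrier_mat t n" unfolding F_def by (rule minus_carrier_mat) (rule TC)
  define Z where "Z = C' * \<Theta>"
  have Z: "Z \<in> carrier_mat n \<mu>" using C T by (simp add: Z_def)
  obtain V where V: "V \<in> carrier_mat n \<mu>" "orthonormal_mat V" "V * (V\<^sup>T * Z) = Z"
    using exists_orthonormal_range[OF Z mu(1)] by auto
  define L where "L = Z * (Z\<^sup>T * V)"
  have L: "L \<in> carrier_mat n \<mu>" using Z V by (simp add: L_def)
  define Y where "Y = C' * F"
  have Y: "Y \<in> carrier_mat n n" using C F by (simp add: Y_def)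
  have "Z\<^sup>T = (V * (V\<^sup>T * Z))\<^sup>T" by (simp only: V(3))
  also have "\<dots> = (V\<^sup>T * Z)\<^sup>T * V\<^sup>T"
    by (rule transpose_mult) (use V Z in auto)
  also have "(V\<^sup>T * Z)\<^sup>T = Z\<^sup>T * V" using V Z by (simp add: transpose_mult[of _ \<mu> n _ \<mu>])
  finally have ZT: "Z\<^sup>T = (Z\<^sup>T * V) * V\<^sup>T" .
  have "L * V\<^sup>T = Z * ((Z\<^sup>T * V) * V\<^sup>T)" unfolding L_def
    by (rule assoc_mult_mat) (use Z V in auto)
  then have LV: "L * V\<^sup>T = Z * Z\<^sup>T" using ZT by simp
  have "Z * Z\<^sup>T = C' * (\<Theta> * (\<Theta>\<^sup>T * C'\<^sup>T))"
    unfolding Z_def using C T by (simp add: transpose_mult[of _ n t _ \<mu>] assoc_mult_mat[of _ n t _ \<mu> _ n])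
  moreover have "Y = C' * C'\<^sup>T - C' * (\<Theta> * (\<Theta>\<^sup>T * C'\<^sup>T))"
    unfolding Y_def F_def by (rule mult_minus_distrib_mat) (use C TC in auto)
  moreover have "A = B + (A - B)" if "A \<in> carrier_mat n n" "B \<in> carrier_mat n n" for A B :: "real mat"
    by (rule eq_matI) (use that in auto)
  ultimately have split: "C' * C'\<^sup>T = L * V\<^sup>T + Y"
    using LV C Z by (metis mult_carrier_mat transpose_carrier_mat)
  let ?W = "(X - U * (U\<^sup>T * X)) * S"
  have Xt: "X - U * (U\<^sup>T * X) \<in> carrier_mat n c" by (rule minus_carrier_mat) (use U X in simp)
  have W: "?W \<in> carrier_mat n t" using Xt S by simp
  have WT: "?W\<^sup>T \<in> carrier_mat t n" using W by simp
  have UC: "U * (U\<^sup>T * C') \<in> carrier_mat n t" using U C by simp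
  have W_eq: "?W = C' - U * (U\<^sup>T * C')"
  proof -
    have "?W = X * S - U * (U\<^sup>T * X) * S"
      by (rule minus_mult_distrib_mat) (use X U S in auto)
    also have "U * (U\<^sup>T * X) * S = U * ((U\<^sup>T * X) * S)"
      by (rule assoc_mult_mat) (use X U S in auto)
    also have "(U\<^sup>T * X) * S = U\<^sup>T * C'" unfolding C'_def
      by (rule assoc_mult_mat) (use X U S in auto)
    finally show ?thesis by (simp add: C'_def)
  qed
  have UCT: "(U * (U\<^sup>T * C'))\<^sup>T = (C'\<^sup>T * U) * U\<^sup>T"
    using U C by (simp add: transpose_mult[of U n \<mu> _ t] transpose_mult[of "U\<^sup>T" \<mu> n C' t])
  have UCTc: "(C'\<^sup>T * U) * U\<^sup>T \<in> carrier_mat t n" using U C by simp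
  have WTeq: "?W\<^sup>T = C'\<^sup>T - (C'\<^sup>T * U) * U\<^sup>T"
    unfolding W_eq using transpose_minus[OF C UC] UCT by simp
  have "\<Theta> * (\<Theta>\<^sup>T * ((C'\<^sup>T * U) * U\<^sup>T)) = (C'\<^sup>T * U) * U\<^sup>T"
  proof -
    have "\<Theta>\<^sup>T * ((C'\<^sup>T * U) * U\<^sup>T) = (\<Theta>\<^sup>T * (C'\<^sup>T * U)) * U\<^sup>T"
      by (rule assoc_mult_mat[symmetric]) (use T C U in auto)
    then have "\<Theta> * (\<Theta>\<^sup>T * ((C'\<^sup>T * U) * U\<^sup>T)) = \<Theta> * ((\<Theta>\<^sup>T * (C'\<^sup>T * U)) * U\<^sup>T)" by simp
    also have "\<dots> = (\<Theta> * (\<Theta>\<^sup>T * (C'\<^sup>T * U))) * U\<^sup>T"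
      by (rule assoc_mult_mat[symmetric]) (use T C U in auto)
    finally show ?thesis by (simp only: T(3))
  qed
  then have "\<Theta> * (\<Theta>\<^sup>T * ?W\<^sup>T) = \<Theta> * (\<Theta>\<^sup>T * C'\<^sup>T) - (C'\<^sup>T * U) * U\<^sup>T"
    unfolding WTeq using T C UCTc
    by (simp only: mult_minus_distrib_mat[of "\<Theta>\<^sup>T" \<mu> t _ n] mult_minus_distrib_mat[of \<Theta> t \<mu> _ n]
      transpose_carrier_mat mult_carrier_mat[of _ \<mu> t _ n])
  moreover have "(A - B) - (D - B) = A - D"
    if "A \<in> carrier_mat t n" "B \<in> carrier_mat t n" "D \<in> carrier_mat t n" for A B D :: "real mat"
    by (rule eq_matI) (use that in auto)
  \<comment> \<open>Since \<open>\<Theta>\<close> reproduces \<open>C'\<^sup>T U\<close>, the part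
    of \<open>C'\<^sup>T\<close> coming from \<open>U\<close> leaves no residual: \<open>F\<close>
    is the residual of \<open>?W\<^sup>T\<close>, the sampled tail alone.\<close>
  ultimately have F_W: "F = ?W\<^sup>T - \<Theta> * (\<Theta>\<^sup>T * ?W\<^sup>T)"
    unfolding WTeq F_def using C UCTc TC by simp
  have TF: "\<Theta>\<^sup>T * F = 0\<^sub>m \<mu> n"
  proof -
    have "\<Theta>\<^sup>T * (\<Theta> * (\<Theta>\<^sup>T * C'\<^sup>T)) = (\<Theta>\<^sup>T * \<Theta>) * (\<Theta>\<^sup>T * C'\<^sup>T)"
      by (rule assoc_mult_mat[symmetric]) (use T C in auto)
    also have "\<dots> = \<Theta>\<^sup>T * C'\<^sup>T" using T C orthonormal_matD[OF T(2,1)] by simp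
    finally show ?thesis
      unfolding F_def using mult_minus_distrib_mat[of "\<Theta>\<^sup>T" \<mu> t "C'\<^sup>T" n "\<Theta> * (\<Theta>\<^sup>T * C'\<^sup>T)"] T C TC
      by simp
  qed
  \<comment> \<open>The remainder is a Gram matrix, so its norm is quadratic in the sampled tail;
    bounding \<open>C' F\<close> by the product of the norms would bring back the leading part of
    \<open>X\<close>.\<close>
  have "Y = F\<^sup>T * F"
  proof -
    have "F\<^sup>T = C' - (\<Theta> * (\<Theta>\<^sup>T * C'\<^sup>T))\<^sup>T"
      unfolding F_def using transpose_minus[of "C'\<^sup>T" t n "\<Theta> * (\<Theta>\<^sup>T * C'\<^sup>T)"] C TC by simp
    also have "(\<Theta> * (\<Theta>\<^sup>T * C'\<^sup>T))\<^sup>T = Z * \<Theta>\<^sup>T"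
      unfolding Z_def using T C by (simp add: transpose_mult[of \<Theta> t \<mu> _ n] transpose_mult[of "\<Theta>\<^sup>T" \<mu> t "C'\<^sup>T" n])
    finally have "F\<^sup>T * F = C' * F - (Z * \<Theta>\<^sup>T) * F"
      using minus_mult_distrib_mat[of C' n t "Z * \<Theta>\<^sup>T" F n] C Z T F by simp
    also have "(Z * \<Theta>\<^sup>T) * F = Z * (\<Theta>\<^sup>T * F)"
      by (rule assoc_mult_mat) (use Z T F in auto)
    also have "\<dots> = 0\<^sub>m n n" using TF Z by simp
    finally have "F\<^sup>T * F = Y - 0\<^sub>m n n" by (simp only: Y_def)
    also have "\<dots> = Y" by (rule eq_matI) (use Y in auto)
    finally show ?thesis by simp
  qed
  then have "frob_norm Y \<le> frob_norm F * frob_norm F"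
    using frob_norm_mult[of "F\<^sup>T" n t F n] F by (simp add: frob_norm_transpose)
  also have "\<dots> \<le> frob_norm ?W * frob_norm ?W"
    using frob_norm_projection_residual_le[OF T(2,1) WT] frob_norm_nonneg[of F]
    by (intro mult_mono) (simp_all add: F_W[symmetric] frob_norm_transpose frob_norm_nonneg)
  finally have "frob_norm Y \<le> finner ?W ?W" by (simp add: power2_eq_square flip: frob_norm_power2)
  then show ?thesis using V L Y split unfolding resid_def by blast
qed

text \<open>The hypothesis on \<open>t\<close> says that right multiplication by
  \<open>V\<^sup>T G\<close> is bounded below, with \<open>t\<close> acting as the squared norm of a
  pseudoinverse. The residual of \<open>L\<close> is then read off from that of
  \<open>L V\<^sup>T G = B G - Y G\<close>; the sketch \<open>B G\<close> and the remainder
  \<open>Y G\<close> each contribute at most \<open>\<parallel>Y G\<parallel>\<close>, whence the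
  factor 2.\<close>

lemma range_basis_residual:
  fixes B G Q L V Y :: "real mat"
  assumes G: "G \<in> carrier_mat n (\<mu> + K)"
    and V: "V \<in> carrier_mat n \<mu>" and L: "L \<in> carrier_mat n \<mu>" and Y: "Y \<in> carrier_mat n n"
    and oV: "orthonormal_mat V" and B: "B = L * V\<^sup>T + Y"
    and Q: "range_basis \<mu> K (B * G) Q" and t0: "0 \<le> t"
    and t: "\<And>R. R \<in> carrier_mat n \<mu> \<Longrightarrow> finner R R \<le> finner (R * (V\<^sup>T * G)) (R * (V\<^sup>T * G)) * t"
  shows "frob_norm (resid Q B) \<le> frob_norm Y + 2 * frob_norm (Y * G) * sqrt t"
proof -
  have LV: "L * V\<^sup>T \<in> carrier_mat n n" using L V by simp
  have Bc: "B \<in> carrier_mat n n" using B LV Y by simp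
  have C: "B * G \<in> carrier_mat n (\<mu> + K)" using Bc G by simp
  have YG: "Y * G \<in> carrier_mat n (\<mu> + K)" using Y G by simp
  have dimC: "dim_row (B * G) = n" using C by (simp only: carrier_matD)
  obtain R where Q': "Q \<in> carrier_mat n \<mu>" "orthonormal_mat Q" and R: "R \<in> carrier_mat \<mu> (\<mu> + K)"
    and QR: "frob_norm (Q * R - B * G) \<le> sqrt (\<Sum>k = \<mu> + 1..\<mu> + K. (sigma_val k (B * G))\<^sup>2)"
    using Q unfolding range_basis_def dimC by auto
  note rc = resid_carrier[OF Q'(1)]
  have QRc: "Q * R \<in> carrier_mat n (\<mu> + K)" using Q' R by simp
  have "resid Q (Q * R - B * G) = 0\<^sub>m n (\<mu> + K) - resid Q (B * G)"
    unfolding resid_minus[OF Q'(1) QRc C] resid_range[OF Q' R] ..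
  also have "\<dots> = - resid Q (B * G)" using rc[OF C] by (intro eq_matI) auto
  finally have "frob_norm (resid Q (B * G)) = frob_norm (resid Q (Q * R - B * G))"
    using frob_norm_uminus[OF rc[OF C]] by simp
  also have "\<dots> \<le> frob_norm (Q * R - B * G)"
    by (rule frob_norm_resid_le[OF Q']) (rule minus_carrier_mat[OF C])
  also note QR
  finally have PC1: "frob_norm (resid Q (B * G)) \<le> sqrt (\<Sum>k = \<mu> + 1..\<mu> + K. (sigma_val k (B * G))\<^sup>2)" .
  have M: "V\<^sup>T * G \<in> carrier_mat \<mu> (\<mu> + K)" using V G by simp
  have LM: "L * (V\<^sup>T * G) \<in> carrier_mat n (\<mu> + K)" using L M by simp
  have BG: "B * G = L * (V\<^sup>T * G) + Y * G"
  proof -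
    have "B * G = (L * V\<^sup>T) * G + Y * G" unfolding B
      by (rule add_mult_distrib_mat[OF LV Y G])
    also have "(L * V\<^sup>T) * G = L * (V\<^sup>T * G)" by (rule assoc_mult_mat) (use L V G in auto)
    finally show ?thesis .
  qed
  \<comment> \<open>\<open>V\<^sup>T G\<close> has \<open>\<mu>\<close> rows and
    \<open>\<mu> + K\<close> columns, so its kernel contains \<open>K\<close> orthonormal vectors.
    On them \<open>B G\<close> agrees with \<open>Y G\<close>, and the variational bound limits the
    \<open>K\<close> trailing singular values of \<open>B G\<close> by
    \<open>\<parallel>Y G\<parallel>\<close>.\<close>
  obtain Z where Z: "Z \<in> carrier_mat (\<mu> + K) K" "orthonormal_mat Z" "(V\<^sup>T * G) * Z = 0\<^sub>m \<mu> K"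
    using exists_orthonormal_kernel[OF M] by auto
  have YGZ: "(Y * G) * Z \<in> carrier_mat n K" by (rule mult_carrier_mat[OF YG Z(1)])
  have "(B * G) * Z = (L * (V\<^sup>T * G)) * Z + (Y * G) * Z"
    unfolding BG by (rule add_mult_distrib_mat[OF LM YG Z(1)])
  also have "(L * (V\<^sup>T * G)) * Z = L * ((V\<^sup>T * G) * Z)"
    by (rule assoc_mult_mat[OF L M Z(1)])
  also have "\<dots> = 0\<^sub>m n K" unfolding Z(3) by (rule right_mult_zero_mat[OF L])
  also have "0\<^sub>m n K + (Y * G) * Z = (Y * G) * Z" by (rule left_add_zero_mat[OF YGZ])
  finally have BGZ: "(B * G) * Z = (Y * G) * Z" .
  have "(\<Sum>k = \<mu> + 1..\<mu> + K. (sigma_val k (B * G))\<^sup>2) \<le> finner ((Y * G) * Z) ((Y * G) * Z)"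
    using sum_tail_singular_values_le[OF C Z(1,2)] unfolding BGZ .
  also have "\<dots> \<le> finner (Y * G) (Y * G)"
    using frob_norm_mult_orthonormal_le[OF Z(2,1) YG] by (simp only: frob_norm_le_iff)
  finally have "sqrt (\<Sum>k = \<mu> + 1..\<mu> + K. (sigma_val k (B * G))\<^sup>2) \<le> frob_norm (Y * G)"
    unfolding frob_norm_finner by (rule real_sqrt_le_mono)
  with PC1 have PC: "frob_norm (resid Q (B * G)) \<le> frob_norm (Y * G)" by (rule order_trans)
  have "resid Q L * (V\<^sup>T * G) = resid Q (L * (V\<^sup>T * G))" by (rule resid_mult[OF Q'(1) L M, symmetric])
  also have "L * (V\<^sup>T * G) = B * G - Y * G"
    unfolding BG by (rule mat_add_diff_cancel_right[OF LM YG, symmetric])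
  also have "resid Q (B * G - Y * G) = resid Q (B * G) - resid Q (Y * G)" by (rule resid_minus[OF Q'(1) C YG])
  finally have "frob_norm (resid Q L * (V\<^sup>T * G)) \<le> frob_norm (resid Q (B * G)) + frob_norm (resid Q (Y * G))"
    using frob_norm_triangle_minus[OF rc[OF C] rc[OF YG]] by simp
  also have "\<dots> \<le> 2 * frob_norm (Y * G)"
    using PC frob_norm_resid_le[OF Q' YG] by simp
  finally have PL: "frob_norm (resid Q L * (V\<^sup>T * G)) \<le> 2 * frob_norm (Y * G)" .
  have VT: "V\<^sup>T \<in> carrier_mat \<mu> n" using V by simp
  have "frob_norm (resid Q (L * V\<^sup>T)) = frob_norm (resid Q L)"
    unfolding resid_mult[OF Q'(1) L VT] by (rule frob_norm_mult_orthonormal_transpose[OF oV V rc[OF L]])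
  also have "\<dots> \<le> frob_norm (resid Q L * (V\<^sup>T * G)) * sqrt t"
    using t[OF rc[OF L]] unfolding frob_norm_finner by (metis real_sqrt_le_mono real_sqrt_mult)
  also have "\<dots> \<le> (2 * frob_norm (Y * G)) * sqrt t"
    using PL t0 by (intro mult_right_mono) auto
  finally have 1: "frob_norm (resid Q (L * V\<^sup>T)) \<le> 2 * frob_norm (Y * G) * sqrt t" .
  have "resid Q B = resid Q (L * V\<^sup>T) + resid Q Y"
    unfolding B by (rule resid_add[OF Q'(1) LV Y])
  then have "frob_norm (resid Q B) \<le> frob_norm (resid Q (L * V\<^sup>T)) + frob_norm (resid Q Y)"
    using frob_norm_triangle[OF rc[OF LV] rc[OF Y]] by simp
  then show ?thesis using 1 frob_norm_resid_le[OF Q' Y] by simp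
qed

text \<open>With \<open>P = 1 - Q Q\<^sup>T\<close> and \<open>U\<close> an orthonormal basis of the
  column space, the squared norm of \<open>P X\<close> is the inner product of
  \<open>X = U U\<^sup>T X\<close> with \<open>P X\<close>, that is of \<open>U\<^sup>T\<close> with
  \<open>U\<^sup>T P X X\<^sup>T\<close>. Cauchy-Schwarz costs the norm of \<open>U\<close>, the
  root of the rank; \<open>X X\<^sup>T\<close> enters linearly, so \<open>B\<close> can be
  substituted at the price of the difference.\<close>

lemma projection_residual_le_rank:
  fixes X B Q :: "real mat"
  assumes X: "X \<in> carrier_mat n c" and Q: "Q \<in> carrier_mat n \<mu>" "orthonormal_mat Q"
    and B: "B \<in> carrier_mat n n"
  shows "finner (resid Q X) (resid Q X)
    \<le> sqrt (real (vec_space.rank n X)) * (frob_norm (X * X\<^sup>T - B) + frob_norm (resid Q B))"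
proof -
  let ?r = "vec_space.rank n X"
  obtain U where U: "U \<in> carrier_mat n ?r" "orthonormal_mat U" "U * (U\<^sup>T * X) = X"
    using exists_orthonormal_column_space[OF X] by auto
  have P: "resid Q X \<in> carrier_mat n c" by (rule resid_carrier[OF Q(1) X])
  have XX: "X * X\<^sup>T \<in> carrier_mat n n" using X by simp
  have QX: "Q * (Q\<^sup>T * X) \<in> carrier_mat n c" using Q X by simp
  have QP: "Q\<^sup>T * resid Q X = 0\<^sub>m \<mu> c"
  proof -
    have "Q\<^sup>T * (Q * (Q\<^sup>T * X)) = (Q\<^sup>T * Q) * (Q\<^sup>T * X)"
      by (rule assoc_mult_mat[symmetric]) (use Q X in auto)
    then have "Q\<^sup>T * (Q * (Q\<^sup>T * X)) = Q\<^sup>T * X" using orthonormal_matD[OF Q(2,1)] Q X by simp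
    then show ?thesis
      unfolding resid_def using mult_minus_distrib_mat[of "Q\<^sup>T" \<mu> n X c "Q * (Q\<^sup>T * X)"] Q X QX by simp
  qed
  have "finner (Q * (Q\<^sup>T * X)) (resid Q X) = finner (Q\<^sup>T * X) (Q\<^sup>T * resid Q X)"
    by (rule finner_mult_left) (use Q X P in auto)
  also have "\<dots> = 0" unfolding QP using Q X by (auto simp: finner_def intro!: sum.neutral)
  finally have "finner (resid Q X) (resid Q X) = finner X (resid Q X)"
    using finner_minus_left[OF X QX P] by (simp add: resid_def)
  also have "\<dots> = finner (U * (U\<^sup>T * X)) (resid Q X)" by (simp only: U(3))
  also have "\<dots> = finner (U\<^sup>T * X) (U\<^sup>T * resid Q X)"
    by (rule finner_mult_left) (use U X P in auto)
  also have "\<dots> = finner U\<^sup>T ((U\<^sup>T * resid Q X) * X\<^sup>T)"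
    by (rule finner_mult_right) (use U X P in auto)
  also have "(U\<^sup>T * resid Q X) * X\<^sup>T = U\<^sup>T * (resid Q X * X\<^sup>T)"
    by (rule assoc_mult_mat) (use U X P in auto)
  also have "resid Q X * X\<^sup>T = resid Q (X * X\<^sup>T)"
    by (rule resid_mult[OF Q(1) X, symmetric]) (use X in auto)
  also have "finner U\<^sup>T (U\<^sup>T * resid Q (X * X\<^sup>T)) \<le> frob_norm U\<^sup>T * frob_norm (U\<^sup>T * resid Q (X * X\<^sup>T))"
    by (rule finner_le[of _ ?r n]) (use U resid_carrier[OF Q(1) XX] in auto)
  also have "frob_norm U\<^sup>T = sqrt (real ?r)"
    using frob_norm_orthonormal[OF U(2,1)] by (simp add: frob_norm_transpose)
  also have "sqrt (real ?r) * frob_norm (U\<^sup>T * resid Q (X * X\<^sup>T)) \<le> sqrt (real ?r) * frob_norm (resid Q (X * X\<^sup>T))"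
    by (intro mult_left_mono frob_norm_orthonormal_transpose_mult_le[OF U(2,1) resid_carrier[OF Q(1) XX]]) simp
  finally have 1: "finner (resid Q X) (resid Q X) \<le> sqrt (real ?r) * frob_norm (resid Q (X * X\<^sup>T))" .
  have D: "X * X\<^sup>T - B \<in> carrier_mat n n" by (rule minus_carrier_mat[OF B])
  have "X * X\<^sup>T = (X * X\<^sup>T - B) + B"
    by (rule eq_matI) (use XX B in \<open>auto simp del: index_mult_mat(1)\<close>)
  then have "resid Q (X * X\<^sup>T) = resid Q (X * X\<^sup>T - B) + resid Q B"
    using resid_add[OF Q(1) D B] by simp
  then have "frob_norm (resid Q (X * X\<^sup>T)) \<le> frob_norm (resid Q (X * X\<^sup>T - B)) + frob_norm (resid Q B)"
    using frob_norm_triangle[OF resid_carrier[OF Q(1) D] resid_carrier[OF Q(1) B]] by simp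
  also have "\<dots> \<le> frob_norm (X * X\<^sup>T - B) + frob_norm (resid Q B)"
    using frob_norm_resid_le[OF Q D] by simp
  finally show ?thesis using 1 by (meson mult_left_mono order_trans real_sqrt_ge_zero of_nat_0_le_iff)
qed

section \<open>Orthogonal invariance of Gaussian vectors\<close>

abbreviation std_normal :: "real measure" where
  "std_normal \<equiv> density lborel (\<lambda>x. ennreal (std_normal_density x))"

lemma prob_space_std_normal: "prob_space std_normal"
  using prob_space_normal_density[of 1 0] by simp

interpretation std_normal: prob_space std_normal
  by (rule prob_space_std_normal)

lemma std_normal_density_mult_rotate:
  assumes "a\<^sup>2 + b\<^sup>2 = 1"
  shows "std_normal_density (a * u - b * v) * std_normal_density (b * u + a * v)
    = std_normal_density u * std_normal_density v"
proof -
  have "(a * u - b * v)\<^sup>2 + (b * u + a * v)\<^sup>2 = (a\<^sup>2 + b\<^sup>2) * (u\<^sup>2 + v\<^sup>2)"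
    by (simp add: power2_eq_square algebra_simps)
  then have *: "(a * u - b * v)\<^sup>2 + (b * u + a * v)\<^sup>2 = u\<^sup>2 + v\<^sup>2" using assms by simp
  have "exp (- (a * u - b * v)\<^sup>2 / 2) * exp (- (b * u + a * v)\<^sup>2 / 2) = exp (- (u\<^sup>2) / 2) * exp (- (v\<^sup>2) / 2)"
    unfolding exp_add[symmetric] using * by (simp add: field_simps)
  then show ?thesis by (simp add: std_normal_density_def)
qed

text \<open>The rotation is composed of substitutions in one variable: \<open>u = a x + b y\<close>
  in the inner integral and, after exchanging the order, \<open>y = b u + a v\<close>. The Jacobians
  \<open>1 / a\<close> and \<open>a\<close> cancel, and the product density depends on the sum of
  squares only. Division by \<open>a\<close> requires \<open>a \<noteq> 0\<close>.\<close>

lemma std_normal_rotate_nonzero: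
  fixes f :: "real \<Rightarrow> real \<Rightarrow> ennreal"
  assumes f [measurable]: "case_prod f \<in> borel_measurable (borel \<Otimes>\<^sub>M borel)"
    and ab: "a\<^sup>2 + b\<^sup>2 = 1" and a: "a \<noteq> 0"
  shows "(\<integral>\<^sup>+y. \<integral>\<^sup>+x. f (a * x + b * y) (a * y - b * x) \<partial>std_normal \<partial>std_normal)
    = (\<integral>\<^sup>+y. \<integral>\<^sup>+x. f x y \<partial>std_normal \<partial>std_normal)"
proof -
  let ?p = "\<lambda>x. ennreal (std_normal_density x)"
  have [measurable]: "(\<lambda>x. f (g x) (h x)) \<in> borel_measurable N"
    if "g \<in> borel_measurable N" "h \<in> borel_measurable N" for g h and N :: "'c measure"
    using measurable_compose[OF measurable_Pair[OF that] f] by simp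
  have "(\<integral>\<^sup>+y. \<integral>\<^sup>+x. f (a * x + b * y) (a * y - b * x) \<partial>std_normal \<partial>std_normal)
    = (\<integral>\<^sup>+y. \<integral>\<^sup>+x. ?p y * (?p x * f (a * x + b * y) (a * y - b * x)) \<partial>lborel \<partial>lborel)"
    by (simp add: nn_integral_density nn_integral_cmult)
  also have "\<dots> = (\<integral>\<^sup>+y. ennreal \<bar>1 / a\<bar> * (\<integral>\<^sup>+u. ?p y * (?p (- (b * y) / a + 1 / a * u) *
      f (a * (- (b * y) / a + 1 / a * u) + b * y) (a * y - b * (- (b * y) / a + 1 / a * u))) \<partial>lborel) \<partial>lborel)"
    using a by (intro nn_integral_cong nn_integral_real_affine) auto
  also have "\<dots> = (\<integral>\<^sup>+y. \<integral>\<^sup>+u. ennreal \<bar>1 / a\<bar> * (?p y * (?p ((u - b * y) / a) *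
      f u (a * y - b * ((u - b * y) / a)))) \<partial>lborel \<partial>lborel)"
  proof (intro nn_integral_cong)
    fix y
    have 1: "- (b * y) / a + 1 / a * u = (u - b * y) / a" for u by (simp add: diff_divide_distrib)
    have 2: "a * ((u - b * y) / a) + b * y = u" for u using a by simp
    show "ennreal \<bar>1 / a\<bar> * (\<integral>\<^sup>+u. ?p y * (?p (- (b * y) / a + 1 / a * u) *
      f (a * (- (b * y) / a + 1 / a * u) + b * y) (a * y - b * (- (b * y) / a + 1 / a * u))) \<partial>lborel)
      = (\<integral>\<^sup>+u. ennreal \<bar>1 / a\<bar> * (?p y * (?p ((u - b * y) / a) * f u (a * y - b * ((u - b * y) / a)))) \<partial>lborel)"
      unfolding 1 2 by (rule nn_integral_cmult[symmetric]) measurable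
  qed
  also have "\<dots> = (\<integral>\<^sup>+u. \<integral>\<^sup>+y. ennreal \<bar>1 / a\<bar> * (?p y * (?p ((u - b * y) / a) *
      f u (a * y - b * ((u - b * y) / a)))) \<partial>lborel \<partial>lborel)"
    by (rule lborel_pair.Fubini') measurable
  also have "\<dots> = (\<integral>\<^sup>+u. ennreal \<bar>a\<bar> * (\<integral>\<^sup>+v. ennreal \<bar>1 / a\<bar> * (?p (b * u + a * v) * (?p ((u - b * (b * u + a * v)) / a) *
      f u (a * (b * u + a * v) - b * ((u - b * (b * u + a * v)) / a)))) \<partial>lborel) \<partial>lborel)"
    using a by (intro nn_integral_cong nn_integral_real_affine) auto
  also have "\<dots> = (\<integral>\<^sup>+u. \<integral>\<^sup>+v. ?p u * (?p v * f u v) \<partial>lborel \<partial>lborel)"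
  proof (intro nn_integral_cong)
    fix u
    have "u - b * (b * u + a * v) = a * (a * u - b * v)" for v
    proof -
      have "u - b * (b * u + a * v) = (a\<^sup>2 + b\<^sup>2) * u - b * (b * u + a * v)" using ab by simp
      then show ?thesis by (simp add: power2_eq_square algebra_simps)
    qed
    then have 1: "(u - b * (b * u + a * v)) / a = a * u - b * v" for v using a by simp
    have 2: "a * (b * u + a * v) - b * (a * u - b * v) = v" for v
    proof -
      have "a * (b * u + a * v) - b * (a * u - b * v) = (a\<^sup>2 + b\<^sup>2) * v"
        by (simp add: power2_eq_square algebra_simps)
      then show ?thesis using ab by simp
    qed
    have "?p (b * u + a * v) * ?p (a * u - b * v) = ?p u * ?p v" for v
      using std_normal_density_mult_rotate[OF ab, of u v]
      by (simp add: ennreal_mult[symmetric] mult.commute[of "std_normal_density (b * u + a * v)"])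
    then have 3: "?p (b * u + a * v) * (?p (a * u - b * v) * z) = ?p u * (?p v * z)" for v z
      by (simp only: mult.assoc[symmetric])
    have "ennreal \<bar>a\<bar> * (\<integral>\<^sup>+v. ennreal \<bar>1 / a\<bar> * (?p u * (?p v * f u v)) \<partial>lborel)
      = (ennreal \<bar>a\<bar> * ennreal \<bar>1 / a\<bar>) * (\<integral>\<^sup>+v. ?p u * (?p v * f u v) \<partial>lborel)"
      by (subst nn_integral_cmult) (auto simp: mult.assoc)
    also have "ennreal \<bar>a\<bar> * ennreal \<bar>1 / a\<bar> = 1"
      using a by (simp add: ennreal_mult[symmetric])
    finally show "ennreal \<bar>a\<bar> * (\<integral>\<^sup>+v. ennreal \<bar>1 / a\<bar> * (?p (b * u + a * v) * (?p ((u - b * (b * u + a * v)) / a) *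
      f u (a * (b * u + a * v) - b * ((u - b * (b * u + a * v)) / a)))) \<partial>lborel)
      = (\<integral>\<^sup>+v. ?p u * (?p v * f u v) \<partial>lborel)"
      unfolding 1 2 3 by simp
  qed
  also have "\<dots> = (\<integral>\<^sup>+v. \<integral>\<^sup>+u. ?p u * (?p v * f u v) \<partial>lborel \<partial>lborel)"
    by (rule lborel_pair.Fubini') measurable
  also have "\<dots> = (\<integral>\<^sup>+v. \<integral>\<^sup>+u. ?p v * (?p u * f u v) \<partial>lborel \<partial>lborel)"
    by (simp add: ac_simps)
  also have "\<dots> = (\<integral>\<^sup>+y. \<integral>\<^sup>+x. f x y \<partial>std_normal \<partial>std_normal)"
    by (simp add: nn_integral_density nn_integral_cmult)
  finally show ?thesis .
qed

lemma std_normal_rotate: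
  fixes f :: "real \<Rightarrow> real \<Rightarrow> ennreal"
  assumes f: "case_prod f \<in> borel_measurable (borel \<Otimes>\<^sub>M borel)" and ab: "a\<^sup>2 + b\<^sup>2 = 1"
  shows "(\<integral>\<^sup>+y. \<integral>\<^sup>+x. f (a * x + b * y) (a * y - b * x) \<partial>std_normal \<partial>std_normal)
    = (\<integral>\<^sup>+y. \<integral>\<^sup>+x. f x y \<partial>std_normal \<partial>std_normal)"
proof (cases "a = 0")
  case False
  then show ?thesis by (rule std_normal_rotate_nonzero[OF f ab])
next
  \<comment> \<open>A quarter turn is two turns by 45 degrees.\<close>
  case True
  then have b: "b\<^sup>2 = 1" using ab by simp
  define c where "c = 1 / sqrt 2"
  have c: "c \<noteq> 0" "c\<^sup>2 + (c * b)\<^sup>2 = 1" and cc: "c * c = 1 / 2"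
    using b by (auto simp: c_def power_mult_distrib field_simps)
  have "c * (c * x + c * b * y) + c * b * (c * y - c * b * x) = (c * c) * (x + 2 * (b * y) - b\<^sup>2 * x)" for x y
    by (simp add: algebra_simps power2_eq_square)
  moreover have "c * (c * y - c * b * x) - c * b * (c * x + c * b * y) = (c * c) * (y - 2 * (b * x) - b\<^sup>2 * y)" for x y
    by (simp add: algebra_simps power2_eq_square)
  ultimately have 1: "c * (c * x + c * b * y) + c * b * (c * y - c * b * x) = b * y"
    "c * (c * y - c * b * x) - c * b * (c * x + c * b * y) = - (b * x)" for x y
    unfolding cc b by simp_all
  define g where "g x y = f (c * x + c * b * y) (c * y - c * b * x)" for x y
  have g: "case_prod g \<in> borel_measurable (borel \<Otimes>\<^sub>M borel)"
    unfolding g_def split_def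
    using measurable_compose[OF measurable_Pair f, of "\<lambda>z. c * fst z + c * b * snd z" "borel \<Otimes>\<^sub>M borel"
        "\<lambda>z. c * snd z - c * b * fst z"] by simp
  have "(\<integral>\<^sup>+y. \<integral>\<^sup>+x. g (c * x + c * b * y) (c * y - c * b * x) \<partial>std_normal \<partial>std_normal)
    = (\<integral>\<^sup>+y. \<integral>\<^sup>+x. f x y \<partial>std_normal \<partial>std_normal)"
    using std_normal_rotate_nonzero[OF g c(2,1)] std_normal_rotate_nonzero[OF f c(2,1)]
    by (simp add: g_def)
  then show ?thesis unfolding g_def 1 using True by simp
qed

lemma std_normal_reflect:
  assumes [measurable]: "f \<in> borel_measurable borel"
  shows "(\<integral>\<^sup>+x. f (- x) \<partial>std_normal) = (\<integral>\<^sup>+x. f x \<partial>std_normal)"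
proof -
  have "(\<integral>\<^sup>+x. f x \<partial>std_normal) = (\<integral>\<^sup>+x. ennreal (std_normal_density x) * f x \<partial>lborel)"
    by (simp add: nn_integral_density)
  also have "\<dots> = ennreal \<bar>-1\<bar> * (\<integral>\<^sup>+x. ennreal (std_normal_density (0 + (-1) * x)) * f (0 + (-1) * x) \<partial>lborel)"
    by (rule nn_integral_real_affine) auto
  also have "\<dots> = (\<integral>\<^sup>+x. f (- x) \<partial>std_normal)"
    by (simp add: nn_integral_density std_normal_density_def)
  finally show ?thesis by simp
qed

section \<open>Isometries of product Gaussian measures\<close>

abbreviation gauss :: "'a set \<Rightarrow> ('a \<Rightarrow> real) measure" where
  "gauss A \<equiv> \<Pi>\<^sub>M a\<in>A. std_normal"

interpretation gauss: product_prob_space "\<lambda>_. std_normal" I for I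
  by unfold_locales

lemma prob_space_gauss: "prob_space (gauss A)"
  by (intro prob_space_PiM prob_space_std_normal)

lemma sets_gauss [measurable_cong]: "sets (gauss A) = sets (\<Pi>\<^sub>M a\<in>A. borel)"
  by (intro sets_PiM_cong) auto

lemma emeasure_distr_eq_nn_integral:
  assumes f: "f \<in> measurable M N" and X: "X \<in> sets N"
  shows "emeasure (distr M N f) X = (\<integral>\<^sup>+x. indicator X (f x) \<partial>M)"
proof -
  have "emeasure (distr M N f) X = (\<integral>\<^sup>+y. indicator X y \<partial>distr M N f)" using X by simp
  also have "\<dots> = (\<integral>\<^sup>+x. indicator X (f x) \<partial>M)"
    by (rule nn_integral_distr[OF f]) (use X in simp)
  finally show ?thesis .
qed

text \<open>Preservation of the inner product is carried along with invariance of the measure: an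
  orthonormal family stays orthonormal under the maps already composed, as the induction over the
  family requires.\<close>

definition gauss_isometry :: "'a set \<Rightarrow> (('a \<Rightarrow> real) \<Rightarrow> ('a \<Rightarrow> real)) \<Rightarrow> bool" where
  "gauss_isometry A R \<longleftrightarrow> R \<in> measurable (gauss A) (gauss A) \<and> distr (gauss A) (gauss A) R = gauss A \<and>
     (\<forall>u x. (\<Sum>a\<in>A. R u a * R x a) = (\<Sum>a\<in>A. u a * x a))"

lemma gauss_isometry_comp:
  assumes R: "gauss_isometry A R" and R': "gauss_isometry A R'"
  shows "gauss_isometry A (R' \<circ> R)"
proof -
  have m: "R \<in> measurable (gauss A) (gauss A)" "R' \<in> measurable (gauss A) (gauss A)"
    using assms by (auto simp: gauss_isometry_def)
  have "distr (gauss A) (gauss A) (R' \<circ> R) = distr (distr (gauss A) (gauss A) R) (gauss A) R'"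
    by (rule distr_distr[OF m(2,1), symmetric])
  then show ?thesis using assms m by (auto simp: gauss_isometry_def measurable_comp)
qed

lemma gauss_isometry_id: "gauss_isometry A (\<lambda>x. x)"
  by (auto simp: gauss_isometry_def distr_id)

lemma gauss_isometry_reflect:
  assumes A: "finite A" and a: "a \<in> A"
  shows "gauss_isometry A (\<lambda>x. x(a := - x a))"
proof -
  define B where "B = A - {a}"
  have B: "A = insert a B" "a \<notin> B" "finite B" using assms by (auto simp: B_def)
  have refl_meas: "(\<lambda>x. x(a := - x a)) \<in> measurable (gauss A) (gauss A)"
    unfolding B(1) by (rule measurable_PiM_single') (auto simp: space_PiM PiE_iff extensional_def)
  have "gauss A = distr (gauss A) (gauss A) (\<lambda>x. x(a := - x a))"
  proof (rule measure_eqI)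
    fix X assume XA: "X \<in> sets (gauss A)"
    then have X [measurable]: "X \<in> sets (gauss (insert a B))" using B(1) by simp
    have "emeasure (distr (gauss A) (gauss A) (\<lambda>x. x(a := - x a))) X
      = (\<integral>\<^sup>+x. indicator X (x(a := - x a)) \<partial>gauss (insert a B))"
      unfolding B(1)[symmetric] by (rule emeasure_distr_eq_nn_integral[OF refl_meas XA])
    also have "\<dots> = (\<integral>\<^sup>+x. \<integral>\<^sup>+y. indicator X ((x(a := y))(a := - (x(a := y)) a)) \<partial>std_normal \<partial>gauss B)"
    proof (rule gauss.product_nn_integral_insert[OF B(3,2)])
      show "(\<lambda>x. indicator X (x(a := - x a)) :: ennreal) \<in> borel_measurable (gauss (insert a B))"
        using measurable_compose[OF refl_meas, of "indicator X :: _ \<Rightarrow> ennreal" borel] XA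
        unfolding B(1)[symmetric] by simp
    qed
    also have "\<dots> = (\<integral>\<^sup>+x. \<integral>\<^sup>+y. indicator X (x(a := - y)) \<partial>std_normal \<partial>gauss B)" by simp
    also have "\<dots> = (\<integral>\<^sup>+x. \<integral>\<^sup>+y. indicator X (x(a := y)) \<partial>std_normal \<partial>gauss B)"
    proof (rule nn_integral_cong)
      fix x assume x: "x \<in> space (gauss B)"
      have "(\<lambda>y. x(a := y)) \<in> measurable borel (gauss (insert a B))"
        using x B by (intro measurable_PiM_single') (auto simp: space_PiM PiE_iff extensional_def)
      then have "(\<lambda>y. indicator X (x(a := y)) :: ennreal) \<in> borel_measurable borel" by measurable
      from std_normal_reflect[OF this]
      show "(\<integral>\<^sup>+y. indicator X (x(a := - y)) \<partial>std_normal) = (\<integral>\<^sup>+y. indicator X (x(a := y)) \<partial>std_normal)" .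
    qed
    also have "\<dots> = (\<integral>\<^sup>+x. indicator X x \<partial>gauss (insert a B))"
      using B by (subst gauss.product_nn_integral_insert) auto
    also have "\<dots> = emeasure (gauss A) X" using X B(1) by simp
    finally show "emeasure (gauss A) X = emeasure (distr (gauss A) (gauss A) (\<lambda>x. x(a := - x a))) X" ..
  qed simp
  moreover have "(\<Sum>k\<in>A. (u(a := - u a)) k * (x(a := - x a)) k) = (\<Sum>k\<in>A. u k * x k)" for u x :: "'a \<Rightarrow> real"
    by (intro sum.cong) auto
  ultimately show ?thesis using refl_meas unfolding gauss_isometry_def by simp
qed

text \<open>A Givens rotation in the coordinates \<open>i\<close> and \<open>j\<close>; both new
  entries are computed from the old \<open>x\<close>.\<close>

definition plane_rot :: "'a \<Rightarrow> 'a \<Rightarrow> real \<Rightarrow> real \<Rightarrow> ('a \<Rightarrow> real) \<Rightarrow> ('a \<Rightarrow> real)" where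
  "plane_rot i j a b x = x(i := a * x i + b * x j, j := a * x j - b * x i)"

lemma gauss_isometry_plane_rot:
  assumes A: "finite A" and ij: "i \<in> A" "j \<in> A" "i \<noteq> j" and ab: "a\<^sup>2 + b\<^sup>2 = 1"
  shows "gauss_isometry A (plane_rot i j a b)"
proof -
  define B where "B = A - {i, j}"
  have B: "A = insert i (insert j B)" "j \<notin> B" "i \<notin> insert j B" "finite B" "finite (insert j B)"
    using assms by (auto simp: B_def)
  have m [measurable]: "plane_rot i j a b \<in> measurable (gauss A) (gauss A)"
  proof (rule measurable_PiM_single')
    fix k assume k: "k \<in> A"
    have [measurable]: "(\<lambda>x. x l) \<in> borel_measurable (gauss A)" if "l \<in> A" for l
      using measurable_component_singleton[OF that, of "\<lambda>_. std_normal"] by simp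
    show "(\<lambda>x. plane_rot i j a b x k) \<in> measurable (gauss A) std_normal"
      using k ij by (cases "k = j"; cases "k = i") (auto simp: plane_rot_def)
  qed (use B in \<open>auto simp: space_PiM PiE_iff extensional_def plane_rot_def\<close>)
  have "gauss A = distr (gauss A) (gauss A) (plane_rot i j a b)"
  proof (rule measure_eqI)
    fix X assume X [measurable]: "X \<in> sets (gauss A)"
    have ind: "(\<lambda>x. indicator X (plane_rot i j a b x) :: ennreal) \<in> borel_measurable (gauss A)" by measurable
    let ?m = "\<lambda>z x y. z(j := y, i := x)"
    \<comment> \<open>The two rotated coordinates become the innermost integrals, so that the planar
      statement applies for each fixed value \<open>z\<close> of the others.\<close>
    have expand: "(\<integral>\<^sup>+x. g x \<partial>gauss A) = (\<integral>\<^sup>+z. \<integral>\<^sup>+y. \<integral>\<^sup>+x. g (?m z x y) \<partial>std_normal \<partial>std_normal \<partial>gauss B)"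
      if g: "g \<in> borel_measurable (gauss A)" for g :: "('a \<Rightarrow> real) \<Rightarrow> ennreal"
    proof -
      have g': "g \<in> borel_measurable (gauss (insert i (insert j B)))" using g B(1) by simp
      have "(\<integral>\<^sup>+x. g x \<partial>gauss A) = (\<integral>\<^sup>+z. \<integral>\<^sup>+x. g (z(i := x)) \<partial>std_normal \<partial>gauss (insert j B))"
        unfolding B(1) by (rule gauss.product_nn_integral_insert[OF B(5,3) g'])
      also have "\<dots> = (\<integral>\<^sup>+z. \<integral>\<^sup>+y. \<integral>\<^sup>+x. g (z(j := y, i := x)) \<partial>std_normal \<partial>std_normal \<partial>gauss B)"
      proof (rule gauss.product_nn_integral_insert[OF B(4,2)])
        have "(\<lambda>zx. g ((fst zx)(i := snd zx))) \<in> borel_measurable (gauss (insert j B) \<Otimes>\<^sub>M std_normal)"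
          using g' by measurable
        then show "(\<lambda>z. \<integral>\<^sup>+x. g (z(i := x)) \<partial>std_normal) \<in> borel_measurable (gauss (insert j B))"
          by (intro std_normal.borel_measurable_nn_integral) (simp add: split_def)
      qed
      finally show ?thesis .
    qed
    have "emeasure (distr (gauss A) (gauss A) (plane_rot i j a b)) X
      = (\<integral>\<^sup>+x. indicator X (plane_rot i j a b x) \<partial>gauss A)"
      by (rule emeasure_distr_eq_nn_integral[OF m X])
    also have "\<dots> = (\<integral>\<^sup>+z. \<integral>\<^sup>+y. \<integral>\<^sup>+x. indicator X (plane_rot i j a b (?m z x y)) \<partial>std_normal \<partial>std_normal \<partial>gauss B)"
      by (rule expand[OF ind])
    also have "\<dots> = (\<integral>\<^sup>+z. \<integral>\<^sup>+y. \<integral>\<^sup>+x. indicator X (?m z (a * x + b * y) (a * y - b * x)) \<partial>std_normal \<partial>std_normal \<partial>gauss B)"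
    proof -
      have "plane_rot i j a b (?m z x y) = ?m z (a * x + b * y) (a * y - b * x)" for z x y
        using ij by (auto simp: plane_rot_def)
      then show ?thesis by simp
    qed
    also have "\<dots> = (\<integral>\<^sup>+z. \<integral>\<^sup>+y. \<integral>\<^sup>+x. indicator X (?m z x y) \<partial>std_normal \<partial>std_normal \<partial>gauss B)"
    proof (rule nn_integral_cong)
      fix z assume z: "z \<in> space (gauss B)"
      have "(\<lambda>w. ?m z (fst w) (snd w)) \<in> measurable (borel \<Otimes>\<^sub>M borel) (gauss A)"
      proof (rule measurable_PiM_single')
        show "(\<lambda>w. ?m z (fst w) (snd w) k) \<in> measurable (borel \<Otimes>\<^sub>M borel) std_normal" if "k \<in> A" for k
          by (cases "k = i"; cases "k = j") auto
      qed (use z B in \<open>auto simp: space_PiM PiE_iff extensional_def\<close>)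
      then have "(\<lambda>w. indicator X (?m z (fst w) (snd w)) :: ennreal) \<in> borel_measurable (borel \<Otimes>\<^sub>M borel)"
        by measurable
      then have "case_prod (\<lambda>x y. indicator X (?m z x y) :: ennreal) \<in> borel_measurable (borel \<Otimes>\<^sub>M borel)"
        by (simp add: split_def)
      from std_normal_rotate[OF this ab]
      show "(\<integral>\<^sup>+y. \<integral>\<^sup>+x. indicator X (?m z (a * x + b * y) (a * y - b * x)) \<partial>std_normal \<partial>std_normal)
        = (\<integral>\<^sup>+y. \<integral>\<^sup>+x. indicator X (?m z x y) \<partial>std_normal \<partial>std_normal)" .
    qed
    also have "\<dots> = (\<integral>\<^sup>+x. indicator X x \<partial>gauss A)" by (rule expand[symmetric]) measurable
    also have "\<dots> = emeasure (gauss A) X" by simp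
    finally show "emeasure (gauss A) X = emeasure (distr (gauss A) (gauss A) (plane_rot i j a b)) X" ..
  qed simp
  moreover have "(\<Sum>k\<in>A. plane_rot i j a b u k * plane_rot i j a b x k) = (\<Sum>k\<in>A. u k * x k)" for u x
  proof -
    have "(\<Sum>k\<in>A. plane_rot i j a b u k * plane_rot i j a b x k)
      = (a * u i + b * u j) * (a * x i + b * x j) + ((a * u j - b * u i) * (a * x j - b * x i) + (\<Sum>k\<in>B. u k * x k))"
    proof -
      have "(\<Sum>k\<in>B. plane_rot i j a b u k * plane_rot i j a b x k) = (\<Sum>k\<in>B. u k * x k)"
        using B by (intro sum.cong) (auto simp: plane_rot_def)
      then show ?thesis using B ij(3) unfolding B(1) by (simp add: plane_rot_def)
    qed
    also have "\<dots> = (a\<^sup>2 + b\<^sup>2) * (u i * x i + u j * x j) + (\<Sum>k\<in>B. u k * x k)"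
      by (simp add: algebra_simps power2_eq_square)
    also have "\<dots> = (\<Sum>k\<in>A. u k * x k)" using B unfolding ab by simp
    finally show ?thesis .
  qed
  ultimately show ?thesis using m unfolding gauss_isometry_def by simp
qed

text \<open>Givens rotations clear the nonzero coordinates of \<open>u\<close> other than
  \<open>a\<close> one by one; what is left is 1 or -1 at \<open>a\<close>, and a reflection mends
  the sign. The rotations involve \<open>a\<close> and coordinates where \<open>u\<close> is
  nonzero, all of them in \<open>A'\<close>, so the coordinates outside \<open>A'\<close> stay
  fixed.\<close>

lemma exists_gauss_isometry_unit:
  assumes A: "finite A" and A': "A' \<subseteq> A" "a \<in> A'"
    and u: "(\<Sum>k\<in>A. (u k)\<^sup>2) = 1" "\<And>k. k \<in> A - A' \<Longrightarrow> u k = 0"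
  shows "\<exists>R. gauss_isometry A R \<and> (\<forall>k\<in>A - A'. \<forall>x. R x k = x k) \<and> (\<forall>x. R x a = (\<Sum>k\<in>A. u k * x k))"
  using u
proof (induction "card {k \<in> A - {a}. u k \<noteq> 0}" arbitrary: u)
  case 0
  have aA: "a \<in> A" using A' by auto
  have z: "u k = 0" if "k \<in> A - {a}" for k using 0(1) A that by auto
  have "(\<Sum>k\<in>A. (u k)\<^sup>2) = (u a)\<^sup>2"
    using A aA z by (subst sum.remove[of _ a]) auto
  then have ua: "u a = 1 \<or> u a = - 1" using 0(2) by (simp add: power2_eq_1_iff)
  have s: "(\<Sum>k\<in>A. u k * x k) = u a * x a" for x
    using A aA z by (subst sum.remove[of _ a]) auto
  from ua show ?case
  proof
    assume "u a = 1"
    then show ?thesis using gauss_isometry_id s by (intro exI[of _ "\<lambda>x. x"]) auto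
  next
    assume "u a = - 1"
    then show ?thesis using gauss_isometry_reflect[OF A aA] s A' 
      by (intro exI[of _ "\<lambda>x. x(a := - x a)"] conjI) (auto simp del: fun_upd_apply simp: fun_upd_def)
  qed
next
  case (Suc n)
  have aA: "a \<in> A" using A' by auto
  have "{k \<in> A - {a}. u k \<noteq> 0} \<noteq> {}" using Suc(2) by (metis card.empty nat.distinct(1))
  then obtain b where b: "b \<in> A" "b \<noteq> a" "u b \<noteq> 0" by auto
  then have bA': "b \<in> A'" using Suc(4) by auto
  define c where "c = sqrt ((u a)\<^sup>2 + (u b)\<^sup>2)"
  have c2: "c\<^sup>2 = (u a)\<^sup>2 + (u b)\<^sup>2" by (simp add: c_def)
  have c: "c \<noteq> 0" using b c2 by (metis add_nonneg_eq_0_iff power2_eq_iff_nonneg zero_le_power2 zero_power2 power_eq_0_iff zero_neq_numeral)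
  have "(u a / c)\<^sup>2 + (u b / c)\<^sup>2 = c\<^sup>2 / c\<^sup>2"
    unfolding c2 by (simp only: power_divide add_divide_distrib c2)
  then have "(u a / c)\<^sup>2 + (u b / c)\<^sup>2 = 1" using c by simp
  then have rot: "gauss_isometry A (plane_rot a b (u a / c) (u b / c))"
    using b aA by (intro gauss_isometry_plane_rot[OF A]) auto
  \<comment> \<open>The image of \<open>u\<close> under the rotation: the pair
    \<open>(u a, u b)\<close> becomes \<open>(c, 0)\<close>.\<close>
  define v where "v = u(a := c, b := 0)"
  have "{k \<in> A - {a}. v k \<noteq> 0} = {k \<in> A - {a}. u k \<noteq> 0} - {b}" using b by (auto simp: v_def)
  then have card: "n = card {k \<in> A - {a}. v k \<noteq> 0}" using Suc(2) b A by simp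
  define B where "B = A - {a, b}"
  have B: "A = insert a (insert b B)" "a \<notin> insert b B" "b \<notin> B" "finite B" using A aA b by (auto simp: B_def)
  have "(\<Sum>k\<in>A. (v k)\<^sup>2) = c\<^sup>2 + (\<Sum>k\<in>B. (u k)\<^sup>2)"
  proof -
    have "(\<Sum>k\<in>B. (v k)\<^sup>2) = (\<Sum>k\<in>B. (u k)\<^sup>2)" using B by (intro sum.cong) (auto simp: v_def)
    then show ?thesis using B b unfolding B(1) by (simp add: v_def)
  qed
  also have "\<dots> = 1" using Suc(3) B unfolding B(1) by (simp add: c2)
  finally have v1: "(\<Sum>k\<in>A. (v k)\<^sup>2) = 1" .
  have "v k = 0" if "k \<in> A - A'" for k using that Suc(4)[OF that] A' bA' by (auto simp: v_def)
  then obtain R where R: "gauss_isometry A R" "\<And>k x. k \<in> A - A' \<Longrightarrow> R x k = x k"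
    "\<And>x. R x a = (\<Sum>k\<in>A. v k * x k)"
    using Suc(1)[OF card v1] by auto
  let ?R = "R \<circ> plane_rot a b (u a / c) (u b / c)"
  have "?R x a = (\<Sum>k\<in>A. u k * x k)" for x
  proof -
    have "(\<Sum>k\<in>B. v k * plane_rot a b (u a / c) (u b / c) x k) = (\<Sum>k\<in>B. u k * x k)"
      using B by (intro sum.cong) (auto simp: v_def plane_rot_def)
    then have "?R x a = c * (u a / c * x a + u b / c * x b) + (\<Sum>k\<in>B. u k * x k)"
      using B b by (simp add: R(3)) (simp add: B(1) v_def plane_rot_def)
    also have "\<dots> = (\<Sum>k\<in>A. u k * x k)" using B c unfolding B(1) by (simp add: field_simps)
    finally show ?thesis .
  qed
  moreover have "?R x k = x k" if "k \<in> A - A'" for k x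
    using that R(2)[OF that] A' bA' by (auto simp: plane_rot_def)
  ultimately show ?case using gauss_isometry_comp[OF rot R(1)] by blast
qed

text \<open>Suppose that \<open>R\<close> already reads off the earlier \<open>w j\<close> at the
  coordinates \<open>e j\<close>. Then the entry of \<open>R (w i)\<close> at \<open>e j\<close> is
  the inner product of \<open>w j\<close> and \<open>w i\<close>, which is 0. So
  \<open>R (w i)\<close> is supported on the remaining coordinates, and the next isometry can leave
  the earlier ones alone.\<close>

lemma exists_gauss_isometry_orthonormal:
  fixes e :: "'b \<Rightarrow> 'a" and w :: "'b \<Rightarrow> 'a \<Rightarrow> real"
  assumes A: "finite A" and J: "finite J" and e: "inj_on e J" "e ` J \<subseteq> A"
    and w: "\<And>i j. i \<in> J \<Longrightarrow> j \<in> J \<Longrightarrow> (\<Sum>k\<in>A. w i k * w j k) = (if i = j then 1 else 0)"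
  shows "\<exists>R. gauss_isometry A R \<and> (\<forall>j\<in>J. \<forall>x. R x (e j) = (\<Sum>k\<in>A. w j k * x k))"
  using J e w
proof (induction J rule: finite_induct)
  case empty
  then show ?case using gauss_isometry_id by auto
next
  case (insert i J)
  obtain R where R: "gauss_isometry A R" "\<And>j x. j \<in> J \<Longrightarrow> R x (e j) = (\<Sum>k\<in>A. w j k * x k)"
    using insert.IH insert.prems by auto
  have dot: "(\<Sum>k\<in>A. R u k * R x k) = (\<Sum>k\<in>A. u k * x k)" for u x
    using R(1) by (auto simp: gauss_isometry_def)
  define u where "u = R (w i)"
  have "(\<Sum>k\<in>A. (u k)\<^sup>2) = 1"
    using dot[of "w i" "w i"] insert.prems(3)[of i i] by (simp add: u_def power2_eq_square)
  moreover have "u k = 0" if "k \<in> A - (A - e ` J)" for k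
  proof -
    have "k \<in> e ` J" using that by blast
    then obtain j where j: "j \<in> J" "k = e j" by blast
    then have "u k = (\<Sum>k\<in>A. w j k * w i k)" by (simp add: u_def R(2))
    then show ?thesis using insert.prems(3)[of j i] j insert.hyps by auto
  qed
  moreover have "e i \<in> A - e ` J" using insert by auto
  ultimately obtain R' where R': "gauss_isometry A R'" "\<And>k x. k \<in> A - (A - e ` J) \<Longrightarrow> R' x k = x k"
    "\<And>x. R' x (e i) = (\<Sum>k\<in>A. u k * x k)"
    using exists_gauss_isometry_unit[OF A, of "A - e ` J" "e i" u] by auto
  have "R' (R x) (e j) = (\<Sum>k\<in>A. w j k * x k)" if "j \<in> insert i J" for j x
  proof (cases "j = i")
    case True
    then show ?thesis using dot[of "w i" x] by (simp add: R'(3) u_def)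
  next
    case False
    then have "j \<in> J" using that by simp
    then show ?thesis using R'(2)[of "e j" "R x"] R(2)[of j x] insert.prems(2) by auto
  qed
  then show ?case using gauss_isometry_comp[OF R(1) R'(1)] by (intro exI[of _ "R' \<circ> R"]) (simp add: comp_def)
qed

text \<open>After the isometry the functionals are coordinate projections, and a marginal of a
  product measure is the product of the factors. The injection \<open>e\<close> reserves one
  coordinate for each functional.\<close>

theorem distr_gauss_orthonormal:
  fixes e :: "'b \<Rightarrow> 'a" and w :: "'b \<Rightarrow> 'a \<Rightarrow> real"
  assumes A: "finite A" and J: "finite J" and e: "inj_on e J" "e ` J \<subseteq> A"
    and w: "\<And>i j. i \<in> J \<Longrightarrow> j \<in> J \<Longrightarrow> (\<Sum>k\<in>A. w i k * w j k) = (if i = j then 1 else 0)"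
  shows "distr (gauss A) (\<Pi>\<^sub>M j\<in>J. borel) (\<lambda>x. \<lambda>j\<in>J. \<Sum>k\<in>A. w j k * x k) = gauss J"
proof -
  obtain R where R: "gauss_isometry A R" "\<And>j x. j \<in> J \<Longrightarrow> R x (e j) = (\<Sum>k\<in>A. w j k * x k)"
    using exists_gauss_isometry_orthonormal[OF assms] by auto
  have Rm: "R \<in> measurable (gauss A) (gauss A)" and Rd: "distr (gauss A) (gauss A) R = gauss A"
    using R(1) by (auto simp: gauss_isometry_def)
  have re: "(\<lambda>x. \<lambda>j\<in>J. x (e j)) \<in> measurable (gauss A) (gauss J)"
    using e(2) by (intro measurable_restrict measurable_component_singleton) auto
  have "distr (gauss A) (\<Pi>\<^sub>M j\<in>J. borel) (\<lambda>x. \<lambda>j\<in>J. \<Sum>k\<in>A. w j k * x k)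
    = distr (gauss A) (gauss J) ((\<lambda>x. \<lambda>j\<in>J. x (e j)) \<circ> R)"
    by (rule distr_cong) (auto simp: R(2) sets_gauss restrict_def)
  also have "\<dots> = distr (distr (gauss A) (gauss A) R) (gauss J) (\<lambda>x. \<lambda>j\<in>J. x (e j))"
    by (rule distr_distr[OF re Rm, symmetric])
  also have "\<dots> = gauss J" unfolding Rd
    using distr_PiM_reindex[of A "\<lambda>_. std_normal" e J] e prob_space_std_normal by auto
  finally show ?thesis .
qed

section \<open>Row distances of Gaussian matrices\<close>

lemma nn_integral_exp_square_std_normal:
  assumes s: "s < 1 / 2"
  shows "(\<integral>\<^sup>+z. ennreal (exp (s * z\<^sup>2)) \<partial>std_normal) = ennreal ((1 - 2 * s) powr (- 1 / 2))"
proof -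
  \<comment> \<open>The factor \<open>exp (s * z\<^sup>2)\<close> turns the standard normal density
    into \<open>\<sigma>\<close> times a normal density of variance
    \<open>1 / (1 - 2 * s)\<close>.\<close>
  define \<sigma> where "\<sigma> = 1 / sqrt (1 - 2 * s)"
  have \<sigma>: "\<sigma> > 0" "\<sigma>\<^sup>2 = 1 / (1 - 2 * s)" using s by (simp_all add: \<sigma>_def power_divide)
  have "std_normal_density z * exp (s * z\<^sup>2) = \<sigma> * normal_density 0 \<sigma> z" for z
  proof -
    have "exp (- z\<^sup>2 / 2) * exp (s * z\<^sup>2) = exp (- (z - 0)\<^sup>2 / (2 * \<sigma>\<^sup>2))"
      using s by (simp add: exp_add[symmetric] \<sigma>(2) field_simps)
    moreover have "sqrt (2 * pi * \<sigma>\<^sup>2) = sqrt (2 * pi) * \<sigma>"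
      using \<sigma>(1) by (simp only: real_sqrt_mult[of _ "\<sigma>\<^sup>2"] real_sqrt_abs abs_of_pos)
    ultimately show ?thesis using \<sigma> by (simp add: normal_density_def)
  qed
  then have "(\<integral>\<^sup>+z. ennreal (exp (s * z\<^sup>2)) \<partial>std_normal) = (\<integral>\<^sup>+z. ennreal \<sigma> * ennreal (normal_density 0 \<sigma> z) \<partial>lborel)"
    using \<sigma> by (simp add: nn_integral_density flip: ennreal_mult)
  also have "\<dots> = ennreal \<sigma> * (\<integral>\<^sup>+z. ennreal (normal_density 0 \<sigma> z) \<partial>lborel)"
    by (rule nn_integral_cmult) simp
  also have "(\<integral>\<^sup>+z. ennreal (normal_density 0 \<sigma> z) \<partial>lborel) = 1"
    using prob_space.emeasure_space_1[OF prob_space_normal_density[OF \<sigma>(1), of 0]]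
    by (simp add: emeasure_density)
  finally show ?thesis using s by (simp add: \<sigma>_def powr_minus powr_half_sqrt inverse_eq_divide)
qed

lemma nn_integral_exp_sum_squares_gauss:
  assumes s: "s < 1 / 2" and J: "finite J"
  shows "(\<integral>\<^sup>+z. ennreal (exp (s * (\<Sum>j\<in>J. (z j)\<^sup>2))) \<partial>gauss J)
    = ennreal ((1 - 2 * s) powr (- real (card J) / 2))"
proof -
  have "(\<integral>\<^sup>+z. ennreal (exp (s * (\<Sum>j\<in>J. (z j)\<^sup>2))) \<partial>gauss J)
    = (\<integral>\<^sup>+z. (\<Prod>j\<in>J. ennreal (exp (s * (z j)\<^sup>2))) \<partial>gauss J)"
    using J by (simp add: sum_distrib_left exp_sum prod_ennreal)
  also have "\<dots> = (\<Prod>j\<in>J. \<integral>\<^sup>+z. ennreal (exp (s * z\<^sup>2)) \<partial>std_normal)"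
    using J by (intro gauss.product_nn_integral_prod) auto
  also have "\<dots> = ennreal (((1 - 2 * s) powr (- 1 / 2)) ^ card J)"
    using s by (simp add: nn_integral_exp_square_std_normal ennreal_power)
  also have "((1 - 2 * s) powr (- 1 / 2)) ^ card J = (1 - 2 * s) powr (- real (card J) / 2)"
    using s by (simp add: powr_realpow[symmetric] powr_powr)
  finally show ?thesis .
qed

lemma nn_integral_exp_orthonormal_gauss:
  fixes e :: "'b \<Rightarrow> 'a" and w :: "'b \<Rightarrow> 'a \<Rightarrow> real"
  assumes A: "finite A" and J: "finite J" and e: "inj_on e J" "e ` J \<subseteq> A" and s: "s < 1 / 2"
    and w: "\<And>i j. i \<in> J \<Longrightarrow> j \<in> J \<Longrightarrow> (\<Sum>k\<in>A. w i k * w j k) = (if i = j then 1 else 0)"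
  shows "(\<integral>\<^sup>+x. ennreal (exp (s * (\<Sum>j\<in>J. (\<Sum>k\<in>A. w j k * x k)\<^sup>2))) \<partial>gauss A)
    = ennreal ((1 - 2 * s) powr (- real (card J) / 2))"
proof -
  have m: "(\<lambda>x. \<lambda>j\<in>J. \<Sum>k\<in>A. w j k * x k) \<in> measurable (gauss A) (\<Pi>\<^sub>M j\<in>J. borel)"
    by (intro measurable_restrict borel_measurable_sum borel_measurable_times borel_measurable_const)
      (auto intro: measurable_component_singleton[of _ A "\<lambda>_. std_normal", simplified])
  have "(\<integral>\<^sup>+x. ennreal (exp (s * (\<Sum>j\<in>J. (\<Sum>k\<in>A. w j k * x k)\<^sup>2))) \<partial>gauss A)
    = (\<integral>\<^sup>+x. ennreal (exp (s * (\<Sum>j\<in>J. ((\<lambda>j\<in>J. \<Sum>k\<in>A. w j k * x k) j)\<^sup>2))) \<partial>gauss A)"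
    by simp
  also have "\<dots> = (\<integral>\<^sup>+z. ennreal (exp (s * (\<Sum>j\<in>J. (z j)\<^sup>2)))
      \<partial>distr (gauss A) (\<Pi>\<^sub>M j\<in>J. borel) (\<lambda>x. \<lambda>j\<in>J. \<Sum>k\<in>A. w j k * x k))"
    by (rule nn_integral_distr[OF m, symmetric]) measurable
  also have "\<dots> = (\<integral>\<^sup>+z. ennreal (exp (s * (\<Sum>j\<in>J. (z j)\<^sup>2))) \<partial>gauss J)"
    by (simp only: distr_gauss_orthonormal[OF A J e w])
  also have "\<dots> = ennreal ((1 - 2 * s) powr (- real (card J) / 2))"
    by (rule nn_integral_exp_sum_squares_gauss[OF s J])
  finally show ?thesis .
qed

text \<open>The squared distance of row \<open>k\<close> from the span of the other rows; rational coefficients make its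
  measurability evident.\<close>

definition row_dist2 :: "nat \<Rightarrow> nat \<Rightarrow> nat \<Rightarrow> (nat \<times> nat \<Rightarrow> real) \<Rightarrow> real" where
  "row_dist2 \<mu> m k x = (INF q\<in>Pi\<^sub>E ({..<\<mu>} - {k}) (\<lambda>_. \<rat>).
     \<Sum>c<m. (x (k, c) - (\<Sum>j\<in>{..<\<mu>} - {k}. q j * x (j, c)))\<^sup>2)"

lemma row_dist2_bdd:
  fixes x :: "nat \<times> nat \<Rightarrow> real"
  shows "bdd_below ((\<lambda>q. \<Sum>c<m. (x (k, c) - (\<Sum>j\<in>{..<\<mu>} - {k}. q j * x (j, c)))\<^sup>2) ` Q)"
  by (rule bdd_belowI2[of _ 0]) (intro sum_nonneg zero_le_power2)

lemma measurable_row_dist2 [measurable]: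
  assumes "k < \<mu>"
  shows "row_dist2 \<mu> m k \<in> borel_measurable (\<Pi>\<^sub>M ij\<in>{..<\<mu>} \<times> {..<m}. borel)"
proof -
  have c: "countable (Pi\<^sub>E ({..<\<mu>} - {k}) (\<lambda>_. \<rat> :: real set))"
    by (intro countable_PiE) (auto intro: countable_rat)
  have [measurable]: "(\<lambda>x. x (j, c)) \<in> borel_measurable (\<Pi>\<^sub>M ij\<in>{..<\<mu>} \<times> {..<m}. borel :: real measure)"
    if "j < \<mu>" "c < m" for j c using that by (intro measurable_component_singleton) auto
  show ?thesis unfolding row_dist2_def
    by (rule borel_measurable_cINF_real[OF c])
      (intro borel_measurable_sum borel_measurable_power borel_measurable_diff borel_measurable_times
        borel_measurable_const, use assms in auto)
qed

text \<open>Every real coefficient is a limit of rational ones, and the sum of squares is continuous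
  in the coefficients.\<close>

lemma row_dist2_le:
  "row_dist2 \<mu> m k x \<le> (\<Sum>c<m. (x (k, c) - (\<Sum>j\<in>{..<\<mu>} - {k}. a j * x (j, c)))\<^sup>2)"
proof -
  have "\<exists>q. (\<forall>n. q n \<in> \<rat>) \<and> q \<longlonglongrightarrow> a j" for j
    using closure_sequential[of "a j" "\<rat> :: real set"] by (simp add: Rats_closure_real)
  then have "\<forall>j. \<exists>q. (\<forall>n. q n \<in> \<rat>) \<and> q \<longlonglongrightarrow> a j" by blast
  then obtain q where "\<forall>j. (\<forall>n. q j n \<in> \<rat>) \<and> q j \<longlonglongrightarrow> a j"
    by (rule choice[THEN exE])
  then have q: "\<And>j n. q j n \<in> \<rat>" "\<And>j. q j \<longlonglongrightarrow> a j" by blast+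
  let ?f = "\<lambda>q. \<Sum>c<m. (x (k, c) - (\<Sum>j\<in>{..<\<mu>} - {k}. q j * x (j, c)))\<^sup>2"
  have "(\<lambda>n. ?f (\<lambda>j. q j n)) \<longlonglongrightarrow> ?f a"
    by (intro tendsto_sum tendsto_power tendsto_diff tendsto_mult tendsto_const q(2))
  moreover have "row_dist2 \<mu> m k x \<le> ?f (\<lambda>j. q j n)" for n
  proof -
    have "row_dist2 \<mu> m k x \<le> ?f (\<lambda>j\<in>{..<\<mu>} - {k}. q j n)"
      unfolding row_dist2_def
      by (rule cINF_lower[OF row_dist2_bdd, of "\<lambda>j\<in>{..<\<mu>} - {k}. q j n"]) (use q in auto)
    then show ?thesis by simp
  qed
  ultimately show ?thesis using LIMSEQ_le_const by blast
qed

lemma rat_coefficients_nonempty: "Pi\<^sub>E A (\<lambda>_. \<rat> :: real set) \<noteq> {}"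
  using Rats_0 by (auto simp only: PiE_eq_empty_iff)

text \<open>If entry \<open>(i, k)\<close> of \<open>R\<close> is nonzero, dividing row
  \<open>i\<close> of \<open>R M\<close> by it leaves row \<open>k\<close> of \<open>M\<close> plus
  a combination of the other rows; so the squared entry times \<open>D\<^sub>k\<close> is at most
  the squared length of row \<open>i\<close> of \<open>R M\<close>. For independent rows,
  \<open>1 / D\<^sub>k\<close> is the diagonal entry \<open>k\<close> of the inverse of
  \<open>M M\<^sup>T\<close>, and the sum is the squared Frobenius norm of the
  pseudoinverse.\<close>

lemma finner_le_sum_inverse_row_dist2:
  fixes R M :: "real mat"
  assumes R: "R \<in> carrier_mat n \<mu>" and M: "M \<in> carrier_mat \<mu> m"
    and pos: "\<And>k. k < \<mu> \<Longrightarrow> 0 < row_dist2 \<mu> m k (\<lambda>ij. M $$ ij)"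
  shows "finner R R \<le> finner (R * M) (R * M) * (\<Sum>k<\<mu>. 1 / row_dist2 \<mu> m k (\<lambda>ij. M $$ ij))"
proof -
  let ?D = "\<lambda>k. row_dist2 \<mu> m k (\<lambda>ij. M $$ ij)"
  let ?s = "\<lambda>i. \<Sum>c<m. (\<Sum>j<\<mu>. R $$ (i, j) * M $$ (j, c))\<^sup>2"
  have row: "(R $$ (i, k))\<^sup>2 * ?D k \<le> ?s i" if k: "k < \<mu>" for i k
  proof (cases "R $$ (i, k) = 0")
    case True
    then show ?thesis by (simp add: sum_nonneg)
  next
    case False
    let ?r = "R $$ (i, k)"
    have "?r\<^sup>2 * ?D k \<le> ?r\<^sup>2 * (\<Sum>c<m. (M $$ (k, c) - (\<Sum>j\<in>{..<\<mu>} - {k}. (- (R $$ (i, j) / ?r)) * M $$ (j, c)))\<^sup>2)"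
      by (intro mult_left_mono row_dist2_le) auto
    also have "\<dots> = (\<Sum>c<m. (?r * (M $$ (k, c) - (\<Sum>j\<in>{..<\<mu>} - {k}. (- (R $$ (i, j) / ?r)) * M $$ (j, c))))\<^sup>2)"
      by (simp only: sum_distrib_left power_mult_distrib)
    also have "\<dots> = ?s i"
    proof (intro sum.cong refl arg_cong[where f = "\<lambda>x. x\<^sup>2"])
      fix c
      have "?r * (M $$ (k, c) - (\<Sum>j\<in>{..<\<mu>} - {k}. (- (R $$ (i, j) / ?r)) * M $$ (j, c)))
        = ?r * M $$ (k, c) + (\<Sum>j\<in>{..<\<mu>} - {k}. R $$ (i, j) * M $$ (j, c))"
        using False by (simp add: right_diff_distrib distrib_left sum_negf sum_distrib_left)
      also have "\<dots> = (\<Sum>j<\<mu>. R $$ (i, j) * M $$ (j, c))"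
        using k by (subst sum.remove[of _ k]) auto
      finally show "?r * (M $$ (k, c) - (\<Sum>j\<in>{..<\<mu>} - {k}. (- (R $$ (i, j) / ?r)) * M $$ (j, c)))
        = (\<Sum>j<\<mu>. R $$ (i, j) * M $$ (j, c))" .
    qed
    finally show ?thesis .
  qed
  have "finner R R = (\<Sum>i<n. \<Sum>k<\<mu>. (R $$ (i, k))\<^sup>2)"
    using R by (simp add: finner_def power2_eq_square)
  also have "\<dots> \<le> (\<Sum>i<n. \<Sum>k<\<mu>. ?s i * (1 / ?D k))"
  proof (intro sum_mono)
    fix i k assume "k \<in> {..<\<mu>}"
    then have k: "k < \<mu>" by simp
    have "(R $$ (i, k))\<^sup>2 \<le> ?s i / ?D k" using row[OF k, of i] pos_le_divide_eq[OF pos[OF k]] by blast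
    then show "(R $$ (i, k))\<^sup>2 \<le> ?s i * (1 / ?D k)" by (simp only: times_divide_eq_right mult_1_right)
  qed
  also have "\<dots> = (\<Sum>i<n. ?s i) * (\<Sum>k<\<mu>. 1 / ?D k)"
    by (simp only: sum_product)
  also have "(\<Sum>i<n. ?s i) = finner (R * M) (R * M)"
  proof -
    have "finner (R * M) (R * M) = (\<Sum>i<n. \<Sum>c<m. (R * M) $$ (i, c) * (R * M) $$ (i, c))"
      using R M by (simp add: finner_def del: index_mult_mat(1))
    also have "\<dots> = (\<Sum>i<n. ?s i)"
      by (intro sum.cong refl) (simp add: mult_mat_entry[OF R M] power2_eq_square del: index_mult_mat(1))
    finally show ?thesis ..
  qed
  finally show ?thesis .
qed

text \<open>With the other rows fixed, there are \<open>m - (\<mu> - 1)\<close> orthonormal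
  directions orthogonal to all of them, and the distance of row \<open>k\<close> from their span is
  at least the length of its projection on these directions. By rotation invariance the squared
  length is chi-square. A lower bound on the distance suffices, as the exponent is negative, so
  dependent rows need no separate case.\<close>

lemma nn_integral_exp_row_dist2_le:
  assumes k: "k < \<mu>" and \<mu>: "\<mu> \<le> m" and \<theta>: "0 \<le> \<theta>"
  shows "(\<integral>\<^sup>+x. ennreal (exp (- \<theta> * row_dist2 \<mu> m k x)) \<partial>gauss ({..<\<mu>} \<times> {..<m}))
    \<le> ennreal ((1 + 2 * \<theta>) powr (- real (m - \<mu> + 1) / 2))"
proof -
  define I where "I = ({..<\<mu>} - {k}) \<times> {..<m}"
  define J where "J = {k} \<times> {..<m}"
  define n where "n = m - \<mu> + 1"
  have IJ: "{..<\<mu>} \<times> {..<m} = I \<union> J" "I \<inter> J = {}" "finite I" "finite J"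
    using k by (auto simp: I_def J_def)
  have meas: "(\<lambda>x. ennreal (exp (- \<theta> * row_dist2 \<mu> m k x))) \<in> borel_measurable (gauss (I \<union> J))"
    unfolding IJ(1)[symmetric] using k by measurable
  have "(\<integral>\<^sup>+x. ennreal (exp (- \<theta> * row_dist2 \<mu> m k x)) \<partial>gauss ({..<\<mu>} \<times> {..<m}))
    = (\<integral>\<^sup>+x. \<integral>\<^sup>+y. ennreal (exp (- \<theta> * row_dist2 \<mu> m k (merge I J (x, y)))) \<partial>gauss J \<partial>gauss I)"
    unfolding IJ(1) by (rule gauss.product_nn_integral_fold[OF IJ(2-4) meas])
  also have "\<dots> \<le> (\<integral>\<^sup>+x. ennreal ((1 + 2 * \<theta>) powr (- real n / 2)) \<partial>gauss I)"
  proof (rule nn_integral_mono)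
    fix x assume "x \<in> space (gauss I)"
    \<comment> \<open>Enumerates the \<open>\<mu> - 1\<close> rows other than
      \<open>k\<close>.\<close>
    define f where "f i = (if i < k then i else Suc i)" for i
    define A where "A = Matrix.mat (\<mu> - 1) m (\<lambda>(i, c). x (f i, c))"
    have A: "A \<in> carrier_mat (\<mu> - 1) m" by (simp add: A_def)
    have mn: "m - (\<mu> - 1) = n" and le: "\<mu> - 1 \<le> m" using k \<mu> by (auto simp: n_def)
    obtain Z where Z: "Z \<in> carrier_mat m n" "orthonormal_mat Z" "A * Z = 0\<^sub>m (\<mu> - 1) n"
      using exists_orthonormal_kernel[OF A le] unfolding mn by blast
    have orth: "(\<Sum>c<m. x (j, c) * Z $$ (c, i)) = 0" if j: "j \<in> {..<\<mu>} - {k}" and i: "i < n" for j i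
    proof -
      define l where "l = (if j < k then j else j - 1)"
      have l: "l < \<mu> - 1" "j = f l" using j k by (auto simp: l_def f_def)
      have "(A * Z) $$ (l, i) = (\<Sum>c<m. x (f l, c) * Z $$ (c, i))"
        using l i by (subst mult_mat_entry[OF A Z(1)]) (auto simp: A_def)
      then show ?thesis using l i Z(3) by simp
    qed
    \<comment> \<open>Subtracting a combination of the other rows does not change the pairing with
      the columns of \<open>Z\<close>, so the bound holds for each competitor in the
      infimum.\<close>
    have lower: "(\<Sum>i<n. (\<Sum>c<m. Z $$ (c, i) * y (k, c))\<^sup>2) \<le> row_dist2 \<mu> m k (merge I J (x, y))" for y
      unfolding row_dist2_def
    proof (rule cINF_greatest)
      fix q :: "nat \<Rightarrow> real"
      define d where "d c = y (k, c) - (\<Sum>j\<in>{..<\<mu>} - {k}. q j * x (j, c))" for c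
      define E where "E = Matrix.mat m 1 (\<lambda>(c, _). d c)"
      have E: "E \<in> carrier_mat m 1" by (simp add: E_def)
      have "(Z\<^sup>T * E) $$ (i, 0) = (\<Sum>c<m. Z $$ (c, i) * y (k, c))" if i: "i < n" for i
      proof -
        have "(Z\<^sup>T * E) $$ (i, 0) = (\<Sum>c<m. Z $$ (c, i) * d c)"
          using i Z by (subst mult_mat_entry[of _ n m E 1]) (auto simp: E_def)
        also have "\<dots> = (\<Sum>c<m. Z $$ (c, i) * y (k, c))
            - (\<Sum>c<m. \<Sum>j\<in>{..<\<mu>} - {k}. q j * (x (j, c) * Z $$ (c, i)))"
          by (simp add: d_def right_diff_distrib sum_subtractf sum_distrib_left ac_simps)
        also have "(\<Sum>c<m. \<Sum>j\<in>{..<\<mu>} - {k}. q j * (x (j, c) * Z $$ (c, i)))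
          = (\<Sum>j\<in>{..<\<mu>} - {k}. q j * (\<Sum>c<m. x (j, c) * Z $$ (c, i)))"
          by (subst sum.swap) (simp add: sum_distrib_left)
        also have "\<dots> = 0" using orth i by simp
        finally show ?thesis by simp
      qed
      then have "(\<Sum>i<n. (\<Sum>c<m. Z $$ (c, i) * y (k, c))\<^sup>2) = finner (Z\<^sup>T * E) (Z\<^sup>T * E)"
        using Z E by (simp add: finner_def power2_eq_square del: index_mult_mat(1))
      also have "\<dots> \<le> finner E E"
        using frob_norm_orthonormal_transpose_mult_le[OF Z(2,1) E] by (simp add: frob_norm_le_iff)
      also have "\<dots> = (\<Sum>c<m. (d c)\<^sup>2)" by (simp add: finner_def E_def power2_eq_square)
      also have "\<dots> = (\<Sum>c<m. (merge I J (x, y) (k, c) - (\<Sum>j\<in>{..<\<mu>} - {k}. q j * merge I J (x, y) (j, c)))\<^sup>2)"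
      proof (intro sum.cong refl)
        fix c assume "c \<in> {..<m}"
        then have c: "c < m" by simp
        have "merge I J (x, y) (k, c) = y (k, c)" using c by (simp add: merge_def I_def J_def)
        moreover have "(\<Sum>j\<in>{..<\<mu>} - {k}. q j * merge I J (x, y) (j, c)) = (\<Sum>j\<in>{..<\<mu>} - {k}. q j * x (j, c))"
          by (intro sum.cong refl) (use c in \<open>simp add: merge_def I_def\<close>)
        ultimately show "(d c)\<^sup>2 = (merge I J (x, y) (k, c) - (\<Sum>j\<in>{..<\<mu>} - {k}. q j * merge I J (x, y) (j, c)))\<^sup>2"
          by (simp only: d_def)
      qed
      finally show "(\<Sum>i<n. (\<Sum>c<m. Z $$ (c, i) * y (k, c))\<^sup>2)
        \<le> (\<Sum>c<m. (merge I J (x, y) (k, c) - (\<Sum>j\<in>{..<\<mu>} - {k}. q j * merge I J (x, y) (j, c)))\<^sup>2)" .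
    qed (rule rat_coefficients_nonempty)
    define w :: "nat \<Rightarrow> nat \<times> nat \<Rightarrow> real" where "w i kc = Z $$ (snd kc, i)" for i kc
    have sJ: "(\<Sum>kc\<in>J. g kc) = (\<Sum>c<m. g (k, c))" for g :: "nat \<times> nat \<Rightarrow> real"
      unfolding J_def by (subst sum.cartesian_product') simp
    have "(\<integral>\<^sup>+y. ennreal (exp (- \<theta> * row_dist2 \<mu> m k (merge I J (x, y)))) \<partial>gauss J)
      \<le> (\<integral>\<^sup>+y. ennreal (exp ((- \<theta>) * (\<Sum>i\<in>{..<n}. (\<Sum>kc\<in>J. w i kc * y kc)\<^sup>2))) \<partial>gauss J)"
      using lower \<theta> by (intro nn_integral_mono ennreal_leI) (simp add: sJ w_def mult_left_mono)
    also have "\<dots> = ennreal ((1 - 2 * (- \<theta>)) powr (- real (card {..<n}) / 2))"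
    proof (rule nn_integral_exp_orthonormal_gauss)
      show "inj_on (\<lambda>i. (k, i)) {..<n}" by (auto intro: inj_onI)
      show "(\<lambda>i. (k, i)) ` {..<n} \<subseteq> J" using k \<mu> by (auto simp: J_def n_def)
      fix i j assume "i \<in> {..<n}" "j \<in> {..<n}"
      then have ij: "i < n" "j < n" by auto
      have "(Z\<^sup>T * Z) $$ (i, j) = (\<Sum>c<m. Z $$ (c, i) * Z $$ (c, j))"
        using ij Z by (subst mult_mat_entry[of _ n m Z n]) auto
      then show "(\<Sum>kc\<in>J. w i kc * w j kc) = (if i = j then 1 else 0)"
        using ij orthonormal_matD[OF Z(2,1)] by (simp add: sJ w_def)
    qed (use \<theta> IJ in auto)
    finally show "(\<integral>\<^sup>+y. ennreal (exp (- \<theta> * row_dist2 \<mu> m k (merge I J (x, y)))) \<partial>gauss J)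
      \<le> ennreal ((1 + 2 * \<theta>) powr (- real n / 2))" by simp
  qed
  also have "\<dots> = ennreal ((1 + 2 * \<theta>) powr (- real n / 2))"
    using prob_space.emeasure_space_1[OF prob_space_gauss[of I]] by simp
  finally show ?thesis by (simp add: n_def)
qed

text \<open>The ratio of the squared norms of \<open>Y G\<close> and \<open>Y\<close> is a convex
  combination, with weights \<open>r i / W\<close>, of the ratios for the single rows, and each of
  these is chi-square with \<open>m\<close> degrees of freedom. Convexity of \<open>exp\<close>
  bounds the transform by that of one such variable, without diagonalising \<open>Y\<close>.\<close>

lemma nn_integral_exp_frob_norm_gauss_le:
  fixes Y :: "real mat"
  assumes Y: "Y \<in> carrier_mat d n" and w: "0 < finner Y Y" and \<theta>: "0 \<le> \<theta>" "\<theta> < 1 / 2"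
  shows "(\<integral>\<^sup>+x. ennreal (exp (\<theta> * (\<Sum>i<d. \<Sum>c<m. (\<Sum>l<n. Y $$ (i, l) * x (l, c))\<^sup>2) / finner Y Y))
      \<partial>gauss ({..<n} \<times> {..<m})) \<le> ennreal ((1 - 2 * \<theta>) powr (- real m / 2))"
proof -
  define A where "A = {..<n} \<times> {..<m}"
  define W where "W = finner Y Y"
  define r where "r i = (\<Sum>l<n. (Y $$ (i, l))\<^sup>2)" for i
  have r0: "0 \<le> r i" for i by (simp add: r_def sum_nonneg)
  have Wr: "W = (\<Sum>i<d. r i)" using Y by (simp add: W_def finner_def r_def power2_eq_square)
  have Wpos: "0 < W" using w by (simp add: W_def)
  let ?q = "\<lambda>i x. \<Sum>c<m. (\<Sum>l<n. Y $$ (i, l) * x (l, c))\<^sup>2"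
  \<comment> \<open>A zero row contributes nothing, in agreement with the value 0 of a quotient by
    \<open>r i = 0\<close>.\<close>
  have q0: "?q i x = 0" if "r i = 0" for i x
  proof -
    have "\<forall>l\<in>{..<n}. (Y $$ (i, l))\<^sup>2 = 0"
      using that by (subst (asm) r_def, subst (asm) sum_nonneg_eq_0_iff) auto
    then show ?thesis by simp
  qed
  have [measurable]: "(\<lambda>x. x (l, c)) \<in> borel_measurable (gauss A)" if "l < n" "c < m" for l c
    using measurable_component_singleton[of "(l, c)" A "\<lambda>_. std_normal"] that by (simp add: A_def)
  have m [measurable]: "?q i \<in> borel_measurable (gauss A)" for i
    by (intro borel_measurable_sum borel_measurable_power borel_measurable_times) auto
  have "exp (\<theta> * (\<Sum>i<d. ?q i x) / W) \<le> (\<Sum>i<d. r i / W * exp (\<theta> * (?q i x / r i)))" for x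
  proof -
    have "(\<Sum>i<d. (r i / W) * (\<theta> * (?q i x / r i))) = \<theta> * (\<Sum>i<d. ?q i x) / W"
    proof -
      have "(r i / W) * (\<theta> * (?q i x / r i)) = \<theta> * ?q i x / W" for i
        using q0[of i x] by (cases "r i = 0") auto
      then show ?thesis by (simp only: sum_distrib_left[of \<theta>] sum_divide_distrib[of _ _ W])
    qed
    moreover have "exp (\<Sum>i\<in>{..<d}. (r i / W) *\<^sub>R (\<theta> * (?q i x / r i))) \<le> (\<Sum>i\<in>{..<d}. (r i / W) * exp (\<theta> * (?q i x / r i)))"
    proof (rule convex_on_sum[where C = UNIV])
      show "(\<Sum>i\<in>{..<d}. r i / W) = 1" using Wpos by (simp add: Wr flip: sum_divide_distrib)
      show "{..<d} \<noteq> {}" using Wpos Wr by auto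
    qed (use r0 Wpos in \<open>auto intro: exp_convex\<close>)
    ultimately show ?thesis by simp
  qed
  then have "(\<integral>\<^sup>+x. ennreal (exp (\<theta> * (\<Sum>i<d. ?q i x) / W)) \<partial>gauss A)
    \<le> (\<integral>\<^sup>+x. ennreal (\<Sum>i<d. r i / W * exp (\<theta> * (?q i x / r i))) \<partial>gauss A)"
    by (intro nn_integral_mono ennreal_leI)
  also have "\<dots> = (\<integral>\<^sup>+x. (\<Sum>i<d. ennreal (r i / W) * ennreal (exp (\<theta> * (?q i x / r i)))) \<partial>gauss A)"
  proof (rule nn_integral_cong)
    fix x
    have "(\<Sum>i<d. ennreal (r i / W) * ennreal (exp (\<theta> * (?q i x / r i))))
      = (\<Sum>i<d. ennreal (r i / W * exp (\<theta> * (?q i x / r i))))"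
      by (intro sum.cong refl ennreal_mult[symmetric]) (use r0 Wpos in auto)
    also have "\<dots> = ennreal (\<Sum>i<d. r i / W * exp (\<theta> * (?q i x / r i)))"
      by (rule sum_ennreal) (use r0 Wpos in auto)
    finally show "ennreal (\<Sum>i<d. r i / W * exp (\<theta> * (?q i x / r i)))
      = (\<Sum>i<d. ennreal (r i / W) * ennreal (exp (\<theta> * (?q i x / r i))))" ..
  qed
  also have "\<dots> = (\<Sum>i<d. ennreal (r i / W) * (\<integral>\<^sup>+x. ennreal (exp (\<theta> * (?q i x / r i))) \<partial>gauss A))"
  proof -
    have e: "(\<lambda>x. ennreal (exp (\<theta> * (?q i x / r i)))) \<in> borel_measurable (gauss A)" for i
      by (rule measurable_compose[OF measurable_compose[OF borel_measurable_times[OF borel_measurable_const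
              borel_measurable_divide[OF m[of i] borel_measurable_const]] borel_measurable_exp] measurable_ennreal])
    have "(\<lambda>x. ennreal (r i / W) * ennreal (exp (\<theta> * (?q i x / r i)))) \<in> borel_measurable (gauss A)" for i
      by (rule borel_measurable_times_ennreal[OF borel_measurable_const e])
    then show ?thesis
      by (subst nn_integral_sum) (auto simp only: nn_integral_cmult[OF e])
  qed
  also have "\<dots> \<le> (\<Sum>i<d. ennreal (r i / W) * ennreal ((1 - 2 * \<theta>) powr (- real m / 2)))"
  proof (intro sum_mono)
    fix i assume "i \<in> {..<d}"
    show "ennreal (r i / W) * (\<integral>\<^sup>+x. ennreal (exp (\<theta> * (?q i x / r i))) \<partial>gauss A)
      \<le> ennreal (r i / W) * ennreal ((1 - 2 * \<theta>) powr (- real m / 2))"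
    proof (cases "r i = 0")
      case False
      then have ri: "0 < r i" using r0[of i] by simp
      then have n: "0 < n" by (cases n) (auto simp: r_def)
      define v :: "nat \<Rightarrow> nat \<times> nat \<Rightarrow> real" where "v c lc = (if snd lc = c then Y $$ (i, fst lc) / sqrt (r i) else 0)" for c lc
      have sA: "(\<Sum>lc\<in>A. g lc) = (\<Sum>l<n. \<Sum>c<m. g (l, c))" for g :: "nat \<times> nat \<Rightarrow> real"
        unfolding A_def by (simp add: sum.cartesian_product')
      have vx: "(\<Sum>lc\<in>A. v c lc * x lc) = (\<Sum>l<n. Y $$ (i, l) * x (l, c)) / sqrt (r i)" if "c < m" for c x
      proof -
        have "v c (l, a) * x (l, a) = (if a = c then Y $$ (i, l) * x (l, c) / sqrt (r i) else 0)" for l a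
          by (simp add: v_def)
        then show ?thesis using that by (simp add: sA sum_divide_distrib)
      qed
      have "(\<Sum>c\<in>{..<m}. (\<Sum>lc\<in>A. v c lc * x lc)\<^sup>2) = ?q i x / r i" for x
      proof -
        have "(\<Sum>lc\<in>A. v c lc * x lc)\<^sup>2 = (\<Sum>l<n. Y $$ (i, l) * x (l, c))\<^sup>2 / r i" if "c < m" for c
          using ri unfolding vx[OF that] by (simp only: power_divide real_sqrt_pow2 less_imp_le)
        then have "(\<Sum>c\<in>{..<m}. (\<Sum>lc\<in>A. v c lc * x lc)\<^sup>2) = (\<Sum>c<m. (\<Sum>l<n. Y $$ (i, l) * x (l, c))\<^sup>2 / r i)"
          by (intro sum.cong refl) simp
        then show ?thesis by (simp only: sum_divide_distrib)
      qed
      moreover have "(\<integral>\<^sup>+x. ennreal (exp (\<theta> * (\<Sum>c\<in>{..<m}. (\<Sum>lc\<in>A. v c lc * x lc)\<^sup>2))) \<partial>gauss A)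
        = ennreal ((1 - 2 * \<theta>) powr (- real (card {..<m}) / 2))"
      proof (rule nn_integral_exp_orthonormal_gauss)
        show "inj_on (\<lambda>c. (0 :: nat, c)) {..<m}" by (auto intro: inj_onI)
        show "(\<lambda>c. (0 :: nat, c)) ` {..<m} \<subseteq> A" using n by (auto simp: A_def)
        fix c c' assume "c \<in> {..<m}" "c' \<in> {..<m}"
        then have cc: "c < m" "c' < m" by auto
        have vv: "v c (l, a) * v c' (l, a) = (if a = c then (if c = c' then (Y $$ (i, l))\<^sup>2 / r i else 0) else 0)" for l a
          using ri by (auto simp: v_def power2_eq_square)
        have "(\<Sum>lc\<in>A. v c lc * v c' lc) = (\<Sum>l<n. if c = c' then (Y $$ (i, l))\<^sup>2 / r i else 0)"
          unfolding sA vv using cc by (intro sum.cong refl) simp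
        also have "\<dots> = (if c = c' then r i / r i else 0)"
        proof -
          have "(\<Sum>l<n. (Y $$ (i, l))\<^sup>2 / r i) = r i / r i"
            by (subst sum_divide_distrib[symmetric]) (simp only: r_def)
          then show ?thesis by (simp split: if_split)
        qed
        finally show "(\<Sum>lc\<in>A. v c lc * v c' lc) = (if c = c' then 1 else 0)" using ri by simp
      qed (use \<theta> in \<open>auto simp: A_def\<close>)
      ultimately show ?thesis by simp
    qed simp
  qed
  also have "\<dots> = ennreal (\<Sum>i<d. r i / W) * ennreal ((1 - 2 * \<theta>) powr (- real m / 2))"
  proof -
    have "(\<Sum>i<d. ennreal (r i / W)) = ennreal (\<Sum>i<d. r i / W)"
      by (rule sum_ennreal) (use r0 Wpos in auto)
    then show ?thesis by (simp only: sum_distrib_right[symmetric])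
  qed
  also have "(\<Sum>i<d. r i / W) = 1" using Wpos by (simp add: Wr flip: sum_divide_distrib)
  finally show ?thesis by (simp add: W_def A_def)
qed

section \<open>Matrix-valued random variables and their laws\<close>

lemma space_mat_borel: "space (mat_borel r c) = carrier_mat r c"
  by (simp add: mat_borel_def)

lemma measurable_mat_restrict:
  "(\<lambda>X. restrict (($$) X) ({..<r} \<times> {..<c})) \<in> measurable (mat_borel r c) (\<Pi>\<^sub>M ij\<in>{..<r} \<times> {..<c}. borel)"
  unfolding mat_borel_def by (rule measurable_vimage_algebra1) (auto simp: space_PiM)

lemma measurable_mat_entry:
  assumes "i < r" "j < c"
  shows "(\<lambda>X. X $$ (i, j)) \<in> borel_measurable (mat_borel r c)"
proof -
  have "(i, j) \<in> {..<r} \<times> {..<c}" using assms by simp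
  from measurable_compose[OF measurable_mat_restrict measurable_component_singleton[OF this]]
  show ?thesis using assms by simp
qed

lemma measurable_mat_mult_entry:
  assumes "A \<in> carrier_mat k r" "i < k" "j < c"
  shows "(\<lambda>X. (A * X) $$ (i, j)) \<in> borel_measurable (mat_borel r c)"
proof -
  have "(\<lambda>X. \<Sum>l<r. A $$ (i, l) * X $$ (l, j)) \<in> borel_measurable (mat_borel r c)"
    by (intro borel_measurable_sum borel_measurable_times borel_measurable_const measurable_mat_entry)
      (use assms in auto)
  moreover have "(A * X) $$ (i, j) = (\<Sum>l<r. A $$ (i, l) * X $$ (l, j))" if "X \<in> space (mat_borel r c)" for X
    using mult_mat_entry[OF assms(1) _ assms(2,3), of X] that by (simp add: space_mat_borel del: index_mult_mat(1))
  ultimately show ?thesis by (subst measurable_cong) auto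
qed

lemma row_dist2_cong:
  assumes "k < \<mu>" "\<And>j c. j < \<mu> \<Longrightarrow> c < m \<Longrightarrow> x (j, c) = x' (j, c)"
  shows "row_dist2 \<mu> m k x = row_dist2 \<mu> m k x'"
proof -
  have "(\<Sum>c<m. (x (k, c) - (\<Sum>j\<in>{..<\<mu>} - {k}. q j * x (j, c)))\<^sup>2)
    = (\<Sum>c<m. (x' (k, c) - (\<Sum>j\<in>{..<\<mu>} - {k}. q j * x' (j, c)))\<^sup>2)" for q
  proof (intro sum.cong refl)
    fix c assume "c \<in> {..<m}"
    then have c: "c < m" by simp
    have "(\<Sum>j\<in>{..<\<mu>} - {k}. q j * x (j, c)) = (\<Sum>j\<in>{..<\<mu>} - {k}. q j * x' (j, c))"
      using assms(2)[OF _ c] by (intro sum.cong refl) simp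
    then show "(x (k, c) - (\<Sum>j\<in>{..<\<mu>} - {k}. q j * x (j, c)))\<^sup>2 = (x' (k, c) - (\<Sum>j\<in>{..<\<mu>} - {k}. q j * x' (j, c)))\<^sup>2"
      using assms(2)[OF assms(1) c] by simp
  qed
  then show ?thesis unfolding row_dist2_def by simp
qed

definition mat_row_dist2 :: "nat \<Rightarrow> nat \<Rightarrow> real mat \<Rightarrow> nat \<Rightarrow> real" where
  "mat_row_dist2 \<mu> m M k = row_dist2 \<mu> m k (\<lambda>ij. M $$ ij)"

lemma mat_row_dist2_restrict:
  assumes "k < \<mu>"
  shows "mat_row_dist2 \<mu> m M k = row_dist2 \<mu> m k (\<lambda>ij\<in>{..<\<mu>} \<times> {..<m}. M $$ ij)"
  unfolding mat_row_dist2_def using assms by (intro row_dist2_cong) auto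

lemma measurable_mult_restrict:
  assumes V: "V \<in> carrier_mat d \<mu>"
  shows "(\<lambda>X. \<lambda>ij\<in>{..<\<mu>} \<times> {..<m}. (V\<^sup>T * X) $$ ij) \<in> measurable (mat_borel d m) (\<Pi>\<^sub>M ij\<in>{..<\<mu>} \<times> {..<m}. borel)"
proof (rule measurable_restrict)
  fix ij assume "ij \<in> {..<\<mu>} \<times> {..<m}"
  then obtain i j where ij: "ij = (i, j)" "i < \<mu>" "j < m" by auto
  show "(\<lambda>X. (V\<^sup>T * X) $$ ij) \<in> borel_measurable (mat_borel d m)"
    unfolding ij(1) by (rule measurable_mat_mult_entry) (use V ij in auto)
qed

lemma measurable_mat_row_dist2:
  assumes "V \<in> carrier_mat d \<mu>" "k < \<mu>"
  shows "(\<lambda>X. mat_row_dist2 \<mu> m (V\<^sup>T * X) k) \<in> borel_measurable (mat_borel d m)"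
  unfolding mat_row_dist2_restrict[OF assms(2)]
  by (rule measurable_compose[OF measurable_mult_restrict[OF assms(1)] measurable_row_dist2[OF assms(2)]])

lemma measurable_finner_mult:
  assumes Y: "Y \<in> carrier_mat k d"
  shows "(\<lambda>X. finner (Y * X) (Y * X)) \<in> borel_measurable (mat_borel d m)"
proof -
  have "(\<lambda>X. \<Sum>i<k. \<Sum>j<m. (Y * X) $$ (i, j) * (Y * X) $$ (i, j)) \<in> borel_measurable (mat_borel d m)"
    by (intro borel_measurable_sum borel_measurable_times measurable_mat_mult_entry) (use Y in auto)
  moreover have "finner (Y * X) (Y * X) = (\<Sum>i<k. \<Sum>j<m. (Y * X) $$ (i, j) * (Y * X) $$ (i, j))"
    if "X \<in> space (mat_borel d m)" for X
    using that Y by (simp add: finner_def space_mat_borel del: index_mult_mat(1))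
  ultimately show ?thesis by (subst measurable_cong) auto
qed

text \<open>Independence is expressed as product form of the joint law, for a nonempty index set;
  hence \<open>r\<close> and \<open>c\<close> are positive.\<close>

lemma distr_std_gaussian_mat:
  assumes M: "prob_space M" and G: "std_gaussian_mat M r c G" and "0 < r" "0 < c"
  shows "distr M (\<Pi>\<^sub>M ij\<in>{..<r} \<times> {..<c}. borel) (\<lambda>\<omega>. \<lambda>ij\<in>{..<r} \<times> {..<c}. G \<omega> $$ ij) = gauss ({..<r} \<times> {..<c})"
proof -
  interpret prob_space M by (rule M)
  let ?A = "{..<r} \<times> {..<c}"
  have ne: "?A \<noteq> {}" using assms by auto
  have dist: "distributed M lborel (\<lambda>\<omega>. G \<omega> $$ ij) (\<lambda>x. ennreal (std_normal_density x))" if "ij \<in> ?A" for ij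
    using G that by (auto simp: std_gaussian_mat_def)
  have rv: "(\<lambda>\<omega>. G \<omega> $$ ij) \<in> measurable M borel" if "ij \<in> ?A" for ij
    using distributed_measurable[OF dist[OF that]] by simp
  have "distr M (\<Pi>\<^sub>M ij\<in>?A. borel) (\<lambda>\<omega>. \<lambda>ij\<in>?A. G \<omega> $$ ij) = (\<Pi>\<^sub>M ij\<in>?A. distr M borel (\<lambda>\<omega>. G \<omega> $$ ij))"
    using G indep_vars_iff_distr_eq_PiM'[OF ne rv] by (simp add: std_gaussian_mat_def)
  also have "\<dots> = gauss ?A"
  proof (rule PiM_cong[OF refl])
    fix ij assume "ij \<in> ?A"
    have "distr M borel (\<lambda>\<omega>. G \<omega> $$ ij) = distr M lborel (\<lambda>\<omega>. G \<omega> $$ ij)"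
      by (rule distr_cong) auto
    also have "\<dots> = std_normal" by (rule distributed_distr_eq_density[OF dist[OF \<open>ij \<in> ?A\<close>]])
    finally show "distr M borel (\<lambda>\<omega>. G \<omega> $$ ij) = std_normal" .
  qed
  finally show ?thesis .
qed

lemma measurable_std_gaussian_mat:
  assumes "std_gaussian_mat M r c G"
  shows "G \<in> measurable M (mat_borel r c)"
  using assms by (simp add: std_gaussian_mat_def)

lemma std_gaussian_mat_carrier:
  assumes "std_gaussian_mat M r c G" "\<omega> \<in> space M"
  shows "G \<omega> \<in> carrier_mat r c"
  using measurable_space[OF measurable_std_gaussian_mat[OF assms(1)] assms(2)] by (simp add: space_mat_borel)

lemma distr_orthonormal_gaussian:
  assumes M: "prob_space M" and G: "std_gaussian_mat M d m G" and V: "V \<in> carrier_mat d \<mu>" "orthonormal_mat V"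
    and pos: "0 < d" "0 < m"
  shows "distr M (\<Pi>\<^sub>M ij\<in>{..<\<mu>} \<times> {..<m}. borel) (\<lambda>\<omega>. \<lambda>ij\<in>{..<\<mu>} \<times> {..<m}. (V\<^sup>T * G \<omega>) $$ ij)
    = gauss ({..<\<mu>} \<times> {..<m})"
proof -
  let ?A = "{..<d} \<times> {..<m}" and ?J = "{..<\<mu>} \<times> {..<m}"
  \<comment> \<open>Entry \<open>(k, c)\<close> of \<open>V\<^sup>T G\<close> as a functional of
    \<open>G\<close>: it involves column \<open>c\<close> only, with coefficients from column
    \<open>k\<close> of \<open>V\<close>. Orthonormality of \<open>V\<close> makes these functionals
    orthonormal.\<close>
  define w :: "nat \<times> nat \<Rightarrow> nat \<times> nat \<Rightarrow> real"
    where "w kc lc = (if snd lc = snd kc then V $$ (fst lc, fst kc) else 0)" for kc lc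
  have sA: "(\<Sum>lc\<in>?A. g lc) = (\<Sum>l<d. \<Sum>c<m. g (l, c))" for g :: "nat \<times> nat \<Rightarrow> real"
    by (simp add: sum.cartesian_product')
  have \<mu>d: "\<mu> \<le> d" by (rule orthonormal_cols_le[OF V])
  have m1: "(\<lambda>\<omega>. \<lambda>ij\<in>?A. G \<omega> $$ ij) \<in> measurable M (\<Pi>\<^sub>M ij\<in>?A. borel)"
    using measurable_compose[OF measurable_std_gaussian_mat[OF G] measurable_mat_restrict] by simp
  have m2: "(\<lambda>x. \<lambda>j\<in>?J. \<Sum>k\<in>?A. w j k * x k) \<in> measurable (\<Pi>\<^sub>M ij\<in>?A. borel) (\<Pi>\<^sub>M j\<in>?J. borel)"
    by (intro measurable_restrict borel_measurable_sum borel_measurable_times borel_measurable_const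
        measurable_component_singleton)
  have "distr M (\<Pi>\<^sub>M ij\<in>?J. borel) (\<lambda>\<omega>. \<lambda>ij\<in>?J. (V\<^sup>T * G \<omega>) $$ ij)
    = distr M (\<Pi>\<^sub>M ij\<in>?J. borel) ((\<lambda>x. \<lambda>j\<in>?J. \<Sum>k\<in>?A. w j k * x k) \<circ> (\<lambda>\<omega>. \<lambda>ij\<in>?A. G \<omega> $$ ij))"
  proof (rule distr_cong[OF refl refl])
    fix \<omega> assume w: "\<omega> \<in> space M"
    have "(V\<^sup>T * G \<omega>) $$ ij = (\<Sum>k\<in>?A. w ij k * (\<lambda>ij\<in>?A. G \<omega> $$ ij) k)" if ijJ: "ij \<in> ?J" for ij
    proof -
      obtain k c where kc: "ij = (k, c)" "k < \<mu>" "c < m" using ijJ by auto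
      have wg: "w (k, c) (l, a) * G \<omega> $$ (l, a) = (if a = c then V $$ (l, k) * G \<omega> $$ (l, c) else 0)" for l a
        by (simp add: w_def)
      have "(\<Sum>kk\<in>?A. w (k, c) kk * (\<lambda>ij\<in>?A. G \<omega> $$ ij) kk) = (\<Sum>kk\<in>?A. w (k, c) kk * G \<omega> $$ kk)"
        by (intro sum.cong refl) simp
      also have "\<dots> = (\<Sum>l<d. V $$ (l, k) * G \<omega> $$ (l, c))"
        unfolding sA wg using kc by (intro sum.cong refl) simp
      finally have "(\<Sum>kk\<in>?A. w (k, c) kk * (\<lambda>ij\<in>?A. G \<omega> $$ ij) kk) = (\<Sum>l<d. V $$ (l, k) * G \<omega> $$ (l, c))" .
      moreover have "(V\<^sup>T * G \<omega>) $$ (k, c) = (\<Sum>l<d. V\<^sup>T $$ (k, l) * G \<omega> $$ (l, c))"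
        by (rule mult_mat_entry) (use V kc std_gaussian_mat_carrier[OF G w] in auto)
      ultimately show ?thesis using kc V by simp
    qed
    then show "(\<lambda>ij\<in>?J. (V\<^sup>T * G \<omega>) $$ ij)
      = ((\<lambda>x. \<lambda>j\<in>?J. \<Sum>k\<in>?A. w j k * x k) \<circ> (\<lambda>\<omega>. \<lambda>ij\<in>?A. G \<omega> $$ ij)) \<omega>"
      unfolding comp_def by (intro restrict_ext)
  qed
  also have "\<dots> = distr (distr M (\<Pi>\<^sub>M ij\<in>?A. borel) (\<lambda>\<omega>. \<lambda>ij\<in>?A. G \<omega> $$ ij)) (\<Pi>\<^sub>M ij\<in>?J. borel)
      (\<lambda>x. \<lambda>j\<in>?J. \<Sum>k\<in>?A. w j k * x k)"
    by (rule distr_distr[OF m2 m1, symmetric])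
  also have "\<dots> = gauss ?J"
    unfolding distr_std_gaussian_mat[OF M G pos]
  proof (rule distr_gauss_orthonormal)
    show "inj_on (\<lambda>x. x) ?J" by simp
    show "(\<lambda>x. x) ` ?J \<subseteq> ?A" using \<mu>d by auto
    fix i j assume "i \<in> ?J" "j \<in> ?J"
    then obtain a b a' b' where ij: "i = (a, b)" "j = (a', b')" "a < \<mu>" "b < m" "a' < \<mu>" "b' < m" by auto
    have ww: "w i (l, c) * w j (l, c) = (if c = b then (if b = b' then V $$ (l, a) * V $$ (l, a') else 0) else 0)" for l c
      by (simp add: w_def ij)
    have "(\<Sum>k\<in>?A. w i k * w j k) = (\<Sum>l<d. if b = b' then V $$ (l, a) * V $$ (l, a') else 0)"
      unfolding sA ww using ij by (intro sum.cong refl) simp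
    also have "\<dots> = (if b = b' then (V\<^sup>T * V) $$ (a, a') else 0)"
      using mult_mat_entry[of "V\<^sup>T" \<mu> d V \<mu> a a'] V ij by simp
    also have "\<dots> = (if i = j then 1 else 0)"
      unfolding orthonormal_matD[OF V(2,1)] using ij by simp
    finally show "(\<Sum>k\<in>?A. w i k * w j k) = (if i = j then 1 else 0)" .
  qed simp_all
  finally show ?thesis .
qed

lemma nn_integral_exp_mat_row_dist2_le:
  assumes M: "prob_space M" and G: "std_gaussian_mat M d m G" and V: "V \<in> carrier_mat d \<mu>" "orthonormal_mat V"
    and k: "k < \<mu>" "\<mu> \<le> m" and \<theta>: "0 \<le> \<theta>"
  shows "(\<integral>\<^sup>+\<omega>. ennreal (exp (- \<theta> * mat_row_dist2 \<mu> m (V\<^sup>T * G \<omega>) k)) \<partial>M)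
    \<le> ennreal ((1 + 2 * \<theta>) powr (- real (m - \<mu> + 1) / 2))"
proof -
  let ?J = "{..<\<mu>} \<times> {..<m}"
  have pos: "0 < d" "0 < m" using orthonormal_cols_le[OF V] k by auto
  have m1: "(\<lambda>\<omega>. \<lambda>ij\<in>?J. (V\<^sup>T * G \<omega>) $$ ij) \<in> measurable M (\<Pi>\<^sub>M ij\<in>?J. borel)"
    by (rule measurable_compose[OF measurable_std_gaussian_mat[OF G] measurable_mult_restrict[OF V(1)]])
  have "(\<integral>\<^sup>+\<omega>. ennreal (exp (- \<theta> * mat_row_dist2 \<mu> m (V\<^sup>T * G \<omega>) k)) \<partial>M)
    = (\<integral>\<^sup>+x. ennreal (exp (- \<theta> * row_dist2 \<mu> m k x)) \<partial>distr M (\<Pi>\<^sub>M ij\<in>?J. borel) (\<lambda>\<omega>. \<lambda>ij\<in>?J. (V\<^sup>T * G \<omega>) $$ ij))"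
    unfolding mat_row_dist2_restrict[OF k(1)]
    by (rule nn_integral_distr[OF m1, symmetric]) (use measurable_row_dist2[OF k(1), of m] in measurable)
  also have "\<dots> \<le> ennreal ((1 + 2 * \<theta>) powr (- real (m - \<mu> + 1) / 2))"
    unfolding distr_orthonormal_gaussian[OF M G V pos] by (rule nn_integral_exp_row_dist2_le[OF k \<theta>])
  finally show ?thesis .
qed

lemma nn_integral_exp_finner_gaussian_le:
  assumes M: "prob_space M" and G: "std_gaussian_mat M d m G" and Y: "Y \<in> carrier_mat k d"
    and w: "0 < finner Y Y" and \<theta>: "0 \<le> \<theta>" "\<theta> < 1 / 2" and pos: "0 < d" "0 < m"
  shows "(\<integral>\<^sup>+\<omega>. ennreal (exp (\<theta> * finner (Y * G \<omega>) (Y * G \<omega>) / finner Y Y)) \<partial>M)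
    \<le> ennreal ((1 - 2 * \<theta>) powr (- real m / 2))"
proof -
  let ?A = "{..<d} \<times> {..<m}"
  let ?q = "\<lambda>x. \<Sum>i<k. \<Sum>c<m. (\<Sum>l<d. Y $$ (i, l) * x (l, c))\<^sup>2"
  have m1: "(\<lambda>\<omega>. \<lambda>ij\<in>?A. G \<omega> $$ ij) \<in> measurable M (\<Pi>\<^sub>M ij\<in>?A. borel)"
    using measurable_compose[OF measurable_std_gaussian_mat[OF G] measurable_mat_restrict] by simp
  have comp: "(\<lambda>x. x (l, c)) \<in> borel_measurable (\<Pi>\<^sub>M ij\<in>?A. borel :: real measure)" if "l \<in> {..<d}" "c \<in> {..<m}" for l c
    using that by (intro measurable_component_singleton) auto
  have mq: "?q \<in> borel_measurable (\<Pi>\<^sub>M ij\<in>?A. borel)"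
    by (intro borel_measurable_sum borel_measurable_power borel_measurable_times borel_measurable_const comp)
  have mE: "(\<lambda>x. ennreal (exp (\<theta> * ?q x / finner Y Y))) \<in> borel_measurable (\<Pi>\<^sub>M ij\<in>?A. borel)"
    by (rule measurable_compose[OF measurable_compose[OF borel_measurable_divide[OF borel_measurable_times[OF
              borel_measurable_const mq] borel_measurable_const] borel_measurable_exp] measurable_ennreal])
  have "finner (Y * G \<omega>) (Y * G \<omega>) = ?q (\<lambda>ij\<in>?A. G \<omega> $$ ij)" if "\<omega> \<in> space M" for \<omega>
  proof -
    have Gc: "G \<omega> \<in> carrier_mat d m" by (rule std_gaussian_mat_carrier[OF G that])
    have "finner (Y * G \<omega>) (Y * G \<omega>) = (\<Sum>i<k. \<Sum>c<m. (Y * G \<omega>) $$ (i, c) * (Y * G \<omega>) $$ (i, c))"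
      using Y Gc by (simp add: finner_def del: index_mult_mat(1))
    also have "\<dots> = ?q (\<lambda>ij\<in>?A. G \<omega> $$ ij)"
    proof (intro sum.cong refl)
      fix i c assume "i \<in> {..<k}" "c \<in> {..<m}"
      then have "(Y * G \<omega>) $$ (i, c) = (\<Sum>l<d. Y $$ (i, l) * (\<lambda>ij\<in>?A. G \<omega> $$ ij) (l, c))"
        by (subst mult_mat_entry[OF Y Gc]) auto
      then show "(Y * G \<omega>) $$ (i, c) * (Y * G \<omega>) $$ (i, c) = (\<Sum>l<d. Y $$ (i, l) * (\<lambda>ij\<in>?A. G \<omega> $$ ij) (l, c))\<^sup>2"
        by (simp only: power2_eq_square)
    qed
    finally show ?thesis .
  qed
  then have "(\<integral>\<^sup>+\<omega>. ennreal (exp (\<theta> * finner (Y * G \<omega>) (Y * G \<omega>) / finner Y Y)) \<partial>M)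
    = (\<integral>\<^sup>+\<omega>. ennreal (exp (\<theta> * ?q (\<lambda>ij\<in>?A. G \<omega> $$ ij) / finner Y Y)) \<partial>M)"
    by (intro nn_integral_cong) (simp only:)
  also have "\<dots> = (\<integral>\<^sup>+x. ennreal (exp (\<theta> * ?q x / finner Y Y)) \<partial>distr M (\<Pi>\<^sub>M ij\<in>?A. borel) (\<lambda>\<omega>. \<lambda>ij\<in>?A. G \<omega> $$ ij))"
    by (rule nn_integral_distr[OF m1, symmetric]) (use mE in simp)
  also have "\<dots> \<le> ennreal ((1 - 2 * \<theta>) powr (- real m / 2))"
    unfolding distr_std_gaussian_mat[OF M G pos]
    by (rule nn_integral_exp_frob_norm_gauss_le[OF Y w \<theta>])
  finally show ?thesis .
qed

section \<open>Chernoff bounds and truncated reciprocals\<close>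

lemma (in prob_space) prob_le_of_nn_integral_exp_neg:
  assumes D: "D \<in> borel_measurable M" and \<theta>: "0 \<le> \<theta>" and h: "0 \<le> h"
    and L: "(\<integral>\<^sup>+\<omega>. ennreal (exp (- \<theta> * D \<omega>)) \<partial>M) \<le> ennreal h"
  shows "prob {\<omega> \<in> space M. D \<omega> < s} \<le> exp (\<theta> * s) * h"
proof -
  note D [measurable]
  have "emeasure M {\<omega> \<in> space M. D \<omega> < s} = (\<integral>\<^sup>+\<omega>. indicator {\<omega> \<in> space M. D \<omega> < s} \<omega> \<partial>M)"
    by simp
  also have "\<dots> \<le> (\<integral>\<^sup>+\<omega>. ennreal (exp (\<theta> * s)) * ennreal (exp (- \<theta> * D \<omega>)) \<partial>M)"
  proof (rule nn_integral_mono)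
    fix \<omega>
    have "1 \<le> exp (\<theta> * s) * exp (- \<theta> * D \<omega>)" if "D \<omega> < s"
      using mult_left_mono[OF less_imp_le[OF that] \<theta>] by (simp flip: exp_add)
    then show "indicator {\<omega> \<in> space M. D \<omega> < s} \<omega> \<le> ennreal (exp (\<theta> * s)) * ennreal (exp (- \<theta> * D \<omega>))"
      by (auto simp: indicator_def simp flip: ennreal_mult)
  qed
  also have "\<dots> = ennreal (exp (\<theta> * s)) * (\<integral>\<^sup>+\<omega>. ennreal (exp (- \<theta> * D \<omega>)) \<partial>M)"
    by (rule nn_integral_cmult) measurable
  also have "\<dots> \<le> ennreal (exp (\<theta> * s)) * ennreal h" using L by (rule mult_left_mono) simp
  finally show ?thesis using h by (simp add: emeasure_eq_measure flip: ennreal_mult)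
qed

text \<open>For \<open>D \<ge> s\<close>, the reciprocal \<open>1 / D\<close> is comparable to the integral of \<open>exp (- \<theta> D)\<close> over \<open>[0, B]\<close>.\<close>

lemma (in prob_space) nn_integral_inverse_le_Laplace:
  assumes D: "D \<in> borel_measurable M" and s: "0 < s" and B: "0 < B"
    and L: "\<And>\<theta>. 0 \<le> \<theta> \<Longrightarrow> (\<integral>\<^sup>+\<omega>. ennreal (exp (- \<theta> * D \<omega>)) \<partial>M) \<le> ennreal (h \<theta>)"
  shows "(\<integral>\<^sup>+\<omega>. ennreal (if s \<le> D \<omega> then 1 / D \<omega> else 0) \<partial>M)
    \<le> ennreal (1 / (1 - exp (- B * s))) * (\<integral>\<^sup>+\<theta>. ennreal (h \<theta>) * indicator {0..B} \<theta> \<partial>lborel)"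
proof -
  note D [measurable]
  interpret pair_sigma_finite M lborel by unfold_locales
  define c where "c = 1 / (1 - exp (- B * s))"
  have e1: "exp (- B * s) < 1" using s B by simp
  then have c: "0 < c" by (simp add: c_def)
  \<comment> \<open>Integrating up to \<open>B\<close> gives \<open>1 / D\<close> times
    \<open>1 - exp (- B * D)\<close>, a factor of at least \<open>1 - exp (- B * s)\<close>;
    \<open>c\<close> is the reciprocal of this bound.\<close>
  have pt: "ennreal (if s \<le> D \<omega> then 1 / D \<omega> else 0)
    \<le> ennreal c * (\<integral>\<^sup>+\<theta>. ennreal (exp (- \<theta> * D \<omega>)) * indicator {0..B} \<theta> \<partial>lborel)" for \<omega>
  proof (cases "s \<le> D \<omega>")
    case True
    then have D0: "0 < D \<omega>" using s by simp
    have "(\<integral>\<^sup>+\<theta>. ennreal (exp (- \<theta> * D \<omega>)) * indicator {0..B} \<theta> \<partial>lborel)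
      = ennreal ((- exp (- B * D \<omega>) / D \<omega>) - (- exp (- 0 * D \<omega>) / D \<omega>))"
      by (rule nn_integral_FTC_Icc) (use D0 B in \<open>auto intro!: derivative_eq_intros\<close>)
    also have "(- exp (- B * D \<omega>) / D \<omega>) - (- exp (- 0 * D \<omega>) / D \<omega>) = (1 - exp (- B * D \<omega>)) / D \<omega>"
      by (simp add: diff_divide_distrib)
    finally have I: "(\<integral>\<^sup>+\<theta>. ennreal (exp (- \<theta> * D \<omega>)) * indicator {0..B} \<theta> \<partial>lborel)
      = ennreal ((1 - exp (- B * D \<omega>)) / D \<omega>)" .
    have "exp (- B * D \<omega>) \<le> exp (- B * s)" using True B by simp
    then have "1 \<le> c * (1 - exp (- B * D \<omega>))"
      using e1 by (simp add: c_def pos_le_divide_eq)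
    then have "1 / D \<omega> \<le> c * (1 - exp (- B * D \<omega>)) / D \<omega>"
      using D0 by (intro divide_right_mono) auto
    then have "1 / D \<omega> \<le> c * ((1 - exp (- B * D \<omega>)) / D \<omega>)" by simp
    then show ?thesis unfolding I using True c D0 B
      by (simp flip: ennreal_mult)
  qed simp
  have "(\<integral>\<^sup>+\<omega>. ennreal (if s \<le> D \<omega> then 1 / D \<omega> else 0) \<partial>M)
    \<le> (\<integral>\<^sup>+\<omega>. ennreal c * (\<integral>\<^sup>+\<theta>. ennreal (exp (- \<theta> * D \<omega>)) * indicator {0..B} \<theta> \<partial>lborel) \<partial>M)"
    by (rule nn_integral_mono) (rule pt)
  also have "\<dots> = ennreal c * (\<integral>\<^sup>+\<omega>. \<integral>\<^sup>+\<theta>. ennreal (exp (- \<theta> * D \<omega>)) * indicator {0..B} \<theta> \<partial>lborel \<partial>M)"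
    by (rule nn_integral_cmult) measurable
  also have "(\<integral>\<^sup>+\<omega>. \<integral>\<^sup>+\<theta>. ennreal (exp (- \<theta> * D \<omega>)) * indicator {0..B} \<theta> \<partial>lborel \<partial>M)
    = (\<integral>\<^sup>+\<theta>. \<integral>\<^sup>+\<omega>. ennreal (exp (- \<theta> * D \<omega>)) * indicator {0..B} \<theta> \<partial>M \<partial>lborel)"
    by (rule Fubini'[symmetric]) measurable
  also have "\<dots> = (\<integral>\<^sup>+\<theta>. (\<integral>\<^sup>+\<omega>. ennreal (exp (- \<theta> * D \<omega>)) \<partial>M) * indicator {0..B} \<theta> \<partial>lborel)"
    by (intro nn_integral_cong nn_integral_multc) measurable
  also have "\<dots> \<le> (\<integral>\<^sup>+\<theta>. ennreal (h \<theta>) * indicator {0..B} \<theta> \<partial>lborel)"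
    by (rule nn_integral_mono) (use L in \<open>auto simp: indicator_def\<close>)
  finally show ?thesis by (simp add: c_def mult_left_mono)
qed


text \<open>The good set consists of matrices, not of sample points, so that it can be paired with
  an independent \<open>S\<close> later. Small \<open>D\<close> and a large sketch of
  \<open>Y\<close> are excluded by Chernoff bounds, failure of the last inequality by Markov. The
  latter concerns the square of \<open>p + q sqrt \<tau>\<close>, with \<open>\<tau>\<close> the sum
  of the reciprocals; since a mean of \<open>\<tau>\<close> is available only where all
  \<open>D \<ge> s\<close>, the square is first bounded by a linear function of
  \<open>\<tau>\<close>.\<close>

lemma gaussian_sketch_good_set:
  assumes M: "prob_space M" and G: "std_gaussian_mat M d m G"
    and V: "V \<in> carrier_mat d \<mu>" "orthonormal_mat V" and Y: "Y \<in> carrier_mat d d"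
    and mu: "1 \<le> \<mu>" "\<mu> \<le> m" and n: "n = m - \<mu> + 1"
    and s: "0 < s" "s \<le> real n" and y: "1 < y" and B: "0 < B"
    and F: "(\<integral>\<^sup>+\<theta>. ennreal ((1 + 2 * \<theta>) powr (- real n / 2)) * indicator {0..B} \<theta> \<partial>lborel) \<le> ennreal F" "0 \<le> F"
    and C: "0 < C" "real \<mu> * (F / (1 - exp (- B * s))) \<le> C"
    and pz: "0 \<le> p" "0 \<le> z" "0 < t"
  defines "D \<equiv> \<lambda>X k. mat_row_dist2 \<mu> m (V\<^sup>T * X) k"
  shows "\<exists>H\<in>sets (mat_borel d m).
    measure M {\<omega> \<in> space M. G \<omega> \<notin> H} \<le> real \<mu> * (exp 1 * s / n) powr (real n / 2)
      + (y * exp (1 - y)) powr (real m / 2) + (p + 2 * sqrt (real m * y * C) * z)\<^sup>2 / t\<^sup>2 \<and>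
    (\<forall>X\<in>H. X \<in> carrier_mat d m \<and> (\<forall>k<\<mu>. s \<le> D X k) \<and> finner (Y * X) (Y * X) \<le> real m * y * finner Y Y \<and>
      p + 2 * sqrt (real m * y * (\<Sum>k<\<mu>. 1 / D X k)) * z \<le> t)"
proof -
  interpret prob_space M by (rule M)
  have pos: "0 < d" "0 < m" "0 < n" using orthonormal_cols_le[OF V] mu n by auto
  have GM: "G \<in> measurable M (mat_borel d m)" by (rule measurable_std_gaussian_mat[OF G])
  have Dm [measurable]: "(\<lambda>X. D X k) \<in> borel_measurable (mat_borel d m)" if "k < \<mu>" for k
    unfolding D_def by (rule measurable_mat_row_dist2[OF V(1) that])
  have DG [measurable]: "(\<lambda>\<omega>. D (G \<omega>) k) \<in> borel_measurable M" if "k < \<mu>" for k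
    by (rule measurable_compose[OF GM Dm[OF that]])
  have qm [measurable]: "(\<lambda>X. finner (Y * X) (Y * X)) \<in> borel_measurable (mat_borel d m)"
    by (rule measurable_finner_mult[OF Y])
  have qG: "(\<lambda>\<omega>. finner (Y * G \<omega>) (Y * G \<omega>)) \<in> borel_measurable M"
    by (rule measurable_compose[OF GM qm])
  define \<tau> where "\<tau> X = (\<Sum>k<\<mu>. 1 / D X k)" for X
  have \<tau>m [measurable]: "\<tau> \<in> borel_measurable (mat_borel d m)"
    unfolding \<tau>_def by (intro borel_measurable_sum borel_measurable_divide borel_measurable_const Dm) auto
  define H1 where "H1 = {X \<in> space (mat_borel d m). \<forall>k\<in>{..<\<mu>}. s \<le> D X k}"
  define H2 where "H2 = {X \<in> space (mat_borel d m). finner (Y * X) (Y * X) \<le> real m * y * finner Y Y}"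
  define H3 where "H3 = {X \<in> space (mat_borel d m). p + 2 * sqrt (real m * y * \<tau> X) * z \<le> t}"
  have H1: "H1 \<in> sets (mat_borel d m)"
    unfolding H1_def by (intro sets.sets_Collect_finite_All borel_measurable_le borel_measurable_const Dm) auto
  have H2: "H2 \<in> sets (mat_borel d m)" and H3: "H3 \<in> sets (mat_borel d m)"
    unfolding H2_def H3_def by measurable
  define H where "H = H1 \<inter> H2 \<inter> H3"
  have H: "H \<in> sets (mat_borel d m)" using H1 H2 H3 by (simp add: H_def)
  define E1 where "E1 k = {\<omega> \<in> space M. D (G \<omega>) k < s}" for k
  define E2 where "E2 = {\<omega> \<in> space M. real m * y * finner Y Y < finner (Y * G \<omega>) (Y * G \<omega>)}"
  define E3 where "E3 = {\<omega> \<in> space M. (\<forall>k\<in>{..<\<mu>}. s \<le> D (G \<omega>) k) \<and> t < p + 2 * sqrt (real m * y * \<tau> (G \<omega>)) * z}"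
  have E1s: "E1 k \<in> events" if "k < \<mu>" for k
    unfolding E1_def using DG[OF that] by measurable
  have E2s: "E2 \<in> events" unfolding E2_def using qG by measurable
  have \<tau>G: "(\<lambda>\<omega>. \<tau> (G \<omega>)) \<in> borel_measurable M" by (rule measurable_compose[OF GM \<tau>m])
  have E3s: "E3 \<in> events"
  proof -
    have "E3 = (G -` H1 \<inter> space M) \<inter> {\<omega> \<in> space M. t < p + 2 * sqrt (real m * y * \<tau> (G \<omega>)) * z}"
      using measurable_space[OF GM] by (auto simp: E3_def H1_def)
    then show ?thesis using measurable_sets[OF GM H1] \<tau>G by simp
  qed
  have cover: "{\<omega> \<in> space M. G \<omega> \<notin> H} \<subseteq> (\<Union>k<\<mu>. E1 k) \<union> E2 \<union> E3"
    using measurable_space[OF GM]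
    by (auto simp: H_def H1_def H2_def H3_def E1_def E2_def E3_def not_le)
  have "prob (\<Union>k<\<mu>. E1 k) \<le> (\<Sum>k<\<mu>. prob (E1 k))"
    using E1s by (intro finite_measure_subadditive_finite) auto
  also have "\<dots> \<le> (\<Sum>k<\<mu>. (exp 1 * s / n) powr (real n / 2))"
  proof (rule sum_mono)
    fix k assume "k \<in> {..<\<mu>}"
    then have k: "k < \<mu>" by simp
    \<comment> \<open>The minimiser of the Chernoff bound, \<open>1 + 2 * \<theta> = n / s\<close>;
      it is nonnegative because \<open>s \<le> n\<close>.\<close>
    define \<theta> where "\<theta> = (real n / s - 1) / 2"
    have \<theta>: "0 \<le> \<theta>" "1 + 2 * \<theta> = real n / s" using s by (auto simp: \<theta>_def field_simps)
    have "prob (E1 k) \<le> exp (\<theta> * s) * (1 + 2 * \<theta>) powr (- real n / 2)"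
      unfolding E1_def
    proof (rule prob_le_of_nn_integral_exp_neg[OF DG[OF k] \<theta>(1)])
      show "(\<integral>\<^sup>+\<omega>. ennreal (exp (- \<theta> * D (G \<omega>) k)) \<partial>M) \<le> ennreal ((1 + 2 * \<theta>) powr (- real n / 2))"
        unfolding D_def n by (rule nn_integral_exp_mat_row_dist2_le[OF M G V k mu(2) \<theta>(1)])
    qed simp
    also have "exp (\<theta> * s) \<le> exp (real n / 2)" using s by (simp add: \<theta>_def field_simps)
    then have "exp (\<theta> * s) * (1 + 2 * \<theta>) powr (- real n / 2) \<le> exp (real n / 2) * (1 + 2 * \<theta>) powr (- real n / 2)"
      by (rule mult_right_mono) simp
    also have "exp (real n / 2) * (1 + 2 * \<theta>) powr (- real n / 2) = (exp 1 * s / n) powr (real n / 2)"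
      unfolding \<theta>(2) using s pos
      by (simp add: powr_def ln_div ln_mult algebra_simps add_divide_distrib diff_divide_distrib flip: exp_add)
    finally show "prob (E1 k) \<le> (exp 1 * s / n) powr (real n / 2)" .
  qed
  finally have P1: "prob (\<Union>k<\<mu>. E1 k) \<le> real \<mu> * (exp 1 * s / n) powr (real n / 2)" by simp
  have P2: "prob E2 \<le> (y * exp (1 - y)) powr (real m / 2)"
  proof (cases "finner Y Y = 0")
    case True
    have "finner (Y * G \<omega>) (Y * G \<omega>) \<le> 0" if "\<omega> \<in> space M" for \<omega>
    proof -
      have "frob_norm (Y * G \<omega>) \<le> frob_norm Y * frob_norm (G \<omega>)"
        by (rule frob_norm_mult[OF Y std_gaussian_mat_carrier[OF G that]])
      then show ?thesis using True by (simp add: frob_norm_finner)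
    qed
    then have "E2 = {}" using True by (force simp: E2_def)
    then show ?thesis by simp
  next
    case False
    then have w: "0 < finner Y Y" using finner_self_nonneg[of Y] by simp
    \<comment> \<open>Again the optimal exponent. The upper tail is treated as the lower tail of the
      negated ratio, and \<open>y > 1\<close> keeps \<open>\<theta>\<close> in the range where the
      transform is finite.\<close>
    define \<theta> where "\<theta> = (1 - 1 / y) / 2"
    have \<theta>: "0 \<le> \<theta>" "\<theta> < 1 / 2" "1 - 2 * \<theta> = 1 / y" using y by (auto simp: \<theta>_def field_simps)
    have "prob {\<omega> \<in> space M. - (finner (Y * G \<omega>) (Y * G \<omega>) / finner Y Y) < - (real m * y)}
      \<le> exp (\<theta> * (- (real m * y))) * (1 - 2 * \<theta>) powr (- real m / 2)"
    proof (rule prob_le_of_nn_integral_exp_neg)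
      show "(\<lambda>\<omega>. - (finner (Y * G \<omega>) (Y * G \<omega>) / finner Y Y)) \<in> borel_measurable M"
        using qG by measurable
      show "(\<integral>\<^sup>+\<omega>. ennreal (exp (- \<theta> * - (finner (Y * G \<omega>) (Y * G \<omega>) / finner Y Y))) \<partial>M)
        \<le> ennreal ((1 - 2 * \<theta>) powr (- real m / 2))"
        using nn_integral_exp_finner_gaussian_le[OF M G Y w \<theta>(1,2) pos(1,2)] by simp
    qed (use \<theta> in auto)
    also have "{\<omega> \<in> space M. - (finner (Y * G \<omega>) (Y * G \<omega>) / finner Y Y) < - (real m * y)} = E2"
      using w by (auto simp: E2_def pos_less_divide_eq)
    also have "exp (\<theta> * (- (real m * y))) = exp (real m / 2 * (1 - y))"
      using y by (simp add: \<theta>_def field_simps)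
    also have "exp (real m / 2 * (1 - y)) * (1 - 2 * \<theta>) powr (- real m / 2) = (y * exp (1 - y)) powr (real m / 2)"
    proof -
      have "ln (1 / y) = - ln y" "ln (y * exp (1 - y)) = ln y + (1 - y)"
        using y by (simp_all add: ln_div ln_mult)
      then show ?thesis using y unfolding \<theta>(3)
        by (simp add: powr_def ring_distribs flip: exp_add)
    qed
    finally show ?thesis .
  qed
  define c where "c = 2 * sqrt (real m * y)"
  have c0: "0 < c" using pos y by (simp add: c_def)
  define q where "q = c * z"
  have q0: "0 \<le> q" using c0 pz by (simp add: q_def)
  have b_eq: "2 * sqrt (real m * y * x) * z = q * sqrt x" for x
    by (simp add: q_def c_def real_sqrt_mult)
  \<comment> \<open>The coefficients come from
    \<open>2 * sqrt \<tau> \<le> sqrt C + \<tau> / sqrt C\<close>. This is an equality at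
    \<open>\<tau> = C\<close>, so inserting the bound \<open>C\<close> for the mean loses nothing:
    \<open>\<alpha> + \<beta> * C = (p + q * sqrt C)\<^sup>2 / t\<^sup>2\<close>.\<close>
  define \<alpha> where "\<alpha> = (p\<^sup>2 + p * q * sqrt C) / t\<^sup>2"
  define \<beta> where "\<beta> = (p * q / sqrt C + q\<^sup>2) / t\<^sup>2"
  have ab: "0 \<le> \<alpha>" "0 \<le> \<beta>" using pz q0 C by (simp_all add: \<alpha>_def \<beta>_def)
  \<comment> \<open>Truncated reciprocals: they agree with \<open>1 / D\<close> on \<open>E3\<close>
    and have a finite mean for \<open>n = 2\<close> as well.\<close>
  define f where "f k \<omega> = (if s \<le> D (G \<omega>) k then 1 / D (G \<omega>) k else 0)" for k \<omega>
  have f0: "0 \<le> f k \<omega>" for k \<omega> using s by (simp add: f_def)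
  have fm: "f k \<in> borel_measurable M" if "k < \<mu>" for k
    unfolding f_def using DG[OF that] by measurable
  have E3_pt: "indicator E3 \<omega> \<le> ennreal \<alpha> + ennreal \<beta> * (\<Sum>k<\<mu>. ennreal (f k \<omega>))" for \<omega>
  proof (cases "\<omega> \<in> E3")
    case True
    then have D: "s \<le> D (G \<omega>) k" if "k < \<mu>" for k using that by (auto simp: E3_def)
    have \<tau>_f: "\<tau> (G \<omega>) = (\<Sum>k<\<mu>. f k \<omega>)" unfolding \<tau>_def f_def using D by (intro sum.cong) auto
    then have \<tau>0: "0 \<le> \<tau> (G \<omega>)" using f0 by (simp add: sum_nonneg)
    have "t < p + q * sqrt (\<tau> (G \<omega>))" using True by (simp add: E3_def b_eq)
    then have "t\<^sup>2 \<le> (p + q * sqrt (\<tau> (G \<omega>)))\<^sup>2" using pz by (intro power_mono) auto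
    also have "\<dots> = p\<^sup>2 + p * q * (2 * sqrt (\<tau> (G \<omega>))) + q\<^sup>2 * \<tau> (G \<omega>)"
      using \<tau>0 by (simp add: power2_sum power_mult_distrib algebra_simps)
    also have "2 * sqrt (\<tau> (G \<omega>)) \<le> sqrt C + \<tau> (G \<omega>) / sqrt C"
    proof -
      have "0 \<le> (sqrt C - sqrt (\<tau> (G \<omega>)))\<^sup>2" by simp
      also have "\<dots> = C + \<tau> (G \<omega>) - 2 * sqrt C * sqrt (\<tau> (G \<omega>))"
        using C \<tau>0 by (simp add: power2_diff)
      finally have "2 * sqrt (\<tau> (G \<omega>)) * sqrt C \<le> C + \<tau> (G \<omega>)" by (simp add: ac_simps)
      then have "2 * sqrt (\<tau> (G \<omega>)) \<le> (C + \<tau> (G \<omega>)) / sqrt C" using C by (simp add: pos_le_divide_eq)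
      also have "\<dots> = sqrt C + \<tau> (G \<omega>) / sqrt C" using C by (simp add: add_divide_distrib real_div_sqrt)
      finally show ?thesis .
    qed
    then have "p\<^sup>2 + p * q * (2 * sqrt (\<tau> (G \<omega>))) + q\<^sup>2 * \<tau> (G \<omega>)
      \<le> p\<^sup>2 + p * q * (sqrt C + \<tau> (G \<omega>) / sqrt C) + q\<^sup>2 * \<tau> (G \<omega>)"
      using pz q0 by (intro add_mono mult_left_mono) auto
    also have "\<dots> = t\<^sup>2 * (\<alpha> + \<beta> * \<tau> (G \<omega>))"
    proof -
      have "t\<^sup>2 * \<alpha> = p\<^sup>2 + p * q * sqrt C" "t\<^sup>2 * \<beta> = p * q / sqrt C + q\<^sup>2"
        using pz by (simp_all add: \<alpha>_def \<beta>_def)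
      then have "t\<^sup>2 * (\<alpha> + \<beta> * \<tau> (G \<omega>)) = (p\<^sup>2 + p * q * sqrt C) + (p * q / sqrt C + q\<^sup>2) * \<tau> (G \<omega>)"
        by (simp only: distrib_left mult.assoc[symmetric])
      then show ?thesis by (simp add: algebra_simps)
    qed
    finally have "1 \<le> \<alpha> + \<beta> * \<tau> (G \<omega>)" using pz by simp
    then have "1 \<le> ennreal (\<alpha> + \<beta> * (\<Sum>k<\<mu>. f k \<omega>))" by (simp add: \<tau>_f)
    also have "\<dots> = ennreal \<alpha> + ennreal \<beta> * (\<Sum>k<\<mu>. ennreal (f k \<omega>))"
      using ab f0 by (simp add: ennreal_plus ennreal_mult sum_nonneg flip: sum_ennreal)
    finally show ?thesis using True by simp
  qed simp
  have "emeasure M E3 = (\<integral>\<^sup>+\<omega>. indicator E3 \<omega> \<partial>M)" using E3s by simp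
  also have "\<dots> \<le> (\<integral>\<^sup>+\<omega>. ennreal \<alpha> + ennreal \<beta> * (\<Sum>k<\<mu>. ennreal (f k \<omega>)) \<partial>M)"
    by (rule nn_integral_mono) (rule E3_pt)
  also have "\<dots> = ennreal \<alpha> + ennreal \<beta> * (\<Sum>k<\<mu>. \<integral>\<^sup>+\<omega>. ennreal (f k \<omega>) \<partial>M)"
  proof -
    have fe: "(\<lambda>\<omega>. ennreal (f k \<omega>)) \<in> borel_measurable M" if "k \<in> {..<\<mu>}" for k
      using measurable_compose[OF fm measurable_ennreal] that by simp
    have se: "(\<lambda>\<omega>. \<Sum>k<\<mu>. ennreal (f k \<omega>)) \<in> borel_measurable M"
      by (rule borel_measurable_sum) (rule fe)
    have "(\<integral>\<^sup>+\<omega>. ennreal \<alpha> + ennreal \<beta> * (\<Sum>k<\<mu>. ennreal (f k \<omega>)) \<partial>M)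
      = (\<integral>\<^sup>+\<omega>. ennreal \<alpha> \<partial>M) + (\<integral>\<^sup>+\<omega>. ennreal \<beta> * (\<Sum>k<\<mu>. ennreal (f k \<omega>)) \<partial>M)"
      by (rule nn_integral_add[OF borel_measurable_const borel_measurable_times_ennreal[OF borel_measurable_const se]])
    also have "(\<integral>\<^sup>+\<omega>. ennreal \<alpha> \<partial>M) = ennreal \<alpha>" by (simp add: emeasure_space_1)
    also have "(\<integral>\<^sup>+\<omega>. ennreal \<beta> * (\<Sum>k<\<mu>. ennreal (f k \<omega>)) \<partial>M)
      = ennreal \<beta> * (\<integral>\<^sup>+\<omega>. (\<Sum>k<\<mu>. ennreal (f k \<omega>)) \<partial>M)"
      by (rule nn_integral_cmult[OF se])
    also have "(\<integral>\<^sup>+\<omega>. (\<Sum>k<\<mu>. ennreal (f k \<omega>)) \<partial>M) = (\<Sum>k<\<mu>. \<integral>\<^sup>+\<omega>. ennreal (f k \<omega>) \<partial>M)"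
      by (rule nn_integral_sum[OF fe])
    finally show ?thesis .
  qed
  also have "\<dots> \<le> ennreal \<alpha> + ennreal \<beta> * (\<Sum>k<\<mu>. ennreal (F / (1 - exp (- B * s))))"
  proof (intro add_left_mono mult_left_mono sum_mono)
    fix k assume "k \<in> {..<\<mu>}"
    then have k: "k < \<mu>" by simp
    have e1: "exp (- B * s) < 1" using s B by simp
    have "(\<integral>\<^sup>+\<omega>. ennreal (f k \<omega>) \<partial>M) \<le> ennreal (1 / (1 - exp (- B * s))) *
      (\<integral>\<^sup>+\<theta>. ennreal ((1 + 2 * \<theta>) powr (- real n / 2)) * indicator {0..B} \<theta> \<partial>lborel)"
      unfolding f_def
    proof (rule nn_integral_inverse_le_Laplace[OF DG[OF k] s(1) B])
      show "(\<integral>\<^sup>+\<omega>. ennreal (exp (- \<theta> * D (G \<omega>) k)) \<partial>M) \<le> ennreal ((1 + 2 * \<theta>) powr (- real n / 2))" if "0 \<le> \<theta>" for \<theta>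
        unfolding D_def n by (rule nn_integral_exp_mat_row_dist2_le[OF M G V k mu(2) that])
    qed
    also have "\<dots> \<le> ennreal (1 / (1 - exp (- B * s))) * ennreal F" using F(1) by (rule mult_left_mono) simp
    also have "\<dots> = ennreal (F / (1 - exp (- B * s)))" using e1 F by (simp flip: ennreal_mult)
    finally show "(\<integral>\<^sup>+\<omega>. ennreal (f k \<omega>) \<partial>M) \<le> ennreal (F / (1 - exp (- B * s)))" .
  qed simp_all
  also have "\<dots> = ennreal (\<alpha> + \<beta> * (real \<mu> * (F / (1 - exp (- B * s)))))"
  proof -
    have "exp (- B * s) < 1" using s B by simp
    then have x: "0 \<le> F / (1 - exp (- B * s))" using F by simp
    define x where "x = F / (1 - exp (- B * s))"
    have x0: "0 \<le> x" using x by (simp only: x_def)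
    have "(\<Sum>k<\<mu>. ennreal x) = ennreal (real \<mu> * x)"
      using x0 by (simp add: ennreal_mult ennreal_of_nat_eq_real_of_nat)
    then show ?thesis unfolding x_def[symmetric] using ab x0
      by (simp add: ennreal_plus ennreal_mult)
  qed
  finally have em: "emeasure M E3 \<le> ennreal (\<alpha> + \<beta> * (real \<mu> * (F / (1 - exp (- B * s)))))" .
  have "prob E3 \<le> \<alpha> + \<beta> * (real \<mu> * (F / (1 - exp (- B * s))))"
  proof -
    have "exp (- B * s) < 1" using s B by simp
    then have "0 \<le> \<alpha> + \<beta> * (real \<mu> * (F / (1 - exp (- B * s))))" using ab F by simp
    then show ?thesis
      using em by (simp add: emeasure_eq_measure)
  qed
  also have "\<dots> \<le> \<alpha> + \<beta> * C" by (intro add_left_mono mult_left_mono C ab)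
  also have "\<dots> = (p + q * sqrt C)\<^sup>2 / t\<^sup>2"
  proof -
    have "p * q / sqrt C * C = p * q * (C / sqrt C)" by simp
    also have "C / sqrt C = sqrt C" by (rule real_div_sqrt) (use C in simp)
    finally have h: "(p * q / sqrt C + q\<^sup>2) * C = p * q * sqrt C + q\<^sup>2 * C" by (simp only: distrib_right)
    have sq: "(p + q * sqrt C)\<^sup>2 = (p\<^sup>2 + p * q * sqrt C) + (p * q * sqrt C + q\<^sup>2 * C)"
      using C by (simp add: power2_sum power_mult_distrib algebra_simps)
    have "\<alpha> + \<beta> * C = (p\<^sup>2 + p * q * sqrt C) / t\<^sup>2 + ((p * q / sqrt C + q\<^sup>2) * C) / t\<^sup>2"
      by (simp only: \<alpha>_def \<beta>_def times_divide_eq_left)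
    then show ?thesis unfolding h sq by (simp only: add_divide_distrib)
  qed
  finally have P3: "prob E3 \<le> (p + 2 * sqrt (real m * y * C) * z)\<^sup>2 / t\<^sup>2" by (simp only: b_eq)
  have "prob {\<omega> \<in> space M. G \<omega> \<notin> H} \<le> prob ((\<Union>k<\<mu>. E1 k) \<union> E2 \<union> E3)"
    using E1s E2s E3s cover by (intro finite_measure_mono) auto
  also have "\<dots> \<le> prob ((\<Union>k<\<mu>. E1 k) \<union> E2) + prob E3"
    using E1s E2s E3s by (intro measure_Un_le) auto
  also have "\<dots> \<le> (prob (\<Union>k<\<mu>. E1 k) + prob E2) + prob E3"
    using E1s E2s by (intro add_right_mono measure_Un_le) auto
  finally have "prob {\<omega> \<in> space M. G \<omega> \<notin> H} \<le> real \<mu> * (exp 1 * s / n) powr (real n / 2)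
      + (y * exp (1 - y)) powr (real m / 2) + (p + 2 * sqrt (real m * y * C) * z)\<^sup>2 / t\<^sup>2"
    using P1 P2 P3 by simp
  moreover have "\<forall>X\<in>H. X \<in> carrier_mat d m \<and> (\<forall>k<\<mu>. s \<le> D X k) \<and> finner (Y * X) (Y * X) \<le> real m * y * finner Y Y \<and>
      p + 2 * sqrt (real m * y * (\<Sum>k<\<mu>. 1 / D X k)) * z \<le> t"
    by (auto simp: H_def H1_def H2_def H3_def \<tau>_def space_mat_borel)
  ultimately show ?thesis using H by blast
qed

section \<open>Unfoldings of tensors\<close>

definition unfolding_idx :: "(nat \<Rightarrow> nat) \<Rightarrow> nat \<Rightarrow> nat \<Rightarrow> nat \<Rightarrow> nat \<Rightarrow> nat \<Rightarrow> nat" where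
  "unfolding_idx I N n r c = (\<lambda>k\<in>{1..N}. if k = n then r else (c div (\<Prod>m\<in>{1..<k} - {n}. I m)) mod I k)"

lemma unfolding_mat_carrier: "unfolding_mat I N n A \<in> carrier_mat (I n) (other_dim I N n)"
  by (simp add: unfolding_mat_def)

lemma unfolding_mat_entry:
  assumes "r < I n" "c < other_dim I N n"
  shows "unfolding_mat I N n A $$ (r, c) = A (unfolding_idx I N n r c)"
  using assms by (simp add: unfolding_mat_def unfolding_idx_def)

text \<open>Injectivity is uniqueness of mixed-radix digits; surjectivity follows by counting, as
  both sides have as many elements as the product of all \<open>I k\<close>.\<close>

lemma unfolding_idx_bij:
  assumes n: "n \<in> {1..N}" and I: "\<And>k. k \<in> {1..N} \<Longrightarrow> 1 \<le> I k"
  shows "bij_betw (\<lambda>(r, c). unfolding_idx I N n r c) ({..<I n} \<times> {..<other_dim I N n}) (multi_idx I N)"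
proof -
  let ?f = "\<lambda>(r, c). unfolding_idx I N n r c" and ?A = "{..<I n} \<times> {..<other_dim I N n}"
  define P where "P k = (\<Prod>m\<in>{1..<k} - {n}. I m)" for k
  \<comment> \<open>Agreement of the digits up to mode \<open>j\<close> gives agreement modulo the
    product of the radices up to \<open>j\<close>. Mode \<open>n\<close> has no digit and does not
    enter \<open>P\<close>, so its step is void. At \<open>j = N\<close> the modulus is the number
    of columns.\<close>
  have digits: "c mod P (Suc j) = c' mod P (Suc j)"
    if eq: "\<And>k. k \<in> {1..N} \<Longrightarrow> k \<noteq> n \<Longrightarrow> (c div P k) mod I k = (c' div P k) mod I k" and j: "j \<le> N" for c c' j
    using j
  proof (induction j)
    case 0
    have "P (Suc 0) = 1" by (simp add: P_def)
    then show ?case by simp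
  next
    case (Suc j)
    have IH: "c mod P (Suc j) = c' mod P (Suc j)" using Suc by simp
    have set: "{1..<Suc (Suc j)} = insert (Suc j) {1..<Suc j}" by auto
    show ?case
    proof (cases "Suc j = n")
      case True
      then have "{1..<Suc (Suc j)} - {n} = {1..<Suc j} - {n}" using set by auto
      then show ?thesis using IH by (simp add: P_def)
    next
      case False
      then have "{1..<Suc (Suc j)} - {n} = insert (Suc j) ({1..<Suc j} - {n})" using set by auto
      then have PP: "P (Suc (Suc j)) = P (Suc j) * I (Suc j)" by (simp add: P_def mult.commute)
      have "(c div P (Suc j)) mod I (Suc j) = (c' div P (Suc j)) mod I (Suc j)"
        by (rule eq) (use Suc.prems False in auto)
      then show ?thesis unfolding PP mod_mult2_eq IH by simp
    qed
  qed
  have PN: "P (Suc N) = other_dim I N n"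
    unfolding P_def other_dim_def by (rule prod.cong) auto
  have inj: "inj_on ?f ?A"
  proof (rule inj_onI)
    fix x y assume x: "x \<in> ?A" and y: "y \<in> ?A" and xy: "?f x = ?f y"
    obtain r c r' c' where rc: "x = (r, c)" "y = (r', c')" by (cases x, cases y) auto
    have e: "unfolding_idx I N n r c k = unfolding_idx I N n r' c' k" for k using xy rc by simp
    have r: "r = r'" using e[of n] n by (simp add: unfolding_idx_def)
    have "(c div P k) mod I k = (c' div P k) mod I k" if "k \<in> {1..N}" "k \<noteq> n" for k
      using e[of k] that by (simp add: unfolding_idx_def P_def)
    then have "c mod other_dim I N n = c' mod other_dim I N n"
      using digits[of c c' N] PN by simp
    then have "c = c'" using x y rc by simp
    then show "x = y" using r rc by simp
  qed
  have into: "?f ` ?A \<subseteq> multi_idx I N"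
  proof
    fix i assume "i \<in> ?f ` ?A"
    then obtain r c where rc: "i = unfolding_idx I N n r c" "r < I n" by auto
    show "i \<in> multi_idx I N" unfolding multi_idx_def
    proof (rule PiE_I)
      fix k assume k: "k \<in> {1..N}"
      have "0 < I k" using I[OF k] by simp
      then show "i k \<in> {..<I k}" using k rc by (simp add: unfolding_idx_def)
    next
      fix k assume "k \<notin> {1..N}"
      then show "i k = undefined" unfolding rc(1) unfolding_idx_def by (simp only: restrict_apply if_False)
    qed
  qed
  have fin: "finite (multi_idx I N)" unfolding multi_idx_def by (intro finite_PiE) auto
  have "card (?f ` ?A) = I n * other_dim I N n" using inj by (simp add: card_image)
  also have "\<dots> = (\<Prod>k\<in>{1..N}. I k)" unfolding other_dim_def using prod.remove[of "{1..N}" n I] n by simp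
  also have "\<dots> = card (multi_idx I N)" unfolding multi_idx_def by (simp add: card_PiE)
  finally have "?f ` ?A = multi_idx I N" by (rule card_subset_eq[OF fin into])
  then show ?thesis using inj by (simp add: bij_betw_def)
qed

lemma tensor_norm_unfolding:
  assumes n: "n \<in> {1..N}" and I: "\<And>k. k \<in> {1..N} \<Longrightarrow> 1 \<le> I k"
  shows "(tensor_norm I N A)\<^sup>2 = finner (unfolding_mat I N n A) (unfolding_mat I N n A)"
proof -
  have "(tensor_norm I N A)\<^sup>2 = (\<Sum>i\<in>multi_idx I N. (A i)\<^sup>2)"
    unfolding tensor_norm_def by (rule real_sqrt_pow2) (simp add: sum_nonneg)
  also have "\<dots> = (\<Sum>rc\<in>{..<I n} \<times> {..<other_dim I N n}. (A ((\<lambda>(r, c). unfolding_idx I N n r c) rc))\<^sup>2)"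
    by (rule sum.reindex_bij_betw[OF unfolding_idx_bij[OF n I], symmetric])
  also have "\<dots> = (\<Sum>r<I n. \<Sum>c<other_dim I N n. (A (unfolding_idx I N n r c))\<^sup>2)"
    by (simp add: sum.cartesian_product')
  also have "\<dots> = finner (unfolding_mat I N n A) (unfolding_mat I N n A)"
    unfolding finner_def using unfolding_mat_carrier[of I N n A]
    by (intro sum.cong) (auto simp: unfolding_mat_entry power2_eq_square)
  finally show ?thesis .
qed

lemma unfolding_mat_minus:
  "unfolding_mat I N n (\<lambda>i. A i - B i) = unfolding_mat I N n A - unfolding_mat I N n B"
  by (rule eq_matI) (auto simp: unfolding_mat_def)

lemma unfolding_mat_mode_prod:
  assumes n: "n \<in> {1..N}" and B: "B \<in> carrier_mat (I n) (I n)"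
  shows "unfolding_mat I N n (mode_prod A n B) = B * unfolding_mat I N n A"
proof (rule eq_matI)
  let ?X = "unfolding_mat I N n A"
  fix r c assume "r < dim_row (B * ?X)" "c < dim_col (B * ?X)"
  then have rc: "r < I n" "c < other_dim I N n" using B by (auto simp: unfolding_mat_def)
  have upd: "(unfolding_idx I N n r c)(n := k) = unfolding_idx I N n k c" for k
    using n by (auto simp: unfolding_idx_def)
  have "unfolding_mat I N n (mode_prod A n B) $$ (r, c)
    = (\<Sum>k<I n. A ((unfolding_idx I N n r c)(n := k)) * B $$ (unfolding_idx I N n r c n, k))"
    using rc B by (simp add: unfolding_mat_entry mode_prod_def)
  also have "\<dots> = (\<Sum>k<I n. B $$ (r, k) * ?X $$ (k, c))"
    unfolding upd using rc n by (intro sum.cong refl) (simp add: unfolding_mat_entry unfolding_idx_def)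
  also have "\<dots> = (B * ?X) $$ (r, c)"
    by (rule mult_mat_entry[OF B unfolding_mat_carrier rc, symmetric])
  finally show "unfolding_mat I N n (mode_prod A n B) $$ (r, c) = (B * ?X) $$ (r, c)" .
qed (use B in \<open>auto simp: unfolding_mat_def\<close>)

text \<open>Let \<open>D\<close> be the approximation before mode \<open>k\<close>, with unfolding
  \<open>Y\<close>. The new error \<open>X - Q Q\<^sup>T Y\<close> splits into
  \<open>Q Q\<^sup>T (X - Y)\<close>, bounded by the old error, and the residual of
  \<open>X\<close>, since \<open>Q Q\<^sup>T Y\<close> has no residual. Each mode is thus charged
  with the residual of the original tensor, not of the partly projected one. The format
  \<open>N\<close> stays fixed while \<open>n\<close> counts the processed modes.\<close>

lemma tensor_projection_error:
  assumes I: "\<And>k. k \<in> {1..N} \<Longrightarrow> 1 \<le> I k"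
    and Q: "\<And>k. k \<in> {1..N} \<Longrightarrow> Q k \<in> carrier_mat (I k) (\<mu> k)" "\<And>k. k \<in> {1..N} \<Longrightarrow> orthonormal_mat (Q k)"
    and n: "n \<le> N"
  shows "(tensor_norm I N (\<lambda>i. A i - mode_prods n A (\<lambda>k. Q k * (Q k)\<^sup>T) i))\<^sup>2
    \<le> (\<Sum>k = 1..n. finner (resid (Q k) (unfolding_mat I N k A)) (resid (Q k) (unfolding_mat I N k A)))"
  using n
proof (induction n)
  case 0
  show ?case by (simp add: mode_prods_def tensor_norm_def)
next
  case (Suc n)
  let ?k = "Suc n"
  define D where "D = mode_prods n A (\<lambda>k. Q k * (Q k)\<^sup>T)"
  define X where "X = unfolding_mat I N ?k A"
  define Y where "Y = unfolding_mat I N ?k D"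
  have k: "?k \<in> {1..N}" using Suc.prems by simp
  note Qk = Q(1)[OF k] Q(2)[OF k]
  have X: "X \<in> carrier_mat (I ?k) (other_dim I N ?k)" and Y: "Y \<in> carrier_mat (I ?k) (other_dim I N ?k)"
    by (simp_all add: X_def Y_def unfolding_mat_carrier)
  define c where "c = other_dim I N ?k"
  note X = X[folded c_def] and Y = Y[folded c_def]
  have QY: "(Q ?k)\<^sup>T * Y \<in> carrier_mat (\<mu> ?k) c" using Qk Y by simp
  have QQY: "Q ?k * ((Q ?k)\<^sup>T * Y) \<in> carrier_mat (I ?k) c" using Qk QY by simp
  have XY: "X - Y \<in> carrier_mat (I ?k) c" by (rule minus_carrier_mat[OF Y])
  have step: "mode_prods ?k A (\<lambda>k. Q k * (Q k)\<^sup>T) = mode_prod D ?k (Q ?k * (Q ?k)\<^sup>T)"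
    by (simp add: mode_prods_def D_def)
  have "unfolding_mat I N ?k (mode_prod D ?k (Q ?k * (Q ?k)\<^sup>T)) = (Q ?k * (Q ?k)\<^sup>T) * Y"
    unfolding Y_def by (rule unfolding_mat_mode_prod[OF k]) (use Qk in simp)
  also have "\<dots> = Q ?k * ((Q ?k)\<^sup>T * Y)"
    by (rule assoc_mult_mat) (use Qk Y in auto)
  finally have un: "unfolding_mat I N ?k (mode_prod D ?k (Q ?k * (Q ?k)\<^sup>T)) = Q ?k * ((Q ?k)\<^sup>T * Y)" .
  have tn: "(tensor_norm I N Z)\<^sup>2 = finner (unfolding_mat I N ?k Z) (unfolding_mat I N ?k Z)" for Z
    by (rule tensor_norm_unfolding[OF k]) (rule I)
  define W where "W = X - Q ?k * ((Q ?k)\<^sup>T * Y)"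
  have W: "W \<in> carrier_mat (I ?k) c" unfolding W_def by (rule minus_carrier_mat[OF QQY])
  have "(tensor_norm I N (\<lambda>i. A i - mode_prods ?k A (\<lambda>k. Q k * (Q k)\<^sup>T) i))\<^sup>2 = finner W W"
    unfolding tn unfolding_mat_minus step un W_def X_def ..
  also have "\<dots> = finner ((Q ?k)\<^sup>T * W) ((Q ?k)\<^sup>T * W) + finner (resid (Q ?k) W) (resid (Q ?k) W)"
    unfolding resid_def by (rule orthonormal_projection_Pythagoras[OF Qk(2,1) W])
  also have "(Q ?k)\<^sup>T * W = (Q ?k)\<^sup>T * (X - Y)"
  proof -
    have "(Q ?k)\<^sup>T * W = (Q ?k)\<^sup>T * X - (Q ?k)\<^sup>T * (Q ?k * ((Q ?k)\<^sup>T * Y))"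
      unfolding W_def by (rule mult_minus_distrib_mat) (use Qk X QQY in auto)
    also have "(Q ?k)\<^sup>T * (Q ?k * ((Q ?k)\<^sup>T * Y)) = ((Q ?k)\<^sup>T * Q ?k) * ((Q ?k)\<^sup>T * Y)"
      by (rule assoc_mult_mat[symmetric]) (use Qk QY in auto)
    also have "\<dots> = (Q ?k)\<^sup>T * Y"
      unfolding orthonormal_matD[OF Qk(2,1)] by (rule left_mult_one_mat[OF QY])
    also have "(Q ?k)\<^sup>T * X - (Q ?k)\<^sup>T * Y = (Q ?k)\<^sup>T * (X - Y)"
      by (rule mult_minus_distrib_mat[symmetric]) (use Qk X Y in auto)
    finally show ?thesis .
  qed
  also have "resid (Q ?k) W = resid (Q ?k) X"
  proof -
    have "resid (Q ?k) W = resid (Q ?k) X - 0\<^sub>m (I ?k) c"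
      unfolding W_def resid_minus[OF Qk(1) X QQY] resid_range[OF Qk QY] ..
    also have "\<dots> = resid (Q ?k) X" by (rule eq_matI) (use resid_carrier[OF Qk(1) X] in auto)
    finally show ?thesis .
  qed
  also have "finner ((Q ?k)\<^sup>T * (X - Y)) ((Q ?k)\<^sup>T * (X - Y)) \<le> finner (X - Y) (X - Y)"
    using frob_norm_orthonormal_transpose_mult_le[OF Qk(2,1) XY] by (simp only: frob_norm_le_iff)
  also have "finner (X - Y) (X - Y) = (tensor_norm I N (\<lambda>i. A i - D i))\<^sup>2"
    unfolding tn unfolding_mat_minus X_def Y_def ..
  also have "\<dots> \<le> (\<Sum>k = 1..n. finner (resid (Q k) (unfolding_mat I N k A)) (resid (Q k) (unfolding_mat I N k A)))"
    unfolding D_def by (rule Suc.IH) (use Suc.prems in simp)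
  finally show ?case by (simp add: X_def)
qed

lemma finner_resid_le:
  assumes "Q \<in> carrier_mat n k" "orthonormal_mat Q" "X \<in> carrier_mat n c"
  shows "finner (resid Q X) (resid Q X) \<le> finner X X"
  using frob_norm_resid_le[OF assms] by (simp only: frob_norm_le_iff)

section \<open>Measurability of the approximation error\<close>

lemma measurable_rv_mat_entry:
  assumes "Q \<in> measurable M (mat_borel r c)" "i < r" "j < c"
  shows "(\<lambda>\<omega>. Q \<omega> $$ (i, j)) \<in> borel_measurable M"
  by (rule measurable_compose[OF assms(1) measurable_mat_entry[OF assms(2,3)]])

lemma rv_mat_carrier:
  assumes "Q \<in> measurable M (mat_borel r c)" "\<omega> \<in> space M"
  shows "Q \<omega> \<in> carrier_mat r c"
  using measurable_space[OF assms] by (simp add: space_mat_borel)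

lemma measurable_projector_entry:
  assumes Q: "Q \<in> measurable M (mat_borel r c)" and ij: "i < r" "j < r"
  shows "(\<lambda>\<omega>. (Q \<omega> * (Q \<omega>)\<^sup>T) $$ (i, j)) \<in> borel_measurable M"
proof -
  have "(\<lambda>\<omega>. \<Sum>l<c. Q \<omega> $$ (i, l) * Q \<omega> $$ (j, l)) \<in> borel_measurable M"
    by (intro borel_measurable_sum borel_measurable_times measurable_rv_mat_entry[OF Q]) (use ij in auto)
  moreover have "(Q \<omega> * (Q \<omega>)\<^sup>T) $$ (i, j) = (\<Sum>l<c. Q \<omega> $$ (i, l) * Q \<omega> $$ (j, l))" if "\<omega> \<in> space M" for \<omega>
  proof -
    have c: "Q \<omega> \<in> carrier_mat r c" by (rule rv_mat_carrier[OF Q that])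
    have "(Q \<omega> * (Q \<omega>)\<^sup>T) $$ (i, j) = (\<Sum>l<c. Q \<omega> $$ (i, l) * (Q \<omega>)\<^sup>T $$ (l, j))"
      by (rule mult_mat_entry) (use c ij in auto)
    also have "\<dots> = (\<Sum>l<c. Q \<omega> $$ (i, l) * Q \<omega> $$ (j, l))" using c ij by (intro sum.cong refl) simp
    finally show ?thesis .
  qed
  ultimately show ?thesis by (subst measurable_cong) auto
qed

lemma measurable_mode_prods:
  assumes Q: "\<And>k. k \<in> {1..N} \<Longrightarrow> Q k \<in> measurable M (mat_borel (I k) (\<mu> k))" and n: "n \<le> N" and i: "i \<in> multi_idx I N"
  shows "(\<lambda>\<omega>. mode_prods n A (\<lambda>k. Q k \<omega> * (Q k \<omega>)\<^sup>T) i) \<in> borel_measurable M"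
  using n i
proof (induction n arbitrary: i)
  case 0
  show ?case by (simp add: mode_prods_def)
next
  case (Suc n)
  let ?k = "Suc n"
  have k: "?k \<in> {1..N}" using Suc.prems by simp
  have ik: "i ?k < I ?k" using Suc.prems(2) k by (auto simp: multi_idx_def PiE_iff)
  have upd: "i(?k := l) \<in> multi_idx I N" if "l \<in> {..<I ?k}" for l
    using Suc.prems(2) k that by (auto simp: multi_idx_def PiE_iff extensional_def)
  have "(\<lambda>\<omega>. \<Sum>l<I ?k. mode_prods n A (\<lambda>k. Q k \<omega> * (Q k \<omega>)\<^sup>T) (i(?k := l)) * (Q ?k \<omega> * (Q ?k \<omega>)\<^sup>T) $$ (i ?k, l))
    \<in> borel_measurable M"
    by (intro borel_measurable_sum borel_measurable_times Suc.IH measurable_projector_entry[OF Q[OF k] ik] upd)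
      (use Suc.prems in auto)
  moreover have "mode_prods ?k A (\<lambda>k. Q k \<omega> * (Q k \<omega>)\<^sup>T) i
    = (\<Sum>l<I ?k. mode_prods n A (\<lambda>k. Q k \<omega> * (Q k \<omega>)\<^sup>T) (i(?k := l)) * (Q ?k \<omega> * (Q ?k \<omega>)\<^sup>T) $$ (i ?k, l))"
    if "\<omega> \<in> space M" for \<omega>
  proof -
    have "dim_col (Q ?k \<omega> * (Q ?k \<omega>)\<^sup>T) = I ?k" using rv_mat_carrier[OF Q[OF k] that] by simp
    then show ?thesis by (simp add: mode_prods_def mode_prod_def del: index_mult_mat)
  qed
  ultimately show ?case by (subst measurable_cong) auto
qed

lemma measurable_tensor_error:
  assumes Q: "\<And>k. k \<in> {1..N} \<Longrightarrow> Q k \<in> measurable M (mat_borel (I k) (\<mu> k))"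
  shows "(\<lambda>\<omega>. (tensor_norm I N (\<lambda>i. A i - mode_prods N A (\<lambda>k. Q k \<omega> * (Q k \<omega>)\<^sup>T) i))\<^sup>2) \<in> borel_measurable M"
proof -
  have "(\<lambda>\<omega>. \<Sum>i\<in>multi_idx I N. (A i - mode_prods N A (\<lambda>k. Q k \<omega> * (Q k \<omega>)\<^sup>T) i)\<^sup>2) \<in> borel_measurable M"
    by (intro borel_measurable_sum borel_measurable_power borel_measurable_diff borel_measurable_const
        measurable_mode_prods[OF Q]) auto
  moreover have "(tensor_norm I N B)\<^sup>2 = (\<Sum>i\<in>multi_idx I N. (B i)\<^sup>2)" for B
    unfolding tensor_norm_def by (rule real_sqrt_pow2) (simp add: sum_nonneg)
  ultimately show ?thesis by simp
qed

lemma measurable_finner_resid: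
  assumes Q: "Q \<in> measurable M (mat_borel r c)" and X: "X \<in> carrier_mat r k"
  shows "(\<lambda>\<omega>. finner (resid (Q \<omega>) X) (resid (Q \<omega>) X)) \<in> borel_measurable M"
proof -
  \<comment> \<open>The projection is regrouped as \<open>(Q Q\<^sup>T) X\<close>, so that
    measurability of the projector entries can be reused.\<close>
  let ?e = "\<lambda>\<omega> i j. X $$ (i, j) - (\<Sum>l<r. (Q \<omega> * (Q \<omega>)\<^sup>T) $$ (i, l) * X $$ (l, j))"
  have "(\<lambda>\<omega>. \<Sum>i<r. \<Sum>j<k. ?e \<omega> i j * ?e \<omega> i j) \<in> borel_measurable M"
    by (intro borel_measurable_sum borel_measurable_times borel_measurable_diff borel_measurable_const
        measurable_projector_entry[OF Q]) auto
  moreover have "finner (resid (Q \<omega>) X) (resid (Q \<omega>) X) = (\<Sum>i<r. \<Sum>j<k. ?e \<omega> i j * ?e \<omega> i j)"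
    if "\<omega> \<in> space M" for \<omega>
  proof -
    have c: "Q \<omega> \<in> carrier_mat r c" by (rule rv_mat_carrier[OF Q that])
    then have cc: "Q \<omega> * (Q \<omega>)\<^sup>T \<in> carrier_mat r r" by simp
    have "Q \<omega> * ((Q \<omega>)\<^sup>T * X) = (Q \<omega> * (Q \<omega>)\<^sup>T) * X"
      by (rule assoc_mult_mat[symmetric]) (use c X in auto)
    then have R: "resid (Q \<omega>) X = X - (Q \<omega> * (Q \<omega>)\<^sup>T) * X" by (simp only: resid_def)
    have "resid (Q \<omega>) X $$ (i, j) = ?e \<omega> i j" if "i < r" "j < k" for i j
    proof -
      have "((Q \<omega> * (Q \<omega>)\<^sup>T) * X) $$ (i, j) = (\<Sum>l<r. (Q \<omega> * (Q \<omega>)\<^sup>T) $$ (i, l) * X $$ (l, j))"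
        by (rule mult_mat_entry[OF cc X that])
      then show ?thesis unfolding R using that X cc c by (simp del: index_mult_mat(1) assoc_mult_mat)
    qed
    then show ?thesis using resid_carrier[OF c X] by (simp add: finner_def)
  qed
  ultimately show ?thesis by (subst measurable_cong) auto
qed

section \<open>Second moments of importance sampling\<close>

text \<open>Formulated with level sets, so that \<open>X\<close> may be an index, a pair of indices
  or a matrix, without a sigma-algebra on its values.\<close>

lemma (in prob_space) expectation_finite_range:
  fixes h :: "'b \<Rightarrow> real"
  assumes R: "finite R" "\<And>\<omega>. \<omega> \<in> space M \<Longrightarrow> X \<omega> \<in> R"
    and X: "\<And>x. x \<in> R \<Longrightarrow> {\<omega> \<in> space M. X \<omega> = x} \<in> sets M"
  shows "integrable M (\<lambda>\<omega>. h (X \<omega>))"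
    and "(\<integral>\<omega>. h (X \<omega>) \<partial>M) = (\<Sum>x\<in>R. measure M {\<omega> \<in> space M. X \<omega> = x} * h x)"
proof -
  let ?f = "\<lambda>\<omega>. \<Sum>x\<in>R. indicat_real {\<omega> \<in> space M. X \<omega> = x} \<omega> * h x"
  have eq: "h (X \<omega>) = ?f \<omega>" if "\<omega> \<in> space M" for \<omega>
  proof -
    have "?f \<omega> = (\<Sum>x\<in>R. if x = X \<omega> then h x else 0)"
      using that by (intro sum.cong refl) (auto simp: indicator_def)
    also have "\<dots> = h (X \<omega>)" using R(2)[OF that] by (simp add: sum.delta[OF R(1)])
    finally show ?thesis by (rule sym)
  qed
  have int1: "integrable M (\<lambda>\<omega>. indicat_real {\<omega> \<in> space M. X \<omega> = x} \<omega> * h x)" if "x \<in> R" for x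
    by (rule integrable_mult_left, rule integrable_real_indicator[OF X[OF that]]) (simp add: emeasure_eq_measure)
  have int: "integrable M ?f" by (rule Bochner_Integration.integrable_sum[OF int1])
  have "integrable M (\<lambda>\<omega>. h (X \<omega>)) \<longleftrightarrow> integrable M ?f"
    by (rule Bochner_Integration.integrable_cong[OF refl eq])
  then show "integrable M (\<lambda>\<omega>. h (X \<omega>))" using int by (rule iffD2)
  have "(\<integral>\<omega>. h (X \<omega>) \<partial>M) = (\<integral>\<omega>. ?f \<omega> \<partial>M)" by (rule Bochner_Integration.integral_cong[OF refl eq])
  also have "\<dots> = (\<Sum>x\<in>R. \<integral>\<omega>. indicat_real {\<omega> \<in> space M. X \<omega> = x} \<omega> * h x \<partial>M)"
    by (rule Bochner_Integration.integral_sum[OF int1])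
  also have "\<dots> = (\<Sum>x\<in>R. measure M {\<omega> \<in> space M. X \<omega> = x} * h x)"
  proof (rule sum.cong[OF refl])
    fix x assume x: "x \<in> R"
    have "{\<omega> \<in> space M. X \<omega> = x} \<inter> space M = {\<omega> \<in> space M. X \<omega> = x}" by blast
    then show "(\<integral>\<omega>. indicat_real {\<omega> \<in> space M. X \<omega> = x} \<omega> * h x \<partial>M) = measure M {\<omega> \<in> space M. X \<omega> = x} * h x"
      by (simp del: integral_mult_left_zero add: Bochner_Integration.integral_mult_left_zero integral_indicator)
  qed
  finally show "(\<integral>\<omega>. h (X \<omega>) \<partial>M) = (\<Sum>x\<in>R. measure M {\<omega> \<in> space M. X \<omega> = x} * h x)" .
qed

text \<open>The estimator is the mean of \<open>L\<close> independent copies of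
  \<open>f / p\<close>, whose mean is the sum of \<open>f\<close>; its variance is
  \<open>1 / L\<close> times a single variance, which is bounded by the second moment. The
  hypothesis on \<open>f\<close> covers indices of probability 0, where the quotient by
  \<open>p i\<close> has the value 0.\<close>

lemma (in prob_space) importance_sampling_variance:
  fixes f p :: "nat \<Rightarrow> real" and L :: nat
  assumes ind: "indep_vars (\<lambda>_. count_space {..<J}) \<xi> {..<L}"
    and prb: "\<And>j i. j < L \<Longrightarrow> i < J \<Longrightarrow> measure M {\<omega> \<in> space M. \<xi> j \<omega> = i} = p i"
    and p: "prob_vector J p" and L: "1 \<le> L"
    and f: "\<And>i. i < J \<Longrightarrow> p i = 0 \<Longrightarrow> f i = 0"
  shows "(\<integral>\<omega>. ((\<Sum>j<L. f (\<xi> j \<omega>) / (L * p (\<xi> j \<omega>))) - (\<Sum>i<J. f i))\<^sup>2 \<partial>M) \<le> (\<Sum>i<J. (f i)\<^sup>2 / p i) / L"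
proof -
  define m where "m = (\<Sum>i<J. f i)"
  define g where "g i = f i / p i - m" for i
  have p1: "(\<Sum>i<J. p i) = 1" using p by (simp add: prob_vector_def)
  have rv: "\<xi> j \<in> measurable M (count_space {..<J})" if "j < L" for j
    using ind that by (auto simp: indep_vars_def)
  have \<xi>: "\<xi> j \<omega> \<in> {..<J}" if "j < L" "\<omega> \<in> space M" for j \<omega>
    using measurable_space[OF rv[OF that(1)] that(2)] by simp
  have ev: "{\<omega> \<in> space M. \<xi> j \<omega> = i} \<in> sets M" if "j < L" "i < J" for j i
  proof -
    have "\<xi> j -` {i} \<inter> space M \<in> sets M" by (rule measurable_sets[OF rv[OF that(1)]]) (use that in simp)
    moreover have "\<xi> j -` {i} \<inter> space M = {\<omega> \<in> space M. \<xi> j \<omega> = i}" by blast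
    ultimately show ?thesis by simp
  qed
  have pg: "p i * g i = f i - p i * m" if "i < J" for i
    using f[OF that] by (cases "p i = 0") (simp_all add: g_def field_simps)
  have g0: "(\<Sum>i<J. p i * g i) = 0"
  proof -
    have "(\<Sum>i<J. p i * g i) = (\<Sum>i<J. f i - p i * m)" by (rule sum.cong[OF refl pg]) simp
    also have "\<dots> = m - (\<Sum>i<J. p i) * m" by (simp add: sum_subtractf m_def sum_distrib_right)
    finally show ?thesis by (simp add: p1)
  qed
  have pgg: "p i * (g i)\<^sup>2 = (f i)\<^sup>2 / p i - 2 * m * f i + m\<^sup>2 * p i" if "i < J" for i
    using f[OF that] by (cases "p i = 0") (simp_all add: g_def field_simps power2_eq_square)
  have g2: "(\<Sum>i<J. p i * (g i)\<^sup>2) \<le> (\<Sum>i<J. (f i)\<^sup>2 / p i)"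
  proof -
    have "(\<Sum>i<J. p i * (g i)\<^sup>2) = (\<Sum>i<J. (f i)\<^sup>2 / p i - 2 * m * f i + m\<^sup>2 * p i)"
      by (rule sum.cong[OF refl pgg]) simp
    also have "\<dots> = (\<Sum>i<J. (f i)\<^sup>2 / p i) - 2 * m * m + m\<^sup>2"
      by (simp only: sum.distrib sum_subtractf sum_distrib_left[symmetric] m_def[symmetric] p1 mult_1_right)
    finally show ?thesis by (simp add: power2_eq_square)
  qed
  \<comment> \<open>For \<open>j = k\<close> this is the single variance; for
    \<open>j \<noteq> k\<close> independence factors the expectation into two means of the centred
    \<open>g\<close>, which are 0.\<close>
  have pair: "integrable M (\<lambda>\<omega>. g (\<xi> j \<omega>) * g (\<xi> k \<omega>)) \<and>
      (\<integral>\<omega>. g (\<xi> j \<omega>) * g (\<xi> k \<omega>) \<partial>M) \<le> (if j = k then \<Sum>i<J. p i * (g i)\<^sup>2 else 0)" if jk: "j < L" "k < L" for j k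
  proof (cases "j = k")
    case True
    show ?thesis
      using expectation_finite_range[of "{..<J}" "\<xi> j" "\<lambda>i. g i * g i"] \<xi>[OF jk(1)] ev[OF jk(1)] prb[OF jk(1)] True
      by (simp add: power2_eq_square)
  next
    case False
    have ev2: "{\<omega> \<in> space M. (\<xi> j \<omega>, \<xi> k \<omega>) = (a, b)} \<in> sets M" if "a < J" "b < J" for a b
    proof -
      have "{\<omega> \<in> space M. (\<xi> j \<omega>, \<xi> k \<omega>) = (a, b)} = {\<omega> \<in> space M. \<xi> j \<omega> = a} \<inter> {\<omega> \<in> space M. \<xi> k \<omega> = b}" by blast
      then show ?thesis using ev jk that by simp
    qed
    have joint: "measure M {\<omega> \<in> space M. (\<xi> j \<omega>, \<xi> k \<omega>) = (a, b)} = p a * p b" if ab: "a < J" "b < J" for a b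
    proof -
      let ?A = "\<lambda>l. if l = j then {a} else {b}"
      have "measure M (\<Inter>l\<in>{j, k}. \<xi> l -` ?A l \<inter> space M) = (\<Prod>l\<in>{j, k}. measure M (\<xi> l -` ?A l \<inter> space M))"
        by (rule indep_varsD[OF ind]) (use jk ab in auto)
      also have "\<dots> = measure M (\<xi> j -` {a} \<inter> space M) * measure M (\<xi> k -` {b} \<inter> space M)"
        using False by simp
      also have "\<xi> j -` {a} \<inter> space M = {\<omega> \<in> space M. \<xi> j \<omega> = a}" by blast
      also have "\<xi> k -` {b} \<inter> space M = {\<omega> \<in> space M. \<xi> k \<omega> = b}" by blast
      also have "(\<Inter>l\<in>{j, k}. \<xi> l -` ?A l \<inter> space M) = {\<omega> \<in> space M. (\<xi> j \<omega>, \<xi> k \<omega>) = (a, b)}"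
        using False by auto
      finally show ?thesis using prb jk ab by simp
    qed
    let ?h = "\<lambda>ab :: nat \<times> nat. g (fst ab) * g (snd ab)"
    note E = expectation_finite_range[of "{..<J} \<times> {..<J}" "\<lambda>\<omega>. (\<xi> j \<omega>, \<xi> k \<omega>)" ?h]
    have R: "(\<xi> j \<omega>, \<xi> k \<omega>) \<in> {..<J} \<times> {..<J}" if "\<omega> \<in> space M" for \<omega> using \<xi> jk that by simp
    have ev3: "{\<omega> \<in> space M. (\<xi> j \<omega>, \<xi> k \<omega>) = x} \<in> sets M" if "x \<in> {..<J} \<times> {..<J}" for x
      using that ev2[of "fst x" "snd x"] by (simp add: mem_Times_iff)
    have int: "integrable M (\<lambda>\<omega>. g (\<xi> j \<omega>) * g (\<xi> k \<omega>))"
      using E(1)[OF _ R ev3] by simp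
    have "(\<integral>\<omega>. g (\<xi> j \<omega>) * g (\<xi> k \<omega>) \<partial>M)
      = (\<Sum>x\<in>{..<J} \<times> {..<J}. measure M {\<omega> \<in> space M. (\<xi> j \<omega>, \<xi> k \<omega>) = x} * ?h x)"
      using E(2)[OF _ R ev3] by simp
    also have "\<dots> = (\<Sum>a<J. \<Sum>b<J. measure M {\<omega> \<in> space M. (\<xi> j \<omega>, \<xi> k \<omega>) = (a, b)} * (g a * g b))"
      by (simp only: sum.cartesian_product' fst_conv snd_conv)
    also have "\<dots> = (\<Sum>a<J. \<Sum>b<J. (p a * g a) * (p b * g b))"
      by (intro sum.cong refl) (simp only: joint lessThan_iff mult_ac)
    also have "\<dots> = (\<Sum>a<J. p a * g a) * (\<Sum>b<J. p b * g b)" by (simp only: sum_product)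
    finally show ?thesis using int False g0 by simp
  qed
  have scaled: "(\<Sum>j<L. f (\<xi> j \<omega>) / (L * p (\<xi> j \<omega>))) - m = (\<Sum>j<L. g (\<xi> j \<omega>)) / L" for \<omega>
    using L by (simp add: g_def sum_subtractf sum_divide_distrib diff_divide_distrib mult.commute)
  have sq: "((\<Sum>j<L. f (\<xi> j \<omega>) / (L * p (\<xi> j \<omega>))) - m)\<^sup>2 = (\<Sum>j<L. \<Sum>k<L. g (\<xi> j \<omega>) * g (\<xi> k \<omega>)) / (real L)\<^sup>2" for \<omega>
    by (simp only: scaled power_divide) (simp only: power2_eq_square sum_product)
  have "(\<integral>\<omega>. ((\<Sum>j<L. f (\<xi> j \<omega>) / (L * p (\<xi> j \<omega>))) - m)\<^sup>2 \<partial>M)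
    = (\<integral>\<omega>. (\<Sum>j<L. \<Sum>k<L. g (\<xi> j \<omega>) * g (\<xi> k \<omega>)) \<partial>M) / (real L)\<^sup>2"
    unfolding sq by (rule integral_divide_zero)
  also have "(\<integral>\<omega>. (\<Sum>j<L. \<Sum>k<L. g (\<xi> j \<omega>) * g (\<xi> k \<omega>)) \<partial>M)
    = (\<Sum>j<L. \<integral>\<omega>. (\<Sum>k<L. g (\<xi> j \<omega>) * g (\<xi> k \<omega>)) \<partial>M)"
    by (rule Bochner_Integration.integral_sum, rule Bochner_Integration.integrable_sum) (use pair in simp)
  also have "\<dots> = (\<Sum>j<L. \<Sum>k<L. \<integral>\<omega>. g (\<xi> j \<omega>) * g (\<xi> k \<omega>) \<partial>M)"
    by (rule sum.cong[OF refl], rule Bochner_Integration.integral_sum) (use pair in simp)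
  also have "\<dots> \<le> (\<Sum>j<L. \<Sum>k<L. if j = k then \<Sum>i<J. p i * (g i)\<^sup>2 else 0)"
    by (rule sum_mono, rule sum_mono) (use pair in simp)
  also have "\<dots> = L * (\<Sum>i<J. p i * (g i)\<^sup>2)" by simp
  also have "\<dots> \<le> L * (\<Sum>i<J. (f i)\<^sup>2 / p i)" by (rule mult_left_mono[OF g2]) simp
  finally show ?thesis using L by (simp add: m_def divide_right_mono power2_eq_square)
qed

text \<open>A sampling matrix is a function of the \<open>L\<close> drawn indices, hence takes
  finitely many values; conditioning on \<open>S\<close> reduces to finite sums.\<close>

lemma randsample_simple:
  assumes M: "prob_space M" and S: "randsample M J L p S"
  shows "finite (S ` space M)" "\<And>s. s \<in> S ` space M \<Longrightarrow> s \<in> carrier_mat J L"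
    "\<And>s. {\<omega> \<in> space M. S \<omega> = s} \<in> sets M"
proof -
  interpret prob_space M by (rule M)
  obtain \<xi> :: "nat \<Rightarrow> 'a \<Rightarrow> nat" where ind: "indep_vars (\<lambda>_. count_space {..<J}) \<xi> {..<L}"
    and S: "\<And>\<omega>. \<omega> \<in> space M \<Longrightarrow> S \<omega> = Matrix.mat J L (\<lambda>(i, j). if \<xi> j \<omega> = i then 1 / sqrt (real L * p i) else 0)"
    using S unfolding randsample_def by blast
  have rv: "\<xi> j \<in> measurable M (count_space {..<J})" if "j < L" for j
    using ind that by (auto simp: indep_vars_def)
  define F where "F x = Matrix.mat J L (\<lambda>(i, j). if x j = i then 1 / sqrt (real L * p i) else 0)" for x :: "nat \<Rightarrow> nat"
  define X where "X \<omega> = (\<lambda>j\<in>{..<L}. \<xi> j \<omega>)" for \<omega>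
  have SF: "S \<omega> = F (X \<omega>)" if "\<omega> \<in> space M" for \<omega>
    unfolding S[OF that] F_def X_def by (rule cong_mat) auto
  have X: "X \<omega> \<in> PiE {..<L} (\<lambda>_. {..<J})" if "\<omega> \<in> space M" for \<omega>
    unfolding X_def
  proof (rule PiE_I)
    fix j assume j: "j \<in> {..<L}"
    then have "\<xi> j \<omega> \<in> {..<J}" using measurable_space[OF rv[of j] that] by simp
    then show "(\<lambda>j\<in>{..<L}. \<xi> j \<omega>) j \<in> {..<J}" using j by simp
  qed simp
  have fin: "finite (PiE {..<L} (\<lambda>_. {..<J}))" by (rule finite_PiE) auto
  have sub: "S ` space M \<subseteq> F ` PiE {..<L} (\<lambda>_. {..<J})" using SF X by blast
  show "finite (S ` space M)" by (rule finite_subset[OF sub]) (use fin in simp)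
  show "s \<in> carrier_mat J L" if "s \<in> S ` space M" for s using that S by auto
  have evX: "{\<omega> \<in> space M. X \<omega> = x} \<in> sets M" if x: "x \<in> PiE {..<L} (\<lambda>_. {..<J})" for x
  proof -
    have "{\<omega> \<in> space M. X \<omega> = x} = {\<omega> \<in> space M. \<forall>j\<in>{..<L}. \<xi> j \<omega> = x j}"
    proof (rule Collect_cong, rule conj_cong[OF refl])
      fix \<omega>
      show "X \<omega> = x \<longleftrightarrow> (\<forall>j\<in>{..<L}. \<xi> j \<omega> = x j)"
      proof
        assume "X \<omega> = x" then show "\<forall>j\<in>{..<L}. \<xi> j \<omega> = x j" by (auto simp: X_def)
      next
        assume a: "\<forall>j\<in>{..<L}. \<xi> j \<omega> = x j"
        show "X \<omega> = x" unfolding X_def by (rule extensionalityI[of _ "{..<L}"]) (use x a in \<open>auto simp: PiE_iff\<close>)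
      qed
    qed
    also have "\<dots> \<in> sets M"
    proof (rule sets.sets_Collect_finite_All)
      fix j assume j: "j \<in> {..<L}"
      have "\<xi> j -` {x j} \<inter> space M \<in> sets M"
        by (rule measurable_sets[OF rv]) (use j x in \<open>auto simp: PiE_iff\<close>)
      moreover have "\<xi> j -` {x j} \<inter> space M = {\<omega> \<in> space M. \<xi> j \<omega> = x j}" by blast
      ultimately show "{\<omega> \<in> space M. \<xi> j \<omega> = x j} \<in> sets M" by simp
    qed simp
    finally show ?thesis .
  qed
  show "{\<omega> \<in> space M. S \<omega> = s} \<in> sets M" for s
  proof -
    have "{\<omega> \<in> space M. S \<omega> = s} = (\<Union>x\<in>{x \<in> PiE {..<L} (\<lambda>_. {..<J}). F x = s}. {\<omega> \<in> space M. X \<omega> = x})"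
      using SF X by auto
    also have "\<dots> \<in> sets M" by (rule sets.finite_UN) (use fin evX in auto)
    finally show ?thesis .
  qed
qed

text \<open>The entries of the sampled Gram matrix and the squared norm of \<open>Y S\<close> are
  importance-sampling estimators, so the variance bound leads to sums of
  \<open>c i * c i / p i\<close> with \<open>c i\<close> a squared column length; near-optimality
  bounds \<open>c i / p i\<close> by the squared norm of \<open>X\<close> over
  \<open>\<beta>\<close>. In the second part the probabilities are adapted to \<open>X\<close>, and
  the column condition lets them serve for \<open>Y\<close> as well.\<close>

lemma randsample_moments:
  assumes M: "prob_space M" and S: "randsample M J L p S" and p: "prob_vector J p" and L: "1 \<le> L"
    and X: "X \<in> carrier_mat n J" and X0: "0 < finner X X"
    and \<beta>: "0 < \<beta>" and opt: "nearly_optimal \<beta> X p"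
  shows "(\<Sum>s\<in>S ` space M. measure M {\<omega> \<in> space M. S \<omega> = s} *
      finner (X * X\<^sup>T - (X * s) * (X * s)\<^sup>T) (X * X\<^sup>T - (X * s) * (X * s)\<^sup>T)) \<le> (finner X X)\<^sup>2 / (\<beta> * L)"
    and "\<And>Y. Y \<in> carrier_mat n J \<Longrightarrow> (\<And>i. i < J \<Longrightarrow> (\<Sum>a<n. (Y $$ (a, i))\<^sup>2) \<le> (\<Sum>a<n. (X $$ (a, i))\<^sup>2)) \<Longrightarrow>
      (\<Sum>s\<in>S ` space M. measure M {\<omega> \<in> space M. S \<omega> = s} * (finner (Y * s) (Y * s) - finner Y Y)\<^sup>2)
        \<le> finner Y Y * finner X X / (\<beta> * L)"
proof -
  interpret prob_space M by (rule M)
  obtain \<xi> :: "nat \<Rightarrow> 'a \<Rightarrow> nat" where ind: "indep_vars (\<lambda>_. count_space {..<J}) \<xi> {..<L}"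
    and prb: "\<And>j i. j < L \<Longrightarrow> i < J \<Longrightarrow> measure M {\<omega> \<in> space M. \<xi> j \<omega> = i} = p i"
    and S': "\<And>\<omega>. \<omega> \<in> space M \<Longrightarrow> S \<omega> = Matrix.mat J L (\<lambda>(i, j). if \<xi> j \<omega> = i then 1 / sqrt (real L * p i) else 0)"
    using S unfolding randsample_def by blast
  note simp = randsample_simple[OF M S]
  have rv: "\<xi> j \<in> measurable M (count_space {..<J})" if "j < L" for j
    using ind that by (auto simp: indep_vars_def)
  have \<xi>: "\<xi> j \<omega> < J" if "j < L" "\<omega> \<in> space M" for j \<omega>
    using measurable_space[OF rv[OF that(1)] that(2)] by simp
  define W where "W = finner X X"
  define c where "c i = (\<Sum>a<n. (X $$ (a, i))\<^sup>2)" for i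
  have W0: "0 < W" using X0 by (simp add: W_def)
  have p0: "0 \<le> p i" if "i < J" for i using p that by (simp add: prob_vector_def)
  have cp: "c i \<le> p i * W / \<beta>" if "i < J" for i
  proof -
    have "\<beta> * c i / W \<le> p i"
      using opt X that by (simp add: nearly_optimal_def c_def W_def frob_norm_power2)
    then show ?thesis using W0 \<beta> by (simp add: field_simps)
  qed
  have cW: "(\<Sum>i<J. c i) = W"
  proof -
    have "(\<Sum>i<J. c i) = (\<Sum>a<n. \<Sum>i<J. (X $$ (a, i))\<^sup>2)" unfolding c_def by (rule sum.swap)
    then show ?thesis using X by (simp add: W_def finner_def power2_eq_square)
  qed
  have c0: "0 \<le> c i" for i unfolding c_def by (rule sum_nonneg) simp
  have ent: "(Y * S \<omega>) $$ (a, j) = Y $$ (a, \<xi> j \<omega>) / sqrt (real L * p (\<xi> j \<omega>))"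
    if Y: "Y \<in> carrier_mat n J" and a: "a < n" and j: "j < L" and w: "\<omega> \<in> space M" for Y a j \<omega>
  proof -
    have Sc: "S \<omega> \<in> carrier_mat J L" by (rule simp(2)) (use w in simp)
    have "(Y * S \<omega>) $$ (a, j) = (\<Sum>i<J. Y $$ (a, i) * S \<omega> $$ (i, j))" by (rule mult_mat_entry[OF Y Sc a j])
    also have "\<dots> = (\<Sum>i<J. if i = \<xi> j \<omega> then Y $$ (a, i) / sqrt (real L * p i) else 0)"
      by (rule sum.cong[OF refl]) (use j in \<open>simp add: S'[OF w]\<close>)
    also have "\<dots> = Y $$ (a, \<xi> j \<omega>) / sqrt (real L * p (\<xi> j \<omega>))" using \<xi>[OF j w] by simp
    finally show ?thesis .
  qed
  have prod: "(u / sqrt (real L * p i)) * (v / sqrt (real L * p i)) = u * v / (L * p i)" if "i < J" for u v i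
    using p0[OF that] L by simp
  \<comment> \<open>Near-optimality forces columns of probability 0 to vanish, as the variance bound
    requires.\<close>
  have supp: "c i = 0" if "i < J" "p i = 0" for i using cp[OF that(1)] c0[of i] that(2) by simp
  have suppX: "X $$ (a, i) = 0" if "i < J" "p i = 0" "a < n" for a i
    using supp[OF that(1,2)] that(3) by (simp add: c_def sum_nonneg_eq_0_iff)
  have range: "S \<omega> \<in> S ` space M" if "\<omega> \<in> space M" for \<omega> using that by simp
  have E: "(\<Sum>s\<in>S ` space M. measure M {\<omega> \<in> space M. S \<omega> = s} * h s) = (\<integral>\<omega>. h (S \<omega>) \<partial>M)"
    "integrable M (\<lambda>\<omega>. h (S \<omega>))" for h :: "real mat \<Rightarrow> real"
    using expectation_finite_range[of "S ` space M" S h, OF simp(1) range simp(3)] by simp_all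
  have gram: "((X * S \<omega>) * (X * S \<omega>)\<^sup>T) $$ (a, b)
      = (\<Sum>j<L. (X $$ (a, \<xi> j \<omega>) * X $$ (b, \<xi> j \<omega>)) / (L * p (\<xi> j \<omega>)))"
    if w: "\<omega> \<in> space M" and ab: "a < n" "b < n" for \<omega> a b
  proof -
    have Sc: "S \<omega> \<in> carrier_mat J L" by (rule simp(2)) (use w in simp)
    have XS: "X * S \<omega> \<in> carrier_mat n L" by (rule mult_carrier_mat[OF X Sc])
    have "((X * S \<omega>) * (X * S \<omega>)\<^sup>T) $$ (a, b) = (\<Sum>j<L. (X * S \<omega>) $$ (a, j) * (X * S \<omega>)\<^sup>T $$ (j, b))"
      by (rule mult_mat_entry[OF XS _ ab]) (use XS in simp)
    also have "\<dots> = (\<Sum>j<L. (X * S \<omega>) $$ (a, j) * (X * S \<omega>) $$ (b, j))"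
      by (rule sum.cong[OF refl]) (use ab Sc X in \<open>simp del: index_mult_mat(1)\<close>)
    also have "\<dots> = (\<Sum>j<L. (X $$ (a, \<xi> j \<omega>) * X $$ (b, \<xi> j \<omega>)) / (L * p (\<xi> j \<omega>)))"
      by (rule sum.cong[OF refl]) (use ent[OF X] ab w prod \<xi> in \<open>simp del: index_mult_mat(1)\<close>)
    finally show ?thesis .
  qed
  let ?E = "\<lambda>s. X * X\<^sup>T - (X * s) * (X * s)\<^sup>T"
  have Eent: "?E (S \<omega>) $$ (a, b) = - ((\<Sum>j<L. (X $$ (a, \<xi> j \<omega>) * X $$ (b, \<xi> j \<omega>)) / (L * p (\<xi> j \<omega>)))
      - (\<Sum>i<J. X $$ (a, i) * X $$ (b, i)))" if w: "\<omega> \<in> space M" and ab: "a < n" "b < n" for \<omega> a b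
  proof -
    have "(X * X\<^sup>T) $$ (a, b) = (\<Sum>i<J. X $$ (a, i) * X\<^sup>T $$ (i, b))"
      by (rule mult_mat_entry[OF X _ ab]) (use X in simp)
    also have "\<dots> = (\<Sum>i<J. X $$ (a, i) * X $$ (b, i))" by (rule sum.cong[OF refl]) (use X ab in simp)
    finally have XX: "(X * X\<^sup>T) $$ (a, b) = (\<Sum>i<J. X $$ (a, i) * X $$ (b, i))" .
    have "?E (S \<omega>) $$ (a, b) = (X * X\<^sup>T) $$ (a, b) - ((X * S \<omega>) * (X * S \<omega>)\<^sup>T) $$ (a, b)"
      by (rule index_minus_mat(1)) (use X ab in auto)
    then show ?thesis unfolding XX gram[OF w ab] by simp
  qed
  have fE: "finner (?E (S \<omega>)) (?E (S \<omega>)) = (\<Sum>a<n. \<Sum>b<n. (?E (S \<omega>) $$ (a, b))\<^sup>2)" for \<omega>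
    unfolding finner_def using X by (simp del: index_mult_mat(1) index_minus_mat(1) add: power2_eq_square)
  have "(\<Sum>s\<in>S ` space M. measure M {\<omega> \<in> space M. S \<omega> = s} * finner (?E s) (?E s))
    = (\<integral>\<omega>. finner (?E (S \<omega>)) (?E (S \<omega>)) \<partial>M)" by (rule E(1))
  also have "\<dots> = (\<integral>\<omega>. (\<Sum>a<n. \<Sum>b<n. (?E (S \<omega>) $$ (a, b))\<^sup>2) \<partial>M)" unfolding fE ..
  also have "\<dots> = (\<Sum>a<n. \<integral>\<omega>. (\<Sum>b<n. (?E (S \<omega>) $$ (a, b))\<^sup>2) \<partial>M)"
    by (rule Bochner_Integration.integral_sum) (rule E(2))
  also have "\<dots> = (\<Sum>a<n. \<Sum>b<n. \<integral>\<omega>. (?E (S \<omega>) $$ (a, b))\<^sup>2 \<partial>M)"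
    by (rule sum.cong[OF refl], rule Bochner_Integration.integral_sum) (rule E(2))
  also have "\<dots> \<le> (\<Sum>a<n. \<Sum>b<n. (\<Sum>i<J. (X $$ (a, i) * X $$ (b, i))\<^sup>2 / p i) / L)"
  proof (rule sum_mono, rule sum_mono)
    fix a b assume "a \<in> {..<n}" "b \<in> {..<n}"
    then have ab: "a < n" "b < n" by auto
    have "(\<integral>\<omega>. (?E (S \<omega>) $$ (a, b))\<^sup>2 \<partial>M)
      = (\<integral>\<omega>. ((\<Sum>j<L. (X $$ (a, \<xi> j \<omega>) * X $$ (b, \<xi> j \<omega>)) / (L * p (\<xi> j \<omega>))) - (\<Sum>i<J. X $$ (a, i) * X $$ (b, i)))\<^sup>2 \<partial>M)"
      by (rule Bochner_Integration.integral_cong[OF refl]) (simp only: Eent[OF _ ab] power2_minus)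
    also have "\<dots> \<le> (\<Sum>i<J. (X $$ (a, i) * X $$ (b, i))\<^sup>2 / p i) / L"
      by (rule importance_sampling_variance[OF ind prb p L]) (use suppX ab in auto)
    finally show "(\<integral>\<omega>. (?E (S \<omega>) $$ (a, b))\<^sup>2 \<partial>M) \<le> (\<Sum>i<J. (X $$ (a, i) * X $$ (b, i))\<^sup>2 / p i) / L" .
  qed
  also have "\<dots> = (\<Sum>a<n. \<Sum>b<n. \<Sum>i<J. (X $$ (a, i))\<^sup>2 * (X $$ (b, i))\<^sup>2 / p i) / L"
    by (simp only: sum_divide_distrib power_mult_distrib)
  also have "(\<Sum>a<n. \<Sum>b<n. \<Sum>i<J. (X $$ (a, i))\<^sup>2 * (X $$ (b, i))\<^sup>2 / p i)
    = (\<Sum>a<n. \<Sum>i<J. \<Sum>b<n. (X $$ (a, i))\<^sup>2 * (X $$ (b, i))\<^sup>2 / p i)"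
    by (rule sum.cong[OF refl]) (rule sum.swap)
  also have "\<dots> = (\<Sum>i<J. \<Sum>a<n. \<Sum>b<n. (X $$ (a, i))\<^sup>2 * (X $$ (b, i))\<^sup>2 / p i)" by (rule sum.swap)
  also have "\<dots> = (\<Sum>i<J. c i * c i / p i)"
    by (rule sum.cong[OF refl]) (simp only: c_def sum_product sum_divide_distrib)
  also have "\<dots> \<le> (\<Sum>i<J. c i * (W / \<beta>))"
  proof (rule sum_mono)
    fix i assume "i \<in> {..<J}"
    then have i: "i < J" by simp
    show "c i * c i / p i \<le> c i * (W / \<beta>)"
    proof (cases "p i = 0")
      case False
      then have "c i / p i \<le> W / \<beta>" using cp[OF i] p0[OF i] by (simp add: field_simps)
      from mult_left_mono[OF this c0] show ?thesis by simp
    qed (use c0 W0 \<beta> in simp)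
  qed
  also have "\<dots> = W * (W / \<beta>)" by (simp only: sum_distrib_right[symmetric] cW)
  finally show "(\<Sum>s\<in>S ` space M. measure M {\<omega> \<in> space M. S \<omega> = s} * finner (?E s) (?E s)) \<le> (finner X X)\<^sup>2 / (\<beta> * L)"
    by (simp add: W_def power2_eq_square divide_right_mono)
  fix Y assume Y: "Y \<in> carrier_mat n J" and YX: "\<And>i. i < J \<Longrightarrow> (\<Sum>a<n. (Y $$ (a, i))\<^sup>2) \<le> (\<Sum>a<n. (X $$ (a, i))\<^sup>2)"
  define d where "d i = (\<Sum>a<n. (Y $$ (a, i))\<^sup>2)" for i
  have d0: "0 \<le> d i" for i unfolding d_def by (rule sum_nonneg) simp
  have dc: "d i \<le> c i" if "i < J" for i using YX[OF that] by (simp add: d_def c_def)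
  have dY: "(\<Sum>i<J. d i) = finner Y Y"
  proof -
    have "(\<Sum>i<J. d i) = (\<Sum>a<n. \<Sum>i<J. (Y $$ (a, i))\<^sup>2)" unfolding d_def by (rule sum.swap)
    then show ?thesis using Y by (simp add: finner_def power2_eq_square)
  qed
  have fY: "finner (Y * S \<omega>) (Y * S \<omega>) = (\<Sum>j<L. d (\<xi> j \<omega>) / (L * p (\<xi> j \<omega>)))" if w: "\<omega> \<in> space M" for \<omega>
  proof -
    have Sc: "S \<omega> \<in> carrier_mat J L" by (rule simp(2)) (use w in simp)
    have "finner (Y * S \<omega>) (Y * S \<omega>) = (\<Sum>a<n. \<Sum>j<L. (Y * S \<omega>) $$ (a, j) * (Y * S \<omega>) $$ (a, j))"
      unfolding finner_def using Y Sc by (simp del: index_mult_mat(1))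
    also have "\<dots> = (\<Sum>a<n. \<Sum>j<L. (Y $$ (a, \<xi> j \<omega>))\<^sup>2 / (L * p (\<xi> j \<omega>)))"
    proof (rule sum.cong[OF refl], rule sum.cong[OF refl])
      fix a j assume "a \<in> {..<n}" "j \<in> {..<L}"
      then have aj: "a < n" "j < L" by auto
      show "(Y * S \<omega>) $$ (a, j) * (Y * S \<omega>) $$ (a, j) = (Y $$ (a, \<xi> j \<omega>))\<^sup>2 / (L * p (\<xi> j \<omega>))"
        unfolding ent[OF Y aj w] power2_eq_square by (rule prod[OF \<xi>[OF aj(2) w]])
    qed
    also have "\<dots> = (\<Sum>j<L. \<Sum>a<n. (Y $$ (a, \<xi> j \<omega>))\<^sup>2 / (L * p (\<xi> j \<omega>)))" by (rule sum.swap)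
    also have "\<dots> = (\<Sum>j<L. d (\<xi> j \<omega>) / (L * p (\<xi> j \<omega>)))" by (simp only: d_def sum_divide_distrib)
    finally show ?thesis .
  qed
  have "(\<Sum>s\<in>S ` space M. measure M {\<omega> \<in> space M. S \<omega> = s} * (finner (Y * s) (Y * s) - finner Y Y)\<^sup>2)
    = (\<integral>\<omega>. (finner (Y * S \<omega>) (Y * S \<omega>) - finner Y Y)\<^sup>2 \<partial>M)" by (rule E(1))
  also have "\<dots> = (\<integral>\<omega>. ((\<Sum>j<L. d (\<xi> j \<omega>) / (L * p (\<xi> j \<omega>))) - (\<Sum>i<J. d i))\<^sup>2 \<partial>M)"
    by (rule Bochner_Integration.integral_cong[OF refl]) (simp only: fY dY)
  also have "\<dots> \<le> (\<Sum>i<J. (d i)\<^sup>2 / p i) / L"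
  proof (rule importance_sampling_variance[OF ind prb p L])
    show "d i = 0" if "i < J" "p i = 0" for i using dc[OF that(1)] d0[of i] supp[OF that] by simp
  qed auto
  also have "\<dots> \<le> (\<Sum>i<J. d i * (W / \<beta>)) / L"
  proof (rule divide_right_mono, rule sum_mono)
    fix i assume "i \<in> {..<J}"
    then have i: "i < J" by simp
    show "(d i)\<^sup>2 / p i \<le> d i * (W / \<beta>)"
    proof (cases "p i = 0")
      case False
      then have "0 < p i" using p0[OF i] by simp
      then have "d i / p i \<le> W / \<beta>"
        using order_trans[OF dc[OF i] cp[OF i]] by (simp add: pos_divide_le_eq mult.commute)
      from mult_left_mono[OF this d0] show ?thesis by (simp add: power2_eq_square)
    qed (use d0 W0 \<beta> in simp)
  qed simp
  also have "\<dots> = finner Y Y * finner X X / (\<beta> * L)"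
    by (simp only: sum_distrib_right[symmetric] dY W_def) simp
  finally show "(\<Sum>s\<in>S ` space M. measure M {\<omega> \<in> space M. S \<omega> = s} * (finner (Y * s) (Y * s) - finner Y Y)\<^sup>2)
        \<le> finner Y Y * finner X X / (\<beta> * L)" .
qed

section \<open>Numerical estimates\<close>

text \<open>Machin's formula \<open>pi / 4 = 4 * arctan (1/5) - arctan (1/239)\<close>, with the
  second term dropped and \<open>arctan x \<le> x\<close> in the first.\<close>

lemma pi_le_16_5: "pi \<le> 16 / 5"
proof -
  have "arctan (1/5 :: real) \<le> 1/5"
  proof -
    obtain z where "arctan (1/5) - arctan 0 = (1/5 - 0) * inverse (1 + z\<^sup>2)"
      using MVT2[of 0 "1/5 :: real" arctan "\<lambda>z. inverse (1 + z\<^sup>2)"] DERIV_arctan by auto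
    moreover have "inverse (1 + z\<^sup>2) \<le> 1" by (rule inverse_le_1_iff[THEN iffD2]) simp
    ultimately show ?thesis by simp
  qed
  moreover have "0 < arctan (1/239 :: real)" by simp
  ultimately show ?thesis using machin by linarith
qed

text \<open>Quadratic Taylor bound at \<open>1/4\<close>, raised to the fourth power: the fourth
  power of 1.28125 exceeds 2.69.\<close>

lemma exp_1_ge: "269 / 100 \<le> exp (1 :: real)"
proof -
  have "(1 + 1/4 + (1/4)\<^sup>2 / 2 :: real) ^ 4 \<le> exp (1/4) ^ 4"
    by (rule power_mono[OF exp_lower_Taylor_quadratic]) simp_all
  also have "exp (1/4 :: real) ^ 4 = exp 1" by (simp flip: exp_of_nat_mult)
  finally show ?thesis by (simp add: power2_eq_square eval_nat_numeral)
qed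

lemma exp_4_ge: "(52 :: real) \<le> exp 4"
proof -
  have "(52 :: real) \<le> (269 / 100) ^ 4" by (simp add: eval_nat_numeral)
  also have "\<dots> \<le> exp 1 ^ 4" by (rule power_mono[OF exp_1_ge]) simp
  also have "exp (1 :: real) ^ 4 = exp 4" by (simp flip: exp_of_nat_mult)
  finally show ?thesis .
qed

lemma powr_half_sqrt: "0 < x \<Longrightarrow> x powr (real n / 2) = sqrt (x ^ n)"
proof -
  assume x: "0 < x"
  have "x powr (real n / 2) = (x powr real n) powr (1/2)" by (simp add: powr_powr)
  then show ?thesis using x by (simp add: powr_realpow powr_half_sqrt)
qed

text \<open>The base is nearly forced by \<open>n = 2\<close>, where
  \<open>(36/5)\<^sup>2 = 51.84\<close> stands against \<open>16 * pi \<le> 51.2\<close>. It returns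
  in the level \<open>s\<close> of the row distances.\<close>

lemma power_36_5_ge:
  assumes "2 \<le> n" shows "8 * pi * real n \<le> (36/5) ^ n"
  using assms
proof (induction n rule: nat_induct_at_least)
  case base
  show ?case using pi_le_16_5 by (simp add: power2_eq_square)
next
  case (Suc n)
  have "8 * pi * real (Suc n) \<le> 8 * pi * (36/5 * real n)" using Suc.hyps by (intro mult_left_mono) auto
  also have "\<dots> = 36/5 * (8 * pi * real n)" by simp
  also have "\<dots> \<le> 36/5 * (36/5) ^ n" using Suc.IH by simp
  finally show ?case by simp
qed

text \<open>Equivalent to \<open>36/5 * w \<le> (exp 1 / n)\<^sup>2\<close> for
  \<open>w = (n + 2) * exp (- (n + 1))\<close>, the base of the Chernoff bound for the sketched
  tail.\<close>

lemma exp_ge_cubic: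
  assumes "2 \<le> n" shows "36/5 * (real n)\<^sup>2 * (real n + 2) \<le> exp (real n + 3)"
  using assms
proof (induction n rule: nat_induct_at_least)
  case base
  have "(36/5 * 2\<^sup>2 * (2 + 2) :: real) \<le> (269/100) ^ 5" by (simp add: eval_nat_numeral)
  also have "\<dots> \<le> exp 1 ^ 5" by (rule power_mono[OF exp_1_ge]) simp
  also have "exp (1 :: real) ^ 5 = exp 5" by (simp flip: exp_of_nat_mult)
  finally show ?case by simp
next
  case (Suc n)
  show ?case
  \<comment> \<open>From 2 to 3 the left-hand side grows by the factor \<open>45/16\<close>, more
    than \<open>exp 1\<close>, so 3 is checked directly; from 3 on the ratio stays below
    2.69.\<close>
  proof (cases "n = 2")
    case True
    have "(36/5 * 3\<^sup>2 * (3 + 2) :: real) \<le> (269/100) ^ 6" by (simp add: eval_nat_numeral)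
    also have "\<dots> \<le> exp 1 ^ 6" by (rule power_mono[OF exp_1_ge]) simp
    also have "exp (1 :: real) ^ 6 = exp 6" by (simp flip: exp_of_nat_mult)
    finally show ?thesis using True by simp
  next
    case False
    then have n: "3 \<le> real n" using Suc.hyps by simp
    \<comment> \<open>Shifting by 3 makes every coefficient of the difference polynomial
      nonnegative.\<close>
    define x where "x = real n - 3"
    have nx: "real n = x + 3" "0 \<le> x" using n by (auto simp: x_def)
    have "(real n + 1)\<^sup>2 * (real n + 3) \<le> 269/100 * ((real n)\<^sup>2 * (real n + 2))"
    proof -
      have "269/100 * ((x + 3)\<^sup>2 * (x + 3 + 2)) - (x + 3 + 1)\<^sup>2 * (x + 3 + 3)
        = 169/100 * x ^ 3 + (11 * 269/100 - 14) * x\<^sup>2 + (39 * 269/100 - 64) * x + (45 * 269/100 - 96)"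
        by (simp add: power2_eq_square power3_eq_cube algebra_simps)
      also have "0 \<le> \<dots>" using nx(2) by (intro add_nonneg_nonneg mult_nonneg_nonneg) auto
      finally show ?thesis unfolding nx by simp
    qed
    also have "\<dots> \<le> exp 1 * ((real n)\<^sup>2 * (real n + 2))" by (rule mult_right_mono[OF exp_1_ge]) simp
    finally have "36/5 * (real (Suc n))\<^sup>2 * (real (Suc n) + 2) \<le> exp 1 * (36/5 * (real n)\<^sup>2 * (real n + 2))"
      by (simp add: algebra_simps)
    also have "\<dots> \<le> exp 1 * exp (real n + 3)" using Suc.IH by (intro mult_left_mono) auto
    also have "\<dots> = exp (real (Suc n) + 3)" by (simp flip: exp_add add: algebra_simps)
    finally show ?thesis .
  qed
qed

text \<open>Bernoulli's inequality with the quadratic term; the linear version would not reach the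
  factor \<open>\<mu>\<^sup>2\<close> that has to be absorbed.\<close>

lemma power_one_plus_ge_quadratic:
  assumes "0 \<le> (x :: real)" shows "1 + real n * x + real n * (real n - 1) / 2 * x\<^sup>2 \<le> (1 + x) ^ n"
proof (induction n)
  case (Suc n)
  have "1 + real (Suc n) * x + real (Suc n) * (real (Suc n) - 1) / 2 * x\<^sup>2
    \<le> (1 + real n * x + real n * (real n - 1) / 2 * x\<^sup>2) * (1 + x)"
  proof -
    have "(1 + real n * x + real n * (real n - 1) / 2 * x\<^sup>2) * (1 + x)
      - (1 + real (Suc n) * x + real (Suc n) * (real (Suc n) - 1) / 2 * x\<^sup>2) = real n * (real n - 1) / 2 * x ^ 3"
      by (simp add: power2_eq_square power3_eq_cube field_simps)
    also have "0 \<le> \<dots>" using assms by (cases n) auto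
    finally show ?thesis by simp
  qed
  also have "\<dots> \<le> (1 + x) ^ n * (1 + x)" using Suc assms by (intro mult_right_mono) auto
  finally show ?case by (simp add: mult.commute)
qed simp

text \<open>The level \<open>s\<close> for the row distances and the factor \<open>n + 2\<close> for the sketched tail are chosen so that
  each of the two exceptional events uses half of \<open>\<kappa>\<close>.\<close>

lemma sketch_tail_bounds:
  fixes n \<mu> m :: nat
  assumes n: "2 \<le> n" and \<mu>: "1 \<le> \<mu>" and m: "n \<le> m"
    and s: "s = exp 1 / (36/5 * (real n + 2 * real \<mu> - 2))"
  defines "\<kappa> \<equiv> (exp 1 / real n) ^ n / sqrt (2 * pi * real n)"
  shows "real \<mu> * (exp 1 * s / real n) powr (real n / 2) \<le> \<kappa> / 2"
    and "((real n + 2) * exp (1 - (real n + 2))) powr (real m / 2) \<le> \<kappa> / 2"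
proof -
  have \<kappa>: "\<kappa> / 2 = sqrt ((exp 1 / real n) ^ (2 * n) / (8 * pi * real n))"
  proof -
    have "sqrt ((exp 1 / real n) ^ (2 * n) / (8 * pi * real n))
      = sqrt (((exp 1 / real n) ^ n)\<^sup>2) / sqrt (2\<^sup>2 * (2 * pi * real n))"
      by (simp add: real_sqrt_divide power_mult[symmetric] mult.commute)
    also have "\<dots> = (exp 1 / real n) ^ n / (2 * sqrt (2 * pi * real n))"
      by (simp only: real_sqrt_mult real_sqrt_abs) simp
    finally show ?thesis by (simp add: \<kappa>_def)
  qed
  have n0: "0 < real n" using n by simp
  \<comment> \<open>Chosen so that \<open>exp 1 * s / n = (exp 1 / n)\<^sup>2 / g\<close>. The power
    of \<open>36/5\<close> pays for \<open>8 * pi * n\<close>; the power of the other factor, by the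
    quadratic Bernoulli bound, pays for \<open>\<mu>\<^sup>2\<close>, the square of the number of
    rows in the union bound.\<close>
  define g where "g = 36/5 * (1 + 2 * (real \<mu> - 1) / real n)"
  have g: "0 < g" using \<mu> n by (simp add: g_def add_pos_nonneg)
  have "real n * g = 36/5 * (real n + 2 * real \<mu> - 2)" unfolding g_def using n0 by (simp add: field_simps)
  then have sg: "s = exp 1 / (real n * g)" by (simp only: s)
  have gn: "8 * pi * real n * (real \<mu>)\<^sup>2 \<le> g ^ n"
  proof -
    define t where "t = real \<mu> - 1"
    have t: "0 \<le> t" "real \<mu> = 1 + t" using \<mu> by (auto simp: t_def)
    have "(1 + t)\<^sup>2 \<le> 1 + real n * (2 * t / real n) + real n * (real n - 1) / 2 * (2 * t / real n)\<^sup>2"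
    proof -
      have "real n * (real n - 1) / 2 * (2 * t / real n)\<^sup>2 = 2 * t\<^sup>2 - 2 * t\<^sup>2 / real n"
        using n0 by (simp add: power2_eq_square field_simps)
      moreover have "2 * t\<^sup>2 / real n \<le> 2 * t\<^sup>2 / 2" by (rule divide_left_mono) (use n in auto)
      ultimately show ?thesis using n0 by (simp add: power2_eq_square algebra_simps)
    qed
    also have "\<dots> \<le> (1 + 2 * t / real n) ^ n" by (rule power_one_plus_ge_quadratic) (use t in simp)
    finally have "(8 * pi * real n) * (1 + t)\<^sup>2 \<le> (36/5) ^ n * (1 + 2 * t / real n) ^ n"
      by (intro mult_mono power_36_5_ge n) auto
    also have "\<dots> = g ^ n" unfolding g_def t_def by (simp only: power_mult_distrib)
    finally show ?thesis by (simp only: t(2))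
  qed
  have es: "exp 1 * s / real n = (exp 1 / real n)\<^sup>2 / g" unfolding sg by (simp add: power2_eq_square field_simps)
  have "real \<mu> * (exp 1 * s / real n) powr (real n / 2) = sqrt ((real \<mu>)\<^sup>2) * sqrt (((exp 1 / real n)\<^sup>2 / g) ^ n)"
    unfolding es by (subst powr_half_sqrt) (use g n0 in auto)
  also have "\<dots> = sqrt ((real \<mu>)\<^sup>2 * ((exp 1 / real n) ^ (2 * n) / g ^ n))"
  proof -
    have "((exp 1 / real n)\<^sup>2 / g) ^ n = (exp 1 / real n) ^ (2 * n) / g ^ n" by (simp only: power_divide power_mult)
    then show ?thesis by (simp only: real_sqrt_mult)
  qed
  also have "\<dots> \<le> \<kappa> / 2" unfolding \<kappa>
  proof (rule real_sqrt_le_mono)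
    have "(real \<mu>)\<^sup>2 / g ^ n \<le> 1 / (8 * pi * real n)"
      using gn g n0 by (simp add: field_simps)
    then have "(exp 1 / real n) ^ (2 * n) * ((real \<mu>)\<^sup>2 / g ^ n) \<le> (exp 1 / real n) ^ (2 * n) * (1 / (8 * pi * real n))"
      by (rule mult_left_mono) simp
    then show "(real \<mu>)\<^sup>2 * ((exp 1 / real n) ^ (2 * n) / g ^ n) \<le> (exp 1 / real n) ^ (2 * n) / (8 * pi * real n)"
      by (simp add: mult.commute)
  qed
  finally show "real \<mu> * (exp 1 * s / real n) powr (real n / 2) \<le> \<kappa> / 2" .
  define w where "w = (real n + 2) * exp (1 - (real n + 2))"
  have w0: "0 < w" using n0 by (simp add: w_def)
  have w1: "w \<le> 1"
  proof -
    have "1 - (real n + 2) = - (real n + 1)" by simp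
    then have "w = (real n + 2) / exp (real n + 1)" unfolding w_def by (simp only: exp_minus divide_inverse)
    then show ?thesis using exp_ge_add_one_self[of "real n + 1"] by (simp add: pos_divide_le_eq)
  qed
  have wn: "36/5 * w \<le> (exp 1 / real n)\<^sup>2"
  proof -
    have "36/5 * (real n)\<^sup>2 * (real n + 2) * exp (1 - (real n + 2)) \<le> exp (real n + 3) * exp (1 - (real n + 2))"
      by (rule mult_right_mono[OF exp_ge_cubic[OF n]]) simp
    also have "\<dots> = (exp 1)\<^sup>2" by (simp add: power2_eq_square flip: exp_add)
    finally show ?thesis using n0 by (simp add: w_def power_divide field_simps)
  qed
  \<comment> \<open>Here \<open>w \<le> 1\<close> allows the exponent \<open>m / 2\<close> to be
    lowered to \<open>n / 2\<close>, the one that matches \<open>\<kappa>\<close>.\<close>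
  have "w powr (real m / 2) \<le> w powr (real n / 2)" by (rule powr_mono') (use w0 w1 m in auto)
  also have "\<dots> = sqrt (w ^ n)" by (rule powr_half_sqrt[OF w0])
  also have "\<dots> \<le> \<kappa> / 2" unfolding \<kappa>
  proof (rule real_sqrt_le_mono)
    have "w ^ n * (8 * pi * real n) \<le> w ^ n * (36/5) ^ n"
      by (rule mult_left_mono[OF power_36_5_ge[OF n]]) (use w0 in simp)
    also have "\<dots> = (36/5 * w) ^ n" by (simp only: power_mult_distrib mult.commute)
    also have "\<dots> \<le> ((exp 1 / real n)\<^sup>2) ^ n" by (rule power_mono[OF wn]) (use w0 in simp)
    finally show "w ^ n \<le> (exp 1 / real n) ^ (2 * n) / (8 * pi * real n)"
      using n0 by (simp add: pos_le_divide_eq power_mult)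
  qed
  finally show "((real n + 2) * exp (1 - (real n + 2))) powr (real m / 2) \<le> \<kappa> / 2" by (simp only: w_def)
qed

text \<open>Bounds the mean of \<open>\<Sum>k<\<mu>. 1 / D\<^sub>k\<close> on the event that all \<open>D\<^sub>k \<ge> s\<close>. Each \<open>D\<^sub>k\<close> is chi-square
  with \<open>n\<close> degrees of freedom; for \<open>n = 2\<close> the mean of \<open>1 / D\<^sub>k\<close> diverges and the truncation at \<open>s\<close> costs a
  logarithm, which is absorbed by \<open>sqrt \<mu>\<close>.\<close>

definition sketch_const :: "nat \<Rightarrow> nat \<Rightarrow> real" where
  "sketch_const n \<mu> = (if n = 2 then 51/25 * (real \<mu> * sqrt (real \<mu>)) else 51/50 * real \<mu> / (real n - 2))"

lemma nn_integral_powr_le: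
  fixes n :: nat
  assumes n: "2 \<le> n" and B: "0 \<le> B"
  shows "(\<integral>\<^sup>+\<theta>. ennreal ((1 + 2 * \<theta>) powr (- real n / 2)) * indicator {0..B} \<theta> \<partial>lborel)
    \<le> ennreal (if n = 2 then ln (1 + 2 * B) / 2 else 1 / (real n - 2))"
proof (cases "n = 2")
  case True
  have "(\<integral>\<^sup>+\<theta>. ennreal ((1 + 2 * \<theta>) powr (- real n / 2)) * indicator {0..B} \<theta> \<partial>lborel)
    = ennreal (ln (1 + 2 * B) / 2 - ln (1 + 2 * 0) / 2)"
  proof (rule nn_integral_FTC_Icc)
    show "(\<lambda>\<theta>. (1 + 2 * \<theta>) powr (- real n / 2)) \<in> borel_measurable borel" by measurable
    fix x :: real assume x: "x \<in> {0..B}"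
    show "((\<lambda>x. ln (1 + 2 * x) / 2) has_real_derivative (1 + 2 * x) powr (- real n / 2)) (at x)"
    proof (rule DERIV_cong)
      show "((\<lambda>x. ln (1 + 2 * x) / 2) has_real_derivative inverse (1 + 2 * x)) (at x)"
        using x by (auto intro!: derivative_eq_intros simp: field_simps)
      have "- real n / 2 = - 1" using True by simp
      then show "inverse (1 + 2 * x) = (1 + 2 * x) powr (- real n / 2)"
        using powr_neg_one[of "1 + 2 * x"] x by (simp add: inverse_eq_divide)
    qed
  qed (use B in auto)
  then show ?thesis using True by simp
next
  case False
  then have n3: "0 < real n - 2" using n by simp
  let ?F = "\<lambda>x. - ((1 + 2 * x) powr (1 - real n / 2) / (real n - 2))"
  have "(\<integral>\<^sup>+\<theta>. ennreal ((1 + 2 * \<theta>) powr (- real n / 2)) * indicator {0..B} \<theta> \<partial>lborel) = ennreal (?F B - ?F 0)"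
  proof (rule nn_integral_FTC_Icc)
    show "(\<lambda>\<theta>. (1 + 2 * \<theta>) powr (- real n / 2)) \<in> borel_measurable borel" by measurable
    fix x :: real assume x: "x \<in> {0..B}"
    have "((\<lambda>x. (1 + 2 * x) powr (1 - real n / 2)) has_real_derivative
      (1 - real n / 2) * (1 + 2 * x) powr (1 - real n / 2 - 1) * 2) (at x)"
      using x by (auto intro!: derivative_eq_intros)
    from DERIV_minus[OF DERIV_cdivide[OF this, of "real n - 2"]]
    show "(?F has_real_derivative (1 + 2 * x) powr (- real n / 2)) (at x)"
    proof (rule DERIV_cong)
      have "(1 - real n / 2) * 2 = - (real n - 2)" by simp
      then show "- ((1 - real n / 2) * (1 + 2 * x) powr (1 - real n / 2 - 1) * 2 / (real n - 2)) = (1 + 2 * x) powr (- real n / 2)"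
        using n3 by (simp add: field_simps)
    qed
  qed (use B in auto)
  also have "\<dots> \<le> ennreal (1 / (real n - 2))" by (rule ennreal_leI) (use n3 in simp)
  finally show ?thesis using False by simp
qed

lemma sketch_const_bound:
  fixes n \<mu> :: nat
  assumes n: "2 \<le> n" and \<mu>: "1 \<le> \<mu>" and s: "s = exp 1 / (36/5 * (real n + 2 * real \<mu> - 2))"
  obtains F where "0 \<le> F" "real \<mu> * (F / (1 - exp (- (4 / s) * s))) \<le> sketch_const n \<mu>"
    "(\<integral>\<^sup>+\<theta>. ennreal ((1 + 2 * \<theta>) powr (- real n / 2)) * indicator {0..4 / s} \<theta> \<partial>lborel) \<le> ennreal F"
proof -
  have s0: "0 < s" unfolding s using n \<mu> by simp
  \<comment> \<open>The cut-off \<open>B = 4 / s\<close> makes the truncation factor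
    \<open>1 / (1 - exp (- 4))\<close>, at most \<open>52/51\<close>, which is rounded up to
    \<open>51/50\<close>.\<close>
  have e4: "1 / (1 - exp (- (4 / s) * s)) \<le> 51/50"
  proof -
    have "exp (- 4 :: real) \<le> 1 / 52" using exp_4_ge by (simp add: exp_minus field_simps)
    then have "50/51 \<le> 1 - exp (- (4 / s) * s)" using s0 by simp
    from le_imp_inverse_le[OF this] show ?thesis by (simp add: inverse_eq_divide)
  qed
  have C: "real \<mu> * (F / (1 - exp (- (4 / s) * s))) \<le> 51/50 * (real \<mu> * F)" if "0 \<le> F" for F
    using mult_left_mono[OF e4, of "real \<mu> * F"] that by simp
  note I = nn_integral_powr_le[OF n, of "4 / s"]
  show ?thesis
  proof (cases "n = 2")
    case False
    show ?thesis
    proof (rule that[of "1 / (real n - 2)"])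
      show "0 \<le> 1 / (real n - 2)" using n by simp
      then show "real \<mu> * (1 / (real n - 2) / (1 - exp (- (4 / s) * s))) \<le> sketch_const n \<mu>"
        using C[of "1 / (real n - 2)"] False by (simp add: sketch_const_def)
    qed (use I s0 False in simp)
  next
    case True
    \<comment> \<open>For \<open>n = 2\<close> the integral is half of
      \<open>ln (1 + 8 / s)\<close>, with \<open>s\<close> of order \<open>1 / \<mu>\<close>. From
      \<open>1 + 8 / s \<le> exp 4 * u\<^sup>2\<close> and \<open>ln u \<le> u - 1\<close> the
      logarithm is at most \<open>4 * u\<close>.\<close>
    define u where "u = sqrt (real \<mu>)"
    have u: "1 \<le> u" "real \<mu> = u\<^sup>2" using \<mu> by (auto simp: u_def)
    have "1 + 2 * (4 / s) = 1 + 576/5 * real \<mu> / exp 1" unfolding s True by (simp add: field_simps)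
    also have "576/5 * real \<mu> / exp 1 \<le> 43 * real \<mu>"
      using mult_left_mono[OF exp_1_ge, of "43 * real \<mu>"] by (simp add: pos_divide_le_eq)
    also have "1 + 43 * real \<mu> \<le> 52 * u\<^sup>2" using u \<mu> by simp
    also have "\<dots> \<le> exp 4 * u\<^sup>2" by (rule mult_right_mono[OF exp_4_ge]) simp
    finally have "ln (1 + 2 * (4 / s)) \<le> ln (exp 4 * u\<^sup>2)" using s0 by (subst ln_le_cancel_iff) (use u in \<open>auto simp: add_pos_pos\<close>)
    also have "\<dots> = 4 + 2 * ln u" using u(1) by (simp add: ln_mult ln_realpow)
    also have "\<dots> \<le> 4 + 2 * (u - 1)" using ln_le_minus_one[of u] u(1) by simp
    also have "\<dots> \<le> 4 * u" using u(1) by simp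
    finally have ln: "ln (1 + 2 * (4 / s)) / 2 \<le> 2 * u" by simp
    show ?thesis
    proof (rule that[of "2 * u"])
      show "0 \<le> 2 * u" using u by simp
      then show "real \<mu> * (2 * u / (1 - exp (- (4 / s) * s))) \<le> sketch_const n \<mu>"
        using C[of "2 * u"] True by (simp add: sketch_const_def u_def)
      have "(\<integral>\<^sup>+\<theta>. ennreal ((1 + 2 * \<theta>) powr (- real n / 2)) * indicator {0..4 / s} \<theta> \<partial>lborel)
        \<le> ennreal (ln (1 + 2 * (4 / s)) / 2)" using I s0 True by simp
      also have "\<dots> \<le> ennreal (2 * u)" by (rule ennreal_leI[OF ln])
      finally show "(\<integral>\<^sup>+\<theta>. ennreal ((1 + 2 * \<theta>) powr (- real n / 2)) * indicator {0..4 / s} \<theta> \<partial>lborel) \<le> ennreal (2 * u)" .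
    qed
  qed
qed

text \<open>Worst case of the amplification: with every \<open>D\<^sub>k\<close> at its floor
  \<open>s\<close> the sum of the reciprocals is \<open>\<mu> / s\<close>. It has to fit into
  \<open>5/4\<close> of the amplitude \<open>m + 2 sqrt 2 m\<^sup>2\<close>; the rest of the
  available factor 2 is kept for the deviations.\<close>

lemma sketch_norm_factor_le:
  fixes n \<mu> m :: nat
  assumes n: "2 \<le> n" and \<mu>: "1 \<le> \<mu>" and m: "m + 1 = \<mu> + n"
    and s: "s = exp 1 / (36/5 * (real n + 2 * real \<mu> - 2))"
  shows "1 + 2 * sqrt (real m * (real n + 2) * (real \<mu> / s)) \<le> 5/4 * (real m + 2 * sqrt 2 * (real m)\<^sup>2)"
proof -
  define a k where "a = real \<mu> - 1" and "k = real n - 2"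
  have a: "0 \<le> a" "real \<mu> = a + 1" using \<mu> by (auto simp: a_def)
  have k: "0 \<le> k" "real n = k + 2" using n by (auto simp: k_def)
  have M: "real m = a + k + 2" using m a k by linarith
  have 2: "1414/1000 \<le> sqrt 2" by (rule real_le_rsqrt) (simp add: power2_eq_square)
  \<comment> \<open>\<open>3535/1000\<close> is \<open>5/4 * 2 * 1414/1000\<close>, a rational lower
    bound for the coefficient with \<open>sqrt 2\<close>. In \<open>a = \<mu> - 1\<close> and
    \<open>k = n - 2\<close> the squared comparison becomes a polynomial with nonnegative
    coefficients.\<close>
  let ?R = "3535/1000 * (a + k + 2)\<^sup>2 + 5/4 * (a + k + 2) - 1"
  have R0: "0 \<le> ?R" using a k by (simp add: power2_eq_square algebra_simps)
  have "4 * (real m * (real n + 2) * (real \<mu> / s)) = (144/5 / exp 1) * (real m * real \<mu> * (real n + 2 * real \<mu> - 2) * (real n + 2))"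
    unfolding s using n \<mu> by (simp add: field_simps)
  also have "\<dots> \<le> 1071/100 * (real m * real \<mu> * (real n + 2 * real \<mu> - 2) * (real n + 2))"
  proof (rule mult_right_mono)
    show "144/5 / exp 1 \<le> (1071/100 :: real)" using exp_1_ge by (simp add: field_simps)
  qed (use n \<mu> in simp)
  also have "\<dots> = 1071/100 * ((a + k + 2) * (a + 1) * (k + 2 * a + 2) * (k + 4))"
    unfolding M a(2) k(2) by (simp add: algebra_simps)
  also have "\<dots> \<le> ?R\<^sup>2"
  proof -
    have "?R\<^sup>2 - 1071/100 * ((a + k + 2) * (a + 1) * (k + 2 * a + 2) * (k + 4))
      = 732496/10000 + 2671992/10000 * k + 2617469/10000 * k^2 + 980973/10000 * k^3 + 12496225/1000000 * k^4
        + 529992/10000 * a + 2878738/10000 * (a * k) + 2086119/10000 * (a * k^2) + 392749/10000 * (a * k^3)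
        + 47069/10000 * a^2 + 1122219/10000 * (a^2 * k) + 4284735/100000 * (a^2 * k^2)
        + 231273/10000 * a^3 + 285649/10000 * (a^3 * k) + 12496225/1000000 * a^4"
      by (simp add: power2_eq_square power3_eq_cube power4_eq_xxxx algebra_simps add_divide_distrib diff_divide_distrib)
    also have "0 \<le> \<dots>" using a k by (intro add_nonneg_nonneg mult_nonneg_nonneg zero_le_power) auto
    finally show ?thesis by simp
  qed
  finally have "sqrt (4 * (real m * (real n + 2) * (real \<mu> / s))) \<le> ?R" using R0 by (intro real_le_lsqrt) auto
  moreover have "sqrt (4 * z) = 2 * sqrt z" for z by (simp add: real_sqrt_mult)
  ultimately have "2 * sqrt (real m * (real n + 2) * (real \<mu> / s)) \<le> 3535/1000 * (real m)\<^sup>2 + 5/4 * real m - 1"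
    by (simp only: M[symmetric])
  then have "1 + 2 * sqrt (real m * (real n + 2) * (real \<mu> / s)) \<le> 3535/1000 * (real m)\<^sup>2 + 5/4 * real m" by linarith
  also have "3535/1000 * (real m)\<^sup>2 \<le> 5/2 * sqrt 2 * (real m)\<^sup>2" using 2 by (intro mult_right_mono) auto
  finally show ?thesis by (simp add: algebra_simps)
qed

text \<open>Together with \<open>\<delta> + \<kappa> \<le> 1\<close> these keep
  \<open>\<delta>\<close> at most \<open>4/7\<close> for \<open>n = 2\<close> and at most
  \<open>6/7\<close> for \<open>n = 3\<close>, the cases in which the reciprocals have the largest
  mean.\<close>

lemma sketch_kappa_ge:
  shows "n = 2 \<Longrightarrow> 3/7 \<le> (exp 1 / real n) ^ n / sqrt (2 * pi * real n)"
    and "n = 3 \<Longrightarrow> 1/7 \<le> (exp 1 / real n) ^ n / sqrt (2 * pi * real n)"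
proof -
  assume n: "n = 2"
  have "sqrt (2 * pi * real n) \<le> 4" using pi_less_4 n by (intro real_le_lsqrt) auto
  then have "3/7 * sqrt (2 * pi * real n) \<le> 3/7 * 4" by simp
  also have "\<dots> \<le> ((269/100) / 2) ^ 2" by (simp add: power2_eq_square)
  also have "\<dots> \<le> (exp 1 / real n) ^ n" unfolding n by (rule power_mono) (use exp_1_ge in auto)
  finally show "3/7 \<le> (exp 1 / real n) ^ n / sqrt (2 * pi * real n)" using n by (simp add: pos_le_divide_eq)
next
  assume n: "n = 3"
  have "sqrt (2 * pi * real n) \<le> 49/10" using pi_less_4 n by (intro real_le_lsqrt) (auto simp: power2_eq_square)
  then have "1/7 * sqrt (2 * pi * real n) \<le> 1/7 * (49/10)" by simp
  also have "\<dots> \<le> ((269/100) / 3) ^ 3" by (simp add: power3_eq_cube)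
  also have "\<dots> \<le> (exp 1 / real n) ^ n" unfolding n by (rule power_mono) (use exp_1_ge in auto)
  finally show "1/7 \<le> (exp 1 / real n) ^ n / sqrt (2 * pi * real n)" using n by (simp add: pos_le_divide_eq)
qed

text \<open>\<open>ln (1 / \<delta>) \<ge> 1 - \<delta>\<close> gives
  \<open>\<psi>\<^sup>2 \<ge> 8 - 7 * \<delta>\<close>, and \<open>\<kappa>\<close> limits
  \<open>\<delta>\<close> from above. Here \<open>\<psi>\<close> is
  \<open>sqrt \<delta> * \<eta>\<close>, the factor \<open>\<eta>\<close> of the theorem after
  multiplication by the \<open>sqrt \<delta>\<close> of Chebyshev's inequality.\<close>

lemma deviation_psi_ge:
  fixes \<delta> \<kappa> :: real
  assumes \<delta>: "0 < \<delta>" "\<delta> < 1" and \<kappa>: "\<delta> + \<kappa> \<le> 1"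
  defines "\<psi> \<equiv> sqrt \<delta> + sqrt (8 * ln (1 / \<delta>))"
  shows "1 \<le> \<psi>" "3/7 \<le> \<kappa> \<Longrightarrow> 2 \<le> \<psi>" "1/7 \<le> \<kappa> \<Longrightarrow> 7/5 \<le> \<psi>"
proof -
  have ln: "1 - \<delta> \<le> ln (1 / \<delta>)" using ln_le_minus_one[OF \<delta>(1)] \<delta>(1) by (simp add: ln_div)
  then have ln0: "0 \<le> ln (1 / \<delta>)" using \<delta>(2) by linarith
  have \<psi>0: "0 \<le> \<psi>" unfolding \<psi>_def using \<delta> ln0 by (intro add_nonneg_nonneg) auto
  have "\<psi>\<^sup>2 = \<delta> + 8 * ln (1 / \<delta>) + 2 * (sqrt \<delta> * sqrt (8 * ln (1 / \<delta>)))"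
  proof -
    have "(sqrt \<delta>)\<^sup>2 = \<delta>" "(sqrt (8 * ln (1 / \<delta>)))\<^sup>2 = 8 * ln (1 / \<delta>)" using \<delta> ln0 by (auto intro: real_sqrt_pow2)
    then show ?thesis unfolding \<psi>_def power2_sum by simp
  qed
  moreover have "0 \<le> sqrt \<delta> * sqrt (8 * ln (1 / \<delta>))" by (rule mult_nonneg_nonneg) (use \<delta> ln0 in auto)
  ultimately have sq: "8 - 7 * \<delta> \<le> \<psi>\<^sup>2" using ln by linarith
  show "1 \<le> \<psi>" by (rule power2_le_imp_le[OF _ \<psi>0]) (use sq \<delta> in simp)
  show "2 \<le> \<psi>" if "3/7 \<le> \<kappa>" by (rule power2_le_imp_le[OF _ \<psi>0]) (use sq \<kappa> that in simp)
  show "7/5 \<le> \<psi>" if "1/7 \<le> \<kappa>" by (rule power2_le_imp_le[OF _ \<psi>0]) (use sq \<kappa> that in \<open>simp add: power2_eq_square\<close>)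
qed

text \<open>On the left is the squared coefficient of the tail deviation, on the right what the
  threshold can absorb. A small \<open>n\<close> makes \<open>sketch_const\<close> large, but
  \<open>\<psi>\<close> as well: it is at least 2 for \<open>n = 2\<close>, at least
  \<open>7/5\<close> for \<open>n = 3\<close>, and at least 1 always. The extra
  \<open>sqrt \<mu>\<close> of \<open>sketch_const\<close> at \<open>n = 2\<close> is met by the
  \<open>sqrt \<mu>\<close> on the right.\<close>

lemma sketch_deviation_factor_le:
  fixes n \<mu> m :: nat
  assumes n: "2 \<le> n" and \<mu>: "1 \<le> \<mu>" and m: "m + 1 = \<mu> + n"
    and \<delta>: "0 < \<delta>" "\<delta> < 1" and \<kappa>: "\<delta> + (exp 1 / real n) ^ n / sqrt (2 * pi * real n) \<le> 1"
  defines "\<psi> \<equiv> sqrt \<delta> + sqrt (8 * ln (1 / \<delta>))"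
  shows "(1 + 2 * sqrt (real m * (real n + 2) * sketch_const n \<mu>))\<^sup>2
    \<le> 6 * (real m + 2 * sqrt 2 * (real m)\<^sup>2) * sqrt (real \<mu>) * (\<psi> * (\<psi> - 1 / sqrt 2))"
proof -
  note \<psi> = deviation_psi_ge[OF \<delta> \<kappa>, folded \<psi>_def]
  define u where "u = sqrt (real \<mu>)"
  define v where "v = sqrt (real m)"
  have u: "1 \<le> u" "real \<mu> = u\<^sup>2" using \<mu> by (auto simp: u_def)
  have v: "0 \<le> v" "real m = v\<^sup>2" by (auto simp: v_def)
  have v1: "1 \<le> v" using m n \<mu> by (simp add: v_def)
  define c where "c = 2 * sqrt (real m * (real n + 2) * sketch_const n \<mu>)"
  have C0: "0 \<le> sketch_const n \<mu>" using n by (simp add: sketch_const_def)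
  have c0: "0 \<le> c" using C0 by (simp add: c_def)
  have c2: "c\<^sup>2 = 4 * (real m * (real n + 2) * sketch_const n \<mu>)"
    unfolding c_def power_mult_distrib by (subst real_sqrt_pow2) (use C0 in auto)
  define P where "P = u * (v\<^sup>2 + 2828/1000 * v ^ 4)"
  have P0: "0 \<le> P" using u by (simp add: P_def)
  have q: "1 / sqrt 2 \<le> 7072/10000"
  proof -
    have "14142/10000 \<le> sqrt 2" by (rule real_le_rsqrt) (simp add: power2_eq_square)
    then show ?thesis by (simp add: pos_divide_le_eq)
  qed
  \<comment> \<open>\<open>w\<close> is a rational lower bound for
    \<open>z * (z - 1 / sqrt 2)\<close> at a guaranteed value \<open>z\<close> of
    \<open>\<psi>\<close>, with \<open>1 / sqrt 2\<close> rounded up to 0.7072. The values in use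
    are 2 at \<open>z = 2\<close>, 0.9699 at \<open>z = 7/5\<close> and 0.2927 at
    \<open>z = 1\<close>.\<close>
  have rhs: "6 * w * P \<le> 6 * (real m + 2 * sqrt 2 * (real m)\<^sup>2) * sqrt (real \<mu>) * (\<psi> * (\<psi> - 1 / sqrt 2))"
    if w: "w \<le> z * (z - 7072/10000)" and z: "1 \<le> z" "z \<le> \<psi>" and w0: "0 \<le> w" for w z
  proof -
    have "w \<le> \<psi> * (\<psi> - 1 / sqrt 2)"
    proof (rule order_trans[OF w mult_mono])
      show "z - 7072/10000 \<le> \<psi> - 1 / sqrt 2" "0 \<le> \<psi>" "0 \<le> z - 7072/10000" using z q by linarith+
    qed (rule z)
    moreover have "P \<le> (real m + 2 * sqrt 2 * (real m)\<^sup>2) * u"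
    proof -
      have "1414/1000 \<le> sqrt 2" by (rule real_le_rsqrt) (simp add: power2_eq_square)
      then have "2828/1000 * v ^ 4 \<le> 2 * sqrt 2 * v ^ 4" by (intro mult_right_mono) auto
      then have "v\<^sup>2 + 2828/1000 * v ^ 4 \<le> real m + 2 * sqrt 2 * (real m)\<^sup>2" unfolding v(2) by (simp flip: power_mult)
      from mult_right_mono[OF this, of u] show ?thesis using u by (simp add: P_def mult.commute)
    qed
    ultimately have "P * w \<le> ((real m + 2 * sqrt 2 * (real m)\<^sup>2) * u) * (\<psi> * (\<psi> - 1 / sqrt 2))"
      using P0 w0 u by (intro mult_mono) auto
    then have "6 * (P * w) \<le> 6 * (((real m + 2 * sqrt 2 * (real m)\<^sup>2) * u) * (\<psi> * (\<psi> - 1 / sqrt 2)))"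
      by (rule mult_left_mono) simp
    then show ?thesis by (simp only: u_def mult_ac)
  qed
  have "(1 + c)\<^sup>2 \<le> 6 * (real m + 2 * sqrt 2 * (real m)\<^sup>2) * sqrt (real \<mu>) * (\<psi> * (\<psi> - 1 / sqrt 2))"
  proof (cases "n = 2")
    case True
    have um: "real m = u\<^sup>2 + 1" using m u(2) True by linarith
    have cc: "c\<^sup>2 = 816/25 * (real m * u ^ 3)" 
    proof -
      have "sketch_const n \<mu> = 51/25 * u ^ 3"
        unfolding sketch_const_def u_def[symmetric] u(2) using True u(1) by (simp add: power2_eq_square power3_eq_cube)
      then show ?thesis unfolding c2 using True by simp
    qed
    have "c \<le> 5715/1000 * (real m * u)"
    proof (rule power2_le_imp_le)
      have "u ^ 3 \<le> real m * u\<^sup>2"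
      proof -
        have "u * 1 \<le> u\<^sup>2 + 1" using zero_le_power2[of "u - 1"] u(1) by (simp add: power2_eq_square algebra_simps)
        from mult_right_mono[OF this, of "u\<^sup>2"] show ?thesis unfolding um by (simp add: power3_eq_cube power2_eq_square)
      qed
      then have "real m * u ^ 3 \<le> real m * (real m * u\<^sup>2)" by (rule mult_left_mono) simp
      moreover have "0 \<le> real m * (real m * u\<^sup>2)" by simp
      moreover have "(5715/1000 * (real m * u))\<^sup>2 = 32661225/1000000 * (real m * (real m * u\<^sup>2))"
        by (simp add: power2_eq_square)
      ultimately show "c\<^sup>2 \<le> (5715/1000 * (real m * u))\<^sup>2" unfolding cc by linarith
    qed (use u in simp)
    then have "(1 + c)\<^sup>2 \<le> 1 + 1143/100 * (real m * u) + 816/25 * (real m * u ^ 3)"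
      using cc by (simp add: power2_eq_square algebra_simps)
    also have "\<dots> \<le> u * (1 + 1143/100 * real m + 816/25 * (real m * u\<^sup>2))"
      using u(1) by (simp add: algebra_simps power2_eq_square power3_eq_cube)
    also have "\<dots> \<le> u * (6 * 2 * (real m + 2828/1000 * (real m)\<^sup>2))"
    proof (rule mult_left_mono)
      show "1 + 1143/100 * real m + 816/25 * (real m * u\<^sup>2) \<le> 6 * 2 * (real m + 2828/1000 * (real m)\<^sup>2)"
      proof -
        define x where "x = u\<^sup>2"
        have x: "0 \<le> x" by (simp add: x_def)
        have xx: "0 \<le> x * x" by simp
        show ?thesis unfolding um x_def[symmetric]
          by (simp only: power2_eq_square distrib_left distrib_right mult_1_left mult_1_right) (use x xx in linarith)
      qed
    qed (use u in simp)
    also have "\<dots> = 6 * 2 * P" unfolding P_def v(2) by (simp flip: power_mult)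
    also have "\<dots> \<le> 6 * (real m + 2 * sqrt 2 * (real m)\<^sup>2) * sqrt (real \<mu>) * (\<psi> * (\<psi> - 1 / sqrt 2))"
      by (rule rhs[of 2 2]) (use \<psi>(2) sketch_kappa_ge(1)[OF True] in auto)
    finally show ?thesis .
  next
    case False
    \<comment> \<open>Common scheme for \<open>n \<ge> 3\<close>, where \<open>c\<close> is at most
      a constant \<open>k\<close> times \<open>u * v\<close>, the root of \<open>\<mu> * m\<close>.
      The constant \<open>j\<close> trades a power of \<open>u\<close> for \<open>v\<^sup>2\<close>,
      by \<open>u * k\<^sup>2 \<le> j * v\<^sup>2\<close>; after factoring out \<open>u\<close>, a
      polynomial inequality in \<open>v\<close> is left.\<close>
    have fin: ?thesis
      if cb: "c \<le> k * (u * v)" and k: "0 \<le> k" and w: "w \<le> z * (z - 7072/10000)" "1 \<le> z" "z \<le> \<psi>" "0 \<le> w"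
        and main: "u * k\<^sup>2 \<le> j * v\<^sup>2" and rest: "1 + 2 * k * v + j * v ^ 4 \<le> 6 * w * (v\<^sup>2 + 2828/1000 * v ^ 4)" for k w z j
    proof -
      have "(1 + c)\<^sup>2 \<le> (1 + k * (u * v))\<^sup>2" using cb c0 by (intro power_mono) auto
      also have "\<dots> = 1 + u * (2 * k * v) + u * v\<^sup>2 * (u * k\<^sup>2)" by (simp add: power2_eq_square algebra_simps)
      also have "\<dots> \<le> u + u * (2 * k * v) + u * v\<^sup>2 * (j * v\<^sup>2)"
      proof -
        have "u * v\<^sup>2 * (u * k\<^sup>2) \<le> u * v\<^sup>2 * (j * v\<^sup>2)" by (rule mult_left_mono[OF main]) (use u(1) in simp)
        then show ?thesis using u(1) by linarith
      qed
      also have "\<dots> = u * (1 + 2 * k * v + j * v ^ 4)" by (simp add: power2_eq_square power4_eq_xxxx algebra_simps)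
      also have "\<dots> \<le> u * (6 * w * (v\<^sup>2 + 2828/1000 * v ^ 4))" using u(1) by (intro mult_left_mono rest) auto
      also have "\<dots> = 6 * w * P" by (simp add: P_def)
      also have "\<dots> \<le> 6 * (real m + 2 * sqrt 2 * (real m)\<^sup>2) * sqrt (real \<mu>) * (\<psi> * (\<psi> - 1 / sqrt 2))"
        by (rule rhs[OF w])
      finally show ?thesis .
    qed
    show ?thesis
    proof (cases "n = 3")
      case True
      have vu: "v\<^sup>2 = u\<^sup>2 + 2" using m u(2) v(2) True by linarith
      show ?thesis
      \<comment> \<open>The square of 4.52 exceeds the constant \<open>102/5\<close> in
        \<open>c\<^sup>2\<close>, and \<open>73/10\<close> suits
        \<open>v\<^sup>2 = u\<^sup>2 + 2\<close>, by completing the square at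
        \<open>u = 14/10\<close>.\<close>
      proof (rule fin[of "452/100" "9699/10000" "7/5" "73/10"])
        have "c\<^sup>2 = 102/5 * (v\<^sup>2 * u\<^sup>2)" unfolding c2 u(2) v(2) sketch_const_def using True by (simp add: u(2))
        also have "\<dots> \<le> 204304/10000 * (v\<^sup>2 * u\<^sup>2)" by (rule mult_right_mono) auto
        also have "\<dots> = (452/100 * (u * v))\<^sup>2" by (simp add: power2_eq_square)
        finally show "c \<le> 452/100 * (u * v)" by (rule power2_le_imp_le) (use u v in simp)
        have "0 \<le> 73/10 * (u - 14/10)\<^sup>2" by simp
        then show "u * (452/100)\<^sup>2 \<le> 73/10 * v\<^sup>2" unfolding vu using u(1) by (simp add: power2_eq_square algebra_simps)
        have "v \<le> v\<^sup>2" using v1 by (simp add: power2_eq_square)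
        moreover have "v\<^sup>2 \<le> v ^ 4" using v1 by (intro power_increasing) auto
        ultimately show "1 + 2 * (452/100) * v + 73/10 * v ^ 4 \<le> 6 * (9699/10000) * (v\<^sup>2 + 2828/1000 * v ^ 4)"
          using v1 by simp
        show "7/5 \<le> \<psi>" by (rule \<psi>(3)[OF sketch_kappa_ge(2)[OF True]])
      qed auto
    next
      case n3: False
      then have n4: "4 \<le> real n" using n False by simp
      have vu: "u\<^sup>2 + 3 \<le> v\<^sup>2" using m u(2) v(2) n4 by linarith
      have v2: "2 \<le> v" by (rule power2_le_imp_le) (use vu u(1) v in \<open>auto intro: order_trans[OF _ vu]\<close>)
      show ?thesis
      \<comment> \<open>For \<open>n \<ge> 4\<close> the quotient \<open>(n + 2) / (n - 2)\<close>
        is at most 3, and \<open>3.5\<^sup>2 = 12.25\<close> exceeds \<open>3 * 102/25\<close>. Only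
        \<open>\<psi> \<ge> 1\<close> is at hand here, so the gain comes from
        \<open>v \<ge> 2\<close>.\<close>
      proof (rule fin[of "35/10" "2927/10000" 1 "355/100"])
        have sc: "sketch_const n \<mu> = 51/50 * u\<^sup>2 / (real n - 2)" using False by (simp add: sketch_const_def u(2))
        have "c\<^sup>2 = 102/25 * (v\<^sup>2 * u\<^sup>2) * ((real n + 2) / (real n - 2))"
          unfolding c2 v(2) sc using n4 by (simp add: field_simps)
        also have "\<dots> \<le> 102/25 * (v\<^sup>2 * u\<^sup>2) * 3" by (rule mult_left_mono) (use n4 in \<open>auto simp: pos_divide_le_eq\<close>)
        also have "\<dots> \<le> 1225/100 * (v\<^sup>2 * u\<^sup>2)" by simp
        also have "\<dots> = (35/10 * (u * v))\<^sup>2" by (simp add: power2_eq_square)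
        finally show "c \<le> 35/10 * (u * v)" by (rule power2_le_imp_le) (use u v in simp)
        have "0 \<le> 355/100 * (u - 173/100)\<^sup>2" by simp
        then have "u * (35/10)\<^sup>2 \<le> 355/100 * (u\<^sup>2 + 3)" using u(1) by (simp add: power2_eq_square algebra_simps)
        also have "\<dots> \<le> 355/100 * v\<^sup>2" using vu by simp
        finally show "u * (35/10)\<^sup>2 \<le> 355/100 * v\<^sup>2" .
        have "8 * v \<le> v ^ 4"
        proof -
          have "2 ^ 3 * v \<le> v ^ 3 * v" using v2 by (intro mult_right_mono power_mono) auto
          then show ?thesis by (simp add: power3_eq_cube power4_eq_xxxx)
        qed
        moreover have "4 \<le> v\<^sup>2" using power_mono[OF v2, of 2] by simp
        ultimately show "1 + 2 * (35/10) * v + 355/100 * v ^ 4 \<le> 6 * (2927/10000) * (v\<^sup>2 + 2828/1000 * v ^ 4)"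
          using v2 by simp
      qed (use \<psi>(1) in auto)
    qed
  qed
  then show ?thesis by (simp only: c_def)
qed

text \<open>The threshold \<open>t\<close> must be large enough for Chebyshev to leave probability
  \<open>\<delta>\<close>, and small enough for the claimed bound. For \<open>\<mu> < r\<close> the
  second demand admits \<open>t = (2 \<rho> - 5/4) L \<tau> + R \<eta> \<epsilon>\<close> with
  \<open>R = sqrt r\<close>, \<open>q = sqrt (r - \<mu>)\<close> and \<open>\<rho> = R / q\<close>,
  because \<open>\<tau> \<le> q \<Delta>\<close>. The first demand then is an inequality of
  arithmetic and geometric means in \<open>\<tau>\<close>. The second hypothesis on \<open>h\<close>
  expresses \<open>\<phi> \<le> 1\<close>.\<close>

lemma failure_threshold_exists:
  fixes r \<mu> :: nat and \<tau> \<Delta> L b \<epsilon> h \<delta> \<psi> \<eta> :: real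
  assumes r: "1 \<le> r" and \<mu>: "1 \<le> \<mu>" and \<tau>: "0 \<le> \<tau>" "\<tau> \<le> sqrt (real (r - \<mu>)) * \<Delta>" and L: "0 \<le> L"
    and b0: "0 \<le> b" and b: "b\<^sup>2 \<le> 6 * L * sqrt (real \<mu>) * (\<psi> * (\<psi> - 1 / sqrt 2))" and \<psi>: "1 \<le> \<psi>"
    and \<delta>: "0 < \<delta>" "\<psi> = sqrt \<delta> * \<eta>" and \<epsilon>: "0 < \<epsilon>" and h: "0 \<le> h" "h * \<psi> \<le> \<epsilon> * sqrt \<delta>" and \<Delta>: "0 \<le> \<Delta>"
  obtains t where "0 < t" "\<epsilon> + b * sqrt (\<tau> * h) \<le> sqrt \<delta> * t"
    "sqrt r * (5/4 * L * \<tau> + t) \<le> r * (2 * L * \<Delta> + \<eta> * \<epsilon>)"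
proof -
  have d0: "0 < sqrt \<delta>" using \<delta> by simp
  have "0 < sqrt \<delta> * \<eta>" unfolding \<delta>(2)[symmetric] using \<psi> by linarith
  from zero_less_mult_pos[OF this d0] have \<eta>: "0 < \<eta>" .
  define R where "R = sqrt (real r)"
  have R: "1 \<le> R" "real r = R\<^sup>2" using r by (auto simp: R_def)
  show ?thesis
  proof (cases "r \<le> \<mu>")
    case True
    then have t0: "\<tau> = 0" using \<tau> by simp
    show ?thesis
    proof (rule that[of "R * (\<eta> * \<epsilon>)"])
      show "0 < R * (\<eta> * \<epsilon>)" using R \<eta> \<epsilon> by simp
      have "1 * \<epsilon> \<le> (R * \<psi>) * \<epsilon>" by (rule mult_right_mono) (use R \<psi> \<epsilon> mult_mono[of 1 R 1 \<psi>] in auto)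
      then show "\<epsilon> + b * sqrt (\<tau> * h) \<le> sqrt \<delta> * (R * (\<eta> * \<epsilon>))" unfolding t0 \<delta>(2) by (simp add: mult_ac)
      show "sqrt r * (5/4 * L * \<tau> + R * (\<eta> * \<epsilon>)) \<le> r * (2 * L * \<Delta> + \<eta> * \<epsilon>)"
      proof -
        have "R\<^sup>2 * (\<eta> * \<epsilon>) \<le> R\<^sup>2 * (2 * L * \<Delta> + \<eta> * \<epsilon>)" by (rule mult_left_mono) (use L \<Delta> in simp_all)
        then show ?thesis unfolding R_def[symmetric] unfolding R(2) t0 by (simp add: power2_eq_square)
      qed
    qed
  next
    case False
    define q where "q = sqrt (real (r - \<mu>))"
    define u where "u = sqrt (real \<mu>)"
    have u: "1 \<le> u" "real \<mu> = u\<^sup>2" using \<mu> by (auto simp: u_def)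
    have q: "1 \<le> q" "real (r - \<mu>) = q\<^sup>2" using False by (auto simp: q_def)
    have Rqu: "R\<^sup>2 = q\<^sup>2 + u\<^sup>2" using False R(2) u(2) q(2) by (simp add: of_nat_diff)
    define \<rho> where "\<rho> = R / q"
    have qR: "q \<le> R" by (rule power2_le_imp_le) (use Rqu R in auto)
    have \<rho>: "1 \<le> \<rho>" "\<rho> * q = R" using q qR by (auto simp: \<rho>_def)
    let ?s = "1 / sqrt 2"
    \<comment> \<open>Here \<open>r > \<mu> \<ge> 1\<close>, so \<open>r \<ge> 2\<close>; this is
      the origin of \<open>1 / sqrt 2\<close> in the hypothesis on \<open>b\<close>.\<close>
    have sR: "R * ?s \<ge> 1"
    proof -
      have "1 \<le> q\<^sup>2" "1 \<le> u\<^sup>2" using q(1) u(1) by (auto simp: one_le_power)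
      then have "sqrt 2 \<le> R" using Rqu R by (intro real_le_lsqrt) auto
      then show ?thesis by (simp add: pos_le_divide_eq)
    qed
    have \<psi>s: "0 \<le> \<psi> - ?s"
    proof -
      have "?s \<le> 1" by (simp add: pos_divide_le_eq)
      then show ?thesis using \<psi> by linarith
    qed
    \<comment> \<open>Rests on \<open>2 * u * q \<le> u\<^sup>2 + q\<^sup>2 = R\<^sup>2\<close>,
      that is \<open>2 * u \<le> \<rho> * R\<close>: in this way the threshold absorbs the factor
      \<open>sqrt \<mu>\<close>.\<close>
    have key: "2 * u * (\<psi> - ?s) \<le> \<rho> * (R * \<psi> - 1)"
    proof -
      have "2 * u * q \<le> R\<^sup>2" unfolding Rqu using zero_le_power2[of "u - q"] by (simp add: power2_eq_square algebra_simps)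
      then have "2 * u \<le> \<rho> * R" using q(1) by (simp add: \<rho>_def pos_le_divide_eq power2_eq_square)
      from mult_right_mono[OF this \<psi>s] have "2 * u * (\<psi> - ?s) \<le> \<rho> * (R * \<psi> - R * ?s)" by (simp add: algebra_simps)
      also have "\<dots> \<le> \<rho> * (R * \<psi> - 1)" using sR \<rho>(1) by (intro mult_left_mono) auto
      finally show ?thesis .
    qed
    define a where "a = sqrt \<delta> * ((2 * \<rho> - 5/4) * L)"
    define g where "g = (R * \<psi> - 1) * \<epsilon>"
    have R\<psi>: "1 \<le> R * \<psi>" using R \<psi> mult_mono[of 1 R 1 \<psi>] by simp
    have a0: "0 \<le> a" using \<rho>(1) L \<delta> by (simp add: a_def)
    have g0: "0 \<le> g" using R\<psi> \<epsilon> by (simp add: g_def)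
    have bh: "b\<^sup>2 * h \<le> 4 * a * g"
    proof -
      have "b\<^sup>2 * h \<le> (6 * L * u * (\<psi> * (\<psi> - ?s))) * h" by (rule mult_right_mono) (use b h in \<open>auto simp: u_def\<close>)
      also have "\<dots> = (6 * L * u * (\<psi> - ?s)) * (h * \<psi>)" by simp
      also have "\<dots> \<le> (6 * L * u * (\<psi> - ?s)) * (\<epsilon> * sqrt \<delta>)"
        by (rule mult_left_mono[OF h(2)]) (use L u \<psi>s in simp)
      also have "\<dots> = (3 * L * \<epsilon> * sqrt \<delta>) * (2 * u * (\<psi> - ?s))" by simp
      also have "\<dots> \<le> (3 * L * \<epsilon> * sqrt \<delta>) * (\<rho> * (R * \<psi> - 1))"
        by (rule mult_left_mono[OF key]) (use L \<epsilon> \<delta> in simp)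
      also have "\<dots> = (3 * \<rho>) * (sqrt \<delta> * L * g)" by (simp add: g_def)
      \<comment> \<open>\<open>3 * \<rho> \<le> 8 * \<rho> - 5\<close> means
        \<open>\<rho> \<ge> 1\<close>, with equality at 1: the share \<open>5/4\<close> and the
        constant 6 are matched to each other.\<close>
      also have "\<dots> \<le> (4 * (2 * \<rho> - 5/4)) * (sqrt \<delta> * L * g)"
        by (rule mult_right_mono) (use \<rho>(1) L g0 \<delta> in auto)
      finally show ?thesis by (simp add: a_def mult_ac)
    qed
    \<comment> \<open>\<open>b\<^sup>2 * h \<le> 4 * a * g\<close> says that the quadratic
      \<open>a x\<^sup>2 - b (sqrt h) x + g\<close> has no positive discriminant; it is evaluated at
      \<open>x = sqrt \<tau>\<close>.\<close>
    have amgm: "b * sqrt (\<tau> * h) \<le> a * \<tau> + g"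
    proof (rule power2_le_imp_le)
      have "(b * sqrt (\<tau> * h))\<^sup>2 = \<tau> * (b\<^sup>2 * h)" using \<tau> h by (simp add: power_mult_distrib)
      also have "\<dots> \<le> \<tau> * (4 * a * g)" by (rule mult_left_mono[OF bh \<tau>(1)])
      also have "\<dots> \<le> (a * \<tau> + g)\<^sup>2"
        using zero_le_power2[of "a * \<tau> - g"] by (simp add: power2_eq_square algebra_simps)
      finally show "(b * sqrt (\<tau> * h))\<^sup>2 \<le> (a * \<tau> + g)\<^sup>2" .
    qed (use a0 g0 \<tau> in simp)
    show ?thesis
    proof (rule that[of "(2 * \<rho> - 5/4) * L * \<tau> + R * (\<eta> * \<epsilon>)"])
      have "0 < R * (\<eta> * \<epsilon>)" using R \<eta> \<epsilon> by simp
      then show "0 < (2 * \<rho> - 5/4) * L * \<tau> + R * (\<eta> * \<epsilon>)" using \<rho>(1) L \<tau> by (intro add_nonneg_pos) auto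
      show "\<epsilon> + b * sqrt (\<tau> * h) \<le> sqrt \<delta> * ((2 * \<rho> - 5/4) * L * \<tau> + R * (\<eta> * \<epsilon>))"
        using amgm by (simp add: a_def g_def \<delta>(2) algebra_simps)
      have "R * (2 * \<rho> * L * \<tau>) \<le> R * (2 * \<rho> * L * (q * \<Delta>))"
        using \<tau> R \<rho> L by (intro mult_left_mono) (auto simp: q_def)
      also have "\<dots> = 2 * R * L * \<Delta> * (\<rho> * q)" by simp
      also have "\<dots> = R\<^sup>2 * (2 * L * \<Delta>)" unfolding \<rho>(2) by (simp add: power2_eq_square)
      finally have le: "R * (2 * \<rho> * L * \<tau>) \<le> R\<^sup>2 * (2 * L * \<Delta>)" .
      show "sqrt r * (5/4 * L * \<tau> + ((2 * \<rho> - 5/4) * L * \<tau> + R * (\<eta> * \<epsilon>))) \<le> r * (2 * L * \<Delta> + \<eta> * \<epsilon>)"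
      proof -
        have "R * (5/4 * L * \<tau> + ((2 * \<rho> - 5/4) * L * \<tau> + R * (\<eta> * \<epsilon>))) = R * (2 * \<rho> * L * \<tau>) + R\<^sup>2 * (\<eta> * \<epsilon>)"
          by (simp add: power2_eq_square algebra_simps)
        then show ?thesis unfolding R_def[symmetric] unfolding R(2) distrib_left[of "R\<^sup>2"] using le by linarith
      qed
    qed
  qed
qed

section \<open>Failure probability\<close>

lemma rank_pos:
  fixes X :: "real mat"
  assumes X: "X \<in> carrier_mat n c" and pos: "0 < finner X X"
  shows "1 \<le> vec_space.rank n X"
proof (rule ccontr)
  assume "\<not> 1 \<le> vec_space.rank n X"
  then have r: "vec_space.rank n X = 0" by simp
  obtain U where U: "U \<in> carrier_mat n 0" "U * (U\<^sup>T * X) = X"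
    using exists_orthonormal_column_space[OF X] unfolding r by auto
  have "X $$ (i, j) = 0" if "i < n" "j < c" for i j
  proof -
    have "(U * (U\<^sup>T * X)) $$ (i, j) = (\<Sum>l<0. U $$ (i, l) * (U\<^sup>T * X) $$ (l, j))"
      by (rule mult_mat_entry) (use U(1) X that in auto)
    then show ?thesis unfolding U(2) by simp
  qed
  then have "finner X X = 0" unfolding finner_def using X by simp
  then show False using pos by simp
qed

lemma sets_mat_borel_singleton:
  assumes s: "s \<in> carrier_mat r c"
  shows "{s} \<in> sets (mat_borel r c)"
proof -
  have "{s} = {X \<in> space (mat_borel r c). \<forall>ij\<in>{..<r} \<times> {..<c}. X $$ ij = s $$ ij}"
  proof (rule Set.set_eqI, rule iffI)
    fix X assume "X \<in> {X \<in> space (mat_borel r c). \<forall>ij\<in>{..<r} \<times> {..<c}. X $$ ij = s $$ ij}"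
    then have X: "X \<in> carrier_mat r c" "\<And>i j. i < r \<Longrightarrow> j < c \<Longrightarrow> X $$ (i, j) = s $$ (i, j)"
      by (auto simp: space_mat_borel)
    have "X = s" by (rule eq_matI) (use X s in auto)
    then show "X \<in> {s}" by simp
  qed (use s in \<open>simp add: space_mat_borel\<close>)
  also have "\<dots> \<in> sets (mat_borel r c)"
  proof (rule sets.sets_Collect_finite_All)
    fix ij assume "ij \<in> {..<r} \<times> {..<c}"
    then obtain i j where ij: "ij = (i, j)" "i < r" "j < c" by auto
    have "(\<lambda>X. X $$ (i, j)) -` {s $$ (i, j)} \<inter> space (mat_borel r c) \<in> sets (mat_borel r c)"
      by (rule measurable_sets[OF measurable_mat_entry[OF ij(2,3)]]) simp
    moreover have "(\<lambda>X. X $$ (i, j)) -` {s $$ (i, j)} \<inter> space (mat_borel r c) = {X \<in> space (mat_borel r c). X $$ (i, j) = s $$ (i, j)}"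
      by blast
    ultimately show "{X \<in> space (mat_borel r c). X $$ ij = s $$ ij} \<in> sets (mat_borel r c)" by (simp only: ij(1))
  qed simp
  finally show ?thesis .
qed

text \<open>Stirling's approximation to \<open>1 / n!\<close>; with \<open>n = K + 1\<close> it is
  the second summand in the failure probability of the theorem.\<close>

definition sketch_kappa :: "nat \<Rightarrow> real" where
  "sketch_kappa n = (exp 1 / real n) ^ n / sqrt (2 * pi * real n)"

text \<open>Coefficient of the tail deviation: 1 for \<open>Y\<close> itself, and the root for the
  sketch of \<open>Y\<close> times the root of the sum of the \<open>1 / D\<^sub>k\<close>. With
  \<open>n = K + 1\<close>, the factor \<open>n + 2\<close> is the Chernoff level for the sketch and
  \<open>sketch_const\<close> bounds the truncated mean of the sum.\<close>

definition sketch_dev :: "nat \<Rightarrow> nat \<Rightarrow> real" where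
  "sketch_dev \<mu> K = 1 + 2 * sqrt (real (\<mu> + K) * (real (K + 1) + 2) * sketch_const (K + 1) \<mu>)"

text \<open>A lower estimate of \<open>(1 + \<lambda>) I\<close>: both \<open>I\<close> and the
  maximum in \<open>\<lambda>\<close> are replaced by \<open>m\<close>, and
  \<open>\<gamma> \<beta>\<close> by 1.\<close>

definition sketch_amp :: "nat \<Rightarrow> real" where
  "sketch_amp m = real m + 2 * sqrt 2 * (real m)\<^sup>2"

text \<open>For a fixed sample the sampled tail energy is at most \<open>\<tau> + z\<close>. The
  part with \<open>\<tau>\<close> is amplified by the worst case of the \<open>D\<^sub>k\<close> and
  goes into the deterministic bound; the part with \<open>z\<close> and the Gram error
  \<open>e\<close> go into \<open>t\<close>, where the reciprocals are charged by their truncated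
  mean. \<open>H\<close> is fixed before \<open>Q\<close>, so the estimate covers every admissible
  basis.\<close>

lemma sketch_failure_given_sample:
  fixes X s U :: "real mat"
  assumes M: "prob_space M" and G: "std_gaussian_mat M d (\<mu> + K) G"
    and X: "X \<in> carrier_mat d J" and s: "s \<in> carrier_mat J L"
    and U: "U \<in> carrier_mat d \<mu>" "orthonormal_mat U" and mu: "1 \<le> \<mu>" "1 \<le> K" "\<mu> \<le> d" "\<mu> \<le> L" and t: "0 < t"
  defines "e \<equiv> frob_norm (X * X\<^sup>T - (X * s) * (X * s)\<^sup>T)" and "\<tau> \<equiv> finner (resid U X) (resid U X)"
  defines "z \<equiv> \<bar>finner (resid U X * s) (resid U X * s) - \<tau>\<bar>"
  shows "\<exists>H\<in>sets (mat_borel d (\<mu> + K)).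
    measure M {\<omega> \<in> space M. G \<omega> \<notin> H} \<le> sketch_kappa (K + 1) + (e + sketch_dev \<mu> K * z)\<^sup>2 / t\<^sup>2 \<and>
    (\<forall>g\<in>H. \<forall>Q. range_basis \<mu> K (((X * s) * (X * s)\<^sup>T) * g) Q \<longrightarrow>
      finner (resid Q X) (resid Q X) \<le> sqrt (real (vec_space.rank d X)) * (5/4 * sketch_amp (\<mu> + K) * \<tau> + t))"
proof -
  define m n where "m = \<mu> + K" and "n = K + 1"
  have n2: "2 \<le> n" and mn: "m + 1 = \<mu> + n" "n \<le> m" "n = m - \<mu> + 1" "\<mu> \<le> m" using mu by (auto simp: m_def n_def)
  define \<sigma> where "\<sigma> = exp 1 / (36/5 * (real n + 2 * real \<mu> - 2))"
  have \<sigma>0: "0 < \<sigma>" unfolding \<sigma>_def using n2 mu by simp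
  have \<sigma>n: "\<sigma> \<le> real n"
  proof -
    have "\<sigma> \<le> exp 1 / (36/5 * 2)" unfolding \<sigma>_def by (rule divide_left_mono) (use n2 mu in auto)
    also have "\<dots> \<le> real n" using e_less_272 n2 by simp
    finally show ?thesis .
  qed
  obtain F where F: "0 \<le> F" "real \<mu> * (F / (1 - exp (- (4 / \<sigma>) * \<sigma>))) \<le> sketch_const n \<mu>"
    "(\<integral>\<^sup>+\<theta>. ennreal ((1 + 2 * \<theta>) powr (- real n / 2)) * indicator {0..4 / \<sigma>} \<theta> \<partial>lborel) \<le> ennreal F"
    using sketch_const_bound[OF n2 mu(1) \<sigma>_def] .
  have C0: "0 < sketch_const n \<mu>" using n2 mu by (simp add: sketch_const_def)
  let ?B = "(X * s) * (X * s)\<^sup>T"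
  define Z where "Z = finner (resid U X * s) (resid U X * s)"
  obtain V Lm Y where V: "V \<in> carrier_mat d \<mu>" "orthonormal_mat V" and Lm: "Lm \<in> carrier_mat d \<mu>"
    and Y: "Y \<in> carrier_mat d d" and BV: "?B = Lm * V\<^sup>T + Y" and YZ: "frob_norm Y \<le> Z"
    using sampled_gram_split[OF X s U mu(3,4)] unfolding Z_def by blast
  have e0: "0 \<le> e" unfolding e_def by (rule frob_norm_nonneg)
  have z0: "0 \<le> z" unfolding z_def by simp
  have \<tau>0: "0 \<le> \<tau>" unfolding \<tau>_def by (rule finner_self_nonneg)
  have Z0: "0 \<le> Z" unfolding Z_def by (rule finner_self_nonneg)
  have B0: "0 < 4 / \<sigma>" using \<sigma>0 by simp
  have y1: "1 < real n + 2" by simp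
  \<comment> \<open>The good set is taken with \<open>p = e + z\<close>, the Gram error and the
    deviation of \<open>Y\<close> itself; the amplified deviation is the other summand.\<close>
  have p0: "0 \<le> e + z" using e0 z0 by simp
  obtain H where H: "H \<in> sets (mat_borel d m)" and PH: "measure M {\<omega> \<in> space M. G \<omega> \<notin> H} \<le> real \<mu> * (exp 1 * \<sigma> / n) powr (real n / 2)
      + ((real n + 2) * exp (1 - (real n + 2))) powr (real m / 2) + (e + z + 2 * sqrt (real m * (real n + 2) * sketch_const n \<mu>) * z)\<^sup>2 / t\<^sup>2"
    and GH: "\<And>g. g \<in> H \<Longrightarrow> g \<in> carrier_mat d m \<and> (\<forall>k<\<mu>. \<sigma> \<le> mat_row_dist2 \<mu> m (V\<^sup>T * g) k) \<and> finner (Y * g) (Y * g) \<le> real m * (real n + 2) * finner Y Y \<and>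
      e + z + 2 * sqrt (real m * (real n + 2) * (\<Sum>k<\<mu>. 1 / mat_row_dist2 \<mu> m (V\<^sup>T * g) k)) * z \<le> t"
    using gaussian_sketch_good_set[OF M G[folded m_def] V Y mu(1) mn(4,3) \<sigma>0 \<sigma>n y1 B0 F(3,1) C0 F(2) p0 z0 t] by blast
  show ?thesis
  proof (rule bexI[OF _ H[unfolded m_def]], rule conjI)
    have "measure M {\<omega> \<in> space M. G \<omega> \<notin> H} \<le> sketch_kappa n / 2 + sketch_kappa n / 2
      + (e + z + 2 * sqrt (real m * (real n + 2) * sketch_const n \<mu>) * z)\<^sup>2 / t\<^sup>2"
      using PH sketch_tail_bounds[OF n2 mu(1) mn(2) \<sigma>_def] unfolding sketch_kappa_def by linarith
    also have "e + z + 2 * sqrt (real m * (real n + 2) * sketch_const n \<mu>) * z = e + sketch_dev \<mu> K * z"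
      unfolding sketch_dev_def m_def n_def by (simp add: distrib_right)
    finally show "measure M {\<omega> \<in> space M. G \<omega> \<notin> H} \<le> sketch_kappa (K + 1) + (e + sketch_dev \<mu> K * z)\<^sup>2 / t\<^sup>2"
      unfolding n_def by simp
    show "\<forall>g\<in>H. \<forall>Q. range_basis \<mu> K (?B * g) Q \<longrightarrow>
      finner (resid Q X) (resid Q X) \<le> sqrt (real (vec_space.rank d X)) * (5/4 * sketch_amp (\<mu> + K) * \<tau> + t)"
    proof (intro ballI allI impI)
      fix g Q assume g: "g \<in> H" and Q: "range_basis \<mu> K (?B * g) Q"
      note g' = GH[OF g]
      have gc: "g \<in> carrier_mat d (\<mu> + K)" using g' by (simp add: m_def)
      define T where "T = (\<Sum>k<\<mu>. 1 / mat_row_dist2 \<mu> m (V\<^sup>T * g) k)"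
      have D: "\<sigma> \<le> mat_row_dist2 \<mu> m (V\<^sup>T * g) k" if "k < \<mu>" for k using g' that by blast
      have D0: "0 < mat_row_dist2 \<mu> m (V\<^sup>T * g) k" if "k < \<mu>" for k using D[OF that] \<sigma>0 by linarith
      have T0: "0 \<le> T" unfolding T_def by (rule sum_nonneg) (use D0 in \<open>simp add: less_imp_le\<close>)
      have T\<sigma>: "T \<le> real \<mu> / \<sigma>"
      proof -
        have "T \<le> (\<Sum>k<\<mu>. 1 / \<sigma>)" unfolding T_def
        proof (rule sum_mono)
          fix k assume "k \<in> {..<\<mu>}"
          then have k: "k < \<mu>" by simp
          show "1 / mat_row_dist2 \<mu> m (V\<^sup>T * g) k \<le> 1 / \<sigma>"
            by (rule divide_left_mono[OF D[OF k]]) (use \<sigma>0 D0[OF k] in auto)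
        qed
        then show ?thesis by simp
      qed
      have VG: "V\<^sup>T * g \<in> carrier_mat \<mu> m" using V gc by (auto simp: m_def)
      have key: "finner R R \<le> finner (R * (V\<^sup>T * g)) (R * (V\<^sup>T * g)) * T" if R: "R \<in> carrier_mat d \<mu>" for R
        unfolding T_def mat_row_dist2_def
        by (rule finner_le_sum_inverse_row_dist2[OF R VG]) (rule D0[unfolded mat_row_dist2_def])
      have Bc: "?B \<in> carrier_mat d d" using X by auto
      have resB: "frob_norm (resid Q ?B) \<le> frob_norm Y + 2 * frob_norm (Y * g) * sqrt T"
        by (rule range_basis_residual[OF gc V(1) Lm Y V(2) BV Q T0 key])
      have Qc: "Q \<in> carrier_mat d \<mu>" "orthonormal_mat Q"
      proof -
        have "dim_row (?B * g) = d" using X by simp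
        then show "Q \<in> carrier_mat d \<mu>" "orthonormal_mat Q" using Q unfolding range_basis_def by auto
      qed
      define a where "a = 2 * sqrt (real m * (real n + 2) * T)"
      have a0: "0 \<le> a" unfolding a_def using T0 by simp
      have Yg: "frob_norm (Y * g) \<le> sqrt (real m * (real n + 2)) * Z"
      proof -
        have "frob_norm (Y * g) \<le> sqrt (real m * (real n + 2)) * frob_norm Y"
        proof (rule power2_le_imp_le)
          have "(frob_norm (Y * g))\<^sup>2 \<le> real m * (real n + 2) * finner Y Y" unfolding frob_norm_power2 using g' by blast
          also have "\<dots> = (sqrt (real m * (real n + 2)) * frob_norm Y)\<^sup>2"
            unfolding power_mult_distrib frob_norm_power2 by (subst real_sqrt_pow2) auto
          finally show "(frob_norm (Y * g))\<^sup>2 \<le> (sqrt (real m * (real n + 2)) * frob_norm Y)\<^sup>2" .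
        qed (use frob_norm_nonneg[of Y] in simp)
        also have "\<dots> \<le> sqrt (real m * (real n + 2)) * Z" by (rule mult_left_mono[OF YZ]) simp
        finally show ?thesis .
      qed
      have aZ: "2 * frob_norm (Y * g) * sqrt T \<le> a * Z"
      proof -
        have "frob_norm (Y * g) * sqrt T \<le> (sqrt (real m * (real n + 2)) * Z) * sqrt T"
          by (rule mult_right_mono[OF Yg]) (use T0 in simp)
        then have "2 * (frob_norm (Y * g) * sqrt T) \<le> 2 * ((sqrt (real m * (real n + 2)) * Z) * sqrt T)"
          by (rule mult_left_mono) simp
        then show ?thesis unfolding a_def real_sqrt_mult[of "real m * (real n + 2)" T] by (simp only: mult_ac)
      qed
      have amp: "1 + a \<le> 5/4 * sketch_amp (\<mu> + K)"
      proof -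
        have "sqrt (real m * (real n + 2) * T) \<le> sqrt (real m * (real n + 2) * (real \<mu> / \<sigma>))"
          by (rule real_sqrt_le_mono, rule mult_left_mono[OF T\<sigma>]) simp
        then show ?thesis using sketch_norm_factor_le[OF n2 mu(1) mn(1) \<sigma>_def]
          unfolding a_def sketch_amp_def m_def[symmetric] by linarith
      qed
      have "Z \<le> \<tau> + z" unfolding z_def Z_def by linarith
      then have "(1 + a) * Z \<le> (1 + a) * (\<tau> + z)" by (rule mult_left_mono) (use a0 in simp)
      also have "\<dots> = (1 + a) * \<tau> + (z + a * z)" by (simp add: algebra_simps)
      also have "\<dots> \<le> 5/4 * sketch_amp (\<mu> + K) * \<tau> + (z + a * z)" using mult_right_mono[OF amp \<tau>0] by simp
      finally have "Z + a * Z \<le> 5/4 * sketch_amp (\<mu> + K) * \<tau> + (z + a * z)" by (simp add: distrib_right)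
      moreover have "e + z + a * z \<le> t" using g' unfolding a_def T_def by blast
      ultimately have "e + frob_norm (resid Q ?B) \<le> 5/4 * sketch_amp (\<mu> + K) * \<tau> + t"
        using resB aZ YZ by linarith
      then have "sqrt (real (vec_space.rank d X)) * (e + frob_norm (resid Q ?B))
        \<le> sqrt (real (vec_space.rank d X)) * (5/4 * sketch_amp (\<mu> + K) * \<tau> + t)" by (rule mult_left_mono) simp
      then show "finner (resid Q X) (resid Q X) \<le> sqrt (real (vec_space.rank d X)) * (5/4 * sketch_amp (\<mu> + K) * \<tau> + t)"
        using projection_residual_le_rank[OF X Qc Bc] unfolding e_def by linarith
    qed
  qed
qed

text \<open>Minkowski's inequality in a weighted \<open>l\<^sup>2\<close> space: the two second
  moments combine although \<open>e\<close> and \<open>z\<close> come from the same sample and may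
  be correlated.\<close>

lemma weighted_square_sum_triangle:
  fixes w e z :: "'b \<Rightarrow> real"
  assumes w: "\<And>i. i \<in> A \<Longrightarrow> 0 \<le> w i" and e: "(\<Sum>i\<in>A. w i * (e i)\<^sup>2) \<le> a\<^sup>2" and z: "(\<Sum>i\<in>A. w i * (z i)\<^sup>2) \<le> c"
    and a: "0 \<le> a" and b: "0 \<le> b"
  shows "(\<Sum>i\<in>A. w i * (e i + b * z i)\<^sup>2) \<le> (a + b * sqrt c)\<^sup>2"
proof -
  have sq: "(sqrt (w i) * y)\<^sup>2 = w i * y\<^sup>2" if "i \<in> A" for i y using w[OF that] by (simp add: power_mult_distrib)
  have L2: "L2_set (\<lambda>i. sqrt (w i) * f i) A = sqrt (\<Sum>i\<in>A. w i * (f i)\<^sup>2)" for f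
    unfolding L2_set_def by (rule arg_cong[of _ _ sqrt], rule sum.cong[OF refl], rule sq)
  have "sqrt (\<Sum>i\<in>A. w i * (e i + b * z i)\<^sup>2) = L2_set (\<lambda>i. sqrt (w i) * e i + sqrt (w i) * (b * z i)) A"
    unfolding L2[symmetric] by (simp only: distrib_left)
  also have "\<dots> \<le> sqrt (\<Sum>i\<in>A. w i * (e i)\<^sup>2) + sqrt (\<Sum>i\<in>A. w i * (b * z i)\<^sup>2)"
    unfolding L2[symmetric] by (rule L2_set_triangle_ineq)
  also have "(\<Sum>i\<in>A. w i * (b * z i)\<^sup>2) = b\<^sup>2 * (\<Sum>i\<in>A. w i * (z i)\<^sup>2)"
    by (simp only: sum_distrib_left power_mult_distrib mult_ac)
  also have "sqrt (b\<^sup>2 * (\<Sum>i\<in>A. w i * (z i)\<^sup>2)) = b * sqrt (\<Sum>i\<in>A. w i * (z i)\<^sup>2)" using b by (simp add: real_sqrt_mult)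
  also have "\<dots> \<le> b * sqrt c" by (rule mult_left_mono[OF real_sqrt_le_mono[OF z] b])
  also have "sqrt (\<Sum>i\<in>A. w i * (e i)\<^sup>2) \<le> a" by (rule real_le_lsqrt[OF a e])
  finally have "sqrt (\<Sum>i\<in>A. w i * (e i + b * z i)\<^sup>2) \<le> a + b * sqrt c" by simp
  then have "(sqrt (\<Sum>i\<in>A. w i * (e i + b * z i)\<^sup>2))\<^sup>2 \<le> (a + b * sqrt c)\<^sup>2"
    by (rule power_mono) (use w in \<open>simp add: sum_nonneg\<close>)
  also have "(sqrt (\<Sum>i\<in>A. w i * (e i + b * z i)\<^sup>2))\<^sup>2 = (\<Sum>i\<in>A. w i * (e i + b * z i)\<^sup>2)"
    by (rule real_sqrt_pow2) (use w in \<open>simp add: sum_nonneg\<close>)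
  finally show ?thesis .
qed

text \<open>Condition on \<open>S\<close>, which takes finitely many values: independence factors
  the probability of \<open>S = s\<close> with \<open>G\<close> outside the good set for
  \<open>s\<close>, and the conditional bounds are averaged. Their quadratic terms average to at
  most \<open>\<delta> * t\<^sup>2\<close> before division by \<open>t\<^sup>2\<close>, so
  \<open>\<delta>\<close> is spent once, on Gram error and tail deviation together.\<close>

lemma mode_failure_probability:
  fixes X :: "real mat"
  assumes M: "prob_space M" and S: "randsample M J L p S" and p: "prob_vector J p"
    and G: "std_gaussian_mat M d (\<mu> + K) G"
    and ind: "prob_space.indep_var M (mat_borel J L) S (mat_borel d (\<mu> + K)) G"
    and Q: "Q \<in> measurable M (mat_borel d \<mu>)"
    and rb: "\<And>\<omega>. \<omega> \<in> space M \<Longrightarrow> range_basis \<mu> K (((X * S \<omega>) * (X * S \<omega>)\<^sup>T) * G \<omega>) (Q \<omega>)"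
    and X: "X \<in> carrier_mat d J" and W: "0 < finner X X"
    and mu: "1 \<le> \<mu>" "1 \<le> K" "\<mu> + K \<le> d" "\<mu> + K \<le> L"
    and \<beta>: "0 < \<beta>" and opt: "nearly_optimal \<beta> X p" and \<delta>: "0 < \<delta>" "\<delta> < 1"
    and \<phi>: "\<phi> = (1 + sqrt (8 / \<delta> * ln (1 / \<delta>))) / sqrt (\<beta> * real L)" "\<phi> < 1"
    and \<kappa>: "sketch_kappa (K + 1) + \<delta> \<le> 1"
  shows "measure M {\<omega> \<in> space M. real (vec_space.rank d X) * (2 * sketch_amp (\<mu> + K) * Delta1 (\<mu> + 1) X + \<phi> * finner X X)
      < finner (resid (Q \<omega>) X) (resid (Q \<omega>) X)} \<le> sketch_kappa (K + 1) + \<delta>" (is "measure M ?bad \<le> _")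
proof -
  interpret prob_space M by (rule M)
  define r where "r = vec_space.rank d X"
  define m where "m = \<mu> + K"
  have \<mu>d: "\<mu> \<le> d" "\<mu> \<le> L" and L1: "1 \<le> L" using mu by auto
  have r1: "1 \<le> r" unfolding r_def by (rule rank_pos[OF X W])
  obtain U where U: "U \<in> carrier_mat d \<mu>" "orthonormal_mat U"
    and U\<tau>: "finner (resid U X) (resid U X) \<le> sqrt (real (r - \<mu>)) * Delta1 (\<mu> + 1) X"
    using tail_energy_le_Delta1[OF X \<mu>d(1)] unfolding resid_def r_def by blast
  define \<tau> where "\<tau> = finner (resid U X) (resid U X)"
  have \<tau>0: "0 \<le> \<tau>" unfolding \<tau>_def by (rule finner_self_nonneg)
  define \<Delta> where "\<Delta> = Delta1 (\<mu> + 1) X"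
  have \<Delta>0: "0 \<le> \<Delta>" unfolding \<Delta>_def Delta1_def by (simp add: sum_nonneg)
  define b where "b = sketch_dev \<mu> K"
  have b0: "0 \<le> b" unfolding b_def sketch_dev_def using mu by (simp add: sketch_const_def)
  define A where "A = sketch_amp m"
  have A0: "0 \<le> A" unfolding A_def sketch_amp_def by simp
  define \<eta> where "\<eta> = 1 + sqrt (8 / \<delta> * ln (1 / \<delta>))"
  define \<psi> where "\<psi> = sqrt \<delta> + sqrt (8 * ln (1 / \<delta>))"
  have \<psi>\<eta>: "\<psi> = sqrt \<delta> * \<eta>"
  proof -
    have "sqrt \<delta> * sqrt (8 / \<delta> * ln (1 / \<delta>)) = sqrt (\<delta> * (8 / \<delta> * ln (1 / \<delta>)))" by (simp only: real_sqrt_mult)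
    also have "\<delta> * (8 / \<delta> * ln (1 / \<delta>)) = 8 * ln (1 / \<delta>)" using \<delta> by simp
    finally show ?thesis unfolding \<psi>_def \<eta>_def by (simp add: distrib_left)
  qed
  have \<kappa>': "\<delta> + (exp 1 / real (K + 1)) ^ (K + 1) / sqrt (2 * pi * real (K + 1)) \<le> 1"
    using \<kappa> unfolding sketch_kappa_def by linarith
  have \<psi>1: "1 \<le> \<psi>" unfolding \<psi>_def by (rule deviation_psi_ge(1)[OF \<delta> \<kappa>'])
  have K2: "2 \<le> K + 1" "m + 1 = \<mu> + (K + 1)" using mu by (auto simp: m_def)
  have bb: "b\<^sup>2 \<le> 6 * A * sqrt (real \<mu>) * (\<psi> * (\<psi> - 1 / sqrt 2))"
    using sketch_deviation_factor_le[OF K2(1) mu(1) K2(2) \<delta> \<kappa>']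
    unfolding b_def sketch_dev_def A_def sketch_amp_def \<psi>_def m_def by simp
  define w where "w = finner X X"
  define q where "q = sqrt (\<beta> * real L)"
  have q0: "0 < q" "q\<^sup>2 = \<beta> * real L" using \<beta> L1 by (auto simp: q_def)
  \<comment> \<open>\<open>\<epsilon>\<close> will bound the root mean square of the Gram error, and
    \<open>\<tau> * h\<close> the mean square of the tail deviation.\<close>
  define \<epsilon> where "\<epsilon> = w / q"
  define h where "h = w / (\<beta> * L)"
  have w0: "0 < w" using W by (simp add: w_def)
  have \<epsilon>0: "0 < \<epsilon>" using w0 q0 by (simp add: \<epsilon>_def)
  have h\<epsilon>: "h = \<epsilon> / q" unfolding h_def \<epsilon>_def q0(2)[symmetric] by (simp add: power2_eq_square)
  have \<phi>q: "\<phi> = \<eta> / q" unfolding \<phi>(1) \<eta>_def q_def ..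
  have h0: "0 \<le> h" unfolding h\<epsilon> using \<epsilon>0 q0 by simp
  \<comment> \<open>This is where \<open>\<phi> < 1\<close> enters the choice of the
    threshold.\<close>
  have h\<psi>: "h * \<psi> \<le> \<epsilon> * sqrt \<delta>"
  proof -
    have "h * \<psi> = \<epsilon> * sqrt \<delta> * \<phi>" unfolding h\<epsilon> \<psi>\<eta> \<phi>q by simp
    also have "\<dots> \<le> \<epsilon> * sqrt \<delta> * 1" by (rule mult_left_mono) (use \<phi>(2) \<epsilon>0 \<delta> in auto)
    finally show ?thesis by simp
  qed
  obtain t where t0: "0 < t" and tb: "\<epsilon> + b * sqrt (\<tau> * h) \<le> sqrt \<delta> * t"
    and tr: "sqrt r * (5/4 * A * \<tau> + t) \<le> r * (2 * A * \<Delta> + \<eta> * \<epsilon>)"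
    using failure_threshold_exists[OF r1 mu(1) \<tau>0 U\<tau>[folded \<tau>_def \<Delta>_def] A0 b0 bb \<psi>1 \<delta>(1) \<psi>\<eta> \<epsilon>0 h0 h\<psi> \<Delta>0] .
  have \<eta>\<epsilon>: "\<eta> * \<epsilon> = \<phi> * w" unfolding \<phi>q \<epsilon>_def by simp
  define e where "e s = frob_norm (X * X\<^sup>T - (X * s) * (X * s)\<^sup>T)" for s
  define z where "z s = \<bar>finner (resid U X * s) (resid U X * s) - \<tau>\<bar>" for s
  note simp = randsample_simple[OF M S]
  let ?R = "S ` space M"
  \<comment> \<open>The good set depends on the sample through \<open>V\<close> and
    \<open>Y\<close>, so one is chosen for each value of \<open>S\<close>; the threshold
    \<open>t\<close> is common to all of them.\<close>
  have "\<forall>s\<in>?R. \<exists>H. H \<in> sets (mat_borel d m) \<and>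
    measure M {\<omega> \<in> space M. G \<omega> \<notin> H} \<le> sketch_kappa (K + 1) + (e s + b * z s)\<^sup>2 / t\<^sup>2 \<and>
    (\<forall>g\<in>H. \<forall>Q. range_basis \<mu> K (((X * s) * (X * s)\<^sup>T) * g) Q \<longrightarrow>
      finner (resid Q X) (resid Q X) \<le> sqrt (real r) * (5/4 * A * \<tau> + t))"
  proof
    fix s assume "s \<in> ?R"
    then have s: "s \<in> carrier_mat J L" by (rule simp(2))
    show "\<exists>H. H \<in> sets (mat_borel d m) \<and>
      measure M {\<omega> \<in> space M. G \<omega> \<notin> H} \<le> sketch_kappa (K + 1) + (e s + b * z s)\<^sup>2 / t\<^sup>2 \<and>
      (\<forall>g\<in>H. \<forall>Q. range_basis \<mu> K (((X * s) * (X * s)\<^sup>T) * g) Q \<longrightarrow>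
      finner (resid Q X) (resid Q X) \<le> sqrt (real r) * (5/4 * A * \<tau> + t))"
      using sketch_failure_given_sample[OF M G X s U mu(1,2) \<mu>d t0]
      unfolding e_def z_def b_def r_def A_def m_def \<tau>_def by blast
  qed
  from bchoice[OF this] obtain H where H: "\<And>s. s \<in> ?R \<Longrightarrow> H s \<in> sets (mat_borel d m)"
    and PH: "\<And>s. s \<in> ?R \<Longrightarrow> measure M {\<omega> \<in> space M. G \<omega> \<notin> H s} \<le> sketch_kappa (K + 1) + (e s + b * z s)\<^sup>2 / t\<^sup>2"
    and GH: "\<And>s g Q. s \<in> ?R \<Longrightarrow> g \<in> H s \<Longrightarrow> range_basis \<mu> K (((X * s) * (X * s)\<^sup>T) * g) Q \<Longrightarrow>
      finner (resid Q X) (resid Q X) \<le> sqrt (real r) * (5/4 * A * \<tau> + t)" by blast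
  have GM: "G \<in> measurable M (mat_borel d m)" unfolding m_def by (rule measurable_std_gaussian_mat[OF G])
  let ?P = "\<lambda>s. measure M {\<omega> \<in> space M. S \<omega> = s}"
  let ?C = "\<lambda>s. {\<omega> \<in> space M. S \<omega> = s \<and> G \<omega> \<notin> H s}"
  have evG: "{\<omega> \<in> space M. G \<omega> \<notin> H s} \<in> sets M" if "s \<in> ?R" for s
  proof -
    have "G -` (space (mat_borel d m) - H s) \<inter> space M \<in> sets M"
      by (rule measurable_sets[OF GM]) (use H[OF that] in auto)
    moreover have "G -` (space (mat_borel d m) - H s) \<inter> space M = {\<omega> \<in> space M. G \<omega> \<notin> H s}"
      using measurable_space[OF GM] by blast
    ultimately show ?thesis by simp
  qed
  have evC: "?C s \<in> sets M" if "s \<in> ?R" for s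
  proof -
    have "?C s = {\<omega> \<in> space M. S \<omega> = s} \<inter> {\<omega> \<in> space M. G \<omega> \<notin> H s}" by blast
    then show ?thesis using simp(3) evG[OF that] by simp
  qed
  have PC: "measure M (?C s) = ?P s * measure M {\<omega> \<in> space M. G \<omega> \<notin> H s}" if s: "s \<in> ?R" for s
  proof -
    let ?H = "space (mat_borel d m) - H s"
    have "measure M ((\<lambda>x. (S x, G x)) -` ({s} \<times> ?H) \<inter> space M) = measure M (S -` {s} \<inter> space M) * measure M (G -` ?H \<inter> space M)"
      by (rule indep_varD[OF ind[folded m_def] sets_mat_borel_singleton[OF simp(2)[OF s]]]) (use H[OF s] in auto)
    also have "(\<lambda>x. (S x, G x)) -` ({s} \<times> ?H) \<inter> space M = ?C s" using measurable_space[OF GM] by blast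
    also have "S -` {s} \<inter> space M = {\<omega> \<in> space M. S \<omega> = s}" by blast
    also have "G -` ?H \<inter> space M = {\<omega> \<in> space M. G \<omega> \<notin> H s}" using measurable_space[OF GM] by blast
    finally show ?thesis .
  qed
  have bad: "?bad \<subseteq> (\<Union>s\<in>?R. ?C s)"
  proof
    fix \<omega> assume w: "\<omega> \<in> ?bad"
    then have \<omega>: "\<omega> \<in> space M" by simp
    have "G \<omega> \<notin> H (S \<omega>)"
    proof
      assume g: "G \<omega> \<in> H (S \<omega>)"
      have "finner (resid (Q \<omega>) X) (resid (Q \<omega>) X) \<le> sqrt (real r) * (5/4 * A * \<tau> + t)"
        by (rule GH[OF _ g rb[OF \<omega>]]) (use \<omega> in simp)
      also have "\<dots> \<le> r * (2 * A * \<Delta> + \<phi> * w)" using tr unfolding \<eta>\<epsilon> .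
      finally show False using w unfolding r_def A_def \<Delta>_def w_def m_def by simp
    qed
    then show "\<omega> \<in> (\<Union>s\<in>?R. ?C s)" using \<omega> by blast
  qed
  have P1: "(\<Sum>s\<in>?R. ?P s) = 1"
  proof -
    have "(\<integral>\<omega>. (\<lambda>_. 1 :: real) (S \<omega>) \<partial>M) = (\<Sum>s\<in>?R. ?P s * 1)"
      by (rule expectation_finite_range(2)[OF simp(1) _ simp(3)]) simp
    then show ?thesis by (simp add: prob_space)
  qed
  have momE: "(\<Sum>s\<in>?R. ?P s * (e s)\<^sup>2) \<le> \<epsilon>\<^sup>2"
  proof -
    have "(\<Sum>s\<in>?R. ?P s * (e s)\<^sup>2) \<le> (finner X X)\<^sup>2 / (\<beta> * L)"
      unfolding e_def frob_norm_power2 by (rule randsample_moments(1)[OF M S p L1 X W \<beta> opt])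
    then show ?thesis unfolding \<epsilon>_def power_divide q0(2) w_def .
  qed
  have momZ: "(\<Sum>s\<in>?R. ?P s * (z s)\<^sup>2) \<le> \<tau> * h"
  proof -
    have RU: "resid U X \<in> carrier_mat d J" by (rule resid_carrier[OF U(1) X])
    \<comment> \<open>Column \<open>i\<close> of the residual is the residual of column
      \<open>i\<close>, treated as a one-column matrix, and the projection does not lengthen
      it.\<close>
    have cols: "(\<Sum>a<d. (resid U X $$ (a, i))\<^sup>2) \<le> (\<Sum>a<d. (X $$ (a, i))\<^sup>2)" if i: "i < J" for i
    proof -
      define x where "x = Matrix.mat d 1 (\<lambda>(a, _). X $$ (a, i))"
      have x: "x \<in> carrier_mat d 1" by (simp add: x_def)
      have Ux: "U\<^sup>T * x \<in> carrier_mat \<mu> 1" "U\<^sup>T * X \<in> carrier_mat \<mu> J" using U x X by auto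
      have UTx: "(U\<^sup>T * x) $$ (l, 0) = (U\<^sup>T * X) $$ (l, i)" if "l < \<mu>" for l
      proof -
        have "(U\<^sup>T * x) $$ (l, 0) = (\<Sum>a<d. U\<^sup>T $$ (l, a) * x $$ (a, 0))"
          by (rule mult_mat_entry) (use U x that in auto)
        also have "\<dots> = (\<Sum>a<d. U\<^sup>T $$ (l, a) * X $$ (a, i))" by (rule sum.cong[OF refl]) (simp add: x_def)
        also have "\<dots> = (U\<^sup>T * X) $$ (l, i)"
          by (rule mult_mat_entry[symmetric]) (use U X that i in auto)
        finally show ?thesis .
      qed
      have UUx: "(U * (U\<^sup>T * x)) $$ (a, 0) = (U * (U\<^sup>T * X)) $$ (a, i)" if "a < d" for a
      proof -
        have "(U * (U\<^sup>T * x)) $$ (a, 0) = (\<Sum>l<\<mu>. U $$ (a, l) * (U\<^sup>T * x) $$ (l, 0))"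
          by (rule mult_mat_entry[OF U(1) Ux(1) that]) simp
        also have "\<dots> = (\<Sum>l<\<mu>. U $$ (a, l) * (U\<^sup>T * X) $$ (l, i))"
          by (rule sum.cong[OF refl]) (simp only: UTx lessThan_iff)
        also have "\<dots> = (U * (U\<^sup>T * X)) $$ (a, i)" by (rule mult_mat_entry[OF U(1) Ux(2) that i, symmetric])
        finally show ?thesis .
      qed
      have res: "resid U x $$ (a, 0) = resid U X $$ (a, i)" if "a < d" for a
      proof -
        have "resid U x $$ (a, 0) = x $$ (a, 0) - (U * (U\<^sup>T * x)) $$ (a, 0)"
          unfolding resid_def by (rule index_minus_mat(1)) (use U(1) x that in auto)
        also have "\<dots> = X $$ (a, i) - (U * (U\<^sup>T * X)) $$ (a, i)" unfolding UUx[OF that] using that by (simp add: x_def)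
        also have "\<dots> = resid U X $$ (a, i)"
          unfolding resid_def by (rule index_minus_mat(1)[symmetric]) (use U(1) X that i in auto)
        finally show ?thesis .
      qed
      have Rx: "resid U x \<in> carrier_mat d 1" by (rule resid_carrier[OF U(1) x])
      have "(\<Sum>a<d. (resid U X $$ (a, i))\<^sup>2) = finner (resid U x) (resid U x)"
        unfolding finner_def using Rx by (simp add: power2_eq_square res)
      also have "\<dots> \<le> finner x x" by (rule finner_resid_le[OF U x])
      also have "\<dots> = (\<Sum>a<d. (X $$ (a, i))\<^sup>2)" by (simp add: finner_def x_def power2_eq_square)
      finally show ?thesis .
    qed
    have "(\<Sum>s\<in>?R. ?P s * (z s)\<^sup>2) \<le> finner (resid U X) (resid U X) * finner X X / (\<beta> * L)"
      unfolding z_def power2_abs \<tau>_def by (rule randsample_moments(2)[OF M S p L1 X W \<beta> opt RU cols])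
    then show ?thesis unfolding \<tau>_def h_def w_def by simp
  qed
  have cheb: "(\<Sum>s\<in>?R. ?P s * (e s + b * z s)\<^sup>2) \<le> \<delta> * t\<^sup>2"
  proof -
    have "(\<Sum>s\<in>?R. ?P s * (e s + b * z s)\<^sup>2) \<le> (\<epsilon> + b * sqrt (\<tau> * h))\<^sup>2"
      by (rule weighted_square_sum_triangle[OF _ momE momZ _ b0]) (use \<epsilon>0 in auto)
    also have "\<dots> \<le> (sqrt \<delta> * t)\<^sup>2" by (rule power_mono[OF tb]) (use \<epsilon>0 b0 \<tau>0 h0 in simp)
    also have "\<dots> = \<delta> * t\<^sup>2" using \<delta> by (simp add: power_mult_distrib)
    finally show ?thesis .
  qed
  have "measure M ?bad \<le> measure M (\<Union>s\<in>?R. ?C s)"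
    by (rule finite_measure_mono[OF bad], rule sets.finite_UN[OF simp(1) evC])
  also have "\<dots> \<le> (\<Sum>s\<in>?R. measure M (?C s))"
    by (rule finite_measure_subadditive_finite[OF simp(1)]) (use evC in blast)
  also have "\<dots> \<le> (\<Sum>s\<in>?R. ?P s * (sketch_kappa (K + 1) + (e s + b * z s)\<^sup>2 / t\<^sup>2))"
    by (rule sum_mono) (simp only: PC, rule mult_left_mono[OF PH], simp_all)
  also have "\<dots> = (\<Sum>s\<in>?R. ?P s) * sketch_kappa (K + 1) + (\<Sum>s\<in>?R. ?P s * (e s + b * z s)\<^sup>2) / t\<^sup>2"
    by (simp only: distrib_left sum.distrib sum_distrib_right sum_divide_distrib times_divide_eq_right)
  also have "\<dots> \<le> sketch_kappa (K + 1) + \<delta>"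
    unfolding P1 using cheb t0 by (simp add: pos_divide_le_eq)
  finally show ?thesis .
qed

theorem corollary3:
  fixes M :: "'w measure"
    and N K :: nat and I \<mu> T :: "nat \<Rightarrow> nat"
    and A :: tensor
    and \<beta> \<gamma> \<beta>0 p :: real and \<delta> lam \<phi> :: "nat \<Rightarrow> real"
    and I' I'' :: "nat \<Rightarrow> nat"
    and pr :: "nat \<Rightarrow> nat \<Rightarrow> real"
    and S G Q :: "nat \<Rightarrow> 'w \<Rightarrow> real mat"
  assumes M: "prob_space M"
    and N: "N \<ge> 1" and K: "K \<ge> 1"
    and pos: "\<forall>n\<in>{1..N}. I n \<ge> 1 \<and> T n \<ge> 1 \<and> \<mu> n \<ge> 1"
    and I'': "\<forall>n\<in>{1..N}. I'' n = min (I n) (T n)"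
    and I': "\<forall>n\<in>{1..N}. I' n = min (I n) (other_dim I N n)"
    and \<mu>K: "\<forall>n\<in>{1..N}. \<mu> n + K \<le> I'' n"
    and \<beta>: "\<beta> > 1" and \<gamma>: "\<gamma> > 1"
    and \<delta>: "\<forall>n\<in>{1..N}. 0 < \<delta> n \<and> \<delta> n < 1"
    and p: "p = 1 - (\<Sum>n = 1..N.
        1 / (4 * (\<gamma>\<^sup>2 - 1) * sqrt (pi * max (real (I'' n) - real (\<mu> n)) (real (\<mu> n + K)) * \<gamma>\<^sup>2))
          * (2 * \<gamma>\<^sup>2 / exp (\<gamma>\<^sup>2 - 1))\<^sup>2
        + 1 / sqrt (2 * pi * real (K + 1)) * (exp 1 / real (K + 1)) ^ (K + 1)
        + 1 / (4 * (\<gamma>\<^sup>2 - 1) * sqrt (pi * real (I n) * \<gamma>\<^sup>2)) * (2 * \<gamma>\<^sup>2 / exp (\<gamma>\<^sup>2 - 1))\<^sup>2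
        + \<delta> n)"
    and p_nonneg: "p \<ge> 0"
    and pr: "\<forall>n\<in>{1..N}. prob_vector (other_dim I N n) (pr n)"
    and alg: "sampled_rthosvd M I N A \<mu> T K 1 pr S G Q"
    and lam: "\<forall>n\<in>{1..N}. lam n =
        (sqrt (max (real (I'' n) - real (\<mu> n)) (real (\<mu> n + K))) + sqrt (real (I n)))
          * sqrt (2 * real (\<mu> n + K)) * \<gamma> * \<beta>"
    and \<phi>: "(0 < \<beta>0 \<and> \<beta>0 \<le> 1 \<and>
         (\<forall>n\<in>{1..N}. nearly_optimal \<beta>0 (unfolding_mat I N n A) (pr n) \<and>
            \<phi> n = (1 + sqrt (8 / \<delta> n * ln (1 / \<delta> n))) / sqrt (\<beta>0 * real (T n))))
       \<or> (\<forall>n\<in>{1..N}. uniform_probs (other_dim I N n) (pr n) \<and>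
            \<phi> n = 1 + sqrt (real (I' n) / real (T n))
              + real (I' n) / sqrt (real (T n)) * sqrt (8 * ln (1 / \<delta> n)))"
  shows "measure M {\<omega> \<in> space M.
      (tensor_norm I N (\<lambda>i. A i - mode_prods N A (\<lambda>n. Q n \<omega> * transpose_mat (Q n \<omega>)) i))\<^sup>2
        \<le> (\<Sum>n = 1..N. real (vec_space.rank (I n) (unfolding_mat I N n A))
            * (2 * (1 + lam n) * real (I n) * Delta1 (\<mu> n + 1) (unfolding_mat I N n A)
               + \<phi> n * (tensor_norm I N A)\<^sup>2))} \<ge> p"
proof -
  interpret prob_space M by (rule M)
  let ?X = "\<lambda>n. unfolding_mat I N n A" and ?r = "\<lambda>n. real (vec_space.rank (I n) (unfolding_mat I N n A))"
  let ?W = "(tensor_norm I N A)\<^sup>2"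
  let ?bound = "\<lambda>n. ?r n * (2 * (1 + lam n) * real (I n) * Delta1 (\<mu> n + 1) (?X n) + \<phi> n * ?W)"
  let ?res = "\<lambda>n \<omega>. finner (resid (Q n \<omega>) (?X n)) (resid (Q n \<omega>) (?X n))"
  let ?bad = "\<lambda>n. {\<omega> \<in> space M. ?bound n < ?res n \<omega>}"
  define \<kappa> where "\<kappa> = sketch_kappa (K + 1)"
  have I1: "1 \<le> I n" if "n \<in> {1..N}" for n using pos that by blast
  have XW: "?W = finner (?X n) (?X n)" if "n \<in> {1..N}" for n by (rule tensor_norm_unfolding[OF that I1])
  note Xc = unfolding_mat_carrier[of I N _ A]
  have alg': "randsample M (other_dim I N n) (T n) (pr n) (S n)"
      "std_gaussian_mat M (I n) (\<mu> n + K) (G n)"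
      "indep_var (mat_borel (other_dim I N n) (T n)) (S n) (mat_borel (I n) (\<mu> n + K)) (G n)"
      "Q n \<in> measurable M (mat_borel (I n) (\<mu> n))"
      "\<And>\<omega>. \<omega> \<in> space M \<Longrightarrow> range_basis (\<mu> n) K (((?X n * S n \<omega>) * (?X n * S n \<omega>)\<^sup>T) * G n \<omega>) (Q n \<omega>)"
    if n: "n \<in> {1..N}" for n
  proof -
    note a = alg[unfolded sampled_rthosvd_def, rule_format, OF n]
    show "randsample M (other_dim I N n) (T n) (pr n) (S n)"
      "std_gaussian_mat M (I n) (\<mu> n + K) (G n)"
      "indep_var (mat_borel (other_dim I N n) (T n)) (S n) (mat_borel (I n) (\<mu> n + K)) (G n)"
      "Q n \<in> measurable M (mat_borel (I n) (\<mu> n))"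
      using a by blast+
    fix \<omega> assume \<omega>: "\<omega> \<in> space M"
    let ?B = "(?X n * S n \<omega>) * (?X n * S n \<omega>)\<^sup>T"
    have B: "?B \<in> carrier_mat (I n) (I n)" by (rule carrier_matI) (simp_all add: unfolding_mat_def)
    \<comment> \<open>Matrix powers start from the identity of size \<open>dim_row\<close>, so
      \<open>q = 1\<close> leaves a unit factor to be removed.\<close>
    have "?B ^\<^sub>m 1 = 1\<^sub>m (dim_row ?B) * ?B" by (simp del: index_mult_mat(1) dim_row_mat)
    also have "\<dots> = ?B" using B by (metis carrier_matD(1) left_mult_one_mat)
    finally have pow: "?B ^\<^sub>m 1 = ?B" .
    have "range_basis (\<mu> n) K ((?B ^\<^sub>m 1) * G n \<omega>) (Q n \<omega>)" using a \<omega> unfolding Let_def by blast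
    then show "range_basis (\<mu> n) K (?B * G n \<omega>) (Q n \<omega>)" unfolding pow .
  qed
  have Qc: "Q n \<omega> \<in> carrier_mat (I n) (\<mu> n)" "orthonormal_mat (Q n \<omega>)" if n: "n \<in> {1..N}" and \<omega>: "\<omega> \<in> space M" for n \<omega>
  proof -
    show "Q n \<omega> \<in> carrier_mat (I n) (\<mu> n)" by (rule rv_mat_carrier[OF alg'(4)[OF n] \<omega>])
    show "orthonormal_mat (Q n \<omega>)" using alg'(5)[OF n \<omega>] unfolding range_basis_def by blast
  qed
  have resW: "?res n \<omega> \<le> ?W" if n: "n \<in> {1..N}" and \<omega>: "\<omega> \<in> space M" for n \<omega>
    unfolding XW[OF n] by (rule finner_resid_le[OF Qc[OF n \<omega>] Xc])
  have dims: "1 \<le> \<mu> n" "\<mu> n + K \<le> I n" "\<mu> n + K \<le> T n" "1 \<le> T n" if "n \<in> {1..N}" for n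
    using pos \<mu>K I'' that by (auto simp del: atLeastAtMost_iff)
  \<comment> \<open>Both square roots in the first factor of \<open>lam n\<close> are at least
    \<open>sqrt m\<close>, whence
    \<open>lam n \<ge> 2 * sqrt m * sqrt (2 * m) = 2 * sqrt 2 * m\<close>; moreover
    \<open>I n \<ge> m\<close>.\<close>
  have lam0: "0 \<le> lam n" and amp: "sketch_amp (\<mu> n + K) \<le> (1 + lam n) * real (I n)" if n: "n \<in> {1..N}" for n
  proof -
    define m where "m = real (\<mu> n + K)"
    have m0: "0 \<le> m" and mI: "m \<le> real (I n)" using dims(2)[OF n] by (auto simp: m_def)
    let ?l = "sqrt (max (real (I'' n) - real (\<mu> n)) m) + sqrt (real (I n))"
    have l: "2 * sqrt m \<le> ?l"
    proof -
      have "sqrt m \<le> sqrt (max (real (I'' n) - real (\<mu> n)) m)" "sqrt m \<le> sqrt (real (I n))"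
        using mI by (auto intro: real_sqrt_le_mono)
      then show ?thesis by linarith
    qed
    have "2 * sqrt 2 * m = 2 * sqrt m * sqrt (2 * m)" using m0 by (simp add: real_sqrt_mult)
    also have "\<dots> \<le> ?l * sqrt (2 * m)" by (rule mult_right_mono[OF l]) (use m0 in simp)
    also have "\<dots> \<le> ?l * sqrt (2 * m) * (\<gamma> * \<beta>)"
    proof -
      have "1 * 1 \<le> \<gamma> * \<beta>" by (rule mult_mono) (use \<gamma> \<beta> in auto)
      moreover have "0 \<le> ?l * sqrt (2 * m)"
        by (rule mult_nonneg_nonneg[OF order_trans[OF _ l]]) (use m0 in auto)
      ultimately have "?l * sqrt (2 * m) * 1 \<le> ?l * sqrt (2 * m) * (\<gamma> * \<beta>)" by (intro mult_left_mono) auto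
      then show ?thesis by simp
    qed
    also have "\<dots> = lam n" using lam n unfolding m_def by (simp only: mult.assoc)
    finally have lm: "2 * sqrt 2 * m \<le> lam n" .
    moreover have "0 \<le> 2 * sqrt 2 * m" using m0 by simp
    ultimately show l0: "0 \<le> lam n" by linarith
    have "sketch_amp (\<mu> n + K) = (1 + 2 * sqrt 2 * m) * m"
      unfolding sketch_amp_def m_def[symmetric] by (simp add: power2_eq_square distrib_right)
    also have "\<dots> \<le> (1 + lam n) * real (I n)" by (rule mult_mono) (use lm mI m0 l0 in auto)
    finally show "sketch_amp (\<mu> n + K) \<le> (1 + lam n) * real (I n)" .
  qed
  have \<Delta>0: "0 \<le> Delta1 k Y" for k Y unfolding Delta1_def by (simp add: sum_nonneg)
  have bad: "measure M (?bad n) \<le> \<kappa> + \<delta> n" if n: "n \<in> {1..N}" for n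
  proof -
    have \<kappa>\<delta>: "0 \<le> \<kappa> + \<delta> n" using \<delta> n by (simp add: \<kappa>_def sketch_kappa_def add_nonneg_nonneg less_imp_le)
    have Dpart: "0 \<le> 2 * (1 + lam n) * real (I n) * Delta1 (\<mu> n + 1) (?X n)"
      using lam0[OF n] \<Delta>0 by (simp add: mult_nonneg_nonneg)
    \<comment> \<open>Only the last case needs the probabilistic estimate. For the zero tensor, or
      if \<open>\<phi> n \<ge> 1\<close> with a nonzero tensor and hence positive rank, the residual
      never exceeds the bound; if \<open>\<kappa> + \<delta> n > 1\<close>, every probability is
      small enough. The last case supplies \<open>\<phi> n < 1\<close> and
      \<open>\<kappa> + \<delta> n \<le> 1\<close>.\<close>
    consider "?W = 0" | "0 < ?W" "1 \<le> \<phi> n" | "1 < \<kappa> + \<delta> n" | "0 < ?W" "\<phi> n < 1" "\<kappa> + \<delta> n \<le> 1"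
      using zero_le_power2[of "tensor_norm I N A"] by linarith
    then show ?thesis
    proof cases
      case 1
      have "?res n \<omega> \<le> ?bound n" if "\<omega> \<in> space M" for \<omega>
      proof -
        have "0 \<le> 2 * (1 + lam n) * real (I n) * Delta1 (\<mu> n + 1) (?X n) + \<phi> n * ?W"
          unfolding 1 using Dpart by (simp only: mult_zero_right add_0_right)
        then have "0 \<le> ?bound n" by (rule mult_nonneg_nonneg[OF of_nat_0_le_iff])
        moreover have "?res n \<omega> \<le> 0" using resW[OF n that] unfolding 1 .
        ultimately show ?thesis by (rule order_trans[rotated])
      qed
      then have "?bad n = {}" by (auto simp: not_less)
      then show ?thesis using \<kappa>\<delta> by (simp only: measure_empty)
    next
      case 2
      have r1: "1 \<le> ?r n" using rank_pos[OF Xc] 2(1) unfolding XW[OF n] by simp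
      have "?W \<le> ?bound n"
      proof -
        have "1 * ?W \<le> ?r n * (\<phi> n * ?W)"
        proof (rule mult_mono[OF r1])
          show "?W \<le> \<phi> n * ?W" using mult_right_mono[OF 2(2), of ?W] 2(1) by simp
        qed (use 2 in auto)
        also have "\<dots> \<le> ?bound n" by (rule mult_left_mono) (use Dpart in auto)
        finally show ?thesis by simp
      qed
      then have "?bad n = {}" using resW[OF n] by (auto simp: not_less intro: order_trans)
      then show ?thesis using \<kappa>\<delta> by (simp only: measure_empty)
    next
      case 3
      then show ?thesis using prob_le_1[of "?bad n"] by linarith
    next
      case 4
      have opt: "0 < \<beta>0 \<and> nearly_optimal \<beta>0 (?X n) (pr n) \<and>
        \<phi> n = (1 + sqrt (8 / \<delta> n * ln (1 / \<delta> n))) / sqrt (\<beta>0 * real (T n))"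
      \<comment> \<open>For uniform probabilities \<open>\<phi> n\<close> is 1 plus nonnegative
        terms, so this alternative contradicts \<open>\<phi> n < 1\<close>.\<close>
      proof (rule disjE[OF \<phi>])
        assume "\<forall>n\<in>{1..N}. uniform_probs (other_dim I N n) (pr n) \<and>
            \<phi> n = 1 + sqrt (real (I' n) / real (T n))
              + real (I' n) / sqrt (real (T n)) * sqrt (8 * ln (1 / \<delta> n))"
        then have "\<phi> n = 1 + sqrt (real (I' n) / real (T n))
              + real (I' n) / sqrt (real (T n)) * sqrt (8 * ln (1 / \<delta> n))" using n by blast
        moreover have "0 \<le> ln (1 / \<delta> n)"
        proof (rule ln_ge_zero)
          have "0 < \<delta> n" "\<delta> n < 1" using \<delta> n by auto
          then show "1 \<le> 1 / \<delta> n" by (simp add: pos_le_divide_eq)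
        qed
        ultimately have "1 \<le> \<phi> n" by simp
        then show ?thesis using 4(2) by simp
      qed (use n in blast)
      have X0: "0 < finner (?X n) (?X n)" using 4(1) unfolding XW[OF n] .
      have \<delta>n: "0 < \<delta> n" "\<delta> n < 1" using \<delta> n by auto
      have prn: "prob_vector (other_dim I N n) (pr n)" using pr n by blast
      let ?small = "?r n * (2 * sketch_amp (\<mu> n + K) * Delta1 (\<mu> n + 1) (?X n) + \<phi> n * finner (?X n) (?X n))"
      have small: "?small \<le> ?bound n"
      proof (rule mult_left_mono)
        have "2 * sketch_amp (\<mu> n + K) * Delta1 (\<mu> n + 1) (?X n) \<le> 2 * ((1 + lam n) * real (I n)) * Delta1 (\<mu> n + 1) (?X n)"
          by (rule mult_right_mono[OF _ \<Delta>0]) (use amp[OF n] in simp)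
        then show "2 * sketch_amp (\<mu> n + K) * Delta1 (\<mu> n + 1) (?X n) + \<phi> n * finner (?X n) (?X n)
          \<le> 2 * (1 + lam n) * real (I n) * Delta1 (\<mu> n + 1) (?X n) + \<phi> n * ?W"
          unfolding XW[OF n] by (simp only: mult.assoc add_le_cancel_right)
      qed simp
      have "measure M (?bad n) \<le> measure M {\<omega> \<in> space M. ?small < ?res n \<omega>}"
      proof (rule finite_measure_mono)
        show "?bad n \<subseteq> {\<omega> \<in> space M. ?small < ?res n \<omega>}" using small by (auto intro: le_less_trans)
        show "{\<omega> \<in> space M. ?small < ?res n \<omega>} \<in> sets M"
          by (rule borel_measurable_less[OF borel_measurable_const measurable_finner_resid[OF alg'(4)[OF n] Xc]])
      qed
      also have "\<dots> \<le> \<kappa> + \<delta> n"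
        unfolding \<kappa>_def
        by (rule mode_failure_probability[OF M alg'(1)[OF n] prn alg'(2-5)[OF n] Xc X0 dims(1)[OF n] K dims(2,3)[OF n]
            opt[THEN conjunct1] opt[THEN conjunct2, THEN conjunct1] \<delta>n opt[THEN conjunct2, THEN conjunct2] 4(2) 4(3)[unfolded \<kappa>_def]])
      finally show ?thesis .
    qed
  qed
  let ?err = "\<lambda>\<omega>. (tensor_norm I N (\<lambda>i. A i - mode_prods N A (\<lambda>n. Q n \<omega> * (Q n \<omega>)\<^sup>T) i))\<^sup>2"
  let ?good = "{\<omega> \<in> space M. ?err \<omega> \<le> (\<Sum>n = 1..N. ?bound n)}"
  have badm: "?bad n \<in> sets M" if n: "n \<in> {1..N}" for n
    by (rule borel_measurable_less[OF borel_measurable_const measurable_finner_resid[OF alg'(4)[OF n] Xc]])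
  \<comment> \<open>Passing to the complement at the end requires a measurable event; this rests on
    the measurability of the \<open>Q n\<close>.\<close>
  have goodm: "?good \<in> sets M"
    by (rule borel_measurable_le[OF measurable_tensor_error[OF alg'(4)] borel_measurable_const])
  have cover: "space M - ?good \<subseteq> (\<Union>n\<in>{1..N}. ?bad n)"
  proof
    fix \<omega> assume w: "\<omega> \<in> space M - ?good"
    then have \<omega>: "\<omega> \<in> space M" by simp
    show "\<omega> \<in> (\<Union>n\<in>{1..N}. ?bad n)"
    proof (rule ccontr)
      assume "\<omega> \<notin> (\<Union>n\<in>{1..N}. ?bad n)"
      then have le: "?res n \<omega> \<le> ?bound n" if "n \<in> {1..N}" for n using \<omega> that by (auto simp: not_less simp del: atLeastAtMost_iff)
      have "?err \<omega> \<le> (\<Sum>n = 1..N. ?res n \<omega>)"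
        by (rule tensor_projection_error[OF I1 Qc[OF _ \<omega>] order_refl])
      also have "\<dots> \<le> (\<Sum>n = 1..N. ?bound n)" by (rule sum_mono[OF le])
      finally show False using w by simp
    qed
  qed
  have "measure M (space M - ?good) \<le> measure M (\<Union>n\<in>{1..N}. ?bad n)"
    by (rule finite_measure_mono[OF cover], rule sets.finite_UN[OF _ badm]) simp
  \<comment> \<open>A union bound, as the modes may depend on each other.\<close>
  also have "\<dots> \<le> (\<Sum>n = 1..N. measure M (?bad n))"
  proof (rule finite_measure_subadditive_finite)
    show "?bad ` {1..N} \<subseteq> sets M" by (rule image_subsetI) (rule badm)
  qed simp
  also have "\<dots> \<le> (\<Sum>n = 1..N. \<kappa> + \<delta> n)" by (rule sum_mono[OF bad])
  also have "\<dots> \<le> 1 - p"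
  proof -
    \<comment> \<open>The two terms in \<open>\<gamma>\<close> are nonnegative, so the budget
      \<open>1 - p\<close> is at least the sum of the \<open>\<kappa> + \<delta> n\<close>.\<close>
    have g: "0 \<le> 1 / (4 * (\<gamma>\<^sup>2 - 1) * sqrt (pi * x * \<gamma>\<^sup>2)) * (2 * \<gamma>\<^sup>2 / exp (\<gamma>\<^sup>2 - 1))\<^sup>2" if "0 \<le> x" for x
    proof -
      have "1 \<le> \<gamma>\<^sup>2" using \<gamma> by (simp add: one_le_power)
      then show ?thesis using that by simp
    qed
    have \<kappa>: "\<kappa> = 1 / sqrt (2 * pi * real (K + 1)) * (exp 1 / real (K + 1)) ^ (K + 1)"
      unfolding \<kappa>_def sketch_kappa_def by simp
    have "0 \<le> max (real (I'' n) - real (\<mu> n)) (real (\<mu> n + K))" for n by (simp add: le_max_iff_disj)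
    then have g1: "0 \<le> 1 / (4 * (\<gamma>\<^sup>2 - 1) * sqrt (pi * max (real (I'' n) - real (\<mu> n)) (real (\<mu> n + K)) * \<gamma>\<^sup>2))
      * (2 * \<gamma>\<^sup>2 / exp (\<gamma>\<^sup>2 - 1))\<^sup>2" for n by (rule g)
    have g2: "0 \<le> 1 / (4 * (\<gamma>\<^sup>2 - 1) * sqrt (pi * real (I n) * \<gamma>\<^sup>2)) * (2 * \<gamma>\<^sup>2 / exp (\<gamma>\<^sup>2 - 1))\<^sup>2" for n
      by (rule g) simp
    show ?thesis unfolding p diff_diff_eq2 add_diff_cancel_left'
    proof (rule sum_mono)
      fix n
      show "\<kappa> + \<delta> n \<le> 1 / (4 * (\<gamma>\<^sup>2 - 1) * sqrt (pi * max (real (I'' n) - real (\<mu> n)) (real (\<mu> n + K)) * \<gamma>\<^sup>2))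
          * (2 * \<gamma>\<^sup>2 / exp (\<gamma>\<^sup>2 - 1))\<^sup>2
        + 1 / sqrt (2 * pi * real (K + 1)) * (exp 1 / real (K + 1)) ^ (K + 1)
        + 1 / (4 * (\<gamma>\<^sup>2 - 1) * sqrt (pi * real (I n) * \<gamma>\<^sup>2)) * (2 * \<gamma>\<^sup>2 / exp (\<gamma>\<^sup>2 - 1))\<^sup>2
        + \<delta> n"
        using g1[of n] g2[of n] unfolding \<kappa> by linarith
    qed
  qed
  finally have "measure M (space M - ?good) \<le> 1 - p" .
  then show ?thesis using prob_compl[OF goodm] by linarith
qed

end
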